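(* For every finite dimensional operator space $E$ one has $$ex(E)=d_{SK}(E).$$ More generally, for any operator space $X$, $$ex(X)=\sup\{d_{SK}(E)\mid E\subset X,\ \dim E<\infty\},$$ and $X$ is exact if and only if the right-hand side of the last identity is finite.
   Context: An operator space is a closed subspace $E\subset B(H)$, $H$ a (complex) Hilbert space, with the norms on $M_n(E)$ induced by $B(\ell_2^n(H))$. For a linear map $u:E\to F$ between operator spaces, $\|u\|_{cb}=\sup_{n\ge1}\|I_{M_n}\otimes u\|_{M_n(E)\to M_n(F)}$. A subspace of an operator space carries the induced structure. If $X\subset B(H)$, $Y\subset B(K')$, the minimal tensor product $X\otimes_{\min}Y$ is the completion of $X\otimes Y$ for the norm induced by $B(H\otimes_2 K')$. For operator spaces $E,F$, $d_{cb}(E,F)=\inf\{\|u\|_{cb}\|u^{-1}\|_{cb}\}$ over all isomorphisms $u:E\to F$ ($=\infty$ if $E,F$ are not completely isomorphic). Let $B=B(\ell_2)$ and let $K=K(\ell_2)\subset B$ be the ideal of compact operators. Define $$d_{SK}(E)=\inf\{d_{cb}(E,F)\mid F\subset K \text{ a closed subspace}\}.$$ An operator space $X$ is called exact if the sequence $$\{0\}\to K\otimes_{\min}X\to B\otimes_{\min}X\to (B/K)\otimes_{\min}X\to\{0\}$$ is exact (here $B/K$ is the quotient $C^*$-algebra). Every finite dimensional operator space is exact. Let $$T_X:(B\otimes_{\min}X)/(K\otimes_{\min}X)\to (B/K)\otimes_{\min}X$$ be the associated canonical map; if $X$ is exact, $T_X$ is bijective and $ex(X)=\|T_X^{-1}\|$.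 If $X$ is not exact, put $ex(X)=\infty$. *)

theory Defs
  imports "HOL-Analysis.Analysis"
begin

section \<open>Complex vector spaces and complex Hilbert spaces\<close>

class complex_vector = real_vector +
  fixes scaleC :: "complex \<Rightarrow> 'a \<Rightarrow> 'a" (infixr \<open>*\<^sub>C\<close> 75)
  assumes scaleC_add_right: "c *\<^sub>C (x + y) = c *\<^sub>C x + c *\<^sub>C y"
    and scaleC_add_left: "(c + d) *\<^sub>C x = c *\<^sub>C x + d *\<^sub>C x"
    and scaleC_scaleC: "c *\<^sub>C d *\<^sub>C x = (c * d) *\<^sub>C x"
    and scaleR_scaleC: "r *\<^sub>R x = complex_of_real r *\<^sub>C x"

class complex_normed_vector = complex_vector + real_normed_vector +
  assumes norm_scaleC: "norm (c *\<^sub>C x) = cmod c * norm x"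

text \<open>The inner product is conjugate-linear in the first argument; its real part is
  the inner product of the underlying real Hilbert space.\<close>

class complex_hilbert = complex_normed_vector + real_inner + complete_space +
  fixes cinner :: "'a \<Rightarrow> 'a \<Rightarrow> complex"
  assumes cinner_commute: "cinner x y = cnj (cinner y x)"
    and cinner_add_right: "cinner x (y + z) = cinner x y + cinner x z"
    and cinner_scaleC_right: "cinner x (c *\<^sub>C y) = c * cinner x y"
    and inner_Re_cinner: "inner x y = Re (cinner x y)"

lemma scaleC_one [simp]: "1 *\<^sub>C x = (x :: 'a::complex_vector)"
  using scaleR_scaleC[of 1 x] by simp

lemma scaleC_zero_right [simp]: "c *\<^sub>C (0 :: 'a::complex_vector) = 0"
  using scaleC_add_right[of c 0 0] by simp

lemma scaleC_zero_left [simp]: "0 *\<^sub>C (x :: 'a::complex_vector) = 0"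
  using scaleC_add_left[of 0 0 x] by simp

definition csubspace :: "'a::complex_vector set \<Rightarrow> bool" where
  "csubspace V \<longleftrightarrow> 0 \<in> V \<and> (\<forall>x\<in>V. \<forall>y\<in>V. x + y \<in> V) \<and> (\<forall>c. \<forall>x\<in>V. c *\<^sub>C x \<in> V)"

definition cspan :: "'a::complex_vector set \<Rightarrow> 'a set" where
  "cspan S = csubspace hull S"

definition cfinite_dim :: "'a::complex_vector set \<Rightarrow> bool" where
  "cfinite_dim V \<longleftrightarrow> (\<exists>S. finite S \<and> V = cspan S)"

definition clinear_on :: "'a::complex_vector set \<Rightarrow> ('a \<Rightarrow> 'b::complex_vector) \<Rightarrow> bool" where
  "clinear_on V f \<longleftrightarrow>
     (\<forall>x\<in>V. \<forall>y\<in>V. f (x + y) = f x + f y) \<and> (\<forall>c. \<forall>x\<in>V. f (c *\<^sub>C x) = c *\<^sub>C f x)"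

lemma csubspace_cspan: "csubspace (cspan S)"
  unfolding cspan_def by (rule hull_in) (auto simp: csubspace_def)

lemma cspan_superset: "S \<subseteq> cspan S"
  unfolding cspan_def by (rule hull_subset)

lemma cspan_minimal: "S \<subseteq> V \<Longrightarrow> csubspace V \<Longrightarrow> cspan S \<subseteq> V"
  unfolding cspan_def by (rule hull_minimal)

lemma bounded_linear_scaleC: "bounded_linear (\<lambda>x. c *\<^sub>C (x :: 'a::complex_normed_vector))"
proof (rule bounded_linear_intro[where K="cmod c"])
  show "c *\<^sub>C (r *\<^sub>R x) = r *\<^sub>R (c *\<^sub>C x)" for r and x :: 'a
    by (simp add: scaleR_scaleC scaleC_scaleC mult.commute)
qed (auto simp: scaleC_add_right norm_scaleC mult.commute)

lemma csubspace_closure: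
  assumes "csubspace (V :: 'a::complex_normed_vector set)"
  shows "csubspace (closure V)"
  unfolding csubspace_def
proof (intro conjI ballI allI)
  show "0 \<in> closure V"
    using assms closure_subset unfolding csubspace_def by blast
next
  fix x y assume "x \<in> closure V" "y \<in> closure V"
  then obtain f g where "\<And>n. f n \<in> V" "f \<longlonglongrightarrow> x" "\<And>n. g n \<in> V" "g \<longlonglongrightarrow> y"
    unfolding closure_sequential by blast
  then have "\<forall>n. f n + g n \<in> V" "(\<lambda>n. f n + g n) \<longlonglongrightarrow> x + y"
    using assms by (auto simp: csubspace_def intro: tendsto_add)
  then show "x + y \<in> closure V" by (auto simp: closure_sequential)
next
  fix c x assume "x \<in> closure V"
  then obtain f where "\<And>n. f n \<in> V" "f \<longlonglongrightarrow> x"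
    unfolding closure_sequential by blast
  then have "\<forall>n. c *\<^sub>C f n \<in> V" "(\<lambda>n. c *\<^sub>C f n) \<longlonglongrightarrow> c *\<^sub>C x"
    using assms bounded_linear.tendsto[OF bounded_linear_scaleC] by (auto simp: csubspace_def)
  then show "c *\<^sub>C x \<in> closure V" by (auto simp: closure_sequential)
qed

lemma cinner_add_left: "cinner (x + y) (z :: 'a::complex_hilbert) = cinner x z + cinner y z"
  by (subst (1 2 3) cinner_commute) (simp add: cinner_add_right)

lemma cinner_scaleC_left: "cinner (c *\<^sub>C x) (z :: 'a::complex_hilbert) = cnj c * cinner x z"
  by (subst (1 2) cinner_commute) (simp add: cinner_scaleC_right)

lemma cinner_eq_inner:
  "cinner x (y :: 'a::complex_hilbert) = Complex (inner x y) (inner (\<i> *\<^sub>C x) y)"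
  by (simp add: inner_Re_cinner cinner_scaleC_left complex_eq_iff)


section \<open>The Hilbert spaces \<open>\<ell>\<^sub>2(I)\<close>\<close>

typedef 'i ell2 = "{f :: 'i \<Rightarrow> complex. (\<lambda>i. (cmod (f i))\<^sup>2) summable_on UNIV}"
  morphisms coord Abs_ell2
  by (rule exI[of _ "\<lambda>_. 0"]) simp

setup_lifting type_definition_ell2

lemma sq_summable_mult:
  assumes "(\<lambda>i. (cmod (f i))\<^sup>2) summable_on UNIV" "(\<lambda>i. (cmod (g i))\<^sup>2) summable_on UNIV"
  shows "(\<lambda>i. cnj (f i) * g i) summable_on UNIV"
proof -
  have "(\<lambda>i. cmod (cnj (f i) * g i)) summable_on UNIV"
    using assms by - (rule abs_summable_product, simp_all add: norm_mult power2_eq_square)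
  then show ?thesis by (rule abs_summable_summable)
qed

lemma sq_summable_add:
  assumes "(\<lambda>i. (cmod (f i))\<^sup>2) summable_on UNIV" "(\<lambda>i. (cmod (g i))\<^sup>2) summable_on UNIV"
  shows "(\<lambda>i. (cmod (f i + g i))\<^sup>2) summable_on UNIV"
proof (rule summable_on_comparison_test)
  show "(\<lambda>i. 2 * (cmod (f i))\<^sup>2 + 2 * (cmod (g i))\<^sup>2) summable_on UNIV"
    using assms by (intro summable_on_add summable_on_cmult_right)
  show "(cmod (f i + g i))\<^sup>2 \<le> 2 * (cmod (f i))\<^sup>2 + 2 * (cmod (g i))\<^sup>2" for i
  proof -
    have "(cmod (f i + g i))\<^sup>2 \<le> (cmod (f i) + cmod (g i))\<^sup>2"
      by (intro power_mono norm_triangle_ineq) simp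
    also have "\<dots> \<le> 2 * (cmod (f i))\<^sup>2 + 2 * (cmod (g i))\<^sup>2"
      using zero_le_power2[of "cmod (f i) - cmod (g i)"]
      by (simp add: power2_sum power2_diff)
    finally show ?thesis .
  qed
qed simp

lemma sq_summable_cmult:
  assumes "(\<lambda>i. (cmod (f i))\<^sup>2) summable_on UNIV"
  shows "(\<lambda>i. (cmod (c * f i))\<^sup>2) summable_on UNIV"
  using assms by (simp add: norm_mult power_mult_distrib summable_on_cmult_right)

instantiation ell2 :: (type) complex_vector
begin

lift_definition zero_ell2 :: "'a ell2" is "\<lambda>_. 0" by simp
lift_definition plus_ell2 :: "'a ell2 \<Rightarrow> 'a ell2 \<Rightarrow> 'a ell2" is "\<lambda>f g i. f i + g i"
  using sq_summable_add by auto
lift_definition uminus_ell2 :: "'a ell2 \<Rightarrow> 'a ell2" is "\<lambda>f i. - f i" by simp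
lift_definition minus_ell2 :: "'a ell2 \<Rightarrow> 'a ell2 \<Rightarrow> 'a ell2" is "\<lambda>f g i. f i - g i"
  subgoal for f g using sq_summable_add[of f "\<lambda>i. - g i"] by auto
  done
lift_definition scaleR_ell2 :: "real \<Rightarrow> 'a ell2 \<Rightarrow> 'a ell2" is "\<lambda>r f i. complex_of_real r * f i"
  using sq_summable_cmult by auto
lift_definition scaleC_ell2 :: "complex \<Rightarrow> 'a ell2 \<Rightarrow> 'a ell2" is "\<lambda>c f i. c * f i"
  using sq_summable_cmult by auto

instance
  by standard (transfer, auto simp: algebra_simps fun_eq_iff)+

end

lift_definition cinner_coord :: "'i ell2 \<Rightarrow> 'i ell2 \<Rightarrow> complex"
  is "\<lambda>f g. \<Sum>\<^sub>\<infinity>i. cnj (f i) * g i" .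

lemma coord_summable: "(\<lambda>i. (cmod (coord x i))\<^sup>2) summable_on UNIV"
  using coord[of x] by simp

lemma cinner_coord_self:
  "cinner_coord x x = complex_of_real (\<Sum>\<^sub>\<infinity>i. (cmod (coord x i))\<^sup>2)"
proof -
  have "((\<lambda>i. complex_of_real ((cmod (coord x i))\<^sup>2)) has_sum
      complex_of_real (\<Sum>\<^sub>\<infinity>i. (cmod (coord x i))\<^sup>2)) UNIV"
    using coord_summable[of x]
    by (intro has_sum_bounded_linear[OF bounded_linear_of_real, unfolded o_def] has_sum_infsum)
  moreover have "cnj z * z = complex_of_real ((cmod z)\<^sup>2)" for z
    using complex_norm_square[of z] by (simp only: of_real_power mult.commute)
  ultimately show ?thesis
    unfolding cinner_coord.rep_eq by (intro infsumI) (simp only:)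
qed

lemma cinner_coord_add: "cinner_coord x (y + z) = cinner_coord x y + cinner_coord x z"
  unfolding cinner_coord.rep_eq plus_ell2.rep_eq
  by (simp add: distrib_left infsum_add sq_summable_mult coord_summable)

lemma cinner_coord_scaleC: "cinner_coord x (c *\<^sub>C y) = c * cinner_coord x y"
  unfolding cinner_coord.rep_eq scaleC_ell2.rep_eq
  by (simp add: mult.left_commute infsum_cmult_right sq_summable_mult coord_summable)

lemma cinner_coord_commute: "cinner_coord x y = cnj (cinner_coord y x)"
  unfolding cinner_coord.rep_eq by (simp flip: infsum_cnj add: mult.commute)

instantiation ell2 :: (type) real_inner
begin

definition inner_ell2 :: "'a ell2 \<Rightarrow> 'a ell2 \<Rightarrow> real" where
  "inner_ell2 x y = Re (cinner_coord x y)"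
definition norm_ell2 :: "'a ell2 \<Rightarrow> real" where
  "norm_ell2 x = sqrt (inner x x)"
definition dist_ell2 :: "'a ell2 \<Rightarrow> 'a ell2 \<Rightarrow> real" where
  "dist_ell2 x y = norm (x - y)"
definition sgn_ell2 :: "'a ell2 \<Rightarrow> 'a ell2" where
  "sgn_ell2 x = x /\<^sub>R norm x"
definition uniformity_ell2 :: "('a ell2 \<times> 'a ell2) filter" where
  "uniformity_ell2 = (INF e\<in>{0<..}. principal {(x, y). dist x y < e})"
definition open_ell2 :: "'a ell2 set \<Rightarrow> bool" where
  "open_ell2 S = (\<forall>x\<in>S. \<forall>\<^sub>F (x', y) in uniformity. x' = x \<longrightarrow> y \<in> S)"

instance
proof
  fix x y z :: "'a ell2" and r :: real
  have comm: "inner x y = inner y x" for x y :: "'a ell2"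
    unfolding inner_ell2_def by (subst cinner_coord_commute) simp
  show "inner x y = inner y x" by (rule comm)
  show "inner (x + y) z = inner x z + inner y z"
    by (subst (1 2 3) comm) (simp add: inner_ell2_def cinner_coord_add)
  show "inner (r *\<^sub>R x) y = r * inner x y"
    by (subst (1 2) comm) (simp add: inner_ell2_def cinner_coord_scaleC scaleR_scaleC)
  show "0 \<le> inner x x"
    by (simp add: inner_ell2_def cinner_coord_self infsum_nonneg)
  show "inner x x = 0 \<longleftrightarrow> x = 0"
  proof
    assume "inner x x = 0"
    then have "(\<Sum>\<^sub>\<infinity>i. (cmod (coord x i))\<^sup>2) \<le> 0"
      by (simp add: inner_ell2_def cinner_coord_self)
    then have "(cmod (coord x i))\<^sup>2 = 0" for i
      by (rule nonneg_infsum_le_0D) (auto simp: coord_summable)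
    then show "x = 0"
      by (intro coord_inject[THEN iffD1]) (simp add: fun_eq_iff zero_ell2.rep_eq)
  qed (simp add: inner_ell2_def cinner_coord.rep_eq zero_ell2.rep_eq)
qed (simp_all add: dist_ell2_def sgn_ell2_def uniformity_ell2_def open_ell2_def norm_ell2_def)

end

lemma norm_ell2_sq: "(norm (x :: 'a ell2))\<^sup>2 = (\<Sum>\<^sub>\<infinity>i. (cmod (coord x i))\<^sup>2)"
  by (simp add: norm_ell2_def inner_ell2_def cinner_coord_self infsum_nonneg)

lemma finite_sum_le_norm_ell2:
  "finite F \<Longrightarrow> (\<Sum>i\<in>F. (cmod (coord x i))\<^sup>2) \<le> (norm x)\<^sup>2"
  unfolding norm_ell2_sq by (rule finite_sum_le_infsum) (auto simp: coord_summable)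

lemma norm_coord_le: "cmod (coord x i) \<le> norm x"
  using finite_sum_le_norm_ell2[of "{i}" x] by (simp add: power2_le_iff_abs_le)

lemma ell2_complete:
  fixes X :: "nat \<Rightarrow> 'a ell2"
  assumes "Cauchy X"
  shows "convergent X"
proof -
  have "Cauchy (\<lambda>n. coord (X n) i)" for i
  proof (rule metric_CauchyI)
    fix e :: real assume "e > 0"
    then obtain M where M: "\<forall>m\<ge>M. \<forall>n\<ge>M. dist (X m) (X n) < e"
      using assms unfolding Cauchy_def by blast
    have "dist (coord (X m) i) (coord (X n) i) \<le> dist (X m) (X n)" for m n
      using norm_coord_le[of "X m - X n" i] by (simp add: dist_norm minus_ell2.rep_eq)
    then show "\<exists>M. \<forall>m\<ge>M. \<forall>n\<ge>M. dist (coord (X m) i) (coord (X n) i) < e"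
      using M by (meson le_less_trans)
  qed
  then have "\<exists>l. (\<lambda>n. coord (X n) i) \<longlonglongrightarrow> l" for i
    by (simp add: Cauchy_convergent_iff convergent_def)
  then obtain l where l: "\<And>i. (\<lambda>n. coord (X n) i) \<longlonglongrightarrow> l i" by metis
  have bound: "\<exists>M. \<forall>n\<ge>M. \<forall>F. finite F \<longrightarrow> (\<Sum>i\<in>F. (cmod (l i - coord (X n) i))\<^sup>2) \<le> e\<^sup>2"
    if "e > 0" for e :: real
  proof -
    obtain M where M: "\<forall>m\<ge>M. \<forall>n\<ge>M. dist (X m) (X n) < e"
      using assms \<open>e > 0\<close> unfolding Cauchy_def by blast
    have "(\<Sum>i\<in>F. (cmod (l i - coord (X n) i))\<^sup>2) \<le> e\<^sup>2" if n: "n \<ge> M" and "finite F" for n F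
    proof (rule tendsto_upperbound)
      show "(\<lambda>m. \<Sum>i\<in>F. (cmod (coord (X m) i - coord (X n) i))\<^sup>2)
          \<longlonglongrightarrow> (\<Sum>i\<in>F. (cmod (l i - coord (X n) i))\<^sup>2)"
        by (intro tendsto_intros l)
      show "\<forall>\<^sub>F m in sequentially. (\<Sum>i\<in>F. (cmod (coord (X m) i - coord (X n) i))\<^sup>2) \<le> e\<^sup>2"
      proof (rule eventually_sequentiallyI)
        fix m assume "M \<le> m"
        have "(\<Sum>i\<in>F. (cmod (coord (X m) i - coord (X n) i))\<^sup>2) \<le> (norm (X m - X n))\<^sup>2"
          using finite_sum_le_norm_ell2[OF \<open>finite F\<close>, of "X m - X n"]
          by (simp add: minus_ell2.rep_eq)
        also have "\<dots> \<le> e\<^sup>2"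
          using M n \<open>M \<le> m\<close> by (intro power_mono) (auto simp: dist_norm less_imp_le)
        finally show "(\<Sum>i\<in>F. (cmod (coord (X m) i - coord (X n) i))\<^sup>2) \<le> e\<^sup>2" .
      qed
    qed simp
    then show ?thesis by blast
  qed
  have summ: "(\<lambda>i. (cmod (l i - coord (X n) i))\<^sup>2) summable_on UNIV"
    if "\<forall>F. finite F \<longrightarrow> (\<Sum>i\<in>F. (cmod (l i - coord (X n) i))\<^sup>2) \<le> e\<^sup>2" for n e
    using that by (intro nonneg_bdd_above_summable_on bdd_aboveI2[where M="e\<^sup>2"]) auto
  obtain M where "\<forall>F. finite F \<longrightarrow> (\<Sum>i\<in>F. (cmod (l i - coord (X M) i))\<^sup>2) \<le> 1\<^sup>2"
    using bound[of 1] by auto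
  from sq_summable_add[OF summ[OF this] coord_summable[of "X M"]]
  have "(\<lambda>i. (cmod (l i))\<^sup>2) summable_on UNIV" by simp
  then obtain L where L: "coord L = l" using Abs_ell2_inverse by blast
  have "X \<longlonglongrightarrow> L"
  proof (rule metric_LIMSEQ_I)
    fix r :: real assume "r > 0"
    then obtain M where
      M: "\<forall>n\<ge>M. \<forall>F. finite F \<longrightarrow> (\<Sum>i\<in>F. (cmod (l i - coord (X n) i))\<^sup>2) \<le> (r / 2)\<^sup>2"
      using bound[of "r / 2"] by auto
    have "dist (X n) L < r" if "n \<ge> M" for n
    proof -
      have "(norm (L - X n))\<^sup>2 \<le> (r / 2)\<^sup>2"
        unfolding norm_ell2_sq minus_ell2.rep_eq L
        using M that by (intro infsum_le_finite_sums summ[of n "r / 2"]) auto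
      then have "norm (L - X n) \<le> r / 2"
        using \<open>r > 0\<close> by (simp add: power2_le_iff_abs_le)
      then show ?thesis using \<open>r > 0\<close> by (simp add: dist_norm norm_minus_commute)
    qed
    then show "\<exists>M. \<forall>n\<ge>M. dist (X n) L < r" by blast
  qed
  then show ?thesis by (auto simp: convergent_def)
qed

instantiation ell2 :: (type) complex_hilbert
begin

definition cinner_ell2 :: "'a ell2 \<Rightarrow> 'a ell2 \<Rightarrow> complex" where
  "cinner_ell2 = cinner_coord"

instance
proof
  fix x y z :: "'a ell2" and c :: complex
  have "(norm (c *\<^sub>C x))\<^sup>2 = (cmod c * norm x)\<^sup>2"
    by (simp add: norm_ell2_sq power_mult_distrib scaleC_ell2.rep_eq norm_mult infsum_cmult_right')
  moreover have "0 \<le> norm (c *\<^sub>C x)" "0 \<le> cmod c * norm x"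
    by (auto simp: norm_ell2_def inner_ell2_def cinner_coord_self infsum_nonneg)
  ultimately show "norm (c *\<^sub>C x) = cmod c * norm x"
    by (rule power2_eq_imp_eq)
  show "inner x y = Re (cinner x y)" by (simp add: inner_ell2_def cinner_ell2_def)
  show "Cauchy X \<Longrightarrow> convergent X" for X :: "nat \<Rightarrow> 'a ell2" by (rule ell2_complete)
qed (simp_all only: cinner_ell2_def cinner_coord_commute[symmetric] cinner_coord_add cinner_coord_scaleC)

end

lemma cinner_ell2: "cinner x y = (\<Sum>\<^sub>\<infinity>i. cnj (coord x i) * coord y i)"
  by (simp add: cinner_ell2_def cinner_coord.rep_eq)


section \<open>Hilbert space tensor products\<close>

definition orthonormal :: "'a::complex_hilbert set \<Rightarrow> bool" where
  "orthonormal B \<longleftrightarrow> (\<forall>x\<in>B. \<forall>y\<in>B. cinner x y = (if x = y then 1 else 0))"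

definition orthonormal_basis :: "'a::complex_hilbert set \<Rightarrow> bool" where
  "orthonormal_basis B \<longleftrightarrow> orthonormal B \<and> (\<forall>x. (\<forall>e\<in>B. cinner e x = 0) \<longrightarrow> x = 0)"

definition some_onb :: "'a::complex_hilbert set" where
  "some_onb = (SOME B. orthonormal_basis B)"

lemma cinner_zero_right [simp]: "cinner x (0 :: 'a::complex_hilbert) = 0"
  using cinner_scaleC_right[of x 0 0] by simp

lemma cinner_zero_left [simp]: "cinner (0 :: 'a::complex_hilbert) x = 0"
  using cinner_scaleC_left[of 0 0 x] by simp

lemma cinner_sum_right: "cinner (x :: 'a::complex_hilbert) (\<Sum>e\<in>F. f e) = (\<Sum>e\<in>F. cinner x (f e))"
  by (induction F rule: infinite_finite_induct) (simp_all add: cinner_add_right)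

lemma cinner_diff_right: "cinner (x :: 'a::complex_hilbert) (y - z) = cinner x y - cinner x z"
  using cinner_add_right[of x "y - z" z] by simp

lemma norm_sq_cinner: "(norm (x :: 'a::complex_hilbert))\<^sup>2 = Re (cinner x x)"
  by (simp add: power2_norm_eq_inner inner_Re_cinner)

lemma ex_orthonormal_basis: "\<exists>B :: 'a::complex_hilbert set. orthonormal_basis B"
proof -
  have "\<exists>M\<in>Collect orthonormal. \<forall>X\<in>Collect orthonormal. M \<subseteq> X \<longrightarrow> X = (M :: 'a set)"
  proof (rule subset_Zorn')
    fix C :: "'a set set" assume C: "subset.chain (Collect orthonormal) C"
    have "cinner x y = (if x = y then 1 else 0)" if "x \<in> \<Union>C" "y \<in> \<Union>C" for x y
    proof -
      from that obtain A A' where "A \<in> C" "x \<in> A" "A' \<in> C" "y \<in> A'" by blast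
      moreover from this have "A \<subseteq> A' \<or> A' \<subseteq> A" "orthonormal A" "orthonormal A'"
        using C by (auto simp: subset_chain_def)
      ultimately show ?thesis unfolding orthonormal_def by blast
    qed
    then show "\<Union>C \<in> Collect orthonormal" by (simp add: orthonormal_def)
  qed
  then obtain M :: "'a set" where M: "orthonormal M"
    and max: "\<And>X. orthonormal X \<Longrightarrow> M \<subseteq> X \<Longrightarrow> X = M" by blast
  have "x = 0" if "\<forall>e\<in>M. cinner e x = 0" for x
  proof (rule ccontr)
    assume "x \<noteq> 0"
    define y where "y = complex_of_real (inverse (norm x)) *\<^sub>C x"
    have "cinner x x = complex_of_real ((norm x)\<^sup>2)"
      using cinner_commute[of x x] by (simp add: norm_sq_cinner complex_eq_iff)
    then have yy: "cinner y y = 1"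
      using \<open>x \<noteq> 0\<close>
      by (simp add: y_def cinner_scaleC_left cinner_scaleC_right power2_eq_square divide_simps)
    have ey: "cinner e y = 0" "cinner y e = 0" if "e \<in> M" for e
    proof -
      show "cinner e y = 0"
        using that \<open>\<forall>e\<in>M. cinner e x = 0\<close> by (simp add: y_def cinner_scaleC_right)
      then show "cinner y e = 0" by (subst cinner_commute) simp
    qed
    have "y \<notin> M" using ey yy by force
    moreover have "orthonormal (insert y M)"
      using M ey yy unfolding orthonormal_def by auto
    then have "insert y M = M" using max by blast
    ultimately show False by blast
  qed
  then show ?thesis using M unfolding orthonormal_basis_def by blast
qed

lemma orthonormal_basis_some_onb: "orthonormal_basis some_onb"
  unfolding some_onb_def by (rule someI_ex[OF ex_orthonormal_basis])

lemma tendsto_cinner_right: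
  fixes f :: "_ \<Rightarrow> 'a::complex_hilbert"
  assumes "(f \<longlongrightarrow> l) F"
  shows "((\<lambda>n. cinner x (f n)) \<longlongrightarrow> cinner x l) F"
  unfolding cinner_eq_inner by (intro tendsto_intros assms)

lemma cinner_orthonormal_sum:
  assumes "orthonormal B" "finite F" "F \<subseteq> B" "e \<in> B"
  shows "cinner e (\<Sum>d\<in>F. c d *\<^sub>C d) = (if e \<in> F then c e else 0)"
proof -
  have "cinner e (\<Sum>d\<in>F. c d *\<^sub>C d) = (\<Sum>d\<in>F. if e = d then c d else 0)"
    unfolding cinner_sum_right cinner_scaleC_right
    by (rule sum.cong) (use assms in \<open>auto simp: orthonormal_def\<close>)
  then show ?thesis using assms by simp
qed

lemma cinner_sum_left: "cinner (\<Sum>e\<in>F. f e) (x :: 'a::complex_hilbert) = (\<Sum>e\<in>F. cinner (f e) x)"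
  by (induction F rule: infinite_finite_induct) (simp_all add: cinner_add_left)

lemma Re_cnj_mult_self: "Re (cnj z * z) = (cmod z)\<^sup>2"
  unfolding cmod_power2 by (simp add: power2_eq_square)

lemma norm_orthonormal_sum:
  assumes "orthonormal B" "finite F" "F \<subseteq> B"
  shows "(norm (\<Sum>d\<in>F. c d *\<^sub>C d))\<^sup>2 = (\<Sum>d\<in>F. (cmod (c d))\<^sup>2)"
proof -
  have "cinner (\<Sum>d\<in>F. c d *\<^sub>C d) (\<Sum>d\<in>F. c d *\<^sub>C d) = (\<Sum>d\<in>F. cnj (c d) * c d)"
    unfolding cinner_sum_left cinner_scaleC_left
    by (rule sum.cong) (use assms cinner_orthonormal_sum[OF assms] in auto)
  then show ?thesis
    by (simp add: norm_sq_cinner Re_cnj_mult_self del: times_complex.sel)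
qed

lemma bessel:
  assumes "orthonormal B" "finite F" "F \<subseteq> B"
  shows "(norm (x - (\<Sum>e\<in>F. cinner e x *\<^sub>C e)))\<^sup>2 = (norm x)\<^sup>2 - (\<Sum>e\<in>F. (cmod (cinner e x))\<^sup>2)"
proof -
  define s where "s = (\<Sum>e\<in>F. cinner e x *\<^sub>C e)"
  have "cinner s x = (\<Sum>e\<in>F. cnj (cinner e x) * cinner e x)"
    by (simp add: s_def cinner_sum_left cinner_scaleC_left)
  then have "inner s x = (\<Sum>e\<in>F. (cmod (cinner e x))\<^sup>2)"
    by (simp add: inner_Re_cinner Re_cnj_mult_self del: times_complex.sel)
  moreover have "inner s s = (\<Sum>e\<in>F. (cmod (cinner e x))\<^sup>2)"
    using norm_orthonormal_sum[OF assms, of "\<lambda>e. cinner e x"]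
    by (simp add: s_def power2_norm_eq_inner)
  ultimately show ?thesis
    unfolding s_def[symmetric]
    by (simp add: power2_norm_eq_inner inner_diff_left inner_diff_right inner_commute)
qed

lemma bessel_le:
  assumes "orthonormal B" "finite F" "F \<subseteq> B"
  shows "(\<Sum>e\<in>F. (cmod (cinner e x))\<^sup>2) \<le> (norm x)\<^sup>2"
  using bessel[OF assms, of x] zero_le_power2[of "norm (x - (\<Sum>e\<in>F. cinner e x *\<^sub>C e))"] by linarith

lemma parseval:
  assumes B: "orthonormal_basis B"
  shows "((\<lambda>e. (cmod (cinner e x))\<^sup>2) has_sum (norm x)\<^sup>2) B"
proof -
  let ?f = "\<lambda>e. (cmod (cinner e x))\<^sup>2"
  let ?s = "\<lambda>F. \<Sum>e\<in>F. cinner e x *\<^sub>C e"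
  have on: "orthonormal B" using B by (simp add: orthonormal_basis_def)
  have bdd: "bdd_above (sum ?f ` {F. F \<subseteq> B \<and> finite F})"
    using bessel_le[OF on] by (intro bdd_aboveI2) auto
  define S where "S = (SUP F\<in>{F. finite F \<and> F \<subseteq> B}. sum ?f F)"
  have hs: "(?f has_sum S) B"
    unfolding S_def by (rule nonneg_bdd_above_has_sum[OF _ bdd]) simp
  have le_S: "sum ?f F \<le> S" if "finite F" "F \<subseteq> B" for F
    using finite_sum_le_has_sum[OF hs that] by simp
  have "S \<le> (norm x)\<^sup>2"
    by (rule has_sum_le_finite_sums[OF hs bessel_le[OF on]])
  have "\<exists>F. finite F \<and> F \<subseteq> B \<and> S - inverse (real (Suc n)) < sum ?f F" for n
  proof (rule ccontr)
    assume "\<not> ?thesis"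
    then have "S \<le> S - inverse (real (Suc n))"
      by (intro has_sum_le_finite_sums[OF hs]) (auto simp: not_less)
    then show False by (simp add: field_simps)
  qed
  then obtain F where F: "\<And>n. finite (F n)" "\<And>n. F n \<subseteq> B"
    "\<And>n. S - inverse (real (Suc n)) < sum ?f (F n)" by metis
  have tail: "sum ?f (G - F n) \<le> inverse (real (Suc n))" if "finite G" "G \<subseteq> B" for G n
  proof -
    have "sum ?f (G - F n) + sum ?f (F n) = sum ?f (G \<union> F n)"
      using F that by (subst sum.union_disjoint[symmetric]) (auto intro: sum.cong)
    also have "\<dots> \<le> S" using F that by (intro le_S) auto
    finally show ?thesis using F(3)[of n] by linarith
  qed
  have step: "norm (?s (F m \<union> F n) - ?s (F n)) \<le> sqrt (inverse (real (Suc n)))" for m n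
  proof -
    have "?s (F m \<union> F n) - ?s (F n) = ?s (F m - F n)"
      using F by (subst sum_diff[symmetric]) (auto intro!: sum.cong)
    moreover have "(norm (?s (F m - F n)))\<^sup>2 = sum ?f (F m - F n)"
      using F by (intro norm_orthonormal_sum[OF on]) auto
    ultimately show ?thesis
      using tail[OF F(1,2), of m n] by (intro real_le_rsqrt) simp
  qed
  have lim0: "(\<lambda>n. sqrt (inverse (real (Suc n)))) \<longlonglongrightarrow> 0"
    using tendsto_real_sqrt[OF LIMSEQ_inverse_real_of_nat] by simp
  have "Cauchy (\<lambda>n. ?s (F n))"
  proof (rule metric_CauchyI)
    fix e :: real assume "e > 0"
    then obtain M where M: "\<And>n. n \<ge> M \<Longrightarrow> sqrt (inverse (real (Suc n))) < e / 2"
      using metric_LIMSEQ_D[OF lim0, of "e / 2"] by auto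
    have "dist (?s (F m)) (?s (F n)) < e" if "m \<ge> M" "n \<ge> M" for m n
    proof -
      have "norm (?s (F m) - ?s (F n))
          \<le> norm (?s (F m \<union> F n) - ?s (F n)) + norm (?s (F n \<union> F m) - ?s (F m))"
        using norm_triangle_ineq4[of "?s (F m \<union> F n) - ?s (F n)" "?s (F m \<union> F n) - ?s (F m)"]
        by (simp add: Un_commute)
      then show ?thesis
        using step[of m n] step[of n m] M[OF that(1)] M[OF that(2)] by (simp add: dist_norm)
    qed
    then show "\<exists>M. \<forall>m\<ge>M. \<forall>n\<ge>M. dist (?s (F m)) (?s (F n)) < e" by blast
  qed
  then obtain z where z: "(\<lambda>n. ?s (F n)) \<longlonglongrightarrow> z"
    by (auto simp: Cauchy_convergent_iff convergent_def)
  have "cinner e (x - z) = 0" if "e \<in> B" for e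
  proof -
    have "norm (cinner e (x - ?s (F n))) \<le> sqrt (inverse (real (Suc n)))" for n
    proof (cases "e \<in> F n")
      case True
      then show ?thesis
        using that F by (simp add: cinner_diff_right cinner_orthonormal_sum[OF on])
    next
      case False
      then have "?f e \<le> inverse (real (Suc n))"
        using tail[of "{e}" n] that by (simp add: insert_Diff_if)
      with False show ?thesis
        using that F
        by (intro real_le_rsqrt) (simp add: cinner_diff_right cinner_orthonormal_sum[OF on])
    qed
    then have "(\<lambda>n. cinner e (x - ?s (F n))) \<longlonglongrightarrow> 0"
      by (intro Lim_null_comparison[OF _ lim0]) simp
    moreover have "(\<lambda>n. cinner e (x - ?s (F n))) \<longlonglongrightarrow> cinner e (x - z)"
      by (intro tendsto_cinner_right tendsto_intros z)
    ultimately show ?thesis by (rule LIMSEQ_unique[symmetric])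
  qed
  then have "x - z = 0" using B unfolding orthonormal_basis_def by blast
  then have "(\<lambda>n. (norm (x - ?s (F n)))\<^sup>2) \<longlonglongrightarrow> (norm (x - x))\<^sup>2"
    by (intro tendsto_intros) (use z in simp)
  then have lim: "(\<lambda>n. (norm x)\<^sup>2 - sum ?f (F n)) \<longlonglongrightarrow> 0"
    using F by (simp add: bessel[OF on])
  have "(norm x)\<^sup>2 - S \<le> 0"
    by (rule LIMSEQ_le_const[OF lim]) (use le_S F in auto)
  then show ?thesis using hs \<open>S \<le> (norm x)\<^sup>2\<close> by simp
qed

lift_definition onb_coords :: "'a::complex_hilbert \<Rightarrow> 'a ell2" is
  "\<lambda>x e. if e \<in> some_onb then cinner e x else 0"
proof -
  fix x :: 'a
  have "(\<lambda>e. (cmod (cinner e x))\<^sup>2) summable_on some_onb"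
    using parseval[OF orthonormal_basis_some_onb, of x] by (rule has_sum_imp_summable)
  then show "(\<lambda>e. (cmod (if e \<in> some_onb then cinner e x else 0))\<^sup>2) summable_on UNIV"
    by (subst summable_on_cong_neutral[where T=some_onb and g="\<lambda>e. (cmod (cinner e x))\<^sup>2"]) auto
qed

lemma norm_onb_coords: "norm (onb_coords x) = norm x"
proof -
  have "(\<Sum>\<^sub>\<infinity>e. (cmod (if e \<in> some_onb then cinner e x else 0))\<^sup>2)
      = (\<Sum>\<^sub>\<infinity>e\<in>some_onb. (cmod (cinner e x))\<^sup>2)"
    by (rule infsum_cong_neutral) auto
  also have "\<dots> = (norm x)\<^sup>2"
    by (rule infsumI[OF parseval[OF orthonormal_basis_some_onb]])
  finally have "(norm (onb_coords x))\<^sup>2 = (norm x)\<^sup>2"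
    unfolding norm_ell2_sq onb_coords.rep_eq .
  then show ?thesis by (simp add: power2_eq_iff_nonneg)
qed

lemma onb_coords_add: "onb_coords (x + y) = onb_coords x + onb_coords y"
  by transfer (auto simp: cinner_add_right)

lemma onb_coords_scaleC: "onb_coords (c *\<^sub>C x) = c *\<^sub>C onb_coords x"
  by transfer (auto simp: cinner_scaleC_right)

lemma cinner_onb_coords: "cinner (onb_coords x) (onb_coords y) = cinner x y"
proof -
  have "inner (onb_coords x) (onb_coords y) = inner x y" for x y :: 'a
    unfolding dot_norm onb_coords_add[symmetric] norm_onb_coords ..
  then show ?thesis
    unfolding cinner_eq_inner onb_coords_scaleC[symmetric] by simp
qed

lemma sq_summable_product:
  assumes "(\<lambda>i. (cmod (f i))\<^sup>2) summable_on UNIV" "(\<lambda>j. (cmod (g j))\<^sup>2) summable_on UNIV"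
  shows "(\<lambda>(i, j). (cmod (f i * g j))\<^sup>2) summable_on UNIV"
proof -
  have "(\<lambda>(i, j). (cmod (f i * g j))\<^sup>2) summable_on (UNIV \<times> UNIV)"
  proof (rule summable_on_SigmaI)
    show "((\<lambda>j. case (i, j) of (i, j) \<Rightarrow> (cmod (f i * g j))\<^sup>2) has_sum
        ((cmod (f i))\<^sup>2 * (\<Sum>\<^sub>\<infinity>j. (cmod (g j))\<^sup>2))) UNIV" for i
      using assms(2) by (simp add: norm_mult power_mult_distrib has_sum_cmult_right)
    show "(\<lambda>i. (cmod (f i))\<^sup>2 * (\<Sum>\<^sub>\<infinity>j. (cmod (g j))\<^sup>2)) summable_on UNIV"
      using assms(1) by (rule summable_on_cmult_left)
  qed auto
  then show ?thesis by simp
qed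

lift_definition coord_tensor :: "'i ell2 \<Rightarrow> 'j ell2 \<Rightarrow> ('i \<times> 'j) ell2" is
  "\<lambda>f g (i, j). f i * g j"
  using sq_summable_product by (simp add: case_prod_unfold)

lemma cinner_coord_tensor:
  "cinner (coord_tensor f g) (coord_tensor f' g') = cinner f f' * cinner g g'"
proof -
  let ?F = "\<lambda>(i, j). cnj (coord (coord_tensor f g) (i, j)) * coord (coord_tensor f' g') (i, j)"
  have "?F summable_on UNIV"
    using sq_summable_mult[OF coord_summable coord_summable]
    by (simp add: case_prod_unfold)
  then have "infsum ?F UNIV = (\<Sum>\<^sub>\<infinity>i. \<Sum>\<^sub>\<infinity>j. ?F (i, j))"
    by (subst infsum_Sigma_banach) simp_all
  also have "\<dots> = (\<Sum>\<^sub>\<infinity>i. \<Sum>\<^sub>\<infinity>j. (cnj (coord f i) * coord f' i) * (cnj (coord g j) * coord g' j))"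
    by (simp add: coord_tensor.rep_eq mult_ac)
  also have "\<dots> = (\<Sum>\<^sub>\<infinity>i. cnj (coord f i) * coord f' i) * (\<Sum>\<^sub>\<infinity>j. cnj (coord g j) * coord g' j)"
    by (simp add: infsum_cmult_right' infsum_cmult_left')
  finally show ?thesis by (simp add: cinner_ell2 case_prod_unfold)
qed

text \<open>The Hilbert space tensor product of \<open>H\<close> and \<open>K\<close>, realized in coordinates as the closed
  linear span of the elementary tensors inside \<open>\<ell>\<^sub>2(H \<times> K)\<close>. The lemmas \<open>cinner_htensor\<close> and
  \<open>closure_cspan_htensor\<close> below determine it up to a unique unitary, so the choice of the
  orthonormal bases is immaterial.\<close>

typedef (overloaded) ('a, 'b) htensor =
  "closure (cspan (range (\<lambda>(x :: 'a::complex_hilbert, y :: 'b::complex_hilbert).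
     coord_tensor (onb_coords x) (onb_coords y))))"
  using csubspace_closure[OF csubspace_cspan] unfolding csubspace_def by blast

setup_lifting type_definition_htensor

instantiation htensor :: (complex_hilbert, complex_hilbert) complex_vector
begin

lift_definition zero_htensor :: "('a, 'b) htensor" is 0
  using csubspace_closure[OF csubspace_cspan] unfolding csubspace_def by blast
lift_definition plus_htensor :: "('a, 'b) htensor \<Rightarrow> ('a, 'b) htensor \<Rightarrow> ('a, 'b) htensor" is plus
  using csubspace_closure[OF csubspace_cspan] unfolding csubspace_def by blast
lift_definition scaleC_htensor :: "complex \<Rightarrow> ('a, 'b) htensor \<Rightarrow> ('a, 'b) htensor" is scaleC
  using csubspace_closure[OF csubspace_cspan] unfolding csubspace_def by blast
definition scaleR_htensor :: "real \<Rightarrow> ('a, 'b) htensor \<Rightarrow> ('a, 'b) htensor" where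
  "scaleR_htensor r x = complex_of_real r *\<^sub>C x"
definition uminus_htensor :: "('a, 'b) htensor \<Rightarrow> ('a, 'b) htensor" where
  "uminus_htensor x = (- 1) *\<^sub>C x"
definition minus_htensor :: "('a, 'b) htensor \<Rightarrow> ('a, 'b) htensor \<Rightarrow> ('a, 'b) htensor" where
  "minus_htensor x y = x + (- 1) *\<^sub>C y"

instance
proof
  have [simp]: "1 *\<^sub>C x = x" for x :: "('a, 'b) htensor" by transfer simp
  fix x y z :: "('a, 'b) htensor" and c d :: complex and r s :: real
  show "x + y + z = x + (y + z)" "x + y = y + x" "0 + x = x" by (transfer, simp add: ac_simps)+
  show add: "c *\<^sub>C (x + y) = c *\<^sub>C x + c *\<^sub>C y" for c and x y :: "('a, 'b) htensor"
    by transfer (simp add: scaleC_add_right)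
  show addl: "(c + d) *\<^sub>C x = c *\<^sub>C x + d *\<^sub>C x" for c d and x :: "('a, 'b) htensor"
    by transfer (simp add: scaleC_add_left)
  show assoc: "c *\<^sub>C d *\<^sub>C x = (c * d) *\<^sub>C x" for c d and x :: "('a, 'b) htensor"
    by transfer (simp add: scaleC_scaleC)
  have "0 *\<^sub>C x = 0" by transfer simp
  then show "- x + x = 0"
    using addl[of "- 1" 1 x] by (simp add: uminus_htensor_def)
  show "x - y = x + - y" by (simp add: uminus_htensor_def minus_htensor_def)
  show "r *\<^sub>R (x + y) = r *\<^sub>R x + r *\<^sub>R y" "(r + s) *\<^sub>R x = r *\<^sub>R x + s *\<^sub>R x"
    "r *\<^sub>R s *\<^sub>R x = (r * s) *\<^sub>R x" "1 *\<^sub>R x = x" "r *\<^sub>R x = complex_of_real r *\<^sub>C x"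
    by (simp_all add: scaleR_htensor_def add addl assoc)
qed

end

lemma Rep_htensor_diff: "Rep_htensor (x - y) = Rep_htensor x - Rep_htensor y"
proof -
  have "Rep_htensor (x - y) + Rep_htensor y = Rep_htensor x"
    unfolding plus_htensor.rep_eq[symmetric] by simp
  then show ?thesis by (simp add: eq_diff_eq)
qed

lemma Rep_htensor_scaleR: "Rep_htensor (r *\<^sub>R x) = r *\<^sub>R Rep_htensor x"
  by (simp add: scaleR_scaleC scaleC_htensor.rep_eq)

instantiation htensor :: (complex_hilbert, complex_hilbert) real_inner
begin

definition inner_htensor :: "('a, 'b) htensor \<Rightarrow> ('a, 'b) htensor \<Rightarrow> real" where
  "inner_htensor x y = inner (Rep_htensor x) (Rep_htensor y)"
definition norm_htensor :: "('a, 'b) htensor \<Rightarrow> real" where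
  "norm_htensor x = norm (Rep_htensor x)"
definition dist_htensor :: "('a, 'b) htensor \<Rightarrow> ('a, 'b) htensor \<Rightarrow> real" where
  "dist_htensor x y = norm (x - y)"
definition sgn_htensor :: "('a, 'b) htensor \<Rightarrow> ('a, 'b) htensor" where
  "sgn_htensor x = x /\<^sub>R norm x"
definition uniformity_htensor :: "(('a, 'b) htensor \<times> ('a, 'b) htensor) filter" where
  "uniformity_htensor = (INF e\<in>{0<..}. principal {(x, y). dist x y < e})"
definition open_htensor :: "('a, 'b) htensor set \<Rightarrow> bool" where
  "open_htensor S = (\<forall>x\<in>S. \<forall>\<^sub>F (x', y) in uniformity. x' = x \<longrightarrow> y \<in> S)"

instance
proof
  fix x y z :: "('a, 'b) htensor" and r :: real
  show "inner (x + y) z = inner x z + inner y z"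
    by (simp add: inner_htensor_def plus_htensor.rep_eq inner_add_left)
  show "inner x x = 0 \<longleftrightarrow> x = 0"
    by (simp add: inner_htensor_def flip: zero_htensor.rep_eq Rep_htensor_inject)
qed (simp_all add: dist_htensor_def sgn_htensor_def uniformity_htensor_def open_htensor_def
      inner_htensor_def norm_htensor_def inner_commute
      Rep_htensor_scaleR norm_eq_sqrt_inner)

end

lemma dist_Rep_htensor: "dist (Rep_htensor x) (Rep_htensor y) = dist x y"
  by (simp add: dist_htensor_def norm_htensor_def Rep_htensor_diff dist_norm)

instantiation htensor :: (complex_hilbert, complex_hilbert) complex_hilbert
begin

definition cinner_htensor :: "('a, 'b) htensor \<Rightarrow> ('a, 'b) htensor \<Rightarrow> complex" where
  "cinner_htensor x y = cinner (Rep_htensor x) (Rep_htensor y)"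

instance
proof
  fix x y z :: "('a, 'b) htensor" and c :: complex
  show "norm (c *\<^sub>C x) = cmod c * norm x"
    by (simp add: norm_htensor_def scaleC_htensor.rep_eq norm_scaleC)
  show "cinner x y = cnj (cinner y x)"
    unfolding cinner_htensor_def by (rule cinner_commute)
  show "convergent X" if "Cauchy X" for X :: "nat \<Rightarrow> ('a, 'b) htensor"
  proof -
    have "Cauchy (\<lambda>n. Rep_htensor (X n))"
      using that unfolding Cauchy_def dist_Rep_htensor .
    then obtain l where l: "(\<lambda>n. Rep_htensor (X n)) \<longlonglongrightarrow> l"
      by (auto simp: Cauchy_convergent_iff convergent_def)
    have "l \<in> range (Rep_htensor :: ('a, 'b) htensor \<Rightarrow> _)"
      by (rule closed_sequentially[OF _ _ l])
        (simp_all add: type_definition.Rep_range[OF type_definition_htensor] Rep_htensor)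
    then obtain L where "l = Rep_htensor L" by blast
    then have "X \<longlonglongrightarrow> L"
      using l by (simp add: lim_sequentially dist_Rep_htensor)
    then show ?thesis by (auto simp: convergent_def)
  qed
qed (simp_all add: cinner_htensor_def inner_htensor_def plus_htensor.rep_eq scaleC_htensor.rep_eq
      cinner_add_right cinner_scaleC_right inner_Re_cinner)

end

lift_definition htensor :: "'a::complex_hilbert \<Rightarrow> 'b::complex_hilbert \<Rightarrow> ('a, 'b) htensor"
    (infixl \<open>\<otimes>\<^sub>h\<close> 70) is
  "\<lambda>x y. coord_tensor (onb_coords x) (onb_coords y)"
  by (rule subsetD[OF closure_subset], rule subsetD[OF cspan_superset]) auto

lemma cinner_htensor: "cinner (x \<otimes>\<^sub>h y) (x' \<otimes>\<^sub>h y') = cinner x x' * cinner y y'"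
  by (simp add: cinner_htensor_def htensor.rep_eq cinner_coord_tensor cinner_onb_coords)

lemma coord_tensor_linear:
  "coord_tensor (f + f') g = coord_tensor f g + coord_tensor f' g"
  "coord_tensor f (g + g') = coord_tensor f g + coord_tensor f g'"
  "coord_tensor (c *\<^sub>C f) g = c *\<^sub>C coord_tensor f g"
  "coord_tensor f (c *\<^sub>C g) = c *\<^sub>C coord_tensor f g"
  by (auto simp: coord_inject[symmetric] coord_tensor.rep_eq plus_ell2.rep_eq scaleC_ell2.rep_eq
      algebra_simps fun_eq_iff)

lemma htensor_linear:
  "(x + x') \<otimes>\<^sub>h y = x \<otimes>\<^sub>h y + x' \<otimes>\<^sub>h y"
  "x \<otimes>\<^sub>h (y + y') = x \<otimes>\<^sub>h y + x \<otimes>\<^sub>h y'"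
  "(c *\<^sub>C x) \<otimes>\<^sub>h y = c *\<^sub>C (x \<otimes>\<^sub>h y)"
  "x \<otimes>\<^sub>h (c *\<^sub>C y) = c *\<^sub>C (x \<otimes>\<^sub>h y)"
  by (simp_all add: Rep_htensor_inject[symmetric] htensor.rep_eq plus_htensor.rep_eq
      scaleC_htensor.rep_eq onb_coords_add onb_coords_scaleC coord_tensor_linear)

lemma csubspace_Rep_htensor:
  fixes V :: "('a::complex_hilbert, 'b::complex_hilbert) htensor set"
  assumes V: "csubspace V"
  shows "csubspace (Rep_htensor ` V)"
  unfolding csubspace_def
proof (intro conjI ballI allI)
  show "0 \<in> Rep_htensor ` V"
    unfolding zero_htensor.rep_eq[symmetric] using V by (intro imageI) (simp add: csubspace_def)
next
  fix x y assume "x \<in> Rep_htensor ` V" "y \<in> Rep_htensor ` V"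
  then obtain x' y' where *: "x' \<in> V" "y' \<in> V" "x = Rep_htensor x'" "y = Rep_htensor y'"
    by blast
  show "x + y \<in> Rep_htensor ` V"
    unfolding *(3,4) plus_htensor.rep_eq[symmetric]
    using V * by (intro imageI) (simp add: csubspace_def)
next
  fix c x assume "x \<in> Rep_htensor ` V"
  then obtain x' where *: "x' \<in> V" "x = Rep_htensor x'" by blast
  show "c *\<^sub>C x \<in> Rep_htensor ` V"
    unfolding *(2) scaleC_htensor.rep_eq[symmetric]
    using V * by (intro imageI) (simp add: csubspace_def)
qed

lemma closure_cspan_htensor:
  "closure (cspan (range (\<lambda>(x, y). x \<otimes>\<^sub>h y))) = (UNIV :: ('a::complex_hilbert, 'b::complex_hilbert) htensor set)"
proof -
  let ?E = "range (\<lambda>(x :: 'a, y :: 'b). x \<otimes>\<^sub>h y)"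
  have "csubspace (Rep_htensor ` cspan ?E)"
    by (rule csubspace_Rep_htensor[OF csubspace_cspan])
  moreover have "range (\<lambda>(x :: 'a, y :: 'b). coord_tensor (onb_coords x) (onb_coords y))
      \<subseteq> Rep_htensor ` cspan ?E"
  proof clarify
    fix x :: 'a and y :: 'b
    have "x \<otimes>\<^sub>h y \<in> cspan ?E" using cspan_superset[of ?E] by auto
    then show "coord_tensor (onb_coords x) (onb_coords y) \<in> Rep_htensor ` cspan ?E"
      unfolding htensor.rep_eq[symmetric] by (rule imageI)
  qed
  ultimately have sub: "cspan (range (\<lambda>(x :: 'a, y :: 'b). coord_tensor (onb_coords x) (onb_coords y)))
      \<subseteq> Rep_htensor ` cspan ?E"
    by (intro cspan_minimal)
  have "t \<in> closure (cspan ?E)" for t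
  proof -
    have "Rep_htensor t \<in> closure (Rep_htensor ` cspan ?E)"
      using Rep_htensor[of t] closure_mono[OF sub] by blast
    then show ?thesis
      unfolding closure_approachable by (auto simp: dist_Rep_htensor)
  qed
  then show ?thesis by blast
qed


section \<open>Operators and operator spaces\<close>

instantiation blinfun :: (real_normed_vector, complex_normed_vector) complex_normed_vector
begin

lift_definition scaleC_blinfun :: "complex \<Rightarrow> ('a \<Rightarrow>\<^sub>L 'b) \<Rightarrow> 'a \<Rightarrow>\<^sub>L 'b" is
  "\<lambda>c f x. c *\<^sub>C f x"
  by (rule bounded_linear_compose[OF bounded_linear_scaleC])

instance
proof
  fix f g :: "'a \<Rightarrow>\<^sub>L 'b" and c d :: complex and r :: real
  show "c *\<^sub>C (f + g) = c *\<^sub>C f + c *\<^sub>C g"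
    by transfer (simp add: scaleC_add_right)
  show "(c + d) *\<^sub>C f = c *\<^sub>C f + d *\<^sub>C f"
    by transfer (simp add: scaleC_add_left)
  show assoc: "c *\<^sub>C d *\<^sub>C f = (c * d) *\<^sub>C f" for c d and f :: "'a \<Rightarrow>\<^sub>L 'b"
    by transfer (simp add: scaleC_scaleC)
  show "r *\<^sub>R f = complex_of_real r *\<^sub>C f"
    by transfer (simp add: scaleR_scaleC)
  have le: "norm (c *\<^sub>C f) \<le> cmod c * norm f" for c and f :: "'a \<Rightarrow>\<^sub>L 'b"
  proof (rule norm_blinfun_bound)
    fix x
    show "norm (blinfun_apply (c *\<^sub>C f) x) \<le> cmod c * norm f * norm x"
      using mult_left_mono[OF norm_blinfun[of f x], of "cmod c"]
      by (simp add: scaleC_blinfun.rep_eq norm_scaleC mult.assoc)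
  qed simp
  show "norm (c *\<^sub>C f) = cmod c * norm f"
  proof (cases "c = 0")
    case True
    then show ?thesis using le[of c f] by simp
  next
    case False
    have "inverse c *\<^sub>C c *\<^sub>C f = f"
      using False unfolding assoc by transfer simp
    then have "norm f \<le> inverse (cmod c) * norm (c *\<^sub>C f)"
      using le[of "inverse c" "c *\<^sub>C f"] by (simp add: norm_inverse)
    then have "cmod c * norm f \<le> norm (c *\<^sub>C f)"
      using False by (simp add: field_simps)
    then show ?thesis using le[of c f] by simp
  qed
qed

end

text \<open>Bounded real-linear maps are the library's type \<open>\<Rightarrow>\<^sub>L\<close>; \<open>B(H, K)\<close> consists of the
  complex-linear ones. The norm is the operator norm.\<close>

definition bounded_ops :: "('a::complex_hilbert \<Rightarrow>\<^sub>L 'b::complex_hilbert) set" where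
  "bounded_ops = {a. \<forall>c x. blinfun_apply a (c *\<^sub>C x) = c *\<^sub>C blinfun_apply a x}"

definition compact_ops :: "('a::complex_hilbert \<Rightarrow>\<^sub>L 'b::complex_hilbert) set" where
  "compact_ops = {a \<in> bounded_ops. compact (closure (blinfun_apply a ` cball 0 1))}"

definition adjoint_pair ::
    "('a::complex_hilbert \<Rightarrow>\<^sub>L 'b::complex_hilbert) \<Rightarrow> ('b \<Rightarrow>\<^sub>L 'a) \<Rightarrow> bool" where
  "adjoint_pair a b \<longleftrightarrow> (\<forall>x y. cinner (blinfun_apply a x) y = cinner x (blinfun_apply b y))"

definition operator_space :: "('a::complex_hilbert \<Rightarrow>\<^sub>L 'a) set \<Rightarrow> bool" where
  "operator_space X \<longleftrightarrow> X \<subseteq> bounded_ops \<and> csubspace X \<and> closed X"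

text \<open>The norm of the matrix \<open>a\<close> (with entries indexed by \<open>i, j < n\<close>) as an operator on
  \<open>\<ell>\<^sub>2\<^sup>n(H)\<close>.\<close>

definition mat_norm :: "nat \<Rightarrow> (nat \<Rightarrow> nat \<Rightarrow> ('a::complex_hilbert \<Rightarrow>\<^sub>L 'a)) \<Rightarrow> real" where
  "mat_norm n a =
     (SUP x \<in> {x :: nat \<Rightarrow> 'a. (\<Sum>j<n. (norm (x j))\<^sup>2) \<le> 1}.
        sqrt (\<Sum>i<n. (norm (\<Sum>j<n. blinfun_apply (a i j) (x j)))\<^sup>2))"

definition cb_norm ::
    "('a::complex_hilbert \<Rightarrow>\<^sub>L 'a) set \<Rightarrow> (('a \<Rightarrow>\<^sub>L 'a) \<Rightarrow> ('b::complex_hilbert \<Rightarrow>\<^sub>L 'b)) \<Rightarrow> ennreal" where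
  "cb_norm E u =
     (SUP n \<in> {1..}. SUP a \<in> {a. (\<forall>i<n. \<forall>j<n. a i j \<in> E) \<and> mat_norm n a \<le> 1}.
        ennreal (mat_norm n (\<lambda>i j. u (a i j))))"

text \<open>All linear bijections may be admitted here: those that are not complete isomorphisms
  contribute \<open>\<infinity>\<close>. In particular \<open>d_cb E F = \<infinity>\<close> if there is no complete isomorphism.\<close>

definition d_cb ::
    "('a::complex_hilbert \<Rightarrow>\<^sub>L 'a) set \<Rightarrow> ('b::complex_hilbert \<Rightarrow>\<^sub>L 'b) set \<Rightarrow> ennreal" where
  "d_cb E F = (INF u \<in> {u. clinear_on E u \<and> bij_betw u E F}. cb_norm E u * cb_norm F (inv_into E u))"

definition d_SK :: "('a::complex_hilbert \<Rightarrow>\<^sub>L 'a) set \<Rightarrow> ennreal" where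
  "d_SK E =
     (INF F \<in> {F :: (nat ell2 \<Rightarrow>\<^sub>L nat ell2) set. operator_space F \<and> F \<subseteq> compact_ops}. d_cb E F)"


section \<open>Minimal tensor products\<close>

text \<open>The operator \<open>a \<otimes> b\<close> on the Hilbert space tensor product. It exists for all
  \<open>a\<close>, \<open>b\<close> in \<open>bounded_ops\<close>, and it is unique because the elementary tensors are total.\<close>

definition tensor_op ::
    "('a::complex_hilbert \<Rightarrow>\<^sub>L 'a) \<Rightarrow> ('b::complex_hilbert \<Rightarrow>\<^sub>L 'b) \<Rightarrow> (('a, 'b) htensor \<Rightarrow>\<^sub>L ('a, 'b) htensor)"
    (infixl \<open>\<otimes>\<^sub>o\<close> 70) where
  "a \<otimes>\<^sub>o b = (THE c. c \<in> bounded_ops \<and>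
     (\<forall>x y. blinfun_apply c (x \<otimes>\<^sub>h y) = blinfun_apply a x \<otimes>\<^sub>h blinfun_apply b y))"

text \<open>The completion of the algebraic tensor product is its closure in the Banach space
  of all bounded operators on the Hilbert space tensor product.\<close>

definition min_tensor ::
    "('a::complex_hilbert \<Rightarrow>\<^sub>L 'a) set \<Rightarrow> ('b::complex_hilbert \<Rightarrow>\<^sub>L 'b) set \<Rightarrow>
      (('a, 'b) htensor \<Rightarrow>\<^sub>L ('a, 'b) htensor) set"
    (infixl \<open>\<otimes>\<^sub>m\<^sub>i\<^sub>n\<close> 70) where
  "X \<otimes>\<^sub>m\<^sub>i\<^sub>n Y = closure (cspan {a \<otimes>\<^sub>o b |a b. a \<in> X \<and> b \<in> Y})"


section \<open>The Calkin algebra and exactness\<close>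

definition coset :: "'a::complex_normed_vector set \<Rightarrow> 'a \<Rightarrow> 'a set" where
  "coset W x = (\<lambda>w. x + w) ` W"

definition quotient_space :: "'a::complex_normed_vector set \<Rightarrow> 'a set \<Rightarrow> 'a set set" where
  "quotient_space V W = coset W ` V"

definition quotient_norm :: "'a::complex_normed_vector set \<Rightarrow> real" where
  "quotient_norm C = (INF x\<in>C. norm x)"

abbreviation (input) B_ell2 :: "(nat ell2 \<Rightarrow>\<^sub>L nat ell2) set" where "B_ell2 \<equiv> bounded_ops"
abbreviation (input) K_ell2 :: "(nat ell2 \<Rightarrow>\<^sub>L nat ell2) set" where "K_ell2 \<equiv> compact_ops"

abbreviation calkin_class :: "(nat ell2 \<Rightarrow>\<^sub>L nat ell2) \<Rightarrow> (nat ell2 \<Rightarrow>\<^sub>L nat ell2) set" where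
  "calkin_class \<equiv> coset K_ell2"

text \<open>The quotient \<open>C\<^sup>*\<close>-algebra \<open>B/K\<close> becomes an operator space through an isometric
  \<open>*\<close>-representation \<open>\<pi>\<close> on some Hilbert space. Such \<open>\<pi>\<close> exist by the Gelfand-Naimark theorem
  (for instance on \<open>\<ell>\<^sub>2(I)\<close> with \<open>I\<close> of the cardinality of the continuum), and the operator space
  structure does not depend on the choice of \<open>\<pi>\<close>. Everything below is relative to an arbitrary
  such \<open>\<pi>\<close>.\<close>

definition calkin_representation ::
    "((nat ell2 \<Rightarrow>\<^sub>L nat ell2) set \<Rightarrow> ('k::complex_hilbert \<Rightarrow>\<^sub>L 'k)) \<Rightarrow> bool" where
  "calkin_representation \<pi> \<longleftrightarrow>
     (\<forall>a\<in>B_ell2. \<pi> (calkin_class a) \<in> bounded_ops \<and>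
        norm (\<pi> (calkin_class a)) = quotient_norm (calkin_class a)) \<and>
     (\<forall>a\<in>B_ell2. \<forall>b\<in>B_ell2.
        \<pi> (calkin_class (a + b)) = \<pi> (calkin_class a) + \<pi> (calkin_class b) \<and>
        \<pi> (calkin_class (a o\<^sub>L b)) = \<pi> (calkin_class a) o\<^sub>L \<pi> (calkin_class b) \<and>
        (adjoint_pair a b \<longrightarrow> adjoint_pair (\<pi> (calkin_class a)) (\<pi> (calkin_class b)))) \<and>
     (\<forall>c. \<forall>a\<in>B_ell2. \<pi> (calkin_class (c *\<^sub>C a)) = c *\<^sub>C \<pi> (calkin_class a))"

definition calkin_algebra ::
    "((nat ell2 \<Rightarrow>\<^sub>L nat ell2) set \<Rightarrow> ('k::complex_hilbert \<Rightarrow>\<^sub>L 'k)) \<Rightarrow> ('k \<Rightarrow>\<^sub>L 'k) set" where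
  "calkin_algebra \<pi> = \<pi> ` quotient_space B_ell2 K_ell2"

text \<open>The map \<open>B \<otimes>\<^sub>m\<^sub>i\<^sub>n X \<rightarrow> (B/K) \<otimes>\<^sub>m\<^sub>i\<^sub>n X\<close> extending \<open>q \<otimes> id\<close>, where \<open>q\<close> is the quotient map.
  It exists, and on \<open>B \<otimes>\<^sub>m\<^sub>i\<^sub>n X\<close> it is determined by the conditions below.\<close>

definition quotient_tensor_map ::
    "((nat ell2 \<Rightarrow>\<^sub>L nat ell2) set \<Rightarrow> ('k::complex_hilbert \<Rightarrow>\<^sub>L 'k)) \<Rightarrow> ('h::complex_hilbert \<Rightarrow>\<^sub>L 'h) set \<Rightarrow>
      ((nat ell2, 'h) htensor \<Rightarrow>\<^sub>L (nat ell2, 'h) htensor) \<Rightarrow> (('k, 'h) htensor \<Rightarrow>\<^sub>L ('k, 'h) htensor)" where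
  "quotient_tensor_map \<pi> X = (SOME Q.
     clinear_on (B_ell2 \<otimes>\<^sub>m\<^sub>i\<^sub>n X) Q \<and> continuous_on (B_ell2 \<otimes>\<^sub>m\<^sub>i\<^sub>n X) Q \<and>
     (\<forall>b\<in>B_ell2. \<forall>x\<in>X. Q (b \<otimes>\<^sub>o x) = \<pi> (calkin_class b) \<otimes>\<^sub>o x))"

text \<open>Exactness of \<open>0 \<rightarrow> K \<otimes>\<^sub>m\<^sub>i\<^sub>n X \<rightarrow> B \<otimes>\<^sub>m\<^sub>i\<^sub>n X \<rightarrow> (B/K) \<otimes>\<^sub>m\<^sub>i\<^sub>n X \<rightarrow> 0\<close>. The first map is the
  inclusion of one closed subspace of \<open>B(\<ell>\<^sub>2 \<otimes> H)\<close> in another, so exactness at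
  \<open>K \<otimes>\<^sub>m\<^sub>i\<^sub>n X\<close> is automatic.\<close>

definition exact_operator_space ::
    "((nat ell2 \<Rightarrow>\<^sub>L nat ell2) set \<Rightarrow> ('k::complex_hilbert \<Rightarrow>\<^sub>L 'k)) \<Rightarrow> ('h::complex_hilbert \<Rightarrow>\<^sub>L 'h) set \<Rightarrow> bool" where
  "exact_operator_space \<pi> X \<longleftrightarrow>
     {t \<in> B_ell2 \<otimes>\<^sub>m\<^sub>i\<^sub>n X. quotient_tensor_map \<pi> X t = 0} = K_ell2 \<otimes>\<^sub>m\<^sub>i\<^sub>n X \<and>
     quotient_tensor_map \<pi> X ` (B_ell2 \<otimes>\<^sub>m\<^sub>i\<^sub>n X) = calkin_algebra \<pi> \<otimes>\<^sub>m\<^sub>i\<^sub>n X"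

text \<open>\<open>quotient_tensor_map\<close> is constant on every coset of \<open>K \<otimes>\<^sub>m\<^sub>i\<^sub>n X\<close> in \<open>B \<otimes>\<^sub>m\<^sub>i\<^sub>n X\<close>, so the
  image of a coset is a singleton.\<close>

definition T_map ::
    "((nat ell2 \<Rightarrow>\<^sub>L nat ell2) set \<Rightarrow> ('k::complex_hilbert \<Rightarrow>\<^sub>L 'k)) \<Rightarrow> ('h::complex_hilbert \<Rightarrow>\<^sub>L 'h) set \<Rightarrow>
      ((nat ell2, 'h) htensor \<Rightarrow>\<^sub>L (nat ell2, 'h) htensor) set \<Rightarrow> (('k, 'h) htensor \<Rightarrow>\<^sub>L ('k, 'h) htensor)" where
  "T_map \<pi> X C = the_elem (quotient_tensor_map \<pi> X ` C)"

definition ex ::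
    "((nat ell2 \<Rightarrow>\<^sub>L nat ell2) set \<Rightarrow> ('k::complex_hilbert \<Rightarrow>\<^sub>L 'k)) \<Rightarrow> ('h::complex_hilbert \<Rightarrow>\<^sub>L 'h) set \<Rightarrow> ennreal" where
  "ex \<pi> X =
     (if exact_operator_space \<pi> X
      then SUP y \<in> {y \<in> calkin_algebra \<pi> \<otimes>\<^sub>m\<^sub>i\<^sub>n X. norm y \<le> 1}.
        ennreal (quotient_norm
          (inv_into (quotient_space (B_ell2 \<otimes>\<^sub>m\<^sub>i\<^sub>n X) (K_ell2 \<otimes>\<^sub>m\<^sub>i\<^sub>n X)) (T_map \<pi> X) y))
      else \<infinity>)"

end

theory Submission
  imports Defs
begin

text \<open>The norm of an operator, of a matrix of operators and of \<open>\<Sum>\<^sub>i b\<^sub>i \<otimes> x\<^sub>i\<close> is in each case the bound of a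
  scalar matrix of entries with respect to orthonormal bases, so that either leg of a tensor
  product can be cut down to finitely many basis vectors.

  If \<open>d\<^sub>S\<^sub>K \<le> S\<close> on the finite-dimensional subspaces, an embedding of \<open>E\<close> into \<open>K\<close> turns an element of
  \<open>B \<otimes> E\<close>, up to a small error, into a finite matrix over \<open>B\<close>. Cuntz isometries identify
  \<open>M\<^sub>m(B)\<close> with \<open>B\<close> and are compatible with \<open>\<pi>\<close>, so the matrix has a compact perturbation whose norm is
  almost that of its image in the Calkin algebra; this perturbation disappears after cutting off
  finitely many coordinates. Hence elements of \<open>(B/K) \<otimes> X\<close> lift with constant \<open>S\<close>.

  Conversely, suppose that \<open>d\<^sub>S\<^sub>K(E) > C'\<close>. Then for every compression \<open>v\<^sub>n\<close> of \<open>E\<close> to finitely many basis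
  vectors there is a matrix \<open>a\<^sub>n\<close> over \<open>E\<close> with \<open>\<parallel>v\<^sub>n(a\<^sub>n)\<parallel> \<le> 1\<close> and \<open>\<parallel>a\<^sub>n\<parallel> > C'\<close>. If the \<open>v\<^sub>n\<close> increase to a
  norming family, the block diagonal sum of the \<open>a\<^sub>n\<close> is an element of \<open>B \<otimes> E\<close> whose image in
  \<open>(B/K) \<otimes> X\<close> has norm at most \<open>1\<close>, as finitely many blocks do not matter there, but whose
  distance to \<open>K \<otimes> X\<close> is at least \<open>C'\<close>. So \<open>ex(X) \<ge> C'\<close>, and \<open>ex(X)\<close> is finite for exact \<open>X\<close> by the
  open mapping theorem.\<close>

section \<open>Linear maps and their extensions\<close>

text \<open>Two obstacles shape the construction in \<open>SK_le_if_exact\<close>. The matrices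
  \<open>a n\<close> have no common norm bound, only their compressions are bounded by 1, so their
  block diagonal sum is not obviously an operator. It is formed coefficientwise: in
  \<open>e = \<Sum>l f l e x l\<close> the functionals \<open>f l\<close> read off finitely many
  matrix entries, and the basis vectors involved are put into every compression. Hence the scalar
  blocks \<open>f l (a n)\<close> are uniformly bounded and assemble to operators
  \<open>T l\<close>, and the sum is \<open>\<Sum>l T l \<otimes> x l\<close>. Secondly,
  \<open>H\<close> may be nonseparable, while the compressions exhaust only countably many basis
  vectors; separability of \<open>E\<close> provides countably many vectors that determine all
  matrix norms over \<open>E\<close>.

  In the other direction the constant is a product of two cb norms: one is paid on the Calkin side
  for entering \<open>K\<close>, the other on the side of \<open>B\<close> for returning; the lift
  between them costs only an \<epsilon>. Finite-dimensional subspaces decide because a finite sum of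
  tensors involves finitely many vectors of \<open>X\<close>; the completion is reached by
  successive approximation.\<close>

instance complex_hilbert \<subseteq> banach ..

lemma scaleC_minus_right: "c *\<^sub>C (- x) = - (c *\<^sub>C (x :: 'a::complex_vector))"
  using scaleC_add_right[of c x "- x"] by (simp add: eq_neg_iff_add_eq_0 add.commute)

lemma scaleC_minus_left: "(- c) *\<^sub>C x = - (c *\<^sub>C (x :: 'a::complex_vector))"
  using scaleC_add_left[of c "- c" x] by (simp add: eq_neg_iff_add_eq_0 add.commute)

lemma scaleC_diff_right: "c *\<^sub>C (x - y) = c *\<^sub>C x - c *\<^sub>C (y :: 'a::complex_vector)"
  using scaleC_add_right[of c x "- y"] by (simp add: scaleC_minus_right)

lemma scaleC_diff_left: "(c - d) *\<^sub>C x = c *\<^sub>C x - d *\<^sub>C (x :: 'a::complex_vector)"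
  using scaleC_add_left[of "c - d" d x] by simp

lemma scaleC_sum_right: "c *\<^sub>C (\<Sum>i\<in>F. f i) = (\<Sum>i\<in>F. c *\<^sub>C (f i :: 'a::complex_vector))"
  by (induction F rule: infinite_finite_induct) (simp_all add: scaleC_add_right)

lemma csubspaceD:
  assumes "csubspace V"
  shows "0 \<in> V" "x \<in> V \<Longrightarrow> y \<in> V \<Longrightarrow> x + y \<in> V" "x \<in> V \<Longrightarrow> c *\<^sub>C x \<in> V"
    "x \<in> V \<Longrightarrow> - x \<in> V" "x \<in> V \<Longrightarrow> y \<in> V \<Longrightarrow> x - y \<in> V"
proof -
  show 1: "0 \<in> V" "x \<in> V \<Longrightarrow> y \<in> V \<Longrightarrow> x + y \<in> V" "x \<in> V \<Longrightarrow> c *\<^sub>C x \<in> V" for x y c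
    using assms by (auto simp: csubspace_def)
  show 2: "x \<in> V \<Longrightarrow> - x \<in> V" for x
    using 1(3)[of x "- 1"] by (simp add: scaleC_minus_left)
  show "x \<in> V \<Longrightarrow> y \<in> V \<Longrightarrow> x - y \<in> V"
    using 1(2)[of x "- y"] 2[of y] by simp
qed

lemma csubspace_comb: "csubspace V \<Longrightarrow> x \<in> V \<Longrightarrow> y \<in> V \<Longrightarrow> x + d *\<^sub>C y \<in> V"
  by (simp add: csubspaceD)

lemma csubspace_sum: "csubspace V \<Longrightarrow> (\<And>i. i \<in> F \<Longrightarrow> f i \<in> V) \<Longrightarrow> (\<Sum>i\<in>F. f i) \<in> V"
  by (induction F rule: infinite_finite_induct) (simp_all add: csubspaceD)

lemma clinear_onD:
  assumes "clinear_on V f" "csubspace V"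
  shows "x \<in> V \<Longrightarrow> y \<in> V \<Longrightarrow> f (x + y) = f x + f y" "x \<in> V \<Longrightarrow> f (c *\<^sub>C x) = c *\<^sub>C f x"
    "f 0 = 0" "x \<in> V \<Longrightarrow> y \<in> V \<Longrightarrow> f (x - y) = f x - f y"
proof -
  show 1: "x \<in> V \<Longrightarrow> y \<in> V \<Longrightarrow> f (x + y) = f x + f y" "x \<in> V \<Longrightarrow> f (c *\<^sub>C x) = c *\<^sub>C f x" for x y c
    using assms(1) by (auto simp: clinear_on_def)
  show "f 0 = 0" using 1(2)[of 0 0] csubspaceD(1)[OF assms(2)] by simp
  show "x \<in> V \<Longrightarrow> y \<in> V \<Longrightarrow> f (x - y) = f x - f y"
    using 1(1)[of "x - y" y] csubspaceD[OF assms(2)] by simp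
qed

lemma clinear_on_subset: "clinear_on V f \<Longrightarrow> W \<subseteq> V \<Longrightarrow> clinear_on W f"
  by (simp add: clinear_on_def subset_iff)

lemma clinear_on_sum:
  assumes "clinear_on V f" "csubspace V" "\<And>i. i \<in> F \<Longrightarrow> g i \<in> V"
  shows "f (\<Sum>i\<in>F. g i) = (\<Sum>i\<in>F. f (g i))"
  using assms(3)
  by (induction F rule: infinite_finite_induct)
    (simp_all add: clinear_onD[OF assms(1,2)] csubspace_sum[OF assms(2)])

lemma lincomb_combine:
  fixes v :: "'i \<Rightarrow> 'a::complex_vector"
  assumes "finite F" "finite F'"
  shows "(\<Sum>i\<in>F. c i *\<^sub>C v i) + d *\<^sub>C (\<Sum>i\<in>F'. c' i *\<^sub>C v i) =
     (\<Sum>i\<in>F \<union> F'. ((if i \<in> F then c i else 0) + d * (if i \<in> F' then c' i else 0)) *\<^sub>C v i)"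
proof -
  have *: "(\<Sum>i\<in>G. c i *\<^sub>C v i) = (\<Sum>i\<in>H. (if i \<in> G then c i else 0) *\<^sub>C v i)"
    if "finite H" "G \<subseteq> H" for G H c
    using that by (intro sum.mono_neutral_cong_left) auto
  show ?thesis
    unfolding scaleC_add_left sum.distrib scaleC_scaleC[symmetric] scaleC_sum_right[symmetric]
    using assms by (subst (1 2) *[of "F \<union> F'"]) auto
qed

lemma cspan_image:
  "cspan (g ` I) = {\<Sum>i\<in>F. c i *\<^sub>C g i | F c. finite F \<and> F \<subseteq> I}" (is "_ = ?R")
proof
  have "csubspace ?R"
    unfolding csubspace_def
  proof (intro conjI ballI allI)
    show "0 \<in> ?R" by (auto intro!: exI[of _ "{}"])
  next
    fix x y assume "x \<in> ?R" "y \<in> ?R"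
    then obtain F c F' c' where *: "finite F" "F \<subseteq> I" "x = (\<Sum>i\<in>F. c i *\<^sub>C g i)"
      "finite F'" "F' \<subseteq> I" "y = (\<Sum>i\<in>F'. c' i *\<^sub>C g i)" by blast
    then have "x + y = (\<Sum>i\<in>F \<union> F'. ((if i \<in> F then c i else 0) + 1 * (if i \<in> F' then c' i else 0)) *\<^sub>C g i)"
      using lincomb_combine[of F F' c g 1 c'] by simp
    moreover have "finite (F \<union> F')" "F \<union> F' \<subseteq> I" using * by auto
    ultimately show "x + y \<in> ?R" by (intro CollectI exI conjI)
  next
    fix a x assume "x \<in> ?R"
    then obtain F c where *: "finite F" "F \<subseteq> I" "x = (\<Sum>i\<in>F. c i *\<^sub>C g i)" by blast
    then have "a *\<^sub>C x = (\<Sum>i\<in>F. (a * c i) *\<^sub>C g i)"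
      by (simp add: scaleC_sum_right scaleC_scaleC)
    then show "a *\<^sub>C x \<in> ?R" using *(1,2) by (intro CollectI exI conjI)
  qed
  moreover have "g ` I \<subseteq> ?R"
  proof clarify
    fix i assume "i \<in> I"
    then show "\<exists>F c. g i = (\<Sum>i\<in>F. c i *\<^sub>C g i) \<and> finite F \<and> F \<subseteq> I"
      by (intro exI[of _ "{i}"] exI[of _ "\<lambda>_. 1"]) simp
  qed
  ultimately show "cspan (g ` I) \<subseteq> ?R" by (rule cspan_minimal[rotated])
  show "?R \<subseteq> cspan (g ` I)"
    using cspan_superset[of "g ` I"]
    by (auto intro!: csubspace_sum[OF csubspace_cspan] csubspaceD(3)[OF csubspace_cspan])
qed

lemma clinear_on_sum_scaleC:
  assumes "clinear_on V f" "csubspace V" "\<And>i. i \<in> F \<Longrightarrow> g i \<in> V"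
  shows "f (\<Sum>i\<in>F. c i *\<^sub>C g i) = (\<Sum>i\<in>F. c i *\<^sub>C f (g i))"
  using assms(3) by (subst clinear_on_sum[OF assms(1,2)])
    (auto intro!: sum.cong simp: clinear_onD[OF assms(1,2)] csubspaceD(3)[OF assms(2)])

text \<open>The bound makes \<open>g i \<mapsto> h i\<close> well defined on the span even when the
  \<open>g i\<close> are linearly dependent: a combination that vanishes for \<open>g\<close>
  vanishes for \<open>h\<close>. Completeness of the target then carries the map to the closure with
  the same bound. Operators given on a total set and the canonical map \<open>Q\<close> are built
  this way.\<close>

lemma extend_clinear:
  fixes g :: "'i \<Rightarrow> 'a::complex_normed_vector" and h :: "'i \<Rightarrow> 'b::{complex_normed_vector,complete_space}"
  assumes bound: "\<And>F c. finite F \<Longrightarrow> F \<subseteq> I \<Longrightarrow>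
      norm (\<Sum>i\<in>F. c i *\<^sub>C h i) \<le> C * norm (\<Sum>i\<in>F. c i *\<^sub>C g i)"
  shows "\<exists>f. clinear_on (closure (cspan (g ` I))) f \<and>
    (\<forall>x\<in>closure (cspan (g ` I)). norm (f x) \<le> C * norm x) \<and>
    (\<forall>i\<in>I. f (g i) = h i) \<and> continuous_on (closure (cspan (g ` I))) f"
proof -
  define V where "V = cspan (g ` I)"
  \<comment> \<open>\<open>R\<close> is the graph of the map on the span, with common coefficients
    for both sides. Working with the graph avoids a choice of coefficients; \<open>uniq\<close>
    turns it into a function.\<close>
  define R where "R = (\<lambda>x y. \<exists>F c. finite F \<and> F \<subseteq> I \<and> x = (\<Sum>i\<in>F. c i *\<^sub>C g i) \<and> y = (\<Sum>i\<in>F. c i *\<^sub>C h i))"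
  have V: "csubspace V" unfolding V_def by (rule csubspace_cspan)
  have ex: "\<exists>y. R x y" if "x \<in> V" for x
    using that unfolding V_def cspan_image R_def by blast
  have bnd: "norm y \<le> C * norm x" if "R x y" for x y
    using that bound unfolding R_def by blast
  have comb: "R (x + d *\<^sub>C x') (y + d *\<^sub>C y')" if "R x y" "R x' y'" for x y x' y' d
  proof -
    from that obtain F c F' c' where *: "finite F" "F \<subseteq> I" "x = (\<Sum>i\<in>F. c i *\<^sub>C g i)" "y = (\<Sum>i\<in>F. c i *\<^sub>C h i)"
      "finite F'" "F' \<subseteq> I" "x' = (\<Sum>i\<in>F'. c' i *\<^sub>C g i)" "y' = (\<Sum>i\<in>F'. c' i *\<^sub>C h i)"
      unfolding R_def by blast
    show ?thesis unfolding R_def *(3,4,7,8)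
      using *(1,2,5,6)
      by (intro exI[of _ "F \<union> F'"]
          exI[of _ "\<lambda>i. (if i \<in> F then c i else 0) + d * (if i \<in> F' then c' i else 0)"]
          conjI lincomb_combine) auto
  qed
  have uniq: "y = y'" if "R x y" "R x y'" for x y y'
    using bnd[OF comb[OF that, of "- 1"]] by (simp add: scaleC_minus_left)
  define f0 where "f0 = (\<lambda>x. SOME y. R x y)"
  have f0: "R x (f0 x)" if "x \<in> V" for x
    unfolding f0_def using ex[OF that] by (rule someI_ex)
  have f0_comb: "f0 (x + d *\<^sub>C x') = f0 x + d *\<^sub>C f0 x'" if "x \<in> V" "x' \<in> V" for x x' d
    by (rule uniq[OF f0 comb]) (use that f0 csubspace_comb[OF V] in blast)+
  have f0_norm: "norm (f0 x) \<le> C * norm x" if "x \<in> V" for x using bnd[OF f0[OF that]] .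
  have f0_diff: "f0 (x - y) = f0 x - f0 y" if "x \<in> V" "y \<in> V" for x y
    using f0_comb[OF that, of "- 1"] by (simp add: scaleC_minus_left)
  have lip: "dist (f0 x) (f0 y) \<le> \<bar>C\<bar> * dist x y" if xy: "x \<in> V" "y \<in> V" for x y
  proof -
    have "norm (f0 (x - y)) \<le> C * norm (x - y)" by (rule f0_norm[OF csubspaceD(5)[OF V xy]])
    also have "\<dots> \<le> \<bar>C\<bar> * norm (x - y)" by (intro mult_right_mono) auto
    finally show ?thesis by (simp add: dist_norm f0_diff[OF xy])
  qed
  have uc0: "uniformly_continuous_on V f0"
    unfolding uniformly_continuous_on_def
  proof (intro allI impI)
    fix e :: real assume "e > 0"
    have "dist (f0 x') (f0 x) < e" if "x \<in> V" "x' \<in> V" "dist x' x < e / (\<bar>C\<bar> + 1)" for x x'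
    proof -
      have "dist (f0 x') (f0 x) \<le> (\<bar>C\<bar> + 1) * dist x' x"
        using lip[OF that(2,1)] by (simp add: distrib_right add_increasing2)
      also have "\<dots> < e" using that(3) by (simp add: field_simps)
      finally show ?thesis .
    qed
    then show "\<exists>d>0. \<forall>x\<in>V. \<forall>x'\<in>V. dist x' x < d \<longrightarrow> dist (f0 x') (f0 x) < e"
      using \<open>e > 0\<close> by (intro exI[of _ "e / (\<bar>C\<bar> + 1)"]) auto
  qed
  obtain f where uc: "uniformly_continuous_on (closure V) f" and ff: "\<And>x. x \<in> V \<Longrightarrow> f0 x = f x"
    by (rule uniformly_continuous_on_extension_on_closure[OF uc0], rule that)
  have cont: "continuous_on (closure V) f" using uc by (rule uniformly_continuous_imp_continuous)
  have lim: "\<exists>xs. (\<forall>n. xs n \<in> V) \<and> xs \<longlonglongrightarrow> x \<and> (\<lambda>n. f0 (xs n)) \<longlonglongrightarrow> f x" if "x \<in> closure V" for x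
  proof -
    obtain xs where xs: "\<forall>n. xs n \<in> V" "xs \<longlonglongrightarrow> x" using \<open>x \<in> closure V\<close> unfolding closure_sequential by blast
    have "(\<lambda>n. f (xs n)) \<longlonglongrightarrow> f x"
      by (rule continuous_on_tendsto_compose[OF cont xs(2) that])
        (use xs closure_subset in \<open>auto intro!: always_eventually\<close>)
    then show ?thesis using xs ff by auto
  qed
  have comb': "f (x + d *\<^sub>C y) = f x + d *\<^sub>C f y" if xy: "x \<in> closure V" "y \<in> closure V" for x y d
  proof -
    obtain xs ys where *: "\<forall>n. xs n \<in> V" "xs \<longlonglongrightarrow> x" "(\<lambda>n. f0 (xs n)) \<longlonglongrightarrow> f x"
      "\<forall>n. ys n \<in> V" "ys \<longlonglongrightarrow> y" "(\<lambda>n. f0 (ys n)) \<longlonglongrightarrow> f y"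
      using lim[OF xy(1)] lim[OF xy(2)] by (elim exE conjE)
    have l: "(\<lambda>n. xs n + d *\<^sub>C ys n) \<longlonglongrightarrow> x + d *\<^sub>C y"
      by (intro tendsto_add * bounded_linear.tendsto[OF bounded_linear_scaleC])
    have inV: "xs n + d *\<^sub>C ys n \<in> V" for n using * by (intro csubspace_comb[OF V]) auto
    have "x + d *\<^sub>C y \<in> closure V"
      by (rule csubspace_comb[OF csubspace_closure[OF V] xy])
    then have "(\<lambda>n. f (xs n + d *\<^sub>C ys n)) \<longlonglongrightarrow> f (x + d *\<^sub>C y)"
      by (rule continuous_on_tendsto_compose[OF cont l])
        (use inV closure_subset in \<open>auto intro!: always_eventually\<close>)
    moreover have "(\<lambda>n. f0 (xs n) + d *\<^sub>C f0 (ys n)) \<longlonglongrightarrow> f x + d *\<^sub>C f y"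
      by (intro tendsto_add bounded_linear.tendsto[OF bounded_linear_scaleC] *)
    moreover have "f (xs n + d *\<^sub>C ys n) = f0 (xs n) + d *\<^sub>C f0 (ys n)" for n
      using ff[OF inV[of n]] f0_comb * by simp
    ultimately show ?thesis using LIMSEQ_unique by simp
  qed
  have 0: "0 \<in> closure V" using csubspace_closure[OF V] by (rule csubspaceD)
  show ?thesis
  proof (intro exI[of _ f] conjI ballI)
    show "clinear_on (closure (cspan (g ` I))) f"
      unfolding clinear_on_def V_def[symmetric]
    proof (intro conjI ballI allI)
      show "f (x + y) = f x + f y" if "x \<in> closure V" "y \<in> closure V" for x y
        using comb'[OF that, of 1] by simp
      have "f 0 = 0" using comb'[OF 0 0, of 1] by simp
      then show "f (c *\<^sub>C x) = c *\<^sub>C f x" if "x \<in> closure V" for c x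
        using comb'[OF 0 that, of c] by simp
    qed
    show "norm (f x) \<le> C * norm x" if x: "x \<in> closure (cspan (g ` I))" for x
    proof -
      obtain xs where *: "\<forall>n. xs n \<in> V" "xs \<longlonglongrightarrow> x" "(\<lambda>n. f0 (xs n)) \<longlonglongrightarrow> f x"
        using lim x unfolding V_def by blast
      show ?thesis
        by (rule LIMSEQ_le[OF tendsto_norm[OF *(3)] tendsto_mult_left[OF tendsto_norm[OF *(2)]]])
          (use *(1) f0_norm in auto)
    qed
    show "f (g i) = h i" if "i \<in> I" for i
    proof -
      have R: "R (g i) (h i)"
        unfolding R_def using that by (intro exI[of _ "{i}"] exI[of _ "\<lambda>_. 1"]) simp
      have "g i \<in> V" unfolding V_def using cspan_superset[of "g ` I"] that by blast
      then show ?thesis using ff[of "g i"] uniq[OF f0 R] by simp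
    qed
    show "continuous_on (closure (cspan (g ` I))) f" using cont by (simp add: V_def)
  qed
qed

lemma closure_cspan_minimal: "S \<subseteq> V \<Longrightarrow> csubspace V \<Longrightarrow> closed V \<Longrightarrow> closure (cspan S) \<subseteq> V"
  by (intro closure_minimal cspan_minimal)

lemma closure_cspan_superset: "S \<subseteq> closure (cspan S)"
  using cspan_superset closure_subset by blast

text \<open>The points of agreement form a closed subspace. This is the uniqueness companion of
  \<open>extend_clinear\<close>.\<close>

lemma clinear_on_closure_cspan_eq:
  fixes f g :: "'a::complex_normed_vector \<Rightarrow> 'b::complex_normed_vector"
  assumes f: "clinear_on (closure (cspan S)) f" "continuous_on (closure (cspan S)) f"
    and g: "clinear_on (closure (cspan S)) g" "continuous_on (closure (cspan S)) g"
    and eq: "\<And>x. x \<in> S \<Longrightarrow> f x = g x" and x: "x \<in> closure (cspan S)"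
  shows "f x = g x"
proof -
  let ?W = "closure (cspan S)"
  let ?V = "{x \<in> ?W. f x - g x = 0}"
  have W: "csubspace ?W" by (rule csubspace_closure[OF csubspace_cspan])
  note D = clinear_onD[OF f(1) W] clinear_onD[OF g(1) W] csubspaceD[OF W]
  have "csubspace ?V" unfolding csubspace_def using D by auto
  moreover have "closed ?V"
    by (intro continuous_closed_preimage_constant continuous_on_diff f g closed_closure)
  moreover have "S \<subseteq> ?V" using eq closure_cspan_superset by auto
  ultimately have "?W \<subseteq> ?V" by (intro closure_cspan_minimal)
  then show ?thesis using x by auto
qed

section \<open>Bounded operators and orthonormal bases\<close>

lemma bounded_opsD: "a \<in> bounded_ops \<Longrightarrow> blinfun_apply a (c *\<^sub>C x) = c *\<^sub>C blinfun_apply a x"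
  by (simp add: bounded_ops_def)

lemma csubspace_bounded_ops: "csubspace bounded_ops"
  by (auto simp: csubspace_def bounded_ops_def blinfun.add_left scaleC_blinfun.rep_eq
      scaleC_add_right scaleC_scaleC mult.commute)

lemmas bounded_ops_arith [simp, intro] = csubspaceD[OF csubspace_bounded_ops]
lemmas bounded_ops_sum [simp, intro] = csubspace_sum[OF csubspace_bounded_ops]

lemma comp_bounded_ops [simp, intro]: "a \<in> bounded_ops \<Longrightarrow> b \<in> bounded_ops \<Longrightarrow> a o\<^sub>L b \<in> bounded_ops"
  by (simp add: bounded_ops_def)

lemma id_bounded_ops [simp]: "id_blinfun \<in> bounded_ops"
  by (simp add: bounded_ops_def)

lemma bounded_ops_lincomb:
  "a \<in> bounded_ops \<Longrightarrow> blinfun_apply a (\<Sum>i\<in>F. c i *\<^sub>C x i) = (\<Sum>i\<in>F. c i *\<^sub>C blinfun_apply a (x i))"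
  by (simp add: blinfun.sum_right bounded_opsD)

lemma bounded_linear_continuous_on_blinfun: "continuous_on S (blinfun_apply a)"
  by (intro linear_continuous_on blinfun.bounded_linear_right)

lemma bounded_ops_eqI:
  assumes "a \<in> bounded_ops" "b \<in> bounded_ops" "closure (cspan S) = UNIV"
    and "\<And>x. x \<in> S \<Longrightarrow> blinfun_apply a x = blinfun_apply b x"
  shows "a = b"
proof (rule blinfun_eqI)
  fix x
  show "blinfun_apply a x = blinfun_apply b x"
    by (rule clinear_on_closure_cspan_eq[of S])
      (use assms in \<open>auto simp: clinear_on_def blinfun.add_right bounded_opsD bounded_linear_continuous_on_blinfun\<close>)
qed

lemma extend_bounded_op:
  fixes g :: "'i \<Rightarrow> 'a::complex_hilbert" and h :: "'i \<Rightarrow> 'b::complex_hilbert"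
  assumes bound: "\<And>F c. finite F \<Longrightarrow> F \<subseteq> I \<Longrightarrow>
      norm (\<Sum>i\<in>F. c i *\<^sub>C h i) \<le> C * norm (\<Sum>i\<in>F. c i *\<^sub>C g i)"
    and UNIV: "closure (cspan (g ` I)) = UNIV" and C: "0 \<le> C"
  obtains a where "a \<in> bounded_ops" "\<And>i. i \<in> I \<Longrightarrow> blinfun_apply a (g i) = h i" "norm a \<le> C"
proof -
  obtain f where f: "clinear_on (closure (cspan (g ` I))) f"
    "\<forall>x\<in>closure (cspan (g ` I)). norm (f x) \<le> C * norm x" "\<forall>i\<in>I. f (g i) = h i"
    using extend_clinear[OF bound] by blast
  have "bounded_linear f"
    using f(1,2) unfolding UNIV clinear_on_def
    by (intro bounded_linear_intro[where K=C]) (auto simp: scaleR_scaleC mult.commute)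
  then have [simp]: "blinfun_apply (Blinfun f) = f" by (rule bounded_linear_Blinfun_apply)
  show thesis
    by (rule that[of "Blinfun f"])
      (use f UNIV C in \<open>auto simp: bounded_ops_def clinear_on_def intro!: norm_blinfun_bound\<close>)
qed

lemma orthonormal_basisD: "orthonormal_basis B \<Longrightarrow> orthonormal B"
  by (simp add: orthonormal_basis_def)

lemma orthonormal_some_onb: "orthonormal some_onb"
  using orthonormal_basisD[OF orthonormal_basis_some_onb] .

text \<open>By Parseval a finite part of the basis carries the squared norm of \<open>x\<close> up
  to the square of \<open>e\<close>, and by the Bessel identity the defect is the squared distance
  to the partial expansion.\<close>

lemma closure_cspan_onb:
  assumes B: "orthonormal_basis B"
  shows "closure (cspan B) = UNIV"
proof -
  have "x \<in> closure (cspan B)" for x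
    unfolding closure_approachable
  proof (intro allI impI)
    fix e :: real assume e: "e > 0"
    have on: "orthonormal B" using B by (rule orthonormal_basisD)
    obtain F where F: "finite F" "F \<subseteq> B" "(norm x)\<^sup>2 - e\<^sup>2 < (\<Sum>b\<in>F. (cmod (cinner b x))\<^sup>2)"
    proof (rule ccontr)
      assume "\<not> thesis"
      then have "(norm x)\<^sup>2 \<le> (norm x)\<^sup>2 - e\<^sup>2"
        by (intro has_sum_le_finite_sums[OF parseval[OF B]]) (use that in force)
      then show False using e by simp
    qed
    have "(norm (x - (\<Sum>b\<in>F. cinner b x *\<^sub>C b)))\<^sup>2 < e\<^sup>2"
      using F by (simp add: bessel[OF on])
    then have "dist (\<Sum>b\<in>F. cinner b x *\<^sub>C b) x < e"
      using e by (simp add: dist_norm norm_minus_commute power2_less_imp_less)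
    moreover have "(\<Sum>b\<in>F. cinner b x *\<^sub>C b) \<in> cspan B"
      using F cspan_superset[of B]
      by (intro csubspace_sum[OF csubspace_cspan] csubspaceD(3)[OF csubspace_cspan]) auto
    ultimately show "\<exists>y\<in>cspan B. dist y x < e" by blast
  qed
  then show ?thesis by blast
qed

lemma norm_le_onb:
  assumes B: "orthonormal_basis B" and C: "0 \<le> C"
    and le: "\<And>F. finite F \<Longrightarrow> F \<subseteq> B \<Longrightarrow> L2_set (\<lambda>b. cmod (cinner b x)) F \<le> C"
  shows "norm x \<le> C"
proof -
  have "(\<Sum>b\<in>F. (cmod (cinner b x))\<^sup>2) \<le> C\<^sup>2" if "finite F" "F \<subseteq> B" for F
    using power_mono[OF le[OF that], of 2] by (simp add: L2_set_def sum_nonneg)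
  then have "(norm x)\<^sup>2 \<le> C\<^sup>2"
    by (rule has_sum_le_finite_sums[OF parseval[OF B]])
  then show ?thesis using C by (rule power2_le_imp_le)
qed

lemma L2_cinner_le_norm:
  assumes "orthonormal B" "finite F" "F \<subseteq> B"
  shows "L2_set (\<lambda>b. cmod (cinner b x)) F \<le> norm x"
  using bessel_le[OF assms, of x] by (simp add: L2_set_def real_le_lsqrt)

lemma norm_orthonormal_L2:
  assumes "orthonormal B" "finite F" "F \<subseteq> B"
  shows "norm (\<Sum>d\<in>F. c d *\<^sub>C d) = L2_set (\<lambda>d. cmod (c d)) F"
  using norm_orthonormal_sum[OF assms, of c]
  by (metis L2_set_def norm_ge_zero real_sqrt_abs abs_of_nonneg)

lemma eq_zero_onb: "orthonormal_basis B \<Longrightarrow> (\<And>b. b \<in> B \<Longrightarrow> cinner b x = 0) \<Longrightarrow> x = 0"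
  by (auto simp: orthonormal_basis_def)

lemma cauchy_schwarz: "cmod (cinner x y) \<le> norm x * norm (y :: 'a::complex_hilbert)"
proof (cases "cinner x y = 0")
  case False
  \<comment> \<open>A unimodular factor turns the inner product into its modulus, which reduces the
    claim to the real inner product.\<close>
  define c where "c = cnj (cinner x y) / cmod (cinner x y)"
  have "cmod c = 1" using False by (simp add: c_def norm_divide)
  have "c * cinner x y = complex_of_real (cmod (cinner x y))"
    using False complex_norm_square[of "cinner x y"]
    by (simp add: c_def power2_eq_square mult.commute field_simps)
  then have "cmod (cinner x y) = inner x (c *\<^sub>C y)"
    unfolding inner_Re_cinner cinner_scaleC_right by simp
  also have "\<dots> \<le> norm x * norm (c *\<^sub>C y)" by (rule norm_cauchy_schwarz)
  finally show ?thesis using \<open>cmod c = 1\<close> by (simp add: norm_scaleC)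
qed simp

section \<open>Scalar matrices\<close>

lemma L2_set_subset: "finite G \<Longrightarrow> F \<subseteq> G \<Longrightarrow> L2_set f F \<le> L2_set f G"
  unfolding L2_set_def by (intro real_sqrt_le_mono sum_mono2) auto

lemma L2_set_times:
  assumes "finite A" "finite B"
  shows "L2_set f (A \<times> B) = L2_set (\<lambda>i. L2_set (\<lambda>j. f (i, j)) B) A"
  unfolding L2_set_def using assms by (simp add: sum.cartesian_product sum_nonneg case_prod_unfold)

lemma L2_set_mono_neutral:
  assumes "finite G" "F \<subseteq> G" "\<And>i. i \<in> G - F \<Longrightarrow> f i = 0"
  shows "L2_set f G = L2_set f F"
  unfolding L2_set_def using assms by (auto intro!: arg_cong[of _ _ sqrt] sum.mono_neutral_right)

text \<open>This says that \<open>M\<close> acts on square summable families over \<open>I\<close>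
  with norm at most \<open>C\<close>. Finite square sections express it without summability, and
  restriction, reindexing and zero padding become manipulations of finite sums.\<close>

definition mbound :: "'i set \<Rightarrow> ('i \<Rightarrow> 'i \<Rightarrow> complex) \<Rightarrow> real \<Rightarrow> bool" where
  "mbound I M C \<longleftrightarrow> (\<forall>F \<alpha>. finite F \<and> F \<subseteq> I \<longrightarrow>
     L2_set (\<lambda>i. cmod (\<Sum>j\<in>F. M i j * \<alpha> j)) F \<le> C * L2_set (\<lambda>j. cmod (\<alpha> j)) F)"

lemma mboundD:
  "mbound I M C \<Longrightarrow> finite F \<Longrightarrow> F \<subseteq> I \<Longrightarrow>
     L2_set (\<lambda>i. cmod (\<Sum>j\<in>F. M i j * \<alpha> j)) F \<le> C * L2_set (\<lambda>j. cmod (\<alpha> j)) F"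
  by (simp add: mbound_def)

lemma L2_restrict:
  assumes "finite H" "F \<subseteq> H"
  shows "L2_set (\<lambda>i. cmod (\<Sum>j\<in>F. M i j * \<alpha> j)) F
      \<le> L2_set (\<lambda>i. cmod (\<Sum>j\<in>H. M i j * (if j \<in> F then \<alpha> j else 0))) H" (is ?A)
    and "L2_set (\<lambda>j. cmod (if j \<in> F then \<alpha> j else 0)) H = L2_set (\<lambda>j. cmod (\<alpha> j)) F" (is ?B)
proof -
  have "(\<Sum>j\<in>F. M i j * \<alpha> j) = (\<Sum>j\<in>H. M i j * (if j \<in> F then \<alpha> j else 0))" for i
    using assms by (intro sum.mono_neutral_cong_left) auto
  then show ?A using L2_set_subset[OF assms] by simp
  show ?B using assms by (subst L2_set_mono_neutral[of H F]) (auto intro: L2_set_cong)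
qed

text \<open>A vector supported in \<open>F\<close> is padded by zeros to the larger section
  \<open>H\<close>. For product index sets this allows sections that are themselves
  products.\<close>

lemma mbound_cofinal:
  assumes "\<And>F. finite F \<Longrightarrow> F \<subseteq> I \<Longrightarrow> \<exists>H. finite H \<and> F \<subseteq> H \<and> mbound H M C"
  shows "mbound I M C"
  unfolding mbound_def
proof (intro allI impI)
  fix F \<alpha> assume "finite F \<and> F \<subseteq> I"
  then obtain H where H: "finite H" "F \<subseteq> H" "mbound H M C" using assms by blast
  show "L2_set (\<lambda>i. cmod (\<Sum>j\<in>F. M i j * \<alpha> j)) F \<le> C * L2_set (\<lambda>j. cmod (\<alpha> j)) F"
    using mboundD[OF H(3,1) subset_refl, of "\<lambda>j. if j \<in> F then \<alpha> j else 0"]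
      L2_restrict(1)[OF H(1,2), of M \<alpha>] by (simp add: L2_restrict(2)[OF H(1,2)])
qed

lemma mbound_subset: "mbound I M C \<Longrightarrow> J \<subseteq> I \<Longrightarrow> mbound J M C"
  unfolding mbound_def by blast

lemma mbound_mono: "mbound I M C \<Longrightarrow> C \<le> D \<Longrightarrow> mbound I M D"
  unfolding mbound_def by (meson L2_set_nonneg mult_right_mono order_trans)

lemma mbound_finiteI:
  assumes F: "finite F"
    and le: "\<And>\<alpha>. L2_set (\<lambda>i. cmod (\<Sum>j\<in>F. M i j * \<alpha> j)) F \<le> C * L2_set (\<lambda>j. cmod (\<alpha> j)) F"
  shows "mbound F M C"
  unfolding mbound_def
proof (intro allI impI)
  fix G \<alpha> assume G: "finite G \<and> G \<subseteq> F"
  show "L2_set (\<lambda>i. cmod (\<Sum>j\<in>G. M i j * \<alpha> j)) G \<le> C * L2_set (\<lambda>j. cmod (\<alpha> j)) G"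
    using le[of "\<lambda>j. if j \<in> G then \<alpha> j else 0"] L2_restrict(1)[OF F, of G M \<alpha>] G
    by (simp add: L2_restrict(2)[OF F])
qed

lemma mbound_cong:
  "(\<And>i j. i \<in> I \<Longrightarrow> j \<in> I \<Longrightarrow> M i j = N i j) \<Longrightarrow> mbound I M C \<longleftrightarrow> mbound I N C"
  unfolding mbound_def
  by (intro all_cong1 imp_cong refl arg_cong2[of _ _ _ _ "(\<le>)"] L2_set_cong arg_cong[of _ _ cmod] sum.cong)
    auto

text \<open>Both index sets are enlarged to \<open>F \<union> G\<close>; the vector is padded by
  zeros, and surplus rows only increase the norm.\<close>

lemma mbound_rectangle:
  assumes M: "mbound I M C" and F: "finite F" "F \<subseteq> I" "finite G" "G \<subseteq> I"
  shows "L2_set (\<lambda>i. cmod (\<Sum>j\<in>F. M i j * c j)) G \<le> C * L2_set (\<lambda>j. cmod (c j)) F"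
proof -
  define \<alpha> where "\<alpha> = (\<lambda>j. if j \<in> F then c j else 0)"
  have s: "(\<Sum>j\<in>F \<union> G. M i j * \<alpha> j) = (\<Sum>j\<in>F. M i j * c j)" for i
    using F by (intro sum.mono_neutral_cong_right) (auto simp: \<alpha>_def)
  have "L2_set (\<lambda>i. cmod (\<Sum>j\<in>F. M i j * c j)) G \<le> L2_set (\<lambda>i. cmod (\<Sum>j\<in>F. M i j * c j)) (F \<union> G)"
    using F by (intro L2_set_subset) auto
  also have "\<dots> \<le> C * L2_set (\<lambda>j. cmod (\<alpha> j)) (F \<union> G)"
    using mboundD[OF M, of "F \<union> G" \<alpha>] F by (simp add: s)
  also have "L2_set (\<lambda>j. cmod (\<alpha> j)) (F \<union> G) = L2_set (\<lambda>j. cmod (\<alpha> j)) F"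
    using F by (intro L2_set_mono_neutral) (auto simp: \<alpha>_def)
  finally show ?thesis by (simp add: \<alpha>_def cong: L2_set_cong)
qed

text \<open>Rows and columns may be selected by different injections. This picks out the block
  belonging to a pair of basis vectors \<open>g\<close>, \<open>h\<close> in
  \<open>mbound_entry_functional\<close>, where the two differ in general.\<close>

lemma mbound_minor:
  assumes M: "mbound I M C" and \<phi>: "inj_on \<phi> J" "\<phi> ` J \<subseteq> I" and \<psi>: "inj_on \<psi> J" "\<psi> ` J \<subseteq> I"
  shows "mbound J (\<lambda>i j. M (\<phi> i) (\<psi> j)) C"
  unfolding mbound_def
proof (intro allI impI)
  fix F and \<alpha> :: "_ \<Rightarrow> complex" assume F: "finite F \<and> F \<subseteq> J"
  have inj: "inj_on \<phi> F" "inj_on \<psi> F" using F \<phi>(1) \<psi>(1) inj_on_subset by blast+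
  define \<beta> where "\<beta> = \<alpha> \<circ> the_inv_into F \<psi>"
  have \<beta>: "\<beta> (\<psi> j) = \<alpha> j" if "j \<in> F" for j
    using that inj(2) by (simp add: \<beta>_def the_inv_into_f_f)
  have "L2_set (\<lambda>i. cmod (\<Sum>j\<in>\<psi> ` F. M i j * \<beta> j)) (\<phi> ` F) \<le> C * L2_set (\<lambda>j. cmod (\<beta> j)) (\<psi> ` F)"
    using F \<phi>(2) \<psi>(2) by (intro mbound_rectangle[OF M] finite_imageI) blast+
  moreover have "(\<Sum>j\<in>\<psi> ` F. M i j * \<beta> j) = (\<Sum>j\<in>F. M i (\<psi> j) * \<alpha> j)" for i
    using inj(2) by (subst sum.reindex) (auto intro!: sum.cong simp: \<beta>)
  ultimately show "L2_set (\<lambda>i. cmod (\<Sum>j\<in>F. M (\<phi> i) (\<psi> j) * \<alpha> j)) F \<le> C * L2_set (\<lambda>j. cmod (\<alpha> j)) F"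
    unfolding L2_set_def using inj by (simp add: sum.reindex \<beta>)
qed

lemma mbound_reindex:
  assumes "mbound I M C" "inj_on \<phi> J" "\<phi> ` J \<subseteq> I"
    and "\<And>i j. i \<in> J \<Longrightarrow> j \<in> J \<Longrightarrow> N i j = M (\<phi> i) (\<phi> j)"
  shows "mbound J N C"
  using mbound_minor[OF assms(1-3,2,3)] assms(4) by (simp cong: mbound_cong)

lemma mbound_add:
  assumes "mbound I M C" "mbound I N D"
  shows "mbound I (\<lambda>i j. M i j + N i j) (C + D)"
  unfolding mbound_def
proof (intro allI impI)
  fix F \<alpha> assume F: "finite F \<and> F \<subseteq> I"
  have "L2_set (\<lambda>i. cmod (\<Sum>j\<in>F. (M i j + N i j) * \<alpha> j)) F
      \<le> L2_set (\<lambda>i. cmod (\<Sum>j\<in>F. M i j * \<alpha> j) + cmod (\<Sum>j\<in>F. N i j * \<alpha> j)) F"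
    by (intro L2_set_mono) (auto simp: distrib_right sum.distrib norm_triangle_ineq)
  also have "\<dots> \<le> L2_set (\<lambda>i. cmod (\<Sum>j\<in>F. M i j * \<alpha> j)) F + L2_set (\<lambda>i. cmod (\<Sum>j\<in>F. N i j * \<alpha> j)) F"
    by (rule L2_set_triangle_ineq)
  also have "\<dots> \<le> (C + D) * L2_set (\<lambda>j. cmod (\<alpha> j)) F"
    using mboundD[OF assms(1), of F \<alpha>] mboundD[OF assms(2), of F \<alpha>] F by (simp add: distrib_right)
  finally show "L2_set (\<lambda>i. cmod (\<Sum>j\<in>F. (M i j + N i j) * \<alpha> j)) F \<le> (C + D) * L2_set (\<lambda>j. cmod (\<alpha> j)) F" .
qed

lemma mbound_cmult:
  assumes "mbound I M C"
  shows "mbound I (\<lambda>i j. c * M i j) (cmod c * C)"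
  unfolding mbound_def
proof (intro allI impI)
  fix F \<alpha> assume F: "finite F \<and> F \<subseteq> I"
  have "L2_set (\<lambda>i. cmod (\<Sum>j\<in>F. c * M i j * \<alpha> j)) F = cmod c * L2_set (\<lambda>i. cmod (\<Sum>j\<in>F. M i j * \<alpha> j)) F"
    by (simp add: mult.assoc norm_mult L2_set_right_distrib flip: sum_distrib_left)
  then show "L2_set (\<lambda>i. cmod (\<Sum>j\<in>F. c * M i j * \<alpha> j)) F \<le> cmod c * C * L2_set (\<lambda>j. cmod (\<alpha> j)) F"
    using mboundD[OF assms, of F \<alpha>] F by (simp add: mult.assoc mult_left_mono)
qed

lemma mbound_zero: "mbound I (\<lambda>_ _. 0) 0"
  by (simp add: mbound_def L2_set_def)

lemma mbound_sum:
  assumes "\<And>r. r \<in> R \<Longrightarrow> mbound I (M r) (C r)"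
  shows "mbound I (\<lambda>i j. \<Sum>r\<in>R. M r i j) (\<Sum>r\<in>R. C r)"
  using assms by (induction R rule: infinite_finite_induct) (auto simp: mbound_zero mbound_add)

lemma mbound_zero_extend:
  assumes M: "mbound J M C" and J: "\<And>i j. i \<in> I \<Longrightarrow> j \<in> I \<Longrightarrow> i \<notin> J \<or> j \<notin> J \<Longrightarrow> M i j = 0" and C: "0 \<le> C"
  shows "mbound I M C"
  unfolding mbound_def
proof (intro allI impI)
  fix F \<alpha> assume F: "finite F \<and> F \<subseteq> I"
  have col: "(\<Sum>j\<in>F. M i j * \<alpha> j) = (\<Sum>j\<in>F \<inter> J. M i j * \<alpha> j)" if "i \<in> F" for i
    using F J that by (intro sum.mono_neutral_right) auto
  have "L2_set (\<lambda>i. cmod (\<Sum>j\<in>F. M i j * \<alpha> j)) F = L2_set (\<lambda>i. cmod (\<Sum>j\<in>F \<inter> J. M i j * \<alpha> j)) F"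
    by (intro L2_set_cong refl) (simp add: col)
  also have "\<dots> = L2_set (\<lambda>i. cmod (\<Sum>j\<in>F \<inter> J. M i j * \<alpha> j)) (F \<inter> J)"
  proof (rule L2_set_mono_neutral)
    fix i assume i: "i \<in> F - F \<inter> J"
    have "M i j * \<alpha> j = 0" if "j \<in> F \<inter> J" for j
      using J[of i j] i that F by auto
    then have "(\<Sum>j\<in>F \<inter> J. M i j * \<alpha> j) = 0" by (intro sum.neutral) blast
    then show "cmod (\<Sum>j\<in>F \<inter> J. M i j * \<alpha> j) = 0" by simp
  qed (use F in auto)
  also have "\<dots> \<le> C * L2_set (\<lambda>j. cmod (\<alpha> j)) (F \<inter> J)"
    using F by (intro mboundD[OF M]) auto
  also have "\<dots> \<le> C * L2_set (\<lambda>j. cmod (\<alpha> j)) F"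
    using F C by (intro mult_left_mono L2_set_subset) auto
  finally show "L2_set (\<lambda>i. cmod (\<Sum>j\<in>F. M i j * \<alpha> j)) F \<le> C * L2_set (\<lambda>j. cmod (\<alpha> j)) F" .
qed

text \<open>Pythagoras over the fibres of the labelling \<open>k\<close>: entries between different
  fibres vanish, so the squared norms add up under the common bound \<open>C\<close>.\<close>

lemma mbound_direct_sum:
  assumes off: "\<And>i j. i \<in> I \<Longrightarrow> j \<in> I \<Longrightarrow> k i \<noteq> k j \<Longrightarrow> M i j = 0"
    and blocks: "\<And>b. mbound {i \<in> I. k i = b} M C" and C: "0 \<le> C"
  shows "mbound I M C"
  unfolding mbound_def
proof (intro allI impI)
  fix F \<alpha> assume F: "finite F \<and> F \<subseteq> I"
  let ?F = "\<lambda>b. {i \<in> F. k i = b}"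
  have "(\<Sum>i\<in>F. (cmod (\<Sum>j\<in>F. M i j * \<alpha> j))\<^sup>2) = (\<Sum>b\<in>k ` F. \<Sum>i\<in>?F b. (cmod (\<Sum>j\<in>F. M i j * \<alpha> j))\<^sup>2)"
    using F by (intro sum.image_gen) auto
  also have "\<dots> = (\<Sum>b\<in>k ` F. \<Sum>i\<in>?F b. (cmod (\<Sum>j\<in>?F b. M i j * \<alpha> j))\<^sup>2)"
    using F off by (intro sum.cong refl arg_cong[of _ _ "\<lambda>x. (cmod x)\<^sup>2"] sum.mono_neutral_right) fastforce+
  also have "\<dots> \<le> (\<Sum>b\<in>k ` F. C\<^sup>2 * (\<Sum>j\<in>?F b. (cmod (\<alpha> j))\<^sup>2))"
  proof (rule sum_mono)
    fix b
    have "L2_set (\<lambda>i. cmod (\<Sum>j\<in>?F b. M i j * \<alpha> j)) (?F b) \<le> C * L2_set (\<lambda>j. cmod (\<alpha> j)) (?F b)"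
      using F by (intro mboundD[OF blocks[of b]]) auto
    from power_mono[OF this, of 2]
    show "(\<Sum>i\<in>?F b. (cmod (\<Sum>j\<in>?F b. M i j * \<alpha> j))\<^sup>2) \<le> C\<^sup>2 * (\<Sum>j\<in>?F b. (cmod (\<alpha> j))\<^sup>2)"
      by (simp add: L2_set_def power_mult_distrib sum_nonneg)
  qed
  also have "\<dots> = C\<^sup>2 * (\<Sum>j\<in>F. (cmod (\<alpha> j))\<^sup>2)"
    using F by (subst (2) sum.image_gen[where g=k]) (auto simp: sum_distrib_left)
  finally have "sqrt (\<Sum>i\<in>F. (cmod (\<Sum>j\<in>F. M i j * \<alpha> j))\<^sup>2) \<le> sqrt (C\<^sup>2 * (\<Sum>j\<in>F. (cmod (\<alpha> j))\<^sup>2))"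
    by (rule real_sqrt_le_mono)
  then show "L2_set (\<lambda>i. cmod (\<Sum>j\<in>F. M i j * \<alpha> j)) F \<le> C * L2_set (\<lambda>j. cmod (\<alpha> j)) F"
    unfolding L2_set_def using C by (simp add: real_sqrt_mult)
qed

section \<open>Norms of matrices of operators\<close>

text \<open>\<open>mat_norm\<close> is a real supremum and can be used only once it is known to be
  bounded. The crude sum of entry norms suffices, and it later measures small perturbations of
  matrices.\<close>

lemma mat_norm_bdd:
  "bdd_above ((\<lambda>x. sqrt (\<Sum>i<n. (norm (\<Sum>j<n. blinfun_apply (a i j) (x j)))\<^sup>2)) `
      {x. (\<Sum>j<n. (norm (x j))\<^sup>2) \<le> 1})" (is ?A)
  and mat_norm_le_sum: "mat_norm n a \<le> (\<Sum>i<n. \<Sum>j<n. norm (a i j))" (is ?B)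
proof -
  have le: "sqrt (\<Sum>i<n. (norm (\<Sum>j<n. blinfun_apply (a i j) (x j)))\<^sup>2) \<le> (\<Sum>i<n. \<Sum>j<n. norm (a i j))"
    if "(\<Sum>j<n. (norm (x j))\<^sup>2) \<le> 1" for x
  proof -
    have x: "norm (x j) \<le> 1" if "j < n" for j
    proof -
      have "(norm (x j))\<^sup>2 \<le> (\<Sum>j<n. (norm (x j))\<^sup>2)" using that by (intro member_le_sum) auto
      then have "(norm (x j))\<^sup>2 \<le> 1\<^sup>2" using \<open>_ \<le> 1\<close> by simp
      then show ?thesis by (rule power2_le_imp_le) simp
    qed
    have "L2_set (\<lambda>i. norm (\<Sum>j<n. blinfun_apply (a i j) (x j))) {..<n}
        \<le> (\<Sum>i<n. norm (\<Sum>j<n. blinfun_apply (a i j) (x j)))"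
      by (rule L2_set_le_sum) auto
    also have "\<dots> \<le> (\<Sum>i<n. \<Sum>j<n. norm (a i j))"
    proof (intro sum_mono order_trans[OF norm_sum])
      fix i j assume "j \<in> {..<n}"
      then show "norm (blinfun_apply (a i j) (x j)) \<le> norm (a i j)"
        using norm_blinfun[of "a i j" "x j"] x[of j] mult_left_mono[of "norm (x j)" 1 "norm (a i j)"] by simp
    qed
    finally show ?thesis by (simp add: L2_set_def)
  qed
  then show ?A by (intro bdd_aboveI2) auto
  show ?B unfolding mat_norm_def using le
    by (intro cSUP_least) (auto intro: exI[of _ "\<lambda>_. 0"])
qed

lemma mat_norm_nonneg: "0 \<le> mat_norm n a"
  unfolding mat_norm_def by (rule cSUP_upper2[OF mat_norm_bdd, of "\<lambda>_. 0"]) auto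

lemma mat_norm_apply:
  "L2_set (\<lambda>i. norm (\<Sum>j<n. blinfun_apply (a i j) (x j))) {..<n}
     \<le> mat_norm n a * L2_set (\<lambda>j. norm (x j)) {..<n}"
proof (cases "L2_set (\<lambda>j. norm (x j)) {..<n} = 0")
  case True
  then have "x j = 0" if "j < n" for j using that by (simp add: L2_set_eq_0_iff)
  then show ?thesis by (simp add: True L2_set_def)
next
  case False
  define r where "r = L2_set (\<lambda>j. norm (x j)) {..<n}"
  have r: "r > 0" using False L2_set_nonneg[of "\<lambda>j. norm (x j)" "{..<n}"] unfolding r_def by linarith
  define y where "y = (\<lambda>j. inverse r *\<^sub>R x j)"
  have "L2_set (\<lambda>j. norm (y j)) {..<n} = 1"
    using r L2_set_right_distrib[of "inverse r" "\<lambda>j. norm (x j)" "{..<n}"] by (simp add: y_def r_def)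
  then have "(\<Sum>j<n. (norm (y j))\<^sup>2) \<le> 1" by (simp add: L2_set_def)
  then have "L2_set (\<lambda>i. norm (\<Sum>j<n. blinfun_apply (a i j) (y j))) {..<n} \<le> mat_norm n a"
    unfolding mat_norm_def L2_set_def by (intro cSUP_upper mat_norm_bdd) simp
  moreover have "norm (\<Sum>j<n. blinfun_apply (a i j) (y j)) = inverse r * norm (\<Sum>j<n. blinfun_apply (a i j) (x j))" for i
    using r by (simp add: y_def blinfun.scaleR_right flip: scaleR_sum_right)
  ultimately have "inverse r * L2_set (\<lambda>i. norm (\<Sum>j<n. blinfun_apply (a i j) (x j))) {..<n} \<le> mat_norm n a"
    using r by (simp add: L2_set_right_distrib)
  then show ?thesis using r unfolding r_def[symmetric] by (simp add: field_simps)
qed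

lemma mat_norm_le_iff:
  assumes "0 \<le> C"
  shows "mat_norm n a \<le> C \<longleftrightarrow>
    (\<forall>x. L2_set (\<lambda>i. norm (\<Sum>j<n. blinfun_apply (a i j) (x j))) {..<n} \<le> C * L2_set (\<lambda>j. norm (x j)) {..<n})"
proof
  assume "mat_norm n a \<le> C"
  then show "\<forall>x. L2_set (\<lambda>i. norm (\<Sum>j<n. blinfun_apply (a i j) (x j))) {..<n} \<le> C * L2_set (\<lambda>j. norm (x j)) {..<n}"
    using mat_norm_apply[of a _ n] by (meson L2_set_nonneg mult_right_mono order_trans)
next
  assume R: "\<forall>x. L2_set (\<lambda>i. norm (\<Sum>j<n. blinfun_apply (a i j) (x j))) {..<n} \<le> C * L2_set (\<lambda>j. norm (x j)) {..<n}"
  show "mat_norm n a \<le> C"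
    unfolding mat_norm_def
  proof (rule cSUP_least)
    fix x :: "nat \<Rightarrow> 'a" assume "x \<in> {x. (\<Sum>j<n. (norm (x j))\<^sup>2) \<le> 1}"
    then have "L2_set (\<lambda>j. norm (x j)) {..<n} \<le> 1" by (simp add: L2_set_def)
    then show "sqrt (\<Sum>i<n. (norm (\<Sum>j<n. blinfun_apply (a i j) (x j)))\<^sup>2) \<le> C"
      using R[rule_format, of x] mult_left_mono[OF _ assms, of _ 1] unfolding L2_set_def by fastforce
  qed (auto intro: exI[of _ "\<lambda>_. 0"])
qed

lemma mat_norm_add: "mat_norm n (\<lambda>i j. a i j + b i j) \<le> mat_norm n a + mat_norm n b"
proof (subst mat_norm_le_iff, safe)
  fix x :: "nat \<Rightarrow> 'a"
  have "L2_set (\<lambda>i. norm (\<Sum>j<n. blinfun_apply (a i j + b i j) (x j))) {..<n}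
     \<le> L2_set (\<lambda>i. norm (\<Sum>j<n. blinfun_apply (a i j) (x j)) + norm (\<Sum>j<n. blinfun_apply (b i j) (x j))) {..<n}"
    by (intro L2_set_mono) (auto simp: blinfun.add_left sum.distrib norm_triangle_ineq)
  also have "\<dots> \<le> L2_set (\<lambda>i. norm (\<Sum>j<n. blinfun_apply (a i j) (x j))) {..<n}
      + L2_set (\<lambda>i. norm (\<Sum>j<n. blinfun_apply (b i j) (x j))) {..<n}"
    by (rule L2_set_triangle_ineq)
  also have "\<dots> \<le> (mat_norm n a + mat_norm n b) * L2_set (\<lambda>j. norm (x j)) {..<n}"
    using mat_norm_apply[of a x n] mat_norm_apply[of b x n] by (simp add: distrib_right)
  finally show "L2_set (\<lambda>i. norm (\<Sum>j<n. blinfun_apply (a i j + b i j) (x j))) {..<n}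
    \<le> (mat_norm n a + mat_norm n b) * L2_set (\<lambda>j. norm (x j)) {..<n}" .
qed (simp add: mat_norm_nonneg)

lemma mat_norm_zero: "mat_norm 0 a = 0"
  using mat_norm_le_sum[of 0 a] mat_norm_nonneg[of 0 a] by simp

lemma mat_norm_zero_matrix: "mat_norm n (\<lambda>_ _. 0) = 0"
  by (rule antisym[OF order_trans[OF mat_norm_le_sum] mat_norm_nonneg]) simp

lemma mat_norm_cong:
  "(\<And>i j. i < n \<Longrightarrow> j < n \<Longrightarrow> a i j = b i j) \<Longrightarrow> mat_norm n a = mat_norm n b"
  unfolding mat_norm_def by (intro SUP_cong refl arg_cong[of _ _ sqrt] sum.cong) simp

text \<open>Coefficients outside the support \<open>G\<close> vanish, so the expansion holds over
  every larger finite set. Finitely many vectors can thus be expanded over a common set.\<close>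

lemma cspan_onb_expansion:
  assumes B: "orthonormal B" and x: "x \<in> cspan B"
  obtains G where "finite G" "G \<subseteq> B"
    "\<And>H. finite H \<Longrightarrow> G \<subseteq> H \<Longrightarrow> H \<subseteq> B \<Longrightarrow> x = (\<Sum>g\<in>H. cinner g x *\<^sub>C g)"
proof -
  have "x \<in> cspan (id ` B)" using x by simp
  then obtain G c where G: "finite G" "G \<subseteq> B" "x = (\<Sum>g\<in>G. c g *\<^sub>C g)"
    unfolding cspan_image by auto
  have "x = (\<Sum>g\<in>H. cinner g x *\<^sub>C g)" if "finite H" "G \<subseteq> H" "H \<subseteq> B" for H
  proof -
    have "cinner g x = (if g \<in> G then c g else 0)" if "g \<in> B" for g
      using cinner_orthonormal_sum[OF B G(1,2) that] by (simp add: G(3))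
    then show ?thesis
      using that G by (subst G(3), intro sum.mono_neutral_cong_left) (auto simp: subset_iff)
  qed
  with G show thesis using that by blast
qed

text \<open>Partial Parseval sums increase with \<open>F\<close>, so only sets containing a
  prescribed finite \<open>G\<close> have to be tested. In \<open>mat_norm_le_mbound\<close> this
  \<open>G\<close> contains the supports of the input vectors.\<close>

lemma L2_norm_le_onb:
  assumes B: "orthonormal_basis B" and n: "finite N" and C: "0 \<le> C" and G: "finite G" "G \<subseteq> B"
    and le: "\<And>F. finite F \<Longrightarrow> G \<subseteq> F \<Longrightarrow> F \<subseteq> B \<Longrightarrow> L2_set (\<lambda>i. L2_set (\<lambda>b. cmod (cinner b (z i))) F) N \<le> C"
  shows "L2_set (\<lambda>i. norm (z i)) N \<le> C"
proof -
  have hs: "((\<lambda>b. \<Sum>i\<in>N. (cmod (cinner b (z i)))\<^sup>2) has_sum (\<Sum>i\<in>N. (norm (z i))\<^sup>2)) B"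
    using n by (induction N) (auto intro: has_sum_add parseval[OF B])
  have "(\<Sum>b\<in>F. \<Sum>i\<in>N. (cmod (cinner b (z i)))\<^sup>2) \<le> C\<^sup>2" if F: "finite F" "F \<subseteq> B" for F
  proof -
    have "(\<Sum>b\<in>F. \<Sum>i\<in>N. (cmod (cinner b (z i)))\<^sup>2) \<le> (\<Sum>b\<in>F \<union> G. \<Sum>i\<in>N. (cmod (cinner b (z i)))\<^sup>2)"
      using F G by (intro sum_mono2) (auto intro: sum_nonneg)
    also have "\<dots> = (L2_set (\<lambda>i. L2_set (\<lambda>b. cmod (cinner b (z i))) (F \<union> G)) N)\<^sup>2"
      unfolding L2_set_def by (subst sum.swap) (simp add: sum_nonneg)
    also have "\<dots> \<le> C\<^sup>2"
      using F G by (intro power_mono le) auto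
    finally show ?thesis .
  qed
  then have "(\<Sum>i\<in>N. (norm (z i))\<^sup>2) \<le> C\<^sup>2" by (rule has_sum_le_finite_sums[OF hs])
  then show ?thesis unfolding L2_set_def using C by (intro real_le_lsqrt) (auto simp: sum_nonneg)
qed

abbreviation entry :: "(nat \<Rightarrow> nat \<Rightarrow> ('a::complex_hilbert \<Rightarrow>\<^sub>L 'a)) \<Rightarrow> nat \<times> 'a \<Rightarrow> nat \<times> 'a \<Rightarrow> complex" where
  "entry a u v \<equiv> cinner (snd u) (blinfun_apply (a (fst u) (fst v)) (snd v))"

lemma sum_entry:
  fixes a :: "nat \<Rightarrow> nat \<Rightarrow> ('a::complex_hilbert \<Rightarrow>\<^sub>L 'a)"
  assumes a: "\<And>j. j < n \<Longrightarrow> a i j \<in> bounded_ops"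
  shows "(\<Sum>v\<in>{..<n} \<times> G. cinner g (blinfun_apply (a i (fst v)) (snd v)) * \<alpha> v)
    = cinner g (\<Sum>j<n. blinfun_apply (a i j) (\<Sum>h\<in>G. \<alpha> (j, h) *\<^sub>C h))"
proof -
  have "(\<Sum>v\<in>{..<n} \<times> G. cinner g (blinfun_apply (a i (fst v)) (snd v)) * \<alpha> v)
      = (\<Sum>j<n. \<Sum>h\<in>G. cinner g (blinfun_apply (a i j) h) * \<alpha> (j, h))"
    by (simp add: sum.cartesian_product case_prod_unfold)
  then show ?thesis
    using a by (simp add: cinner_sum_right blinfun.sum_right bounded_opsD cinner_scaleC_right mult.commute)
qed

text \<open>On a section \<open>{..<n} \<times> G\<close> the input norm is computed exactly by
  orthonormality, and the output norm is bounded below by Bessel. The converse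
  \<open>mat_norm_le_mbound\<close> requires completeness of the family.\<close>

lemma mbound_entry_le:
  assumes a: "\<And>i j. i < n \<Longrightarrow> j < n \<Longrightarrow> a i j \<in> bounded_ops"
    and B: "orthonormal B"
  shows "mbound ({..<n} \<times> B) (entry a) (mat_norm n a)"
proof (rule mbound_cofinal)
  fix F assume F: "finite F" "F \<subseteq> {..<n} \<times> B"
  define G where "G = snd ` F"
  have G: "finite G" "G \<subseteq> B" "F \<subseteq> {..<n} \<times> G" using F by (force simp: G_def)+
  have "mbound ({..<n} \<times> G) (entry a) (mat_norm n a)"
  proof (rule mbound_finiteI)
    fix \<alpha> :: "nat \<times> 'a \<Rightarrow> complex"
    define x where "x = (\<lambda>j. \<Sum>h\<in>G. \<alpha> (j, h) *\<^sub>C h)"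
    have "L2_set (\<lambda>i. cmod (\<Sum>v\<in>{..<n} \<times> G. entry a i v * \<alpha> v)) ({..<n} \<times> G)
        = L2_set (\<lambda>i. L2_set (\<lambda>g. cmod (cinner g (\<Sum>j<n. blinfun_apply (a i j) (x j)))) G) {..<n}"
      using G(1) a by (subst L2_set_times) (auto intro!: L2_set_cong simp: sum_entry x_def)
    also have "\<dots> \<le> L2_set (\<lambda>i. norm (\<Sum>j<n. blinfun_apply (a i j) (x j))) {..<n}"
      by (intro L2_set_mono L2_cinner_le_norm[OF B G(1,2)]) auto
    also have "\<dots> \<le> mat_norm n a * L2_set (\<lambda>j. norm (x j)) {..<n}"
      by (rule mat_norm_apply)
    also have "L2_set (\<lambda>j. norm (x j)) {..<n} = L2_set (\<lambda>j. cmod (\<alpha> j)) ({..<n} \<times> G)"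
      using G(1) by (simp add: L2_set_times x_def norm_orthonormal_L2[OF B G(1,2)])
    finally show "L2_set (\<lambda>i. cmod (\<Sum>v\<in>{..<n} \<times> G. entry a i v * \<alpha> v)) ({..<n} \<times> G)
        \<le> mat_norm n a * L2_set (\<lambda>j. cmod (\<alpha> j)) ({..<n} \<times> G)" .
  qed (use G in auto)
  then show "\<exists>H. finite H \<and> F \<subseteq> H \<and> mbound H (entry a) (mat_norm n a)"
    using G by (intro exI[of _ "{..<n} \<times> G"]) auto
qed

text \<open>For inputs in the algebraic span a finite section sees the whole vector, and Parseval
  recovers the output norm from finite sections. General inputs follow by density, both sides being
  continuous in the input.\<close>

lemma mat_norm_le_mbound:
  assumes a: "\<And>i j. i < n \<Longrightarrow> j < n \<Longrightarrow> a i j \<in> bounded_ops"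
    and B: "orthonormal_basis B" and C: "0 \<le> C" and M: "mbound ({..<n} \<times> B) (entry a) C"
  shows "mat_norm n a \<le> C"
proof (subst mat_norm_le_iff[OF C], rule allI)
  fix x :: "nat \<Rightarrow> 'a"
  note on = orthonormal_basisD[OF B]
  let ?z = "\<lambda>x i. \<Sum>j<n. blinfun_apply (a i j) (x j)"
  have span: "L2_set (\<lambda>i. norm (?z y i)) {..<n} \<le> C * L2_set (\<lambda>j. norm (y j)) {..<n}"
    if y: "\<And>j. y j \<in> cspan B" for y
  proof -
    have "\<exists>G. finite G \<and> G \<subseteq> B \<and> (\<forall>H. finite H \<longrightarrow> G \<subseteq> H \<longrightarrow> H \<subseteq> B \<longrightarrow> y j = (\<Sum>g\<in>H. cinner g (y j) *\<^sub>C g))" for j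
      using cspan_onb_expansion[OF on y[of j]] by metis
    then obtain G where G: "\<And>j. finite (G j)" "\<And>j. G j \<subseteq> B"
      "\<And>j H. finite H \<Longrightarrow> G j \<subseteq> H \<Longrightarrow> H \<subseteq> B \<Longrightarrow> y j = (\<Sum>g\<in>H. cinner g (y j) *\<^sub>C g)" by metis
    show ?thesis
    proof (rule L2_norm_le_onb[OF B, of _ _ "\<Union>j<n. G j"])
      fix F assume F: "finite F" "(\<Union>j<n. G j) \<subseteq> F" "F \<subseteq> B"
      define \<alpha> where "\<alpha> = (\<lambda>v. cinner (snd v) (y (fst v)))"
      have yj: "y j = (\<Sum>h\<in>F. \<alpha> (j, h) *\<^sub>C h)" if "j < n" for j
        unfolding \<alpha>_def using G(3)[OF F(1) _ F(3), of j] F that by auto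
      have "L2_set (\<lambda>i. L2_set (\<lambda>b. cmod (cinner b (?z y i))) F) {..<n}
         = L2_set (\<lambda>i. cmod (\<Sum>v\<in>{..<n} \<times> F. entry a i v * \<alpha> v)) ({..<n} \<times> F)"
        using F(1) a yj by (subst L2_set_times) (auto intro!: L2_set_cong simp: sum_entry)
      also have "\<dots> \<le> C * L2_set (\<lambda>j. cmod (\<alpha> j)) ({..<n} \<times> F)"
        using F by (intro mboundD[OF M]) auto
      also have "L2_set (\<lambda>j. cmod (\<alpha> j)) ({..<n} \<times> F) = L2_set (\<lambda>j. norm (y j)) {..<n}"
        using F(1) norm_orthonormal_L2[OF on F(1,3)]
        by (subst L2_set_times) (auto intro!: L2_set_cong simp: yj)
      finally show "L2_set (\<lambda>i. L2_set (\<lambda>b. cmod (cinner b (?z y i))) F) {..<n} \<le> C * L2_set (\<lambda>j. norm (y j)) {..<n}" .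
    qed (use G C in auto)
  qed
  have "\<exists>ys. (\<forall>k. ys k \<in> cspan B) \<and> ys \<longlonglongrightarrow> x j" for j
    using closure_cspan_onb[OF B] closure_sequential[of "x j" "cspan B"] by auto
  then obtain ys where ys: "\<And>j k. ys j k \<in> cspan B" "\<And>j. ys j \<longlonglongrightarrow> x j" by metis
  show "L2_set (\<lambda>i. norm (?z x i)) {..<n} \<le> C * L2_set (\<lambda>j. norm (x j)) {..<n}"
  proof (rule LIMSEQ_le)
    show "(\<lambda>k. L2_set (\<lambda>i. norm (?z (\<lambda>j. ys j k) i)) {..<n}) \<longlonglongrightarrow> L2_set (\<lambda>i. norm (?z x i)) {..<n}"
      unfolding L2_set_def by (intro tendsto_intros ys bounded_linear.tendsto[OF blinfun.bounded_linear_right])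
    show "(\<lambda>k. C * L2_set (\<lambda>j. norm (ys j k)) {..<n}) \<longlonglongrightarrow> C * L2_set (\<lambda>j. norm (x j)) {..<n}"
      unfolding L2_set_def by (intro tendsto_intros ys)
  qed (use span ys in auto)
qed

lemma mat_norm_one_le_iff: "0 \<le> C \<Longrightarrow> mat_norm (Suc 0) (\<lambda>_ _. T) \<le> C \<longleftrightarrow> norm T \<le> C"
proof -
  assume C: "0 \<le> C"
  have "(\<forall>x :: nat \<Rightarrow> 'a. norm (blinfun_apply T (x 0)) \<le> C * norm (x 0)) \<longleftrightarrow> norm T \<le> C"
  proof
    assume L: "\<forall>x :: nat \<Rightarrow> 'a. norm (blinfun_apply T (x 0)) \<le> C * norm (x 0)"
    then show "norm T \<le> C" using spec[OF L, of "\<lambda>_. _"] C by (intro norm_blinfun_bound) auto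
  next
    assume "norm T \<le> C"
    then show "\<forall>x :: nat \<Rightarrow> 'a. norm (blinfun_apply T (x 0)) \<le> C * norm (x 0)"
      using norm_blinfun[of T] by (meson mult_right_mono norm_ge_zero order_trans)
  qed
  then show ?thesis
    by (subst mat_norm_le_iff[OF C]) (simp add: lessThan_Suc L2_set_def)
qed

lemma mat_norm_one: "mat_norm (Suc 0) (\<lambda>_ _. T) = norm T"
  using mat_norm_one_le_iff[of "norm T" T] mat_norm_one_le_iff[of "mat_norm (Suc 0) (\<lambda>_ _. T)" T]
    mat_norm_nonneg[of "Suc 0" "\<lambda>_ _. T"] by auto

lemma norm_le_mbound_iff:
  assumes T: "T \<in> bounded_ops" and B: "orthonormal_basis B" and C: "0 \<le> C"
  shows "norm T \<le> C \<longleftrightarrow> mbound B (\<lambda>g h. cinner g (blinfun_apply T h)) C"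
proof
  assume "norm T \<le> C"
  then have "mbound ({..<Suc 0} \<times> B) (entry (\<lambda>_ _. T)) C"
    using mbound_entry_le[of "Suc 0" "\<lambda>_ _. T", OF T orthonormal_basisD[OF B]]
    by (simp add: mat_norm_one mbound_mono)
  then show "mbound B (\<lambda>g h. cinner g (blinfun_apply T h)) C"
    by (rule mbound_reindex[where \<phi>="\<lambda>g. (0, g)"]) (auto simp: inj_on_def)
next
  assume "mbound B (\<lambda>g h. cinner g (blinfun_apply T h)) C"
  then have "mbound ({..<Suc 0} \<times> B) (entry (\<lambda>_ _. T)) C"
    by (rule mbound_reindex[where \<phi>=snd]) (auto simp: inj_on_def)
  then have "mat_norm (Suc 0) (\<lambda>_ _. T) \<le> C"
    by (rule mat_norm_le_mbound[OF T B C])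
  then show "norm T \<le> C" by (simp add: mat_norm_one)
qed

section \<open>Tensor products of operators\<close>

lemma htensor_scaleR_left: "(r *\<^sub>R x) \<otimes>\<^sub>h y = r *\<^sub>R (x \<otimes>\<^sub>h y)"
  by (simp add: scaleR_scaleC htensor_linear)

lemma htensor_scaleR_right: "x \<otimes>\<^sub>h (r *\<^sub>R y) = r *\<^sub>R (x \<otimes>\<^sub>h y)"
  by (simp add: scaleR_scaleC htensor_linear)

lemma norm_htensor_eq: "norm (x \<otimes>\<^sub>h y) = norm x * norm y"
proof -
  \<comment> \<open>Both factors are real, so the real part of their product is the product of the
    real parts.\<close>
  have im: "Im (cinner z z) = 0" for z :: "'c::complex_hilbert"
    using arg_cong[OF cinner_commute[of z z], of Im] by simp
  have "(norm (x \<otimes>\<^sub>h y))\<^sup>2 = (norm x * norm y)\<^sup>2"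
    unfolding norm_sq_cinner power_mult_distrib by (simp add: cinner_htensor im)
  then show ?thesis by (simp add: power2_eq_iff_nonneg)
qed

lemma bounded_linear_htensor_left: "bounded_linear (\<lambda>x. x \<otimes>\<^sub>h y)"
  by (rule bounded_linear_intro[where K="norm y"])
    (auto simp: htensor_linear htensor_scaleR_left norm_htensor_eq)

lemma bounded_linear_htensor_right: "bounded_linear (\<lambda>y. x \<otimes>\<^sub>h y)"
  by (rule bounded_linear_intro[where K="norm x"])
    (auto simp: htensor_linear htensor_scaleR_right norm_htensor_eq)

lemma htensor_lincomb_left: "(\<Sum>i\<in>F. c i *\<^sub>C f i) \<otimes>\<^sub>h y = (\<Sum>i\<in>F. c i *\<^sub>C (f i \<otimes>\<^sub>h y))"
  by (simp add: linear_sum[OF bounded_linear.linear[OF bounded_linear_htensor_left]] htensor_linear)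

lemma htensor_lincomb_right: "x \<otimes>\<^sub>h (\<Sum>i\<in>F. c i *\<^sub>C f i) = (\<Sum>i\<in>F. c i *\<^sub>C (x \<otimes>\<^sub>h f i))"
  by (simp add: linear_sum[OF bounded_linear.linear[OF bounded_linear_htensor_right]] htensor_linear)

lemma norm_htensor_sum_right:
  assumes B: "orthonormal B" and G: "finite G" "G \<subseteq> B"
  shows "norm (\<Sum>g\<in>G. z g \<otimes>\<^sub>h g) = L2_set (\<lambda>g. norm (z g)) G"
proof -
  have "(norm (\<Sum>g\<in>G. z g \<otimes>\<^sub>h g))\<^sup>2 = (\<Sum>g\<in>G. \<Sum>h\<in>G. Re (cinner (z g) (z h) * cinner g h))"
    by (subst sum.swap) (simp add: norm_sq_cinner cinner_sum_left cinner_sum_right cinner_htensor del: times_complex.sel)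
  also have "\<dots> = (\<Sum>g\<in>G. \<Sum>h\<in>G. if g = h then (norm (z g))\<^sup>2 else 0)"
    using B G by (intro sum.cong refl) (auto simp: orthonormal_def norm_sq_cinner subset_iff)
  also have "\<dots> = (\<Sum>g\<in>G. (norm (z g))\<^sup>2)" using G by simp
  finally show ?thesis unfolding L2_set_def by (rule real_sqrt_unique[symmetric]) simp
qed

lemma norm_htensor_sum_left:
  assumes B: "orthonormal B" and G: "finite G" "G \<subseteq> B"
  shows "norm (\<Sum>g\<in>G. g \<otimes>\<^sub>h z g) = L2_set (\<lambda>g. norm (z g)) G"
proof -
  have "(norm (\<Sum>g\<in>G. g \<otimes>\<^sub>h z g))\<^sup>2 = (\<Sum>g\<in>G. \<Sum>h\<in>G. Re (cinner g h * cinner (z g) (z h)))"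
    by (subst sum.swap) (simp add: norm_sq_cinner cinner_sum_left cinner_sum_right cinner_htensor del: times_complex.sel)
  also have "\<dots> = (\<Sum>g\<in>G. \<Sum>h\<in>G. if g = h then (norm (z g))\<^sup>2 else 0)"
    using B G by (intro sum.cong refl) (auto simp: orthonormal_def norm_sq_cinner subset_iff)
  also have "\<dots> = (\<Sum>g\<in>G. (norm (z g))\<^sup>2)" using G by simp
  finally show ?thesis unfolding L2_set_def by (rule real_sqrt_unique[symmetric]) simp
qed

lemma csubspace_vimage_linear:
  assumes "csubspace V" "\<And>x y. f (x + y) = f x + f y" "\<And>c x. f (c *\<^sub>C x) = c *\<^sub>C f x"
  shows "csubspace {x. f x \<in> V}"
  using assms csubspaceD[OF assms(1)] assms(3)[of 0 0] by (simp add: csubspace_def)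

text \<open>One leg at a time: for a fixed basis vector on the right the admissible left vectors
  form a closed subspace, then for a fixed left vector the admissible right ones do.\<close>

lemma closure_cspan_htensor_onb:
  assumes P: "orthonormal_basis P" and G: "orthonormal_basis G"
  shows "closure (cspan ((\<lambda>(p, g). p \<otimes>\<^sub>h g) ` (P \<times> G))) = UNIV"
proof -
  let ?V = "closure (cspan ((\<lambda>(p, g). p \<otimes>\<^sub>h g) ` (P \<times> G)))"
  have V: "csubspace ?V" by (rule csubspace_closure[OF csubspace_cspan])
  have 1: "x \<otimes>\<^sub>h g \<in> ?V" if "g \<in> G" for x g
  proof -
    have "closure (cspan P) \<subseteq> {x. x \<otimes>\<^sub>h g \<in> ?V}"
    proof (rule closure_cspan_minimal)
      show "P \<subseteq> {x. x \<otimes>\<^sub>h g \<in> ?V}"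
        using that closure_cspan_superset[of "(\<lambda>(p, g). p \<otimes>\<^sub>h g) ` (P \<times> G)"] by auto
      show "csubspace {x. x \<otimes>\<^sub>h g \<in> ?V}"
        by (rule csubspace_vimage_linear[OF V]) (simp_all add: htensor_linear)
      have "closed ((\<lambda>x. x \<otimes>\<^sub>h g) -` ?V)"
        by (intro continuous_closed_vimage closed_closure)
          (auto intro: bounded_linear.isCont[OF bounded_linear_htensor_left])
      then show "closed {x. x \<otimes>\<^sub>h g \<in> ?V}" by (simp add: vimage_def)
    qed
    then show ?thesis unfolding closure_cspan_onb[OF P] by blast
  qed
  have 2: "x \<otimes>\<^sub>h y \<in> ?V" for x y
  proof -
    have "closure (cspan G) \<subseteq> {y. x \<otimes>\<^sub>h y \<in> ?V}"
    proof (rule closure_cspan_minimal)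
      show "G \<subseteq> {y. x \<otimes>\<^sub>h y \<in> ?V}" using 1 by blast
      show "csubspace {y. x \<otimes>\<^sub>h y \<in> ?V}"
        by (rule csubspace_vimage_linear[OF V]) (simp_all add: htensor_linear)
      have "closed ((\<lambda>y. x \<otimes>\<^sub>h y) -` ?V)"
        by (intro continuous_closed_vimage closed_closure)
          (auto intro: bounded_linear.isCont[OF bounded_linear_htensor_right])
      then show "closed {y. x \<otimes>\<^sub>h y \<in> ?V}" by (simp add: vimage_def)
    qed
    then show ?thesis unfolding closure_cspan_onb[OF G] by blast
  qed
  have "closure (cspan (range (\<lambda>(x, y). x \<otimes>\<^sub>h y))) \<subseteq> ?V"
    by (intro closure_cspan_minimal V closed_closure) (use 2 in auto)
  then show ?thesis unfolding closure_cspan_htensor by blast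
qed

lemma orthogonal_closure_cspan:
  assumes "closure (cspan S) = UNIV" "\<And>s. s \<in> S \<Longrightarrow> cinner s (x :: 'a::complex_hilbert) = 0"
  shows "x = 0"
proof -
  have "closure (cspan S) \<subseteq> {y. cinner x y = 0}"
  proof (rule closure_cspan_minimal)
    show "S \<subseteq> {y. cinner x y = 0}"
      using assms(2) cinner_commute[of x] by auto
    show "csubspace {y. cinner x y = 0}"
      by (simp add: csubspace_def cinner_add_right cinner_scaleC_right)
    show "closed {y. cinner x y = 0}"
      unfolding closed_sequential_limits
    proof clarify
      fix ys l assume "\<forall>n. ys n \<in> {y. cinner x y = 0}" "ys \<longlonglongrightarrow> l"
      then show "cinner x l = 0"
        using tendsto_cinner_right[of ys l sequentially x] by (simp add: LIMSEQ_const_iff)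
    qed
  qed
  then have "cinner x x = 0" using assms(1) by blast
  then have "(norm x)\<^sup>2 = 0" by (simp add: norm_sq_cinner)
  then show ?thesis by simp
qed

lemma orthonormal_htensor:
  assumes "orthonormal P" "orthonormal G"
  shows "orthonormal ((\<lambda>(p, g). p \<otimes>\<^sub>h g) ` (P \<times> G))" "inj_on (\<lambda>(p, g). p \<otimes>\<^sub>h g) (P \<times> G)"
proof -
  have c: "cinner (p \<otimes>\<^sub>h g) (p' \<otimes>\<^sub>h g') = (if p = p' \<and> g = g' then 1 else 0)"
    if "p \<in> P" "g \<in> G" "p' \<in> P" "g' \<in> G" for p g p' g'
    using that assms by (auto simp: cinner_htensor orthonormal_def)
  show inj: "inj_on (\<lambda>(p, g). p \<otimes>\<^sub>h g) (P \<times> G)"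
  proof (rule inj_onI, clarify)
    fix p g p' g' assume *: "p \<in> P" "g \<in> G" "p' \<in> P" "g' \<in> G" "p \<otimes>\<^sub>h g = p' \<otimes>\<^sub>h g'"
    then have "cinner (p \<otimes>\<^sub>h g) (p' \<otimes>\<^sub>h g') = 1" using c[of p g p g] by simp
    then show "p = p' \<and> g = g'" using c[OF *(1-4)] by (auto split: if_splits)
  qed
  show "orthonormal ((\<lambda>(p, g). p \<otimes>\<^sub>h g) ` (P \<times> G))"
    unfolding orthonormal_def
  proof clarify
    fix p g p' g' assume *: "p \<in> P" "g \<in> G" "p' \<in> P" "g' \<in> G"
    then have "p \<otimes>\<^sub>h g = p' \<otimes>\<^sub>h g' \<longleftrightarrow> p = p' \<and> g = g'"
      using inj_onD[OF inj, of "(p, g)" "(p', g')"] by auto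
    then show "cinner (p \<otimes>\<^sub>h g) (p' \<otimes>\<^sub>h g') = (if p \<otimes>\<^sub>h g = p' \<otimes>\<^sub>h g' then 1 else 0)"
      using c[OF *] by simp
  qed
qed

lemma orthonormal_basis_htensor:
  assumes "orthonormal_basis P" "orthonormal_basis G"
  shows "orthonormal_basis ((\<lambda>(p, g). p \<otimes>\<^sub>h g) ` (P \<times> G))"
  unfolding orthonormal_basis_def
proof (intro conjI allI impI)
  show "orthonormal ((\<lambda>(p, g). p \<otimes>\<^sub>h g) ` (P \<times> G))"
    using assms by (intro orthonormal_htensor orthonormal_basisD)
  fix x assume "\<forall>e\<in>(\<lambda>(p, g). p \<otimes>\<^sub>h g) ` (P \<times> G). cinner e x = 0"
  then show "x = 0"
    by (intro orthogonal_closure_cspan[OF closure_cspan_htensor_onb[OF assms]]) blast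
qed

text \<open>Padding a finite set of pairs to the rectangle of its projections lets the sum be
  grouped by either coordinate.\<close>

lemma sum_times_restrict:
  fixes f :: "'i \<times> 'j \<Rightarrow> 'c::complex_vector"
  assumes "finite F"
  shows "(\<Sum>v\<in>F. c v *\<^sub>C f v) = (\<Sum>i\<in>fst ` F. \<Sum>j\<in>snd ` F. (if (i, j) \<in> F then c (i, j) else 0) *\<^sub>C f (i, j))"
proof -
  have "F \<subseteq> fst ` F \<times> snd ` F" by force
  then have "(\<Sum>v\<in>F. c v *\<^sub>C f v) = (\<Sum>v\<in>fst ` F \<times> snd ` F. (if v \<in> F then c v else 0) *\<^sub>C f v)"
    using assms by (intro sum.mono_neutral_cong_left) auto
  also have "\<dots> = (\<Sum>(i, j)\<in>fst ` F \<times> snd ` F. (if (i, j) \<in> F then c (i, j) else 0) *\<^sub>C f (i, j))"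
    by (intro sum.cong) auto
  finally show ?thesis by (simp only: sum.cartesian_product)
qed

lemma L2_norm_blinfun_le:
  "L2_set (\<lambda>g. norm (blinfun_apply a (z g))) G \<le> norm a * L2_set (\<lambda>g. norm (z g)) G"
  unfolding L2_set_right_distrib[OF norm_ge_zero] by (intro L2_set_mono norm_blinfun) auto

text \<open>Grouped by the basis vectors \<open>g\<close> of the right leg, a finite combination is
  \<open>\<Sum>g z g \<otimes> g\<close>, whose norm is the \<open>L2_set\<close> of the
  \<open>norm (z g)\<close>; applying \<open>a\<close> to each \<open>z g\<close> gives the bound
  \<open>norm a\<close>. The operator so defined on basis tensors is then identified on all
  elementary tensors, one leg after the other.\<close>

lemma ex_tensor_left:
  fixes a :: "'a::complex_hilbert \<Rightarrow>\<^sub>L 'a"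
  assumes a: "a \<in> bounded_ops"
  shows "\<exists>c\<in>bounded_ops. (\<forall>x (y :: 'b::complex_hilbert). blinfun_apply c (x \<otimes>\<^sub>h y) = blinfun_apply a x \<otimes>\<^sub>h y) \<and> norm c \<le> norm a"
proof -
  define P where "P = (some_onb :: 'a set)"
  define G where "G = (some_onb :: 'b set)"
  have P: "orthonormal_basis P" and G: "orthonormal_basis G"
    by (simp_all add: P_def G_def orthonormal_basis_some_onb)
  have bound: "norm (\<Sum>v\<in>F. k v *\<^sub>C (case v of (p, g) \<Rightarrow> blinfun_apply a p \<otimes>\<^sub>h g))
      \<le> norm a * norm (\<Sum>v\<in>F. k v *\<^sub>C (case v of (p, g) \<Rightarrow> p \<otimes>\<^sub>h g))"
    if F: "finite F" "F \<subseteq> P \<times> G" for F k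
  proof -
    define z where "z = (\<lambda>g. \<Sum>p\<in>fst ` F. (if (p, g) \<in> F then k (p, g) else 0) *\<^sub>C p)"
    have G': "finite (snd ` F)" "snd ` F \<subseteq> G" using F by auto
    have "(\<Sum>v\<in>F. k v *\<^sub>C (case v of (p, g) \<Rightarrow> p \<otimes>\<^sub>h g)) = (\<Sum>g\<in>snd ` F. z g \<otimes>\<^sub>h g)"
      unfolding sum_times_restrict[OF F(1)] z_def htensor_lincomb_left
      by (subst sum.swap) simp
    moreover have "(\<Sum>v\<in>F. k v *\<^sub>C (case v of (p, g) \<Rightarrow> blinfun_apply a p \<otimes>\<^sub>h g)) = (\<Sum>g\<in>snd ` F. blinfun_apply a (z g) \<otimes>\<^sub>h g)"
      unfolding sum_times_restrict[OF F(1)] z_def bounded_ops_lincomb[OF a] htensor_lincomb_left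
      by (subst sum.swap) simp
    ultimately show ?thesis
      using norm_htensor_sum_right[OF orthonormal_basisD[OF G] G', of z]
        norm_htensor_sum_right[OF orthonormal_basisD[OF G] G', of "\<lambda>g. blinfun_apply a (z g)"]
        L2_norm_blinfun_le[of a z] by simp
  qed
  obtain c where c: "c \<in> bounded_ops"
    "\<And>v. v \<in> P \<times> G \<Longrightarrow> blinfun_apply c (case v of (p, g) \<Rightarrow> p \<otimes>\<^sub>h g) = (case v of (p, g) \<Rightarrow> blinfun_apply a p \<otimes>\<^sub>h g)"
    "norm c \<le> norm a"
    using extend_bounded_op[OF bound closure_cspan_htensor_onb[OF P G] norm_ge_zero] by blast
  have 1: "blinfun_apply c (x \<otimes>\<^sub>h g) = blinfun_apply a x \<otimes>\<^sub>h g" if "g \<in> G" for x g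
  proof (rule clinear_on_closure_cspan_eq[of P "\<lambda>x. blinfun_apply c (x \<otimes>\<^sub>h g)" "\<lambda>x. blinfun_apply a x \<otimes>\<^sub>h g"])
    show "continuous_on (closure (cspan P)) (\<lambda>x. blinfun_apply c (x \<otimes>\<^sub>h g))"
      "continuous_on (closure (cspan P)) (\<lambda>x. blinfun_apply a x \<otimes>\<^sub>h g)"
      by (intro linear_continuous_on bounded_linear_compose[OF blinfun.bounded_linear_right]
          bounded_linear_compose[OF bounded_linear_htensor_left] bounded_linear_htensor_left
          blinfun.bounded_linear_right)+
    show "blinfun_apply c (p \<otimes>\<^sub>h g) = blinfun_apply a p \<otimes>\<^sub>h g" if "p \<in> P" for p
      using c(2)[of "(p, g)"] that \<open>g \<in> G\<close> by simp
  qed (use a c(1) closure_cspan_onb[OF P] in \<open>auto simp: clinear_on_def htensor_linear blinfun.add_right bounded_opsD\<close>)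
  have 2: "blinfun_apply c (x \<otimes>\<^sub>h y) = blinfun_apply a x \<otimes>\<^sub>h y" for x y
  proof (rule clinear_on_closure_cspan_eq[of G "\<lambda>y. blinfun_apply c (x \<otimes>\<^sub>h y)" "\<lambda>y. blinfun_apply a x \<otimes>\<^sub>h y"])
    show "continuous_on (closure (cspan G)) (\<lambda>y. blinfun_apply c (x \<otimes>\<^sub>h y))"
      "continuous_on (closure (cspan G)) (\<lambda>y. blinfun_apply a x \<otimes>\<^sub>h y)"
      by (intro linear_continuous_on bounded_linear_compose[OF blinfun.bounded_linear_right]
          bounded_linear_htensor_right)+
  qed (use 1 a c(1) closure_cspan_onb[OF G] in \<open>auto simp: clinear_on_def htensor_linear blinfun.add_right bounded_opsD\<close>)
  show ?thesis using c(1,3) 2 by blast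
qed

lemma ex_tensor_right:
  fixes a :: "'b::complex_hilbert \<Rightarrow>\<^sub>L 'b"
  assumes a: "a \<in> bounded_ops"
  shows "\<exists>c\<in>bounded_ops. (\<forall>(x :: 'a::complex_hilbert) y. blinfun_apply c (x \<otimes>\<^sub>h y) = x \<otimes>\<^sub>h blinfun_apply a y) \<and> norm c \<le> norm a"
proof -
  define P where "P = (some_onb :: 'a set)"
  define G where "G = (some_onb :: 'b set)"
  have P: "orthonormal_basis P" and G: "orthonormal_basis G"
    by (simp_all add: P_def G_def orthonormal_basis_some_onb)
  have bound: "norm (\<Sum>v\<in>F. k v *\<^sub>C (case v of (p, g) \<Rightarrow> p \<otimes>\<^sub>h blinfun_apply a g))
      \<le> norm a * norm (\<Sum>v\<in>F. k v *\<^sub>C (case v of (p, g) \<Rightarrow> p \<otimes>\<^sub>h g))"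
    if F: "finite F" "F \<subseteq> P \<times> G" for F k
  proof -
    define z where "z = (\<lambda>p. \<Sum>g\<in>snd ` F. (if (p, g) \<in> F then k (p, g) else 0) *\<^sub>C g)"
    have P': "finite (fst ` F)" "fst ` F \<subseteq> P" using F by auto
    have "(\<Sum>v\<in>F. k v *\<^sub>C (case v of (p, g) \<Rightarrow> p \<otimes>\<^sub>h g)) = (\<Sum>p\<in>fst ` F. p \<otimes>\<^sub>h z p)"
      unfolding sum_times_restrict[OF F(1)] z_def htensor_lincomb_right by simp
    moreover have "(\<Sum>v\<in>F. k v *\<^sub>C (case v of (p, g) \<Rightarrow> p \<otimes>\<^sub>h blinfun_apply a g)) = (\<Sum>p\<in>fst ` F. p \<otimes>\<^sub>h blinfun_apply a (z p))"
      unfolding sum_times_restrict[OF F(1)] z_def bounded_ops_lincomb[OF a] htensor_lincomb_right by simp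
    ultimately show ?thesis
      using norm_htensor_sum_left[OF orthonormal_basisD[OF P] P', of z]
        norm_htensor_sum_left[OF orthonormal_basisD[OF P] P', of "\<lambda>g. blinfun_apply a (z g)"]
        L2_norm_blinfun_le[of a z] by simp
  qed
  obtain c where c: "c \<in> bounded_ops"
    "\<And>v. v \<in> P \<times> G \<Longrightarrow> blinfun_apply c (case v of (p, g) \<Rightarrow> p \<otimes>\<^sub>h g) = (case v of (p, g) \<Rightarrow> p \<otimes>\<^sub>h blinfun_apply a g)"
    "norm c \<le> norm a"
    using extend_bounded_op[OF bound closure_cspan_htensor_onb[OF P G] norm_ge_zero] by blast
  have 1: "blinfun_apply c (p \<otimes>\<^sub>h y) = p \<otimes>\<^sub>h blinfun_apply a y" if "p \<in> P" for y p
  proof (rule clinear_on_closure_cspan_eq[of G "\<lambda>y. blinfun_apply c (p \<otimes>\<^sub>h y)" "\<lambda>y. p \<otimes>\<^sub>h blinfun_apply a y"])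
    show "continuous_on (closure (cspan G)) (\<lambda>y. blinfun_apply c (p \<otimes>\<^sub>h y))"
      "continuous_on (closure (cspan G)) (\<lambda>y. p \<otimes>\<^sub>h blinfun_apply a y)"
      by (intro linear_continuous_on bounded_linear_compose[OF blinfun.bounded_linear_right]
          bounded_linear_compose[OF bounded_linear_htensor_right] bounded_linear_htensor_right
          blinfun.bounded_linear_right)+
    show "blinfun_apply c (p \<otimes>\<^sub>h g) = p \<otimes>\<^sub>h blinfun_apply a g" if "g \<in> G" for g
      using c(2)[of "(p, g)"] that \<open>p \<in> P\<close> by simp
  qed (use a c(1) closure_cspan_onb[OF G] in \<open>auto simp: clinear_on_def htensor_linear blinfun.add_right bounded_opsD\<close>)
  have 2: "blinfun_apply c (x \<otimes>\<^sub>h y) = x \<otimes>\<^sub>h blinfun_apply a y" for x y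
  proof (rule clinear_on_closure_cspan_eq[of P "\<lambda>x. blinfun_apply c (x \<otimes>\<^sub>h y)" "\<lambda>x. x \<otimes>\<^sub>h blinfun_apply a y"])
    show "continuous_on (closure (cspan P)) (\<lambda>x. blinfun_apply c (x \<otimes>\<^sub>h y))"
      "continuous_on (closure (cspan P)) (\<lambda>x. x \<otimes>\<^sub>h blinfun_apply a y)"
      by (intro linear_continuous_on bounded_linear_compose[OF blinfun.bounded_linear_right]
          bounded_linear_htensor_left)+
  qed (use 1 a c(1) closure_cspan_onb[OF P] in \<open>auto simp: clinear_on_def htensor_linear blinfun.add_right bounded_opsD\<close>)
  show ?thesis using c(1,3) 2 by blast
qed

lemma bounded_ops_htensor_eqI:
  assumes "c \<in> bounded_ops" "d \<in> bounded_ops"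
    and "\<And>x y. blinfun_apply c (x \<otimes>\<^sub>h y) = blinfun_apply d (x \<otimes>\<^sub>h y)"
  shows "c = d"
  by (rule bounded_ops_eqI[OF assms(1,2) closure_cspan_htensor]) (use assms(3) in auto)

text \<open>The description by \<open>THE\<close> is satisfied by the product of
  \<open>a \<otimes> 1\<close> and \<open>1 \<otimes> b\<close>, and by nothing else because
  elementary tensors are total. The product form also gives the norm bound.\<close>

lemma
  fixes a :: "'a::complex_hilbert \<Rightarrow>\<^sub>L 'a" and b :: "'b::complex_hilbert \<Rightarrow>\<^sub>L 'b"
  assumes a: "a \<in> bounded_ops" and b: "b \<in> bounded_ops"
  shows tensor_op_bounded: "a \<otimes>\<^sub>o b \<in> bounded_ops"
    and tensor_op_apply: "blinfun_apply (a \<otimes>\<^sub>o b) (x \<otimes>\<^sub>h y) = blinfun_apply a x \<otimes>\<^sub>h blinfun_apply b y"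
    and norm_tensor_op_le: "norm (a \<otimes>\<^sub>o b) \<le> norm a * norm b"
proof -
  obtain c :: "('a, 'b) htensor \<Rightarrow>\<^sub>L ('a, 'b) htensor"
    where c: "c \<in> bounded_ops" "\<And>x y. blinfun_apply c (x \<otimes>\<^sub>h y) = blinfun_apply a x \<otimes>\<^sub>h y" "norm c \<le> norm a"
    using ex_tensor_left[OF a] by blast
  obtain d :: "('a, 'b) htensor \<Rightarrow>\<^sub>L ('a, 'b) htensor"
    where d: "d \<in> bounded_ops" "\<And>x y. blinfun_apply d (x \<otimes>\<^sub>h y) = x \<otimes>\<^sub>h blinfun_apply b y" "norm d \<le> norm b"
    using ex_tensor_right[OF b] by blast
  define P where "P = (\<lambda>e. e \<in> bounded_ops \<and> (\<forall>x y. blinfun_apply e (x \<otimes>\<^sub>h y) = blinfun_apply a x \<otimes>\<^sub>h blinfun_apply b y))"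
  have cd: "P (c o\<^sub>L d)" using c d by (simp add: P_def)
  moreover have "e = c o\<^sub>L d" if "P e" for e
    by (rule bounded_ops_htensor_eqI) (use that cd in \<open>auto simp: P_def\<close>)
  ultimately have eq: "a \<otimes>\<^sub>o b = c o\<^sub>L d"
    unfolding tensor_op_def P_def[symmetric] by (rule the_equality)
  show "a \<otimes>\<^sub>o b \<in> bounded_ops" "blinfun_apply (a \<otimes>\<^sub>o b) (x \<otimes>\<^sub>h y) = blinfun_apply a x \<otimes>\<^sub>h blinfun_apply b y"
    using cd unfolding eq P_def by auto
  have "norm (c o\<^sub>L d) \<le> norm c * norm d" by (rule norm_blinfun_compose)
  also have "\<dots> \<le> norm a * norm b" using c(3) d(3) by (intro mult_mono) auto
  finally show "norm (a \<otimes>\<^sub>o b) \<le> norm a * norm b" unfolding eq .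
qed

section \<open>Algebra and norms of sums of elementary tensors of operators\<close>

lemma tensor_op_add_left:
  assumes "a \<in> bounded_ops" "a' \<in> bounded_ops" "b \<in> bounded_ops"
  shows "(a + a') \<otimes>\<^sub>o b = a \<otimes>\<^sub>o b + a' \<otimes>\<^sub>o b"
  by (rule bounded_ops_htensor_eqI)
    (use assms in \<open>auto simp: tensor_op_bounded tensor_op_apply blinfun.add_left htensor_linear\<close>)

lemma tensor_op_add_right:
  assumes "a \<in> bounded_ops" "b \<in> bounded_ops" "b' \<in> bounded_ops"
  shows "a \<otimes>\<^sub>o (b + b') = a \<otimes>\<^sub>o b + a \<otimes>\<^sub>o b'"
  by (rule bounded_ops_htensor_eqI)
    (use assms in \<open>auto simp: tensor_op_bounded tensor_op_apply blinfun.add_left htensor_linear\<close>)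

lemma tensor_op_scaleC:
  assumes "a \<in> bounded_ops" "b \<in> bounded_ops"
  shows "(c *\<^sub>C a) \<otimes>\<^sub>o b = c *\<^sub>C (a \<otimes>\<^sub>o b)" "a \<otimes>\<^sub>o (c *\<^sub>C b) = c *\<^sub>C (a \<otimes>\<^sub>o b)"
  by (rule bounded_ops_htensor_eqI;
    use assms in \<open>auto simp: tensor_op_bounded tensor_op_apply scaleC_blinfun.rep_eq htensor_linear\<close>)+

lemma tensor_op_zero_left: "b \<in> bounded_ops \<Longrightarrow> 0 \<otimes>\<^sub>o b = 0"
  using tensor_op_scaleC(1)[of 0 b 0] by simp

lemma tensor_op_comp:
  assumes "a \<in> bounded_ops" "a' \<in> bounded_ops" "b \<in> bounded_ops" "b' \<in> bounded_ops"
  shows "(a \<otimes>\<^sub>o b) o\<^sub>L (a' \<otimes>\<^sub>o b') = (a o\<^sub>L a') \<otimes>\<^sub>o (b o\<^sub>L b')"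
  by (rule bounded_ops_htensor_eqI) (use assms in \<open>auto simp: tensor_op_bounded tensor_op_apply\<close>)

text \<open>With respect to a product basis the entries of an elementary tensor are products of
  entries. The slicing lemmas that follow and the estimate for finite sections of compact operators
  are read off from this scalar matrix.\<close>

lemma norm_tensor_sum_mbound:
  assumes b: "\<And>i. i \<in> I \<Longrightarrow> b i \<in> bounded_ops" and x: "\<And>i. i \<in> I \<Longrightarrow> x i \<in> bounded_ops"
    and P: "orthonormal_basis P" and G: "orthonormal_basis G" and C: "0 \<le> C"
  shows "norm (\<Sum>i\<in>I. b i \<otimes>\<^sub>o x i) \<le> C \<longleftrightarrow>
    mbound (P \<times> G) (\<lambda>u v. \<Sum>i\<in>I. cinner (fst u) (blinfun_apply (b i) (fst v)) * cinner (snd u) (blinfun_apply (x i) (snd v))) C"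
    (is "_ \<longleftrightarrow> mbound _ ?N C")
proof -
  let ?T = "\<Sum>i\<in>I. b i \<otimes>\<^sub>o x i" and ?t = "\<lambda>(p, g). p \<otimes>\<^sub>h g"
  let ?M = "\<lambda>g h. cinner g (blinfun_apply ?T h)"
  have T: "?T \<in> bounded_ops" using b x by (auto simp: tensor_op_bounded)
  have inj: "inj_on ?t (P \<times> G)"
    using P G by (intro orthonormal_htensor orthonormal_basisD)
  have e: "?M (?t u) (?t v) = ?N u v" for u v
    using b x by (simp add: case_prod_unfold blinfun.sum_left tensor_op_apply cinner_sum_right cinner_htensor)
  have "mbound (?t ` (P \<times> G)) ?M C \<longleftrightarrow> mbound (P \<times> G) ?N C"
  proof
    assume "mbound (?t ` (P \<times> G)) ?M C"
    then show "mbound (P \<times> G) ?N C" by (rule mbound_reindex[OF _ inj]) (use e in auto)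
  next
    assume N: "mbound (P \<times> G) ?N C"
    show "mbound (?t ` (P \<times> G)) ?M C"
    proof (rule mbound_reindex[OF N inj_on_the_inv_into[OF inj]])
      show "the_inv_into (P \<times> G) ?t ` ?t ` (P \<times> G) \<subseteq> P \<times> G"
        using the_inv_into_into[OF inj _ subset_refl] by blast
      show "?M i j = ?N (the_inv_into (P \<times> G) ?t i) (the_inv_into (P \<times> G) ?t j)"
        if ij: "i \<in> ?t ` (P \<times> G)" "j \<in> ?t ` (P \<times> G)" for i j
      proof -
        obtain u v where uv: "u \<in> P \<times> G" "i = ?t u" "v \<in> P \<times> G" "j = ?t v" using ij by blast
        show ?thesis
          unfolding uv(2,4) the_inv_into_f_f[OF inj uv(1)] the_inv_into_f_f[OF inj uv(3)] by (rule e)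
      qed
    qed
  qed
  then show ?thesis
    using norm_le_mbound_iff[OF T orthonormal_basis_htensor[OF P G] C] by simp
qed

text \<open>Finite families of basis vectors of the left leg slice the sum into matrices over the
  span of the \<open>x i\<close>, with entries of the \<open>b i\<close> as coefficients. This is
  how the minimal norm meets matrix norms over \<open>X\<close>, and hence cb norms.\<close>

lemma norm_tensor_sum_le_left:
  fixes b :: "'i \<Rightarrow> ('a::complex_hilbert \<Rightarrow>\<^sub>L 'a)" and x :: "'i \<Rightarrow> ('b::complex_hilbert \<Rightarrow>\<^sub>L 'b)"
  assumes b: "\<And>i. i \<in> I \<Longrightarrow> b i \<in> bounded_ops" and x: "\<And>i. i \<in> I \<Longrightarrow> x i \<in> bounded_ops"
    and P: "orthonormal_basis P" and C: "0 \<le> C"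
  shows "norm (\<Sum>i\<in>I. b i \<otimes>\<^sub>o x i) \<le> C \<longleftrightarrow>
    (\<forall>n p. inj_on p {..<n} \<longrightarrow> p ` {..<n} \<subseteq> P \<longrightarrow>
       mat_norm n (\<lambda>r s. \<Sum>i\<in>I. cinner (p r) (blinfun_apply (b i) (p s)) *\<^sub>C x i) \<le> C)"
proof -
  define G where "G = (some_onb :: 'b set)"
  have G: "orthonormal_basis G" by (simp add: G_def orthonormal_basis_some_onb)
  let ?N = "\<lambda>u v. \<Sum>i\<in>I. cinner (fst u) (blinfun_apply (b i) (fst v)) * cinner (snd u) (blinfun_apply (x i) (snd v))"
  let ?a = "\<lambda>p r s. \<Sum>i\<in>I. cinner (p r) (blinfun_apply (b i) (p s)) *\<^sub>C x i"
  have a: "?a p r s \<in> bounded_ops" for p r s using x by auto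
  have e: "entry (?a p) u v = ?N (p (fst u), snd u) (p (fst v), snd v)" for p u v
    by (simp add: blinfun.sum_left scaleC_blinfun.rep_eq cinner_sum_right cinner_scaleC_right)
  have "mbound (P \<times> G) ?N C \<longleftrightarrow>
    (\<forall>n p. inj_on p {..<n} \<longrightarrow> p ` {..<n} \<subseteq> P \<longrightarrow> mat_norm n (?a p) \<le> C)"
  proof (safe)
    fix n :: nat and p assume N: "mbound (P \<times> G) ?N C" and p: "inj_on p {..<n}" "p ` {..<n} \<subseteq> P"
    show "mat_norm n (?a p) \<le> C"
    proof (rule mat_norm_le_mbound[OF a G C])
      show "mbound ({..<n} \<times> G) (entry (?a p)) C"
        by (rule mbound_reindex[OF N, of "\<lambda>u. (p (fst u), snd u)"])
          (use p e in \<open>auto simp: inj_on_def\<close>)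
    qed
  next
    assume R: "\<forall>n p. inj_on p {..<n} \<longrightarrow> p ` {..<n} \<subseteq> P \<longrightarrow> mat_norm n (?a p) \<le> C"
    show "mbound (P \<times> G) ?N C"
    proof (rule mbound_cofinal)
      fix F assume F: "finite F" "F \<subseteq> P \<times> G"
      \<comment> \<open>The finitely many left basis vectors occurring in \<open>F\<close> are
        numbered, so that \<open>F\<close> becomes part of one slice.\<close>
      obtain p n where p: "bij_betw p {..<n::nat} (fst ` F)"
        using ex_bij_betw_nat_finite[of "fst ` F"] F(1) by (auto simp: lessThan_atLeast0)
      then have pp: "inj_on p {..<n}" "p ` {..<n} = fst ` F" "fst ` F \<subseteq> P"
        using F(2) by (auto simp: bij_betw_def)
      define q where "q = the_inv_into {..<n} p"
      have q: "q a < n" "p (q a) = a" if "a \<in> fst ` F" for a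
        using that the_inv_into_into[OF pp(1), of a "{..<n}"] f_the_inv_into_f[OF pp(1), of a] pp(2)
        unfolding q_def by auto
      have "mat_norm n (?a p) \<le> C" using R pp by blast
      then have M: "mbound ({..<n} \<times> G) (entry (?a p)) C"
        by (rule mbound_mono[OF mbound_entry_le[OF a orthonormal_basisD[OF G]]])
      have inj: "inj_on q (fst ` F)" by (metis inj_onI q(2))
      have "mbound F ?N C"
      proof (rule mbound_reindex[OF M, of "\<lambda>u. (q (fst u), snd u)"])
        show "?N u v = entry (?a p) (q (fst u), snd u) (q (fst v), snd v)" if "u \<in> F" "v \<in> F" for u v
          unfolding e using that q(2) by simp
      qed (use F q inj in \<open>auto simp: inj_on_def\<close>)
      then show "\<exists>H. finite H \<and> F \<subseteq> H \<and> mbound H ?N C" using F by blast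
    qed
  qed
  then show ?thesis using norm_tensor_sum_mbound[of I b x P G C] b x P G C by simp
qed

text \<open>Exchanging the legs only permutes the product basis, so
  \<open>\<Sum>i b i \<otimes> x i\<close> and \<open>\<Sum>i x i \<otimes> b i\<close> have the
  same norm.\<close>

lemma norm_tensor_sum_le_right:
  fixes b :: "'i \<Rightarrow> ('a::complex_hilbert \<Rightarrow>\<^sub>L 'a)" and x :: "'i \<Rightarrow> ('b::complex_hilbert \<Rightarrow>\<^sub>L 'b)"
  assumes b: "\<And>i. i \<in> I \<Longrightarrow> b i \<in> bounded_ops" and x: "\<And>i. i \<in> I \<Longrightarrow> x i \<in> bounded_ops"
    and G: "orthonormal_basis G" and C: "0 \<le> C"
  shows "norm (\<Sum>i\<in>I. b i \<otimes>\<^sub>o x i) \<le> C \<longleftrightarrow>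
    (\<forall>n g. inj_on g {..<n} \<longrightarrow> g ` {..<n} \<subseteq> G \<longrightarrow>
       mat_norm n (\<lambda>r s. \<Sum>i\<in>I. cinner (g r) (blinfun_apply (x i) (g s)) *\<^sub>C b i) \<le> C)"
proof -
  define P where "P = (some_onb :: 'a set)"
  have P: "orthonormal_basis P" by (simp add: P_def orthonormal_basis_some_onb)
  let ?N = "\<lambda>u v. \<Sum>i\<in>I. cinner (fst u) (blinfun_apply (b i) (fst v)) * cinner (snd u) (blinfun_apply (x i) (snd v))"
  let ?N' = "\<lambda>u v. \<Sum>i\<in>I. cinner (fst u) (blinfun_apply (x i) (fst v)) * cinner (snd u) (blinfun_apply (b i) (snd v))"
  have swap: "?N u v = ?N' (prod.swap u) (prod.swap v)" for u v by (simp add: mult.commute)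
  have "mbound (P \<times> G) ?N C \<longleftrightarrow> mbound (G \<times> P) ?N' C"
  proof
    assume "mbound (P \<times> G) ?N C"
    then show "mbound (G \<times> P) ?N' C"
      by (rule mbound_reindex[of _ _ _ prod.swap]) (auto simp: mult.commute)
  next
    assume "mbound (G \<times> P) ?N' C"
    then show "mbound (P \<times> G) ?N C"
      by (rule mbound_reindex[of _ _ _ prod.swap]) (auto simp: mult.commute)
  qed
  then have "norm (\<Sum>i\<in>I. b i \<otimes>\<^sub>o x i) \<le> C \<longleftrightarrow> norm (\<Sum>i\<in>I. x i \<otimes>\<^sub>o b i) \<le> C"
    using norm_tensor_sum_mbound[of I b x P G C] norm_tensor_sum_mbound[of I x b G P C] b x P G C by simp
  then show ?thesis using norm_tensor_sum_le_left[of I x b G C] x b G C by simp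
qed

section \<open>Operators on \<open>\<ell>\<^sub>2\<close>\<close>

lift_definition unit_ell2 :: "'i \<Rightarrow> 'i ell2" is "\<lambda>i j. if j = i then 1 else 0"
proof -
  fix i :: 'i
  show "(\<lambda>j. (cmod (if j = i then 1 else 0))\<^sup>2) summable_on UNIV"
    by (subst summable_on_cong_neutral[where T="{i}" and g="\<lambda>_. 1"]) auto
qed

lemma coord_unit: "coord (unit_ell2 i) j = (if j = i then 1 else 0)"
  by transfer simp

lemma ell2_eqI: "(\<And>i. coord x i = coord y i) \<Longrightarrow> x = y"
  by (intro coord_inject[THEN iffD1]) auto

lemma cinner_unit: "cinner (unit_ell2 i) x = coord x i"
proof -
  have "(\<Sum>\<^sub>\<infinity>j. cnj (coord (unit_ell2 i) j) * coord x j) = (\<Sum>\<^sub>\<infinity>j\<in>{i}. coord x j)"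
    by (rule infsum_cong_neutral) (auto simp: coord_unit)
  then show ?thesis by (simp add: cinner_ell2)
qed

lemma inj_unit: "inj unit_ell2"
proof (rule injI)
  fix i j :: 'i assume "unit_ell2 i = unit_ell2 j"
  then have "coord (unit_ell2 i) j = coord (unit_ell2 j) j" by simp
  then show "i = j" by (simp add: coord_unit split: if_splits)
qed

lemma orthonormal_basis_unit: "orthonormal_basis (range unit_ell2)"
  unfolding orthonormal_basis_def orthonormal_def
  by (auto simp: cinner_unit coord_unit zero_ell2.rep_eq inj_eq[OF inj_unit] intro: ell2_eqI)

text \<open>Bounded finite partial norms give square summability and the norm bound together, so
  vectors can be constructed without evaluating infinite sums.\<close>

lemma Abs_ell2_bounded:
  assumes "\<And>F. finite F \<Longrightarrow> L2_set (\<lambda>i. cmod (f i)) F \<le> C"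
  shows "coord (Abs_ell2 f) = f" "norm (Abs_ell2 f) \<le> C"
proof -
  have C: "0 \<le> C" using assms[of "{}"] by simp
  have le: "(\<Sum>i\<in>F. (cmod (f i))\<^sup>2) \<le> C\<^sup>2" if "finite F" for F
    using power_mono[OF assms[OF that], of 2] by (simp add: L2_set_def sum_nonneg)
  then have "(\<lambda>i. (cmod (f i))\<^sup>2) summable_on UNIV"
    by (intro nonneg_bdd_above_summable_on bdd_aboveI2) auto
  then show c: "coord (Abs_ell2 f) = f" by (intro Abs_ell2_inverse) simp
  show "norm (Abs_ell2 f) \<le> C"
  proof (rule norm_le_onb[OF orthonormal_basis_unit C])
    fix F :: "'a ell2 set" assume F: "finite F" "F \<subseteq> range unit_ell2"
    then obtain G where G: "finite G" "F = unit_ell2 ` G" by (meson finite_subset_image)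
    have "L2_set (\<lambda>b. cmod (cinner b (Abs_ell2 f))) F = L2_set (\<lambda>i. cmod (f i)) G"
      unfolding G(2) L2_set_def
      by (subst sum.reindex) (auto intro: inj_on_subset[OF inj_unit] simp: cinner_unit c)
    then show "L2_set (\<lambda>b. cmod (cinner b (Abs_ell2 f))) F \<le> C" using assms[OF G(1)] by simp
  qed
qed

lemma L2_coord_le_norm: "finite F \<Longrightarrow> L2_set (\<lambda>i. cmod (coord x i)) F \<le> norm x"
  using finite_sum_le_norm_ell2[of F x] by (simp add: L2_set_def real_le_lsqrt)

lemma coord_add: "coord (x + y) i = coord x i + coord y i" by transfer simp
lemma coord_scaleC: "coord (c *\<^sub>C x) i = c * coord x i" by transfer simp
lemma coord_sum: "coord (\<Sum>j\<in>F. f j) i = (\<Sum>j\<in>F. coord (f j) i)"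
  by (induction F rule: infinite_finite_induct) (auto simp: coord_add zero_ell2.rep_eq)

lemma norm_lincomb_unit:
  "finite F \<Longrightarrow> norm (\<Sum>j\<in>F. c j *\<^sub>C unit_ell2 j) = L2_set (\<lambda>j. cmod (c j)) F"
proof -
  assume F: "finite F"
  have inj: "inj_on unit_ell2 F" by (rule inj_on_subset[OF inj_unit]) simp
  have "norm (\<Sum>d\<in>unit_ell2 ` F. c (inv unit_ell2 d) *\<^sub>C d)
      = L2_set (\<lambda>d. cmod (c (inv unit_ell2 d))) (unit_ell2 ` F)"
    by (rule norm_orthonormal_L2[OF orthonormal_basisD[OF orthonormal_basis_unit]]) (use F in auto)
  then show ?thesis
    unfolding L2_set_def by (simp add: sum.reindex[OF inj] inv_f_f[OF inj_unit])
qed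

text \<open>The columns of \<open>M\<close> serve as images of the unit vectors; sections with a
  single column show that they are square summable.\<close>

lemma ex_matrix_operator:
  fixes M :: "'i \<Rightarrow> 'i \<Rightarrow> complex"
  assumes M: "mbound UNIV M C" and C: "0 \<le> C"
  obtains T where "T \<in> bounded_ops" "norm T \<le> C" "\<And>i j. coord (blinfun_apply T (unit_ell2 j)) i = M i j"
proof -
  have comb: "L2_set (\<lambda>i. cmod (\<Sum>j\<in>F. M i j * c j)) G \<le> C * L2_set (\<lambda>j. cmod (c j)) F"
    if "finite F" "finite G" for F G c
    using that by (intro mbound_rectangle[OF M]) auto
  define h where "h = (\<lambda>j. Abs_ell2 (\<lambda>i. M i j))"
  have h: "coord (h j) = (\<lambda>i. M i j)" for j
    unfolding h_def
    by (rule Abs_ell2_bounded(1)[of _ C]) (use comb[of "{j}" _ "\<lambda>_. 1"] in simp)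
  have bound: "norm (\<Sum>j\<in>F. c j *\<^sub>C h j) \<le> C * norm (\<Sum>j\<in>F. c j *\<^sub>C unit_ell2 j)"
    if "finite F" "F \<subseteq> UNIV" for F c
  proof -
    let ?s = "\<lambda>i. \<Sum>j\<in>F. M i j * c j"
    have "coord (\<Sum>j\<in>F. c j *\<^sub>C h j) i = ?s i" for i
      by (simp add: coord_sum coord_scaleC h mult.commute)
    then have "coord (\<Sum>j\<in>F. c j *\<^sub>C h j) = ?s" by (rule ext)
    then have "(\<Sum>j\<in>F. c j *\<^sub>C h j) = Abs_ell2 ?s"
      using coord_inverse[of "\<Sum>j\<in>F. c j *\<^sub>C h j"] by simp
    then show ?thesis
      using Abs_ell2_bounded(2)[OF comb[OF that(1)], of c] norm_lincomb_unit[OF that(1), of c] by simp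
  qed
  obtain T where T: "T \<in> bounded_ops" "\<And>j. j \<in> UNIV \<Longrightarrow> blinfun_apply T (unit_ell2 j) = h j" "norm T \<le> C"
    using extend_bounded_op[OF bound closure_cspan_onb[OF orthonormal_basis_unit] C] by blast
  show thesis by (rule that[OF T(1,3)]) (simp add: T(2) h)
qed

section \<open>Partial shifts and coordinate projections\<close>

definition partial_inj :: "('i \<Rightarrow> 'j option) \<Rightarrow> bool" where
  "partial_inj \<phi> \<longleftrightarrow> (\<forall>i i' j. \<phi> i = Some j \<longrightarrow> \<phi> i' = Some j \<longrightarrow> i = i')"

text \<open>Coordinate \<open>i\<close> of the result is coordinate \<open>\<phi> i\<close> of the
  argument, or 0 where \<open>\<phi>\<close> is undefined. Coordinate projections, the Cuntz
  isometries and their adjoints are instances, so that contractivity and adjoints are settled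
  once.\<close>

definition partial_shift :: "('i \<Rightarrow> 'j option) \<Rightarrow> ('j ell2 \<Rightarrow>\<^sub>L 'i ell2)" where
  "partial_shift \<phi> = Blinfun (\<lambda>x. Abs_ell2 (\<lambda>i. case \<phi> i of None \<Rightarrow> 0 | Some j \<Rightarrow> coord x j))"

lemma
  assumes \<phi>: "partial_inj \<phi>"
  shows coord_partial_shift:
      "coord (blinfun_apply (partial_shift \<phi>) x) i = (case \<phi> i of None \<Rightarrow> 0 | Some j \<Rightarrow> coord x j)" (is ?A)
    and partial_shift_bounded: "partial_shift \<phi> \<in> bounded_ops" (is ?B)
    and norm_partial_shift: "norm (partial_shift \<phi>) \<le> 1" (is ?C)
proof -
  let ?f = "\<lambda>x i. case \<phi> i of None \<Rightarrow> 0 | Some j \<Rightarrow> coord x j"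
  have "L2_set (\<lambda>i. cmod (?f x i)) F \<le> norm x" if F: "finite F" for x F
  proof -
    let ?D = "{i \<in> F. \<phi> i \<noteq> None}"
    have inj: "inj_on (\<lambda>i. the (\<phi> i)) ?D"
      using \<phi> by (auto simp: inj_on_def partial_inj_def)
    have "L2_set (\<lambda>i. cmod (?f x i)) F = L2_set (\<lambda>i. cmod (?f x i)) ?D"
      using F by (intro L2_set_mono_neutral) (auto split: option.splits)
    also have "\<dots> = L2_set (\<lambda>j. cmod (coord x j)) ((\<lambda>i. the (\<phi> i)) ` ?D)"
      unfolding L2_set_def by (subst sum.reindex[OF inj]) (auto intro!: sum.cong arg_cong[of _ _ sqrt])
    also have "\<dots> \<le> norm x" using F by (intro L2_coord_le_norm) auto
    finally show ?thesis .
  qed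
  note A = Abs_ell2_bounded[OF this]
  have lin: "bounded_linear (\<lambda>x. Abs_ell2 (?f x))"
  proof (rule bounded_linear_intro[where K=1])
    show "Abs_ell2 (?f (x + y)) = Abs_ell2 (?f x) + Abs_ell2 (?f y)" for x y
      by (rule ell2_eqI) (auto simp: A coord_add split: option.splits)
    show "Abs_ell2 (?f (r *\<^sub>R x)) = r *\<^sub>R Abs_ell2 (?f x)" for x r
      by (rule ell2_eqI) (auto simp: A scaleR_scaleC coord_scaleC split: option.splits)
  qed (use A in auto)
  have app: "blinfun_apply (partial_shift \<phi>) x = Abs_ell2 (?f x)" for x
    unfolding partial_shift_def by (simp add: bounded_linear_Blinfun_apply[OF lin])
  show ?A by (simp add: app A)
  show ?B unfolding bounded_ops_def
    by (auto intro!: ell2_eqI simp: app A coord_scaleC split: option.splits)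
  show ?C by (rule norm_blinfun_bound) (use A in \<open>auto simp: app\<close>)
qed

text \<open>Mutually inverse partial maps restrict to a bijection of their domains, along which the
  sum defining the inner product is reindexed.\<close>

lemma adjoint_partial_shift:
  assumes "partial_inj \<phi>" "partial_inj \<psi>" and inv: "\<And>i j. \<phi> i = Some j \<longleftrightarrow> \<psi> j = Some i"
  shows "adjoint_pair (partial_shift \<phi>) (partial_shift \<psi>)"
  unfolding adjoint_pair_def
proof (intro allI)
  fix x y
  let ?D = "{i. \<phi> i \<noteq> None}" and ?E = "{j. \<psi> j \<noteq> None}"
  have bij: "bij_betw (\<lambda>i. the (\<phi> i)) ?D ?E"
  proof (rule bij_betw_byWitness[where f'="\<lambda>j. the (\<psi> j)"]; clarify)
    fix i j assume *: "\<phi> i = Some j"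
    then have "\<psi> j = Some i" using inv by simp
    then show "the (\<psi> (the (\<phi> i))) = i" using * by simp
  next
    fix i j assume *: "\<psi> j = Some i"
    then have "\<phi> i = Some j" using inv by simp
    then show "the (\<phi> (the (\<psi> j))) = j" using * by simp
  next
    fix i j assume *: "\<phi> i = Some j"
    then show "\<exists>i'. \<psi> (the (\<phi> i)) = Some i'" using inv[of i j] by simp
  next
    fix i j assume *: "\<psi> j = Some i"
    then show "\<exists>j'. \<phi> (the (\<psi> j)) = Some j'" using inv[of i j] by simp
  qed
  have "cinner (blinfun_apply (partial_shift \<phi>) x) y = (\<Sum>\<^sub>\<infinity>i\<in>?D. cnj (coord x (the (\<phi> i))) * coord y i)"
    unfolding cinner_ell2 coord_partial_shift[OF assms(1)]
    by (rule infsum_cong_neutral) (auto split: option.splits)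
  also have "\<dots> = (\<Sum>\<^sub>\<infinity>i\<in>?D. cnj (coord x (the (\<phi> i))) * coord y (the (\<psi> (the (\<phi> i)))))"
    by (rule infsum_cong) (use inv in force)
  also have "\<dots> = (\<Sum>\<^sub>\<infinity>j\<in>?E. cnj (coord x j) * coord y (the (\<psi> j)))"
    by (rule infsum_reindex_bij_betw[OF bij])
  also have "\<dots> = cinner x (blinfun_apply (partial_shift \<psi>) y)"
    unfolding cinner_ell2 coord_partial_shift[OF assms(2)]
    by (rule infsum_cong_neutral) (auto split: option.splits)
  finally show "cinner (blinfun_apply (partial_shift \<phi>) x) y = cinner x (blinfun_apply (partial_shift \<psi>) y)" .
qed

definition coord_proj :: "'i set \<Rightarrow> ('i ell2 \<Rightarrow>\<^sub>L 'i ell2)" where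
  "coord_proj A = partial_shift (\<lambda>i. if i \<in> A then Some i else None)"

lemma
  shows coord_coord_proj: "coord (blinfun_apply (coord_proj A) x) i = (if i \<in> A then coord x i else 0)"
    and coord_proj_bounded [simp]: "coord_proj A \<in> bounded_ops"
    and norm_coord_proj: "norm (coord_proj A) \<le> 1"
proof -
  have inj: "partial_inj (\<lambda>i. if i \<in> A then Some i else None)"
    by (auto simp: partial_inj_def split: if_splits)
  show "coord (blinfun_apply (coord_proj A) x) i = (if i \<in> A then coord x i else 0)"
    "coord_proj A \<in> bounded_ops" "norm (coord_proj A) \<le> 1"
    using coord_partial_shift[OF inj] partial_shift_bounded[OF inj] norm_partial_shift[OF inj]
    by (auto simp: coord_proj_def)
qed

lemma adjoint_coord_proj: "adjoint_pair (coord_proj A) (coord_proj A)"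
  unfolding coord_proj_def
  by (rule adjoint_partial_shift) (auto simp: partial_inj_def split: if_splits)

section \<open>Compact operators\<close>

lemma compact_opsI:
  assumes "a \<in> bounded_ops" "compact K" "\<And>x. norm x \<le> 1 \<Longrightarrow> blinfun_apply a x \<in> K"
  shows "a \<in> compact_ops"
proof -
  have "closure (blinfun_apply a ` cball 0 1) \<subseteq> K"
    using assms by (intro closure_minimal compact_imp_closed) auto
  then have "compact (closure (blinfun_apply a ` cball 0 1))"
    using compact_Int_closed[OF assms(2) closed_closure] by (metis inf.absorb2)
  then show ?thesis using assms(1) by (simp add: compact_ops_def)
qed

lemma compact_opsE:
  assumes "a \<in> compact_ops"
  obtains K where "compact K" "\<And>x. norm x \<le> 1 \<Longrightarrow> blinfun_apply a x \<in> K"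
proof
  show "compact (closure (blinfun_apply a ` cball 0 1))" using assms by (simp add: compact_ops_def)
  show "blinfun_apply a x \<in> closure (blinfun_apply a ` cball 0 1)" if "norm x \<le> 1" for x
    using that by (intro subsetD[OF closure_subset]) auto
qed

lemma compact_ops_bounded: "a \<in> compact_ops \<Longrightarrow> a \<in> bounded_ops"
  by (simp add: compact_ops_def)

lemma csubspace_compact_ops: "csubspace compact_ops"
  unfolding csubspace_def
proof (intro conjI ballI allI)
  show "0 \<in> compact_ops" by (rule compact_opsI[of _ "{0}"]) auto
next
  fix a b :: "'a \<Rightarrow>\<^sub>L 'b" assume ab: "a \<in> compact_ops" "b \<in> compact_ops"
  obtain K where K: "compact K" "\<And>x. norm x \<le> 1 \<Longrightarrow> blinfun_apply a x \<in> K" using ab(1) by (rule compact_opsE) blast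
  obtain L where L: "compact L" "\<And>x. norm x \<le> 1 \<Longrightarrow> blinfun_apply b x \<in> L" using ab(2) by (rule compact_opsE) blast
  show "a + b \<in> compact_ops"
    by (rule compact_opsI[OF _ compact_sums[OF K(1) L(1)]])
      (use ab K L in \<open>auto simp: compact_ops_bounded blinfun.add_left\<close>)
next
  fix c and a :: "'a \<Rightarrow>\<^sub>L 'b" assume a: "a \<in> compact_ops"
  obtain K where K: "compact K" "\<And>x. norm x \<le> 1 \<Longrightarrow> blinfun_apply a x \<in> K" using a by (rule compact_opsE) blast
  have "compact ((\<lambda>x. c *\<^sub>C x) ` K)"
    by (intro compact_continuous_image linear_continuous_on bounded_linear_scaleC K)
  then show "c *\<^sub>C a \<in> compact_ops"
    by (rule compact_opsI[rotated]) (use a K in \<open>auto simp: compact_ops_bounded scaleC_blinfun.rep_eq\<close>)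
qed

lemmas compact_ops_arith = csubspaceD[OF csubspace_compact_ops]
lemmas compact_ops_sum = csubspace_sum[OF csubspace_compact_ops]

lemma compact_ops_comp_left:
  assumes "a \<in> bounded_ops" "k \<in> compact_ops"
  shows "a o\<^sub>L k \<in> compact_ops"
proof -
  obtain K where K: "compact K" "\<And>x. norm x \<le> 1 \<Longrightarrow> blinfun_apply k x \<in> K" using assms(2) by (rule compact_opsE) blast
  have "compact (blinfun_apply a ` K)"
    by (intro compact_continuous_image bounded_linear_continuous_on_blinfun K)
  then show ?thesis
    by (rule compact_opsI[rotated]) (use assms K in \<open>auto simp: compact_ops_bounded\<close>)
qed

lemma compact_ops_comp_right:
  assumes "a \<in> bounded_ops" "k \<in> compact_ops"
  shows "k o\<^sub>L a \<in> compact_ops"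
proof -
  obtain K where K: "compact K" "\<And>x. norm x \<le> 1 \<Longrightarrow> blinfun_apply k x \<in> K" using assms(2) by (rule compact_opsE) blast
  \<comment> \<open>The unit ball is mapped into the ball of radius \<open>r\<close>; the increment
    1 keeps \<open>r\<close> positive when \<open>a = 0\<close>.\<close>
  define r where "r = norm a + 1"
  have r: "r > 0" by (simp add: r_def add_nonneg_pos)
  have "compact ((\<lambda>x. r *\<^sub>R x) ` K)"
    by (intro compact_continuous_image K continuous_intros)
  then show ?thesis
  proof (rule compact_opsI[rotated])
    fix x :: 'a assume x: "norm x \<le> 1"
    have "norm (blinfun_apply a x) \<le> norm a * 1"
      using norm_blinfun[of a x] mult_left_mono[OF x, of "norm a"] by simp
    then have "norm (inverse r *\<^sub>R blinfun_apply a x) \<le> 1"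
      using r by (simp add: r_def field_simps)
    then have "blinfun_apply k (inverse r *\<^sub>R blinfun_apply a x) \<in> K" by (rule K)
    then have "r *\<^sub>R blinfun_apply k (inverse r *\<^sub>R blinfun_apply a x) \<in> (\<lambda>x. r *\<^sub>R x) ` K" by blast
    then show "blinfun_apply (k o\<^sub>L a) x \<in> (\<lambda>x. r *\<^sub>R x) ` K"
      using r by (simp add: blinfun.scaleR_right)
  qed (use assms in \<open>auto simp: compact_ops_bounded\<close>)
qed

section \<open>Rank one operators and strong convergence\<close>

definition rank_one :: "'b::complex_hilbert \<Rightarrow> 'a::complex_hilbert \<Rightarrow> ('a \<Rightarrow>\<^sub>L 'b)" where
  "rank_one \<xi> \<eta> = Blinfun (\<lambda>x. cinner \<eta> x *\<^sub>C \<xi>)"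

lemma rank_one_apply: "blinfun_apply (rank_one \<xi> \<eta>) x = cinner \<eta> x *\<^sub>C \<xi>"
proof -
  have "bounded_linear (\<lambda>x. cinner \<eta> x *\<^sub>C \<xi>)"
  proof (rule bounded_linear_intro[where K="norm \<eta> * norm \<xi>"])
    show "norm (cinner \<eta> x *\<^sub>C \<xi>) \<le> norm x * (norm \<eta> * norm \<xi>)" for x
      using mult_right_mono[OF cauchy_schwarz[of \<eta> x], of "norm \<xi>"] by (simp add: norm_scaleC mult_ac)
  qed (simp_all add: cinner_add_right scaleC_add_left scaleR_scaleC cinner_scaleC_right scaleC_scaleC)
  then show ?thesis unfolding rank_one_def by (simp add: bounded_linear_Blinfun_apply)
qed

lemma norm_rank_one_le: "norm (rank_one \<xi> \<eta>) \<le> norm \<xi> * norm \<eta>"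
proof (rule norm_blinfun_bound)
  show "norm (blinfun_apply (rank_one \<xi> \<eta>) x) \<le> norm \<xi> * norm \<eta> * norm x" for x
    using mult_right_mono[OF cauchy_schwarz[of \<eta> x], of "norm \<xi>"]
    by (simp add: rank_one_apply norm_scaleC mult_ac)
qed simp

lemma rank_one_compact: "rank_one \<xi> \<eta> \<in> compact_ops"
proof (rule compact_opsI)
  show "rank_one \<xi> \<eta> \<in> bounded_ops"
    by (simp add: bounded_ops_def rank_one_apply cinner_scaleC_right scaleC_scaleC)
  have "continuous_on UNIV (\<lambda>c. c *\<^sub>C \<xi>)"
    by (intro linear_continuous_on bounded_linear_intro[where K="norm \<xi>"])
      (auto simp: scaleC_add_left norm_scaleC scaleR_scaleC scaleC_scaleC scaleR_conv_of_real)
  then show "compact ((\<lambda>c. c *\<^sub>C \<xi>) ` cball 0 (norm \<eta>))"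
    by (intro compact_continuous_image compact_cball) (rule continuous_on_subset, auto)
  show "blinfun_apply (rank_one \<xi> \<eta>) x \<in> (\<lambda>c. c *\<^sub>C \<xi>) ` cball 0 (norm \<eta>)" if "norm x \<le> 1" for x
  proof -
    have "cmod (cinner \<eta> x) \<le> norm \<eta>"
      using cauchy_schwarz[of \<eta> x] mult_left_mono[OF that, of "norm \<eta>"] by simp
    then show ?thesis by (auto simp: rank_one_apply)
  qed
qed

lemma coord_proj_compact:
  assumes "finite A"
  shows "coord_proj A \<in> compact_ops"
proof -
  have "coord_proj A = (\<Sum>i\<in>A. rank_one (unit_ell2 i) (unit_ell2 i))"
    using assms by (intro blinfun_eqI ell2_eqI)
      (simp add: coord_coord_proj blinfun.sum_left coord_sum rank_one_apply cinner_unit coord_scaleC coord_unit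
        if_distrib[of "\<lambda>x. _ * x"] cong: if_cong)
  then show ?thesis by (auto intro: compact_ops_sum rank_one_compact)
qed

text \<open>The vectors with limit 0 form a subspace, which is closed because the \<open>R n\<close>
  are contractions.\<close>

lemma strong_null_dense:
  assumes R: "\<And>n. norm (R n) \<le> 1" "\<And>n. R n \<in> bounded_ops" and S: "closure (cspan S) = UNIV"
    and lim: "\<And>s. s \<in> S \<Longrightarrow> (\<lambda>n. blinfun_apply (R n) s) \<longlonglongrightarrow> 0"
  shows "(\<lambda>n. blinfun_apply (R n) x) \<longlonglongrightarrow> 0"
proof -
  have 1: "norm (blinfun_apply (R n) x) \<le> norm x" for n x
    using norm_blinfun[of "R n" x] mult_right_mono[OF R(1)[of n], of "norm x"] by simp
  let ?V = "{x. (\<lambda>n. blinfun_apply (R n) x) \<longlonglongrightarrow> 0}"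
  have sub: "csubspace ?V"
    unfolding csubspace_def
  proof (intro conjI ballI allI)
    show "0 \<in> ?V" by simp
    show "x + y \<in> ?V" if "x \<in> ?V" "y \<in> ?V" for x y
      using tendsto_add[of _ 0 sequentially _ 0] that by (simp add: blinfun.add_right)
    show "c *\<^sub>C x \<in> ?V" if "x \<in> ?V" for c x
      using bounded_linear.tendsto[OF bounded_linear_scaleC, of _ 0 sequentially c] that R(2)
      by (simp add: bounded_opsD)
  qed
  have "x \<in> ?V" if x: "x \<in> closure (cspan S)" for x
  proof -
    have sp: "cspan S \<subseteq> ?V" using lim by (intro cspan_minimal sub) auto
    show ?thesis
      unfolding mem_Collect_eq
    proof (rule LIMSEQ_I)
      fix e :: real assume e: "e > 0"
      obtain y where y: "y \<in> cspan S" "norm (y - x) < e / 2"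
        using x e half_gt_zero[OF e] unfolding closure_approachable dist_norm by blast
      then have "(\<lambda>n. blinfun_apply (R n) y) \<longlonglongrightarrow> 0" using sp by auto
      then obtain N where N: "\<And>n. n \<ge> N \<Longrightarrow> norm (blinfun_apply (R n) y) < e / 2"
        using LIMSEQ_D[of _ 0 "e / 2"] e by fastforce
      have "norm (blinfun_apply (R n) x - 0) < e" if "n \<ge> N" for n
      proof -
        have "blinfun_apply (R n) x = blinfun_apply (R n) y - blinfun_apply (R n) (y - x)"
          by (simp add: blinfun.diff_right)
        then have "norm (blinfun_apply (R n) x) \<le> norm (blinfun_apply (R n) y) + norm (blinfun_apply (R n) (y - x))"
          using norm_triangle_ineq4[of "blinfun_apply (R n) y" "blinfun_apply (R n) (y - x)"] by simp
        then show ?thesis using N[OF that] 1[of n "y - x"] y by simp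
      qed
      then show "\<exists>N. \<forall>n\<ge>N. norm (blinfun_apply (R n) x - 0) < e" by blast
    qed
  qed
  then show ?thesis using S by blast
qed

lemma coord_proj_strong_null:
  assumes "\<And>i. finite {n :: nat. i \<in> A n}"
  shows "(\<lambda>n. blinfun_apply (coord_proj (A n)) x) \<longlonglongrightarrow> 0"
proof (rule strong_null_dense[OF norm_coord_proj coord_proj_bounded closure_cspan_onb[OF orthonormal_basis_unit]])
  fix s :: "'a ell2" assume "s \<in> range unit_ell2"
  then obtain i where s: "s = unit_ell2 i" by blast
  obtain N where N: "\<And>n. i \<in> A n \<Longrightarrow> n < N"
    using assms[of i] finite_nat_set_iff_bounded by auto
  have "blinfun_apply (coord_proj (A n)) s = 0" if "n \<ge> N" for n
    using N[of n] that by (intro ell2_eqI) (auto simp: s coord_coord_proj coord_unit zero_ell2.rep_eq)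
  then show "(\<lambda>n. blinfun_apply (coord_proj (A n)) s) \<longlonglongrightarrow> 0"
    by (intro tendsto_eventually eventually_sequentiallyI[of N])
qed

text \<open>Strong convergence of contractions is uniform on compact sets, here on one containing
  the image of the unit ball under \<open>k\<close>.\<close>

lemma compact_strong_null:
  assumes k: "k \<in> compact_ops" and R: "\<And>n. norm (R n) \<le> 1"
    and lim: "\<And>x. (\<lambda>n. blinfun_apply (R n) x) \<longlonglongrightarrow> 0"
  shows "(\<lambda>n. norm (R n o\<^sub>L k)) \<longlonglongrightarrow> 0"
proof (rule LIMSEQ_I)
  fix e :: real assume e: "e > 0"
  obtain K where K: "compact K" "\<And>x. norm x \<le> 1 \<Longrightarrow> blinfun_apply k x \<in> K" using k by (rule compact_opsE) blast
  \<comment> \<open>The values on the net and the distance to the net contribute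
    \<open>e / 4\<close> each; the sum \<open>e / 2\<close> leaves a strict bound by
    \<open>e\<close>.\<close>
  obtain Y where Y: "finite Y" "K \<subseteq> (\<Union>y\<in>Y. ball y (e / 4))"
    using K(1) e unfolding compact_eq_totally_bounded by (meson zero_less_divide_iff zero_less_numeral)
  have "\<forall>\<^sub>F n in sequentially. \<forall>y\<in>Y. norm (blinfun_apply (R n) y) < e / 4"
    using Y(1)
  proof (rule eventually_ball_finite, intro ballI)
    fix y
    show "\<forall>\<^sub>F n in sequentially. norm (blinfun_apply (R n) y) < e / 4"
      using tendstoD[OF lim[of y], of "e / 4"] e by simp
  qed
  then obtain N where N: "\<And>n y. n \<ge> N \<Longrightarrow> y \<in> Y \<Longrightarrow> norm (blinfun_apply (R n) y) < e / 4"
    unfolding eventually_sequentially by blast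
  have "norm (R n o\<^sub>L k) < e" if n: "n \<ge> N" for n
  proof -
    have u: "norm (blinfun_apply (R n) (blinfun_apply k x)) \<le> e / 2" if x: "norm x \<le> 1" for x
    proof -
      obtain y where y: "y \<in> Y" "norm (y - blinfun_apply k x) < e / 4"
        using K(2)[OF x] Y(2) by (auto simp: dist_norm)
      have "norm (blinfun_apply (R n) (y - blinfun_apply k x)) \<le> norm (y - blinfun_apply k x)"
        using norm_blinfun[of "R n" "y - blinfun_apply k x"] mult_right_mono[OF R[of n], of "norm (y - blinfun_apply k x)"] by simp
      moreover have "blinfun_apply (R n) (blinfun_apply k x) = blinfun_apply (R n) y - blinfun_apply (R n) (y - blinfun_apply k x)"
        by (simp add: blinfun.diff_right)
      ultimately show ?thesis
        using N[OF n y(1)] y(2) norm_triangle_ineq4[of "blinfun_apply (R n) y" "blinfun_apply (R n) (y - blinfun_apply k x)"] by simp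
    qed
    have "norm (R n o\<^sub>L k) \<le> e / 2"
    proof (rule norm_blinfun_bound)
      fix x :: 'a
      show "norm (blinfun_apply (R n o\<^sub>L k) x) \<le> e / 2 * norm x"
      proof (cases "x = 0")
        case False
        then show ?thesis
          using u[of "inverse (norm x) *\<^sub>R x"] by (simp add: blinfun.scaleR_right field_simps)
      qed simp
    qed (use e in simp)
    then show ?thesis using e by simp
  qed
  then show "\<exists>N. \<forall>n\<ge>N. norm (norm (R n o\<^sub>L k) - 0) < e" by auto
qed

lemma compact_coord_proj_left:
  assumes "k \<in> compact_ops" "\<And>i. finite {n :: nat. i \<in> A n}"
  shows "(\<lambda>n. norm (coord_proj (A n) o\<^sub>L k)) \<longlonglongrightarrow> 0"
  by (rule compact_strong_null[OF assms(1) norm_coord_proj coord_proj_strong_null[OF assms(2)]])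

lemma coord_proj_Compl: "blinfun_apply (coord_proj (- A)) x = x - blinfun_apply (coord_proj A) x"
  by (rule ell2_eqI) (auto simp: coord_coord_proj minus_ell2.rep_eq)

section \<open>Cuntz isometries and the Calkin algebra\<close>

lemma adjoint_pairD: "adjoint_pair a b \<Longrightarrow> cinner (blinfun_apply a x) y = cinner x (blinfun_apply b y)"
  by (simp add: adjoint_pair_def)

text \<open>\<open>P\<close> is kept general because a representation of the Calkin algebra need not be unital.\<close>

locale cuntz_family =
  fixes S S' :: "nat \<Rightarrow> ('a::complex_hilbert \<Rightarrow>\<^sub>L 'a)" and P :: "'a \<Rightarrow>\<^sub>L 'a" and m :: nat
  assumes adj: "i < m \<Longrightarrow> adjoint_pair (S i) (S' i)"
    and orth: "i < m \<Longrightarrow> j < m \<Longrightarrow> S' i o\<^sub>L S j = (if i = j then P else 0)"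
    and complete: "(\<Sum>i<m. S i o\<^sub>L S' i) = P"
    and norm_P: "norm P \<le> 1"
begin

lemma P_le: "norm (blinfun_apply P x) \<le> norm x"
  using norm_blinfun[of P x] mult_right_mono[OF norm_P, of "norm x"] by simp

lemma Re_P_le: "Re (cinner x (blinfun_apply P x)) \<le> (norm x)\<^sup>2"
proof -
  have "Re (cinner x (blinfun_apply P x)) \<le> norm x * norm (blinfun_apply P x)"
    using complex_Re_le_cmod cauchy_schwarz order_trans by blast
  also have "\<dots> \<le> norm x * norm x" by (intro mult_left_mono P_le) simp
  finally show ?thesis by (simp add: power2_eq_square)
qed

text \<open>The row of the \<open>S j\<close> is contractive on the direct sum: cross terms vanish
  by \<open>orth\<close>, and each diagonal term is the quadratic form of the contraction
  \<open>P\<close>.\<close>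

lemma norm_row_le: "norm (\<Sum>j<m. blinfun_apply (S j) (x j)) \<le> L2_set (\<lambda>j. norm (x j)) {..<m}"
proof -
  have *: "cinner (blinfun_apply (S j) (x j)) (blinfun_apply (S k) (x k))
      = (if j = k then cinner (x j) (blinfun_apply P (x j)) else 0)" if "j < m" "k < m" for j k
    using adjoint_pairD[OF adj[OF that(1)], of "x j" "blinfun_apply (S k) (x k)"]
      arg_cong[OF orth[OF that], of "\<lambda>T. blinfun_apply T (x k)"] by auto
  have "(norm (\<Sum>j<m. blinfun_apply (S j) (x j)))\<^sup>2
      = (\<Sum>j<m. \<Sum>k<m. Re (cinner (blinfun_apply (S j) (x j)) (blinfun_apply (S k) (x k))))"
    by (subst sum.swap) (simp add: norm_sq_cinner cinner_sum_left cinner_sum_right)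
  also have "\<dots> = (\<Sum>j<m. \<Sum>k<m. if j = k then Re (cinner (x j) (blinfun_apply P (x j))) else 0)"
    by (intro sum.cong refl) (simp add: *)
  also have "\<dots> = (\<Sum>j<m. Re (cinner (x j) (blinfun_apply P (x j))))" by simp
  also have "\<dots> \<le> (\<Sum>j<m. (norm (x j))\<^sup>2)" by (intro sum_mono Re_P_le)
  finally show ?thesis unfolding L2_set_def by (intro real_le_rsqrt)
qed

text \<open>The squared norm of the column of the \<open>S' i\<close> is the quadratic form of the
  sum of the \<open>S i S' i\<close>, which is \<open>P\<close> by \<open>complete\<close>.\<close>

lemma norm_column_le: "L2_set (\<lambda>i. norm (blinfun_apply (S' i) y)) {..<m} \<le> norm y"
proof -
  have "(\<Sum>i<m. (norm (blinfun_apply (S' i) y))\<^sup>2)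
      = (\<Sum>i<m. Re (cinner (blinfun_apply (S i) (blinfun_apply (S' i) y)) y))"
    by (intro sum.cong refl) (simp add: norm_sq_cinner adjoint_pairD[OF adj])
  also have "\<dots> = Re (cinner (blinfun_apply P y) y)"
    unfolding complete[symmetric] by (simp add: blinfun.sum_left cinner_sum_left)
  also have "\<dots> = Re (cinner y (blinfun_apply P y))" by (subst cinner_commute) simp
  also have "\<dots> \<le> (norm y)\<^sup>2" by (rule Re_P_le)
  finally show ?thesis unfolding L2_set_def by (simp add: real_le_lsqrt sum_nonneg)
qed

text \<open>The matrix factors as the column of the \<open>S' i\<close> times \<open>B\<close> times
  the row of the \<open>S j\<close>.\<close>

lemma mat_norm_compress: "mat_norm m (\<lambda>i j. S' i o\<^sub>L B o\<^sub>L S j) \<le> norm B"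
proof (subst mat_norm_le_iff, safe)
  fix x :: "nat \<Rightarrow> 'a"
  let ?\<xi> = "\<Sum>j<m. blinfun_apply (S j) (x j)"
  have "L2_set (\<lambda>i. norm (\<Sum>j<m. blinfun_apply (S' i o\<^sub>L B o\<^sub>L S j) (x j))) {..<m}
      = L2_set (\<lambda>i. norm (blinfun_apply (S' i) (blinfun_apply B ?\<xi>))) {..<m}"
    by (simp add: blinfun.sum_right)
  also have "\<dots> \<le> norm (blinfun_apply B ?\<xi>)" by (rule norm_column_le)
  also have "\<dots> \<le> norm B * norm ?\<xi>" by (rule norm_blinfun)
  also have "\<dots> \<le> norm B * L2_set (\<lambda>j. norm (x j)) {..<m}"
    by (intro mult_left_mono norm_row_le) simp
  finally show "L2_set (\<lambda>i. norm (\<Sum>j<m. blinfun_apply (S' i o\<^sub>L B o\<^sub>L S j) (x j))) {..<m}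
    \<le> norm B * L2_set (\<lambda>j. norm (x j)) {..<m}" .
qed simp

text \<open>The operator factors as row times \<open>b\<close> times column. Together with
  \<open>mat_norm_compress\<close> and \<open>compress_amalgamate\<close> this makes the norm of a
  matrix equal to that of its amalgamation when \<open>P\<close> is the identity.\<close>

lemma norm_amalgamate: "norm (\<Sum>i<m. \<Sum>j<m. S i o\<^sub>L b i j o\<^sub>L S' j) \<le> mat_norm m b"
proof (rule norm_blinfun_bound)
  fix x
  let ?\<eta> = "\<lambda>j. blinfun_apply (S' j) x"
  let ?\<zeta> = "\<lambda>i. \<Sum>j<m. blinfun_apply (b i j) (?\<eta> j)"
  have "blinfun_apply (\<Sum>i<m. \<Sum>j<m. S i o\<^sub>L b i j o\<^sub>L S' j) x = (\<Sum>i<m. blinfun_apply (S i) (?\<zeta> i))"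
    by (simp add: blinfun.sum_left blinfun.sum_right)
  then have "norm (blinfun_apply (\<Sum>i<m. \<Sum>j<m. S i o\<^sub>L b i j o\<^sub>L S' j) x) \<le> L2_set (\<lambda>i. norm (?\<zeta> i)) {..<m}"
    using norm_row_le[of ?\<zeta>] by simp
  also have "\<dots> \<le> mat_norm m b * L2_set (\<lambda>j. norm (?\<eta> j)) {..<m}" by (rule mat_norm_apply)
  also have "\<dots> \<le> mat_norm m b * norm x" by (intro mult_left_mono norm_column_le mat_norm_nonneg)
  finally show "norm (blinfun_apply (\<Sum>i<m. \<Sum>j<m. S i o\<^sub>L b i j o\<^sub>L S' j) x) \<le> mat_norm m b * norm x" .
qed (rule mat_norm_nonneg)

lemma compress_amalgamate:
  assumes "P = id_blinfun" "k < m" "l < m"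
  shows "S' k o\<^sub>L (\<Sum>i<m. \<Sum>j<m. S i o\<^sub>L b i j o\<^sub>L S' j) o\<^sub>L S l = b k l"
proof (rule blinfun_eqI)
  fix x
  have *: "blinfun_apply (S' i) (blinfun_apply (S j) y) = (if i = j then y else 0)" if "i < m" "j < m" for i j y
    using arg_cong[OF orth[OF that], of "\<lambda>T. blinfun_apply T y"] assms(1) by auto
  have "blinfun_apply (S' k o\<^sub>L (\<Sum>i<m. \<Sum>j<m. S i o\<^sub>L b i j o\<^sub>L S' j) o\<^sub>L S l) x
      = (\<Sum>i<m. \<Sum>j<m. blinfun_apply (S' k) (blinfun_apply (S i)
          (blinfun_apply (b i j) (blinfun_apply (S' j) (blinfun_apply (S l) x)))))"
    by (simp add: blinfun.sum_left blinfun.sum_right)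
  also have "\<dots> = (\<Sum>i<m. if k = i then \<Sum>j<m. if j = l then blinfun_apply (b i j) x else 0 else 0)"

  proof (rule sum.cong[OF refl])
    fix i assume "i \<in> {..<m}"
    then have "(\<Sum>j<m. blinfun_apply (S' k) (blinfun_apply (S i) (blinfun_apply (b i j) (blinfun_apply (S' j) (blinfun_apply (S l) x)))))
        = (\<Sum>j<m. if k = i then (if j = l then blinfun_apply (b i j) x else 0) else 0)"
      using assms(2,3) by (intro sum.cong refl) (auto simp: *)
    then show "(\<Sum>j<m. blinfun_apply (S' k) (blinfun_apply (S i) (blinfun_apply (b i j) (blinfun_apply (S' j) (blinfun_apply (S l) x)))))
        = (if k = i then \<Sum>j<m. if j = l then blinfun_apply (b i j) x else 0 else 0)" by simp
  qed
  also have "\<dots> = blinfun_apply (b k l) x"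
    by (simp only: sum.delta sum.delta' finite_lessThan lessThan_iff assms(2,3) if_True)
  finally show "blinfun_apply (S' k o\<^sub>L (\<Sum>i<m. \<Sum>j<m. S i o\<^sub>L b i j o\<^sub>L S' j) o\<^sub>L S l) x = blinfun_apply (b k l) x" .
qed

end

text \<open>The isometry sending the unit vector \<open>j\<close> to the unit vector
  \<open>j * m + k\<close>: the residue classes modulo \<open>m\<close> split the index set into
  \<open>m\<close> copies of itself. \<open>cuntz_coiso\<close> is its adjoint.\<close>

definition cuntz_iso :: "nat \<Rightarrow> nat \<Rightarrow> (nat ell2 \<Rightarrow>\<^sub>L nat ell2)" where
  "cuntz_iso m k = partial_shift (\<lambda>r. if r mod m = k then Some (r div m) else None)"

definition cuntz_coiso :: "nat \<Rightarrow> nat \<Rightarrow> (nat ell2 \<Rightarrow>\<^sub>L nat ell2)" where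
  "cuntz_coiso m k = partial_shift (\<lambda>j. Some (j * m + k))"

lemma partial_inj_cuntz:
  fixes m k :: nat
  assumes "0 < m"
  shows "partial_inj (\<lambda>r. if r mod m = k then Some (r div m) else None)" "partial_inj (\<lambda>j. Some (j * m + k))"
proof -
  show "partial_inj (\<lambda>r. if r mod m = k then Some (r div m) else None)"
    unfolding partial_inj_def
  proof (intro allI impI)
    fix r r' j assume "(if r mod m = k then Some (r div m) else None) = Some j"
      "(if r' mod m = k then Some (r' div m) else None) = Some j"
    then have "r mod m = r' mod m" "r div m = r' div m" by (auto split: if_splits)
    then show "r = r'" by (metis div_mult_mod_eq)
  qed
qed (use assms in \<open>auto simp: partial_inj_def\<close>)

lemma cuntz_bounded:
  "0 < m \<Longrightarrow> cuntz_iso m k \<in> bounded_ops" "0 < m \<Longrightarrow> cuntz_coiso m k \<in> bounded_ops"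
  unfolding cuntz_iso_def cuntz_coiso_def by (intro partial_shift_bounded partial_inj_cuntz; simp)+

lemma coord_cuntz:
  assumes "0 < m"
  shows "coord (blinfun_apply (cuntz_iso m k) x) r = (if r mod m = k then coord x (r div m) else 0)"
    "coord (blinfun_apply (cuntz_coiso m k) x) j = coord x (j * m + k)"
  using assms by (auto simp: cuntz_iso_def cuntz_coiso_def coord_partial_shift partial_inj_cuntz)

lemma cuntz_family_cuntz:
  assumes m: "0 < m"
  shows "cuntz_family (cuntz_iso m) (cuntz_coiso m) id_blinfun m"
proof
  fix i j assume i: "i < m" and j: "j < m"
  show "cuntz_coiso m i o\<^sub>L cuntz_iso m j = (if i = j then id_blinfun else 0)"
    by (intro blinfun_eqI ell2_eqI) (use i j in \<open>auto simp: coord_cuntz[OF m] zero_ell2.rep_eq\<close>)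
next
  fix i assume i: "i < m"
  have "(if r mod m = i then Some (r div m) else None) = Some j \<longleftrightarrow> Some (j * m + i) = Some r" for r j
  proof -
    have "(j * m + i) div m = j" "(j * m + i) mod m = i" using i by simp_all
    then show ?thesis using div_mult_mod_eq[of r m] by auto
  qed
  then show "adjoint_pair (cuntz_iso m i) (cuntz_coiso m i)"
    unfolding cuntz_iso_def cuntz_coiso_def by (intro adjoint_partial_shift partial_inj_cuntz[OF m])
next
  show "(\<Sum>i<m. cuntz_iso m i o\<^sub>L cuntz_coiso m i) = id_blinfun"
    using m by (intro blinfun_eqI ell2_eqI)
      (simp add: blinfun.sum_left coord_sum coord_cuntz[OF m] if_distrib[of "coord _"] cong: if_cong)
  show "norm (id_blinfun :: nat ell2 \<Rightarrow>\<^sub>L nat ell2) \<le> 1"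
    by (intro norm_blinfun_bound) auto
qed

section \<open>Quotient norms of cosets\<close>

lemma norm_quotient:
  fixes W :: "'a::complex_normed_vector set"
  assumes W: "csubspace W"
  shows "quotient_norm (coset W a) \<le> norm a"
    and "0 < e \<Longrightarrow> \<exists>w\<in>W. norm (a + w) < quotient_norm (coset W a) + e"
    and "(\<And>w. w \<in> W \<Longrightarrow> C \<le> norm (a + w)) \<Longrightarrow> C \<le> quotient_norm (coset W a)"
    and "w \<in> W \<Longrightarrow> quotient_norm (coset W a) \<le> norm (a + w)"
proof -
  have bdd: "bdd_below (norm ` coset W a)" by (intro bdd_belowI2[where m=0]) simp
  have 0: "0 \<in> W" using W by (rule csubspaceD)
  show 1: "w \<in> W \<Longrightarrow> quotient_norm (coset W a) \<le> norm (a + w)" for w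
    unfolding quotient_norm_def by (rule cINF_lower[OF bdd]) (simp add: coset_def)
  show "quotient_norm (coset W a) \<le> norm a" using 1[OF 0] by simp
  show "\<exists>w\<in>W. norm (a + w) < quotient_norm (coset W a) + e" if "0 < e"
  proof -
    have "\<exists>x\<in>coset W a. norm x < quotient_norm (coset W a) + e"
      using cINF_less_iff[OF _ bdd, of "quotient_norm (coset W a) + e"] 0 that
      by (auto simp: quotient_norm_def coset_def)
    then show ?thesis by (auto simp: coset_def)
  qed
  show "C \<le> quotient_norm (coset W a)" if "\<And>w. w \<in> W \<Longrightarrow> C \<le> norm (a + w)"
    unfolding quotient_norm_def by (rule cINF_greatest) (use 0 that in \<open>auto simp: coset_def\<close>)
qed

section \<open>The quotient map onto the Calkin algebra and its amplifications\<close>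

locale calkin =
  fixes \<pi> :: "(nat ell2 \<Rightarrow>\<^sub>L nat ell2) set \<Rightarrow> ('k::complex_hilbert \<Rightarrow>\<^sub>L 'k)"
  assumes rep: "calkin_representation \<pi>"
begin

text \<open>The quotient map followed by the representation. Stating everything for \<open>q\<close>
  keeps cosets out of the arguments.\<close>

definition q :: "(nat ell2 \<Rightarrow>\<^sub>L nat ell2) \<Rightarrow> ('k \<Rightarrow>\<^sub>L 'k)" where
  "q a = \<pi> (calkin_class a)"

lemma q_bounded [simp]: "a \<in> bounded_ops \<Longrightarrow> q a \<in> bounded_ops"
  and norm_q: "a \<in> bounded_ops \<Longrightarrow> norm (q a) = quotient_norm (calkin_class a)"
  and q_add: "a \<in> bounded_ops \<Longrightarrow> b \<in> bounded_ops \<Longrightarrow> q (a + b) = q a + q b"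
  and q_mult: "a \<in> bounded_ops \<Longrightarrow> b \<in> bounded_ops \<Longrightarrow> q (a o\<^sub>L b) = q a o\<^sub>L q b"
  and q_adjoint: "a \<in> bounded_ops \<Longrightarrow> b \<in> bounded_ops \<Longrightarrow> adjoint_pair a b \<Longrightarrow> adjoint_pair (q a) (q b)"
  and q_scaleC: "a \<in> bounded_ops \<Longrightarrow> q (c *\<^sub>C a) = c *\<^sub>C q a"
  using rep by (auto simp: calkin_representation_def q_def)

lemma q_zero [simp]: "q 0 = 0"
  using q_scaleC[of 0 0] by simp

lemma q_sum: "(\<And>i. i \<in> F \<Longrightarrow> f i \<in> bounded_ops) \<Longrightarrow> q (\<Sum>i\<in>F. f i) = (\<Sum>i\<in>F. q (f i))"
  by (induction F rule: infinite_finite_induct) (auto simp: q_add)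

lemma norm_q_le: "a \<in> bounded_ops \<Longrightarrow> norm (q a) \<le> norm a"
  using norm_quotient(1)[OF csubspace_compact_ops] by (simp add: norm_q)

lemma q_compact: "k \<in> compact_ops \<Longrightarrow> q k = 0"
proof -
  assume k: "k \<in> compact_ops"
  have "norm (q k) \<le> 0"
    using norm_quotient(4)[OF csubspace_compact_ops compact_ops_arith(4)[OF k], of k] norm_q[of k]
    by (simp add: compact_ops_bounded[OF k])
  then show "q k = 0" by simp
qed

lemma q_lift: "a \<in> bounded_ops \<Longrightarrow> 0 < e \<Longrightarrow> \<exists>k\<in>compact_ops. norm (a + k) < norm (q a) + e"
  using norm_quotient(2)[OF csubspace_compact_ops] by (simp add: norm_q)

lemma cuntz_family_q:
  assumes m: "0 < m"
  shows "cuntz_family (\<lambda>i. q (cuntz_iso m i)) (\<lambda>i. q (cuntz_coiso m i)) (q id_blinfun) m"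
proof -
  interpret C: cuntz_family "cuntz_iso m" "cuntz_coiso m" id_blinfun m by (rule cuntz_family_cuntz[OF m])
  note b = cuntz_bounded[OF m]
  show ?thesis
  proof
    fix i j assume "i < m" "j < m"
    then show "q (cuntz_coiso m i) o\<^sub>L q (cuntz_iso m j) = (if i = j then q id_blinfun else 0)"
      using C.orth[of i j] by (simp add: b flip: q_mult)
  next
    show "adjoint_pair (q (cuntz_iso m i)) (q (cuntz_coiso m i))" if "i < m" for i
      by (intro q_adjoint b C.adj that)
    show "(\<Sum>i<m. q (cuntz_iso m i) o\<^sub>L q (cuntz_coiso m i)) = q id_blinfun"
      using C.complete q_sum[of "{..<m}" "\<lambda>i. cuntz_iso m i o\<^sub>L cuntz_coiso m i"] by (simp add: b flip: q_mult)
    show "norm (q id_blinfun) \<le> 1"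
      using norm_q_le[OF id_bounded_ops] C.norm_P by linarith
  qed
qed

text \<open>Amalgamating the matrix into a single operator reduces statements about the amplifications
  of \<open>\<pi>\<close> to \<open>\<pi>\<close> itself; this replaces the general theory of \<open>*\<close>-homomorphisms.\<close>

lemma mat_norm_q_le:
  assumes b: "\<And>i j. i < m \<Longrightarrow> j < m \<Longrightarrow> b i j \<in> bounded_ops"
  shows "mat_norm m (\<lambda>i j. q (b i j)) \<le> mat_norm m b"
proof (cases "m = 0")
  case False
  then have m: "0 < m" by simp
  interpret C: cuntz_family "cuntz_iso m" "cuntz_coiso m" id_blinfun m by (rule cuntz_family_cuntz[OF m])
  interpret Q: cuntz_family "\<lambda>i. q (cuntz_iso m i)" "\<lambda>i. q (cuntz_coiso m i)" "q id_blinfun" m by (rule cuntz_family_q[OF m])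
  note cb = cuntz_bounded[OF m]
  let ?B = "\<Sum>i<m. \<Sum>j<m. cuntz_iso m i o\<^sub>L b i j o\<^sub>L cuntz_coiso m j"
  have B: "?B \<in> bounded_ops" by (intro bounded_ops_sum comp_bounded_ops cb b) auto
  have "mat_norm m (\<lambda>i j. q (b i j)) = mat_norm m (\<lambda>i j. q (cuntz_coiso m i) o\<^sub>L q ?B o\<^sub>L q (cuntz_iso m j))"
  proof (rule mat_norm_cong)
    fix k l assume kl: "k < m" "l < m"
    have "q (b k l) = q (cuntz_coiso m k o\<^sub>L ?B o\<^sub>L cuntz_iso m l)"
      by (subst C.compress_amalgamate[OF refl kl]) simp
    then show "q (b k l) = q (cuntz_coiso m k) o\<^sub>L q ?B o\<^sub>L q (cuntz_iso m l)"
      using B cb by (simp add: q_mult del: bounded_ops_sum)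
  qed
  also have "\<dots> \<le> norm (q ?B)" by (rule Q.mat_norm_compress)
  also have "\<dots> \<le> norm ?B" by (rule norm_q_le[OF B])
  also have "\<dots> \<le> mat_norm m b" by (rule C.norm_amalgamate)
  finally show ?thesis .
qed (simp add: mat_norm_zero)

text \<open>Amalgamation leaves a single operator, whose distance to the compact operators is
  attained up to \<open>e\<close> by some \<open>K\<close>; compression distributes \<open>K\<close>
  over compact entries. The Cuntz relations hold in \<open>B\<close> and for the images under
  \<open>q\<close>, so neither passage increases norms.\<close>

lemma mat_norm_q_lift:
  assumes b: "\<And>i j. i < m \<Longrightarrow> j < m \<Longrightarrow> b i j \<in> bounded_ops" and e: "0 < e"
  obtains k where "\<And>i j. i < m \<Longrightarrow> j < m \<Longrightarrow> k i j \<in> compact_ops"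
    "mat_norm m (\<lambda>i j. b i j + k i j) \<le> mat_norm m (\<lambda>i j. q (b i j)) + e"
proof (cases "m = 0")
  case True
  then show thesis using e by (intro that[of "\<lambda>_ _. 0"]) (auto simp: mat_norm_zero)
next
  case False
  then have m: "0 < m" by simp
  interpret C: cuntz_family "cuntz_iso m" "cuntz_coiso m" id_blinfun m by (rule cuntz_family_cuntz[OF m])
  interpret Q: cuntz_family "\<lambda>i. q (cuntz_iso m i)" "\<lambda>i. q (cuntz_coiso m i)" "q id_blinfun" m by (rule cuntz_family_q[OF m])
  note cb = cuntz_bounded[OF m]
  let ?B = "\<Sum>i<m. \<Sum>j<m. cuntz_iso m i o\<^sub>L b i j o\<^sub>L cuntz_coiso m j"
  have B: "?B \<in> bounded_ops" by (intro bounded_ops_sum comp_bounded_ops cb b) auto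
  have "q ?B = (\<Sum>i<m. \<Sum>j<m. q (cuntz_iso m i) o\<^sub>L q (b i j) o\<^sub>L q (cuntz_coiso m j))"
    using cb b by (subst q_sum, force, intro sum.cong refl, subst q_sum, force) (simp add: q_mult)
  then have 1: "norm (q ?B) \<le> mat_norm m (\<lambda>i j. q (b i j))"
    using Q.norm_amalgamate[of "\<lambda>i j. q (b i j)"] by simp
  obtain K where K: "K \<in> compact_ops" "norm (?B + K) < norm (q ?B) + e"
    using q_lift[OF B e] by blast
  show thesis
  proof (rule that[of "\<lambda>i j. cuntz_coiso m i o\<^sub>L K o\<^sub>L cuntz_iso m j"])
    show "cuntz_coiso m i o\<^sub>L K o\<^sub>L cuntz_iso m j \<in> compact_ops" for i j
      by (intro compact_ops_comp_left compact_ops_comp_right cb K)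
    have "mat_norm m (\<lambda>i j. b i j + (cuntz_coiso m i o\<^sub>L K o\<^sub>L cuntz_iso m j))
        = mat_norm m (\<lambda>i j. cuntz_coiso m i o\<^sub>L (?B + K) o\<^sub>L cuntz_iso m j)"
    proof (rule mat_norm_cong)
      fix k l assume kl: "k < m" "l < m"
      have "b k l + (cuntz_coiso m k o\<^sub>L K o\<^sub>L cuntz_iso m l)
          = (cuntz_coiso m k o\<^sub>L ?B o\<^sub>L cuntz_iso m l) + (cuntz_coiso m k o\<^sub>L K o\<^sub>L cuntz_iso m l)"
        by (subst C.compress_amalgamate[OF refl kl]) simp
      also have "\<dots> = cuntz_coiso m k o\<^sub>L (?B + K) o\<^sub>L cuntz_iso m l"
        by (intro blinfun_eqI) (simp add: blinfun.add_left blinfun.add_right)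
      finally show "b k l + (cuntz_coiso m k o\<^sub>L K o\<^sub>L cuntz_iso m l) = cuntz_coiso m k o\<^sub>L (?B + K) o\<^sub>L cuntz_iso m l" .
    qed
    also have "\<dots> \<le> norm (?B + K)" by (rule C.mat_norm_compress)
    finally show "mat_norm m (\<lambda>i j. b i j + (cuntz_coiso m i o\<^sub>L K o\<^sub>L cuntz_iso m j)) \<le> mat_norm m (\<lambda>i j. q (b i j)) + e"
      using K(2) 1 by linarith
  qed
qed

text \<open>Slicing along the right leg produces matrices over \<open>B\<close> and their images
  under \<open>q\<close>, to which \<open>mat_norm_q_le\<close> applies. This is the contractivity
  from which \<open>Q\<close> is built.\<close>

lemma norm_tensor_q_le:
  fixes x :: "'i \<Rightarrow> ('h::complex_hilbert \<Rightarrow>\<^sub>L 'h)"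
  assumes b: "\<And>i. i \<in> I \<Longrightarrow> b i \<in> bounded_ops" and x: "\<And>i. i \<in> I \<Longrightarrow> x i \<in> bounded_ops"
  shows "norm (\<Sum>i\<in>I. q (b i) \<otimes>\<^sub>o x i) \<le> norm (\<Sum>i\<in>I. b i \<otimes>\<^sub>o x i)"
proof (subst norm_tensor_sum_le_right[OF _ x orthonormal_basis_some_onb])
  show "\<forall>n g. inj_on g {..<n} \<longrightarrow> g ` {..<n} \<subseteq> (some_onb :: 'h set) \<longrightarrow>
      mat_norm n (\<lambda>r s. \<Sum>i\<in>I. cinner (g r) (blinfun_apply (x i) (g s)) *\<^sub>C q (b i)) \<le> norm (\<Sum>i\<in>I. b i \<otimes>\<^sub>o x i)"
  proof (intro allI impI)
    fix n and g :: "nat \<Rightarrow> 'h" assume g: "inj_on g {..<n}" "g ` {..<n} \<subseteq> some_onb"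
    let ?c = "\<lambda>r s. \<Sum>i\<in>I. cinner (g r) (blinfun_apply (x i) (g s)) *\<^sub>C b i"
    have "(\<Sum>i\<in>I. cinner (g r) (blinfun_apply (x i) (g s)) *\<^sub>C q (b i)) = q (?c r s)" for r s
      using b by (simp add: q_sum q_scaleC)
    then have "mat_norm n (\<lambda>r s. \<Sum>i\<in>I. cinner (g r) (blinfun_apply (x i) (g s)) *\<^sub>C q (b i)) = mat_norm n (\<lambda>r s. q (?c r s))"
      by simp
    also have "\<dots> \<le> mat_norm n ?c" by (rule mat_norm_q_le) (use b in auto)
    also have "\<dots> \<le> norm (\<Sum>i\<in>I. b i \<otimes>\<^sub>o x i)"
      using norm_tensor_sum_le_right[OF b x orthonormal_basis_some_onb norm_ge_zero, of I "\<lambda>i. i" "\<lambda>i. i"] g by auto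
    finally show "mat_norm n (\<lambda>r s. \<Sum>i\<in>I. cinner (g r) (blinfun_apply (x i) (g s)) *\<^sub>C q (b i)) \<le> norm (\<Sum>i\<in>I. b i \<otimes>\<^sub>o x i)" .
  qed
qed (use b in auto)

end

section \<open>Completely bounded maps\<close>

text \<open>Linearity turns the supremum over the unit ball into a homogeneous estimate. The matrix
  is divided by some positive \<open>r\<close> not smaller than its norm, since the norm itself may
  vanish.\<close>

lemma cb_norm_leD:
  assumes cb: "cb_norm E u \<le> ennreal U" and U: "0 \<le> U" and n: "0 < n"
    and a: "\<And>i j. i < n \<Longrightarrow> j < n \<Longrightarrow> a i j \<in> E"
    and E: "csubspace E" and u: "clinear_on E u"
  shows "mat_norm n (\<lambda>i j. u (a i j)) \<le> U * mat_norm n a"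
proof -
  have scale: "mat_norm n (\<lambda>i j. c *\<^sub>C b i j) \<le> cmod c * mat_norm n b" for c b and n :: nat
  proof (subst mat_norm_le_iff, safe)
    fix x
    have "L2_set (\<lambda>i. norm (\<Sum>j<n. blinfun_apply (c *\<^sub>C b i j) (x j))) {..<n}
      = cmod c * L2_set (\<lambda>i. norm (\<Sum>j<n. blinfun_apply (b i j) (x j))) {..<n}"
      by (simp add: scaleC_blinfun.rep_eq norm_scaleC L2_set_right_distrib flip: scaleC_sum_right)
    also have "\<dots> \<le> cmod c * (mat_norm n b * L2_set (\<lambda>j. norm (x j)) {..<n})"
      by (intro mult_left_mono mat_norm_apply) simp
    finally show "L2_set (\<lambda>i. norm (\<Sum>j<n. blinfun_apply (c *\<^sub>C b i j) (x j))) {..<n}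
      \<le> cmod c * mat_norm n b * L2_set (\<lambda>j. norm (x j)) {..<n}" by (simp add: mult.assoc)
  qed (simp add: mat_norm_nonneg)
  have unit: "mat_norm n (\<lambda>i j. u (b i j)) \<le> U"
    if b: "\<And>i j. i < n \<Longrightarrow> j < n \<Longrightarrow> b i j \<in> E" and le: "mat_norm n b \<le> 1" for b
  proof -
    have "ennreal (mat_norm n (\<lambda>i j. u (b i j))) \<le> cb_norm E u"
      unfolding cb_norm_def using n b le by (intro SUP_upper2[of n] SUP_upper) auto
    then show ?thesis using cb ennreal_le_iff[OF U] order_trans by blast
  qed
  have le: "mat_norm n (\<lambda>i j. u (a i j)) \<le> U * r" if r: "0 < r" "mat_norm n a \<le> r" for r
  proof -
    have "mat_norm n (\<lambda>i j. complex_of_real (inverse r) *\<^sub>C a i j) \<le> cmod (complex_of_real (inverse r)) * mat_norm n a"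
      by (rule scale)
    also have "\<dots> = inverse r * mat_norm n a" using r by (simp add: norm_inverse)
    also have "\<dots> \<le> 1" using r by (simp add: field_simps)
    finally have 1: "mat_norm n (\<lambda>i j. u (complex_of_real (inverse r) *\<^sub>C a i j)) \<le> U"
      using a by (intro unit csubspaceD(3)[OF E]) auto
    have "mat_norm n (\<lambda>i j. u (a i j)) = mat_norm n (\<lambda>i j. complex_of_real r *\<^sub>C u (complex_of_real (inverse r) *\<^sub>C a i j))"
      using r a by (intro mat_norm_cong) (simp add: clinear_onD[OF u E] scaleC_scaleC)
    also have "\<dots> \<le> r * mat_norm n (\<lambda>i j. u (complex_of_real (inverse r) *\<^sub>C a i j))"
      using scale[of n "complex_of_real r"] r by simp
    also have "\<dots> \<le> r * U" using 1 r by (intro mult_left_mono) auto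
    finally show ?thesis by (simp add: mult.commute)
  qed
  show ?thesis
  proof (rule field_le_epsilon)
    fix e :: real assume e: "0 < e"
    \<comment> \<open>The denominator \<open>U + 1\<close> is positive also for \<open>U = 0\<close>
      and makes \<open>U * d \<le> e\<close>.\<close>
    define d where "d = e / (U + 1)"
    have d: "d > 0" using e U by (simp add: d_def)
    have "mat_norm n (\<lambda>i j. u (a i j)) \<le> U * (mat_norm n a + d)"
      using d mat_norm_nonneg[of n a] by (intro le) auto
    also have "U * d \<le> e" using e U by (simp add: d_def field_simps)
    then have "U * (mat_norm n a + d) \<le> U * mat_norm n a + e" by (simp add: distrib_left)
    finally show "mat_norm n (\<lambda>i j. u (a i j)) \<le> U * mat_norm n a + e" .
  qed
qed

lemma cb_norm_le_ennreal:
  assumes U: "0 \<le> U"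
    and le: "\<And>n a. 0 < n \<Longrightarrow> (\<And>i j. i < n \<Longrightarrow> j < n \<Longrightarrow> a i j \<in> E) \<Longrightarrow> mat_norm n a \<le> 1 \<Longrightarrow> mat_norm n (\<lambda>i j. u (a i j)) \<le> U"
  shows "cb_norm E u \<le> ennreal U"
  unfolding cb_norm_def by (intro SUP_least) (use le U in \<open>auto simp: ennreal_le_iff\<close>)

text \<open>A slice along the left leg turns \<open>id \<otimes> u\<close> into an amplification of
  \<open>u\<close>, by linearity of \<open>u\<close>.\<close>

lemma norm_tensor_cb_le:
  fixes b :: "'i \<Rightarrow> ('k::complex_hilbert \<Rightarrow>\<^sub>L 'k)"
  assumes cb: "cb_norm E u \<le> ennreal U" and U: "0 \<le> U" and E: "csubspace E" "E \<subseteq> bounded_ops"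
    and u: "clinear_on E u" "\<And>x. x \<in> E \<Longrightarrow> u x \<in> bounded_ops"
    and b: "\<And>i. i \<in> I \<Longrightarrow> b i \<in> bounded_ops" and x: "\<And>i. i \<in> I \<Longrightarrow> x i \<in> E"
  shows "norm (\<Sum>i\<in>I. b i \<otimes>\<^sub>o u (x i)) \<le> U * norm (\<Sum>i\<in>I. b i \<otimes>\<^sub>o x i)"
proof (subst norm_tensor_sum_le_left[OF b _ orthonormal_basis_some_onb])
  show "\<forall>n p. inj_on p {..<n} \<longrightarrow> p ` {..<n} \<subseteq> (some_onb :: 'k set) \<longrightarrow>
      mat_norm n (\<lambda>r s. \<Sum>i\<in>I. cinner (p r) (blinfun_apply (b i) (p s)) *\<^sub>C u (x i)) \<le> U * norm (\<Sum>i\<in>I. b i \<otimes>\<^sub>o x i)"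
  proof (intro allI impI)
    fix n and p :: "nat \<Rightarrow> 'k" assume p: "inj_on p {..<n}" "p ` {..<n} \<subseteq> some_onb"
    let ?c = "\<lambda>r s. \<Sum>i\<in>I. cinner (p r) (blinfun_apply (b i) (p s)) *\<^sub>C x i"
    have xb: "x i \<in> bounded_ops" if "i \<in> I" for i using x E(2) that by blast
    show "mat_norm n (\<lambda>r s. \<Sum>i\<in>I. cinner (p r) (blinfun_apply (b i) (p s)) *\<^sub>C u (x i)) \<le> U * norm (\<Sum>i\<in>I. b i \<otimes>\<^sub>o x i)"
    \<comment> \<open>\<open>cb_norm\<close> ranges over sizes from 1 on, so the empty slice is
      treated apart.\<close>
    proof (cases "n = 0")
      case True
      then show ?thesis
        using mat_norm_le_sum[of 0 "\<lambda>r s. \<Sum>i\<in>I. cinner (p r) (blinfun_apply (b i) (p s)) *\<^sub>C u (x i)"] U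
        by (metis (no_types, lifting) mult_nonneg_nonneg norm_ge_zero lessThan_0 order_trans sum.empty)
    next
      case False
      have "mat_norm n (\<lambda>r s. \<Sum>i\<in>I. cinner (p r) (blinfun_apply (b i) (p s)) *\<^sub>C u (x i)) = mat_norm n (\<lambda>r s. u (?c r s))"
        by (simp add: clinear_on_sum_scaleC[OF u(1) E(1) x])
      also have "\<dots> \<le> U * mat_norm n ?c"
        using x False by (intro cb_norm_leD[OF cb U _ _ E(1) u(1)] csubspace_sum[OF E(1)] csubspaceD(3)[OF E(1)]) auto
      also have "\<dots> \<le> U * norm (\<Sum>i\<in>I. b i \<otimes>\<^sub>o x i)"
        using norm_tensor_sum_le_left[of I b x, OF b xb orthonormal_basis_some_onb norm_ge_zero] p U
        by (intro mult_left_mono) auto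
      finally show ?thesis .
    qed
  qed
qed (use u x U in auto)

section \<open>Finite-dimensional operator spaces\<close>

text \<open>The coefficients of an expansion with respect to a spanning family of a finite-dimensional
  operator space can be chosen among these functionals, which see only finitely many matrix entries.\<close>

definition entry_functionals :: "(('a::complex_hilbert \<Rightarrow>\<^sub>L 'a) \<Rightarrow> complex) set" where
  "entry_functionals = {f. \<exists>R \<gamma>. finite R \<and> R \<subseteq> some_onb \<times> some_onb \<and>
     (\<forall>e. f e = (\<Sum>r\<in>R. \<gamma> r * cinner (fst r) (blinfun_apply e (snd r))))}"

lemma entry_functional_entry:
  "g \<in> some_onb \<Longrightarrow> h \<in> some_onb \<Longrightarrow> (\<lambda>e. cinner g (blinfun_apply e h)) \<in> entry_functionals"
  unfolding entry_functionals_def by (intro CollectI exI[of _ "{(g, h)}"] exI[of _ "\<lambda>_. 1"]) auto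

lemma entry_functional_comb:
  assumes "f \<in> entry_functionals" "f' \<in> entry_functionals"
  shows "(\<lambda>e. f e + d * f' e) \<in> entry_functionals"
proof -
  obtain R \<gamma> where R: "finite R" "R \<subseteq> some_onb \<times> some_onb"
    "\<And>e. f e = (\<Sum>r\<in>R. \<gamma> r * cinner (fst r) (blinfun_apply e (snd r)))"
    using assms(1) unfolding entry_functionals_def by blast
  obtain R' \<gamma>' where R': "finite R'" "R' \<subseteq> some_onb \<times> some_onb"
    "\<And>e. f' e = (\<Sum>r\<in>R'. \<gamma>' r * cinner (fst r) (blinfun_apply e (snd r)))"
    using assms(2) unfolding entry_functionals_def by blast
  define \<delta> where "\<delta> = (\<lambda>r. (if r \<in> R then \<gamma> r else 0) + d * (if r \<in> R' then \<gamma>' r else 0))"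
  have ext: "(\<Sum>r\<in>A. \<gamma> r * k r) = (\<Sum>r\<in>R \<union> R'. (if r \<in> A then \<gamma> r else 0) * k r)"
    if "A \<subseteq> R \<union> R'" for A \<gamma> and k :: "'a \<times> 'a \<Rightarrow> complex"
    using that R(1) R'(1) by (intro sum.mono_neutral_cong_left) auto
  have "f e + d * f' e = (\<Sum>r\<in>R \<union> R'. \<delta> r * cinner (fst r) (blinfun_apply e (snd r)))" for e
  proof -
    have "f e + d * f' e = (\<Sum>r\<in>R \<union> R'. (if r \<in> R then \<gamma> r else 0) * cinner (fst r) (blinfun_apply e (snd r)))
       + d * (\<Sum>r\<in>R \<union> R'. (if r \<in> R' then \<gamma>' r else 0) * cinner (fst r) (blinfun_apply e (snd r)))"
      unfolding R(3) R'(3) by (subst (1 2) ext) auto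
    then show ?thesis
      by (simp only: \<delta>_def distrib_right sum.distrib sum_distrib_left mult.assoc)
  qed
  then show ?thesis
    unfolding entry_functionals_def using R R' by (intro CollectI exI[of _ "R \<union> R'"] exI[of _ \<delta>]) auto
qed

lemma entry_functional_zero: "(\<lambda>_. 0) \<in> entry_functionals"
  unfolding entry_functionals_def by (intro CollectI exI[of _ "{}"]) auto

lemma entry_functional_scale: "f \<in> entry_functionals \<Longrightarrow> (\<lambda>e. d * f e) \<in> entry_functionals"
  using entry_functional_comb[OF entry_functional_zero, of f d] by simp

lemma entry_functional_sum:
  "(\<And>l. l < (d::nat) \<Longrightarrow> f l \<in> entry_functionals) \<Longrightarrow> (\<lambda>e. \<Sum>l<d. c l * f l e) \<in> entry_functionals"
  by (induction d) (auto simp: entry_functional_zero entry_functional_comb)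

lemma entry_functional_linear:
  assumes "f \<in> entry_functionals"
  shows "f (x + y) = f x + f y" "f (c *\<^sub>C x) = c * f x" "f 0 = 0"
proof -
  obtain R \<gamma> where R: "\<And>e. f e = (\<Sum>r\<in>R. \<gamma> r * cinner (fst r) (blinfun_apply e (snd r)))"
    using assms unfolding entry_functionals_def by blast
  show "f (x + y) = f x + f y" "f (c *\<^sub>C x) = c * f x" "f 0 = 0"
    unfolding R by (simp_all add: blinfun.add_left cinner_add_right distrib_left sum.distrib
        scaleC_blinfun.rep_eq cinner_scaleC_right sum_distrib_left mult_ac)
qed

lemma entry_functional_tendsto:
  assumes "f \<in> entry_functionals" "(z \<longlongrightarrow> w) F"
  shows "((\<lambda>n. f (z n)) \<longlongrightarrow> f w) F"
proof -
  obtain R \<gamma> where R: "\<And>e. f e = (\<Sum>r\<in>R. \<gamma> r * cinner (fst r) (blinfun_apply e (snd r)))"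
    using assms unfolding entry_functionals_def by blast
  show ?thesis unfolding R
    by (intro tendsto_intros tendsto_cinner_right assms(2))
qed

lemma nonzero_entry:
  fixes a :: "'a::complex_hilbert \<Rightarrow>\<^sub>L 'a"
  assumes "a \<in> bounded_ops" "a \<noteq> 0"
  shows "\<exists>g\<in>some_onb. \<exists>h\<in>some_onb. cinner g (blinfun_apply a h) \<noteq> 0"
proof (rule ccontr)
  assume *: "\<not> ?thesis"
  have "blinfun_apply a h = 0" if "h \<in> some_onb" for h
    by (rule eq_zero_onb[OF orthonormal_basis_some_onb]) (use * that in blast)
  then have "a = 0"
    by (intro bounded_ops_eqI[OF assms(1) bounded_ops_arith(1) closure_cspan_onb[OF orthonormal_basis_some_onb]]) simp
  then show False using assms(2) by blast
qed

lemma cspan_insert: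
  assumes "e \<in> cspan (insert s S)"
  obtains e0 c where "e0 \<in> cspan S" "e = e0 + c *\<^sub>C s"
proof -
  let ?V = "{e. \<exists>e0\<in>cspan S. \<exists>c. e = e0 + c *\<^sub>C s}"
  note sp = csubspaceD[OF csubspace_cspan[of S]]
  have "csubspace ?V"
    unfolding csubspace_def
  proof (intro conjI ballI allI)
    show "0 \<in> ?V" using sp(1) by (auto intro!: bexI[of _ 0] exI[of _ 0])
  next
    fix x y assume "x \<in> ?V" "y \<in> ?V"
    then obtain e0 c e1 d where *: "e0 \<in> cspan S" "x = e0 + c *\<^sub>C s" "e1 \<in> cspan S" "y = e1 + d *\<^sub>C s" by blast
    then have "x + y = (e0 + e1) + (c + d) *\<^sub>C s" by (simp add: scaleC_add_left algebra_simps)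
    then show "x + y \<in> ?V" using sp(2) * by blast
  next
    fix k x assume "x \<in> ?V"
    then obtain e0 c where *: "e0 \<in> cspan S" "x = e0 + c *\<^sub>C s" by blast
    then have "k *\<^sub>C x = k *\<^sub>C e0 + (k * c) *\<^sub>C s" by (simp add: scaleC_add_right scaleC_scaleC)
    then show "k *\<^sub>C x \<in> ?V" using sp(3) * by blast
  qed
  moreover have "insert s S \<subseteq> ?V"
  proof
    fix x assume "x \<in> insert s S"
    then consider "x = s" | "x \<in> S" by blast
    then show "x \<in> ?V"
    proof cases
      case 1 then show ?thesis using sp(1) by (auto intro!: bexI[of _ 0] exI[of _ 1])
    next
      case 2 then show ?thesis using cspan_superset[of S] by (auto intro!: bexI[of _ x] exI[of _ 0])
    qed
  qed
  ultimately show thesis using assms cspan_minimal[of "insert s S" ?V] that by blast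
qed

lemma cspan_mono: "S \<subseteq> T \<Longrightarrow> cspan S \<subseteq> cspan T"
  using cspan_superset[of T] by (intro cspan_minimal csubspace_cspan) auto

text \<open>Elimination: of each new generator only the remainder against the earlier expansion is
  kept. If it is nonzero, some matrix entry detects it, and this entry, corrected by the earlier
  coefficients and normalised, is the new functional.\<close>

lemma finite_dim_dual:
  fixes S :: "('a::complex_hilbert \<Rightarrow>\<^sub>L 'a) set"
  assumes "finite S" "S \<subseteq> bounded_ops"
  shows "\<exists>(d::nat) x f. (\<forall>l<d. x l \<in> cspan S \<and> f l \<in> entry_functionals) \<and>
    (\<forall>e\<in>cspan S. e = (\<Sum>l<d. f l e *\<^sub>C x l))"
  using assms
proof (induction S)
  case empty
  have "cspan {} \<subseteq> {0 :: 'a \<Rightarrow>\<^sub>L 'a}" by (intro cspan_minimal) (auto simp: csubspace_def)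
  then show ?case by (intro exI[of _ 0]) auto
next
  case (insert s S)
  from insert have "\<exists>(d::nat) x f. (\<forall>l<d. x l \<in> cspan S \<and> f l \<in> entry_functionals) \<and>
    (\<forall>e\<in>cspan S. e = (\<Sum>l<d. f l e *\<^sub>C x l))" by blast
  then obtain d :: nat and x f where
    IH0: "\<forall>l<d. x l \<in> cspan S \<and> f l \<in> entry_functionals" "\<forall>e\<in>cspan S. e = (\<Sum>l<d. f l e *\<^sub>C x l)"
    by blast
  have IH: "\<And>l. l < d \<Longrightarrow> x l \<in> cspan S" "\<And>l. l < d \<Longrightarrow> f l \<in> entry_functionals"
      "\<And>e. e \<in> cspan S \<Longrightarrow> e = (\<Sum>l<d. f l e *\<^sub>C x l)" using IH0 by blast+
  let ?p = "\<lambda>e. \<Sum>l<d. f l e *\<^sub>C x l"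
  have sp: "cspan S \<subseteq> cspan (insert s S)" by (rule cspan_mono) auto
  have p_in: "?p e \<in> cspan S" for e
    by (intro csubspace_sum[OF csubspace_cspan] csubspaceD(3)[OF csubspace_cspan] IH(1)) simp
  have p_comb: "?p (e0 + c *\<^sub>C e1) = ?p e0 + c *\<^sub>C ?p e1" for e0 e1 c
    by (simp add: entry_functional_linear[OF IH(2)] scaleC_add_left sum.distrib scaleC_sum_right scaleC_scaleC)
  define s' where "s' = s - ?p s"
  have sS: "cspan S \<subseteq> bounded_ops" using insert.prems by (intro cspan_minimal csubspace_bounded_ops) auto
  have rem: "\<exists>c. e - ?p e = c *\<^sub>C s'" if es: "e \<in> cspan (insert s S)" for e
  proof -
    obtain e0 c where e: "e0 \<in> cspan S" "e = e0 + c *\<^sub>C s" using cspan_insert[OF es] by blast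
    have "e - ?p e = e0 + c *\<^sub>C s - (e0 + c *\<^sub>C ?p s)"
      unfolding e(2) p_comb using IH(3)[OF e(1)] by simp
    then show ?thesis by (intro exI[of _ c]) (simp add: s'_def scaleC_diff_right)
  qed
  show ?case
  proof (cases "s' = 0")
    case True
    then have "e = ?p e" if "e \<in> cspan (insert s S)" for e using rem[OF that] by auto
    then show ?thesis using IH(1,2) sp by (intro exI[of _ d] exI[of _ x] exI[of _ f]) blast
  next
    case False
    have "s' \<in> bounded_ops" unfolding s'_def using insert.prems p_in[of s] sS by (intro bounded_ops_arith(5)) auto
    then obtain g h where gh: "g \<in> some_onb" "h \<in> some_onb" "cinner g (blinfun_apply s' h) \<noteq> 0"
      using nonzero_entry False by blast
    define \<phi> where "\<phi> = (\<lambda>e. cinner g (blinfun_apply e h))"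
    have \<phi>: "\<phi> \<in> entry_functionals" unfolding \<phi>_def by (rule entry_functional_entry[OF gh(1,2)])
    \<comment> \<open>\<open>F e\<close> is the chosen entry of \<open>e - ?p e\<close> divided by
      that of \<open>s'\<close>, written as a combination of entry functionals.\<close>
    define F where "F = (\<lambda>e. inverse (\<phi> s') * (\<phi> e + (- 1) * (\<Sum>l<d. \<phi> (x l) * f l e)))"
    have F: "F \<in> entry_functionals"
      unfolding F_def by (intro entry_functional_scale entry_functional_comb \<phi> entry_functional_sum IH(2))
    have "\<phi> (?p e) = (\<Sum>l<d. \<phi> (x l) * f l e)" for e
      by (simp add: \<phi>_def blinfun.sum_left cinner_sum_right scaleC_blinfun.rep_eq cinner_scaleC_right mult.commute)
    then have F_eq: "F e = inverse (\<phi> s') * \<phi> (e - ?p e)" for e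
      by (simp add: F_def \<phi>_def blinfun.diff_left cinner_diff_right)
    have "e = (\<Sum>l<Suc d. (f(d := F)) l e *\<^sub>C (x(d := s')) l)" if e: "e \<in> cspan (insert s S)" for e
    proof -
      obtain c where c: "e - ?p e = c *\<^sub>C s'" using rem[OF e] by blast
      have "F e = c" unfolding F_eq c using gh(3) by (simp add: \<phi>_def scaleC_blinfun.rep_eq cinner_scaleC_right)
      then have "e = ?p e + F e *\<^sub>C s'" using c by (simp add: algebra_simps)
      then show ?thesis by simp
    qed
    moreover have "s' \<in> cspan (insert s S)"
      unfolding s'_def using p_in[of s] sp cspan_superset[of "insert s S"]
      by (intro csubspaceD(5)[OF csubspace_cspan]) auto
    ultimately show ?thesis
      using IH(1,2) sp F by (intro exI[of _ "Suc d"] exI[of _ "x(d := s')"] exI[of _ "f(d := F)"]) (auto simp: less_Suc_eq)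
  qed
qed

text \<open>The expansion passes to limits because every coefficient functional is
  continuous.\<close>

lemma closed_finite_dim:
  fixes S :: "('a::complex_hilbert \<Rightarrow>\<^sub>L 'a) set"
  assumes "finite S" "S \<subseteq> bounded_ops"
  shows "closed (cspan S)"
  unfolding closed_sequential_limits
proof (intro allI impI, elim conjE)
  fix z w assume z: "\<forall>n. z n \<in> cspan S" "z \<longlonglongrightarrow> w"
  obtain d :: nat and x f where
    D0: "\<forall>l<d. x l \<in> cspan S \<and> f l \<in> entry_functionals" "\<forall>e\<in>cspan S. e = (\<Sum>l<d. f l e *\<^sub>C x l)"
    using finite_dim_dual[OF assms] by blast
  have D: "\<And>l. l < d \<Longrightarrow> x l \<in> cspan S" "\<And>l. l < d \<Longrightarrow> f l \<in> entry_functionals"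
      "\<And>e. e \<in> cspan S \<Longrightarrow> e = (\<Sum>l<d. f l e *\<^sub>C x l)" using D0 by blast+
  have bl: "bounded_linear (\<lambda>c. c *\<^sub>C y)" for y :: "'a \<Rightarrow>\<^sub>L 'a"
    by (rule bounded_linear_intro[where K="norm y"])
      (auto simp: scaleC_add_left norm_scaleC scaleR_scaleC scaleC_scaleC scaleR_conv_of_real)
  have "(\<lambda>n. \<Sum>l<d. f l (z n) *\<^sub>C x l) \<longlonglongrightarrow> (\<Sum>l<d. f l w *\<^sub>C x l)"
    by (intro tendsto_sum bounded_linear.tendsto[OF bl] entry_functional_tendsto D(2) z(2)) simp
  then have "z \<longlonglongrightarrow> (\<Sum>l<d. f l w *\<^sub>C x l)" using D(3) z(1) by simp
  then have "w = (\<Sum>l<d. f l w *\<^sub>C x l)" using z(2) LIMSEQ_unique by blast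
  also have "\<dots> \<in> cspan S"
    by (intro csubspace_sum[OF csubspace_cspan] csubspaceD(3)[OF csubspace_cspan] D(1)) simp
  finally show "w \<in> cspan S" .
qed

lemma operator_space_cspan:
  fixes S :: "('a::complex_hilbert \<Rightarrow>\<^sub>L 'a) set"
  assumes "finite S" "S \<subseteq> bounded_ops"
  shows "operator_space (cspan S)" "cfinite_dim (cspan S)"
  using closed_finite_dim[OF assms] cspan_minimal[OF assms(2) csubspace_bounded_ops] assms(1)
  by (auto simp: operator_space_def csubspace_cspan cfinite_dim_def)

section \<open>Finite sections of compact operators on \<open>\<ell>\<^sub>2\<close>\<close>

lemma bounded_linear_cinner_right: "bounded_linear (\<lambda>y. cinner x (y :: 'a::complex_hilbert))"
  by (rule bounded_linear_intro[where K="norm x"])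
    (auto simp: cinner_add_right scaleR_scaleC cinner_scaleC_right scaleR_conv_of_real mult.commute[of _ "norm x"] cauchy_schwarz)

text \<open>Riesz representation of one coordinate of \<open>f x\<close>, with the representing
  vector read off from the matrix of \<open>f\<close>.\<close>

lemma ex_row:
  assumes f: "f \<in> bounded_ops"
  shows "\<exists>r. \<forall>x. coord (blinfun_apply f x) i = cinner r (x :: 'j ell2)"
proof -
  let ?\<phi> = "\<lambda>j. coord (blinfun_apply f (unit_ell2 j)) i"
  have bd: "L2_set (\<lambda>j. cmod (cnj (?\<phi> j))) F \<le> norm f" if F: "finite F" for F
  proof -
    define s where "s = L2_set (\<lambda>j. cmod (cnj (?\<phi> j))) F"
    \<comment> \<open>Testing \<open>f\<close> on the conjugated finite row gives
      \<open>s * s \<le> norm f * s\<close>, hence the bound for \<open>s\<close>.\<close>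
    define x where "x = (\<Sum>j\<in>F. cnj (?\<phi> j) *\<^sub>C unit_ell2 j)"
    have "coord (blinfun_apply f x) i = (\<Sum>j\<in>F. cnj (?\<phi> j) * ?\<phi> j)"
      by (simp add: x_def bounded_ops_lincomb[OF f] coord_sum coord_scaleC)
    also have "\<dots> = complex_of_real (\<Sum>j\<in>F. (cmod (?\<phi> j))\<^sup>2)"
      unfolding of_real_sum by (intro sum.cong refl) (metis complex_norm_square mult.commute of_real_power)
    finally have c: "coord (blinfun_apply f x) i = complex_of_real (\<Sum>j\<in>F. (cmod (?\<phi> j))\<^sup>2)" .
    have "s\<^sup>2 = cmod (coord (blinfun_apply f x) i)"
      unfolding c norm_of_real by (simp add: s_def L2_set_def sum_nonneg)
    also have "\<dots> \<le> norm (blinfun_apply f x)" by (rule norm_coord_le)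
    also have "\<dots> \<le> norm f * norm x" by (rule norm_blinfun)
    also have "norm x = s" unfolding x_def s_def by (rule norm_lincomb_unit[OF F])
    finally have "s * s \<le> norm f * s" by (simp add: power2_eq_square)
    then show ?thesis
      using mult_right_le_imp_le[of s s "norm f"] L2_set_nonneg[of "\<lambda>j. cmod (cnj (?\<phi> j))" F]
      unfolding s_def[symmetric] by (cases "s = 0") auto
  qed
  define r where "r = Abs_ell2 (\<lambda>j. cnj (?\<phi> j))"
  have r: "coord r j = cnj (?\<phi> j)" for j unfolding r_def using Abs_ell2_bounded(1)[OF bd] by simp
  have "cinner (unit_ell2 i) (blinfun_apply f x) = cinner r x" for x
  proof -
    have "x \<in> closure (cspan (range unit_ell2))" by (simp add: closure_cspan_onb[OF orthonormal_basis_unit])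
    moreover have "closure (cspan (range unit_ell2)) \<subseteq> {x. cinner (unit_ell2 i) (blinfun_apply f x) - cinner r x = 0}"
    proof (rule closure_cspan_minimal)
      have "cinner r (unit_ell2 j) = coord (blinfun_apply f (unit_ell2 j)) i" for j
        by (subst cinner_commute) (simp add: cinner_unit r)
      then show "range unit_ell2 \<subseteq> {x. cinner (unit_ell2 i) (blinfun_apply f x) - cinner r x = 0}"
        by (auto simp: cinner_unit)
      show "csubspace {x. cinner (unit_ell2 i) (blinfun_apply f x) - cinner r x = 0}"
        using f by (auto simp: csubspace_def blinfun.add_right bounded_opsD cinner_add_right cinner_scaleC_right)
      show "closed {x. cinner (unit_ell2 i) (blinfun_apply f x) - cinner r x = 0}"
        by (intro closed_Collect_eq continuous_intros linear_continuous_on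
            bounded_linear_compose[OF bounded_linear_cinner_right blinfun.bounded_linear_right]
            bounded_linear_cinner_right)
    qed
    ultimately show ?thesis by auto
  qed
  then show ?thesis by (auto simp: cinner_unit)
qed

text \<open>Cutting off on the left is uniform by compactness, whereas the same argument on the
  right would call for a compact adjoint. Instead, all but finitely many rows of \<open>f\<close>
  are negligible, and each remaining row is a square summable vector, whose tails tend to 0.\<close>

lemma finite_sections_right:
  fixes f :: "nat ell2 \<Rightarrow>\<^sub>L nat ell2"
  assumes f: "f \<in> compact_ops" and e: "0 < e"
  shows "\<exists>m0. \<forall>m\<ge>m0. norm (f o\<^sub>L coord_proj (- {..<m})) < e"
proof -
  have fin: "finite {n. i \<in> - {..<n}}" for i :: nat
    by (rule finite_subset[of _ "{..i}"]) auto
  obtain N where N: "norm (coord_proj (- {..<N}) o\<^sub>L f) < e / 2"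
    using LIMSEQ_D[OF compact_coord_proj_left[OF f fin], of "e / 2"] e by auto
  have fb: "f \<in> bounded_ops" using f by (rule compact_ops_bounded)
  obtain r where r: "\<And>i x. coord (blinfun_apply f x) i = cinner (r i) x"
    using ex_row[OF fb] by metis
  have "(\<lambda>m. \<Sum>i<N. norm (blinfun_apply (coord_proj (- {..<m})) (r i))) \<longlonglongrightarrow> (\<Sum>i<N. norm (0 :: nat ell2))"
    by (intro tendsto_intros coord_proj_strong_null fin)
  then obtain m0 where m0: "\<And>m. m \<ge> m0 \<Longrightarrow> (\<Sum>i<N. norm (blinfun_apply (coord_proj (- {..<m})) (r i))) < e / 2"
    using LIMSEQ_D[of _ _ "e / 2"] e by fastforce
  have "norm (f o\<^sub>L coord_proj (- {..<m})) < e" if m: "m \<ge> m0" for m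
  proof -
    let ?P = "coord_proj (- {..<m})"
    \<comment> \<open>The rows from \<open>N\<close> on form the first term; each earlier row acts
      as a rank one operator, with the self-adjoint \<open>?P\<close> moved onto the row
      vector.\<close>
    have "f o\<^sub>L ?P = (coord_proj (- {..<N}) o\<^sub>L f o\<^sub>L ?P) + (\<Sum>i<N. rank_one (unit_ell2 i) (blinfun_apply ?P (r i)))"
    proof (intro blinfun_eqI ell2_eqI)
      fix x i
      have "cinner (r i) (blinfun_apply ?P x) = cinner (blinfun_apply ?P (r i)) x" for i
        using adjoint_coord_proj[of "- {..<m}"] by (simp add: adjoint_pair_def)
      then show "coord (blinfun_apply (f o\<^sub>L ?P) x) i = coord (blinfun_apply ((coord_proj (- {..<N}) o\<^sub>L f o\<^sub>L ?P)
          + (\<Sum>i<N. rank_one (unit_ell2 i) (blinfun_apply ?P (r i)))) x) i"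
        by (simp add: blinfun.add_left blinfun.sum_left coord_add coord_sum coord_coord_proj r rank_one_apply
            coord_scaleC coord_unit if_distrib[of "\<lambda>x. _ * x"] cong: if_cong)
    qed
    then have "norm (f o\<^sub>L ?P) \<le> norm (coord_proj (- {..<N}) o\<^sub>L f o\<^sub>L ?P)
        + norm (\<Sum>i<N. rank_one (unit_ell2 i :: nat ell2) (blinfun_apply ?P (r i)))"
      using norm_triangle_ineq by metis
    also have "norm (coord_proj (- {..<N}) o\<^sub>L f o\<^sub>L ?P) \<le> norm (coord_proj (- {..<N}) o\<^sub>L f) * 1"
      by (rule order_trans[OF norm_blinfun_compose]) (intro mult_left_mono norm_coord_proj norm_ge_zero)
    also have "norm (\<Sum>i<N. rank_one (unit_ell2 i :: nat ell2) (blinfun_apply ?P (r i)))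
        \<le> (\<Sum>i<N. norm (blinfun_apply ?P (r i)))"
    proof (rule order_trans[OF norm_sum sum_mono])
      fix i
      have "norm (unit_ell2 i :: nat ell2) = 1"
        using norm_lincomb_unit[of "{i}" "\<lambda>_. 1"] by simp
      then show "norm (rank_one (unit_ell2 i :: nat ell2) (blinfun_apply ?P (r i))) \<le> norm (blinfun_apply ?P (r i))"
        using norm_rank_one_le[of "unit_ell2 i :: nat ell2" "blinfun_apply ?P (r i)"] by simp
    qed
    finally show ?thesis using N m0[OF m] by linarith
  qed
  then show ?thesis by blast
qed

abbreviation section_op :: "nat \<Rightarrow> (nat ell2 \<Rightarrow>\<^sub>L nat ell2) \<Rightarrow> (nat ell2 \<Rightarrow>\<^sub>L nat ell2)" where
  "section_op m f \<equiv> (coord_proj {..<m} o\<^sub>L f o\<^sub>L coord_proj {..<m})"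

lemma finite_sections:
  assumes f: "f \<in> compact_ops" and e: "0 < e"
  shows "\<exists>m0. \<forall>m\<ge>m0. norm (f - section_op m f) < e"
proof -
  have fin: "finite {n. i \<in> - {..<n}}" for i :: nat
    by (rule finite_subset[of _ "{..i}"]) auto
  obtain m1 where m1: "\<And>m. m \<ge> m1 \<Longrightarrow> norm (coord_proj (- {..<m}) o\<^sub>L f) < e / 2"
    using LIMSEQ_D[OF compact_coord_proj_left[OF f fin], of "e / 2"] e by auto
  obtain m2 where m2: "\<And>m. m \<ge> m2 \<Longrightarrow> norm (f o\<^sub>L coord_proj (- {..<m})) < e / 2"
    using finite_sections_right[OF f, of "e / 2"] e by auto
  have "norm (f - section_op m f) < e" if m: "m \<ge> max m1 m2" for m
  proof -
    \<comment> \<open>With \<open>p\<close> the coordinate projection this is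
      \<open>f - p f p = (1 - p) f + p f (1 - p)\<close>.\<close>
    have "f - section_op m f = (coord_proj (- {..<m}) o\<^sub>L f) + (coord_proj {..<m} o\<^sub>L (f o\<^sub>L coord_proj (- {..<m})))"
      by (rule blinfun_eqI)
        (simp add: blinfun.add_left blinfun.diff_left coord_proj_Compl blinfun.diff_right del: Compl_lessThan)
    then have "norm (f - section_op m f) \<le> norm (coord_proj (- {..<m}) o\<^sub>L f)
        + norm (coord_proj {..<m} o\<^sub>L (f o\<^sub>L coord_proj (- {..<m})))"
      using norm_triangle_ineq by metis
    also have "norm (coord_proj {..<m} o\<^sub>L (f o\<^sub>L coord_proj (- {..<m}))) \<le> 1 * norm (f o\<^sub>L coord_proj (- {..<m}))"
      by (rule order_trans[OF norm_blinfun_compose]) (intro mult_right_mono norm_coord_proj norm_ge_zero)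
    finally show ?thesis using m1[of m] m2[of m] m by simp
  qed
  then show ?thesis by blast
qed

section \<open>Approximate lifting\<close>

text \<open>Each step halves the residual, so the corrections are dominated by a geometric series
  with sum \<open>2 * C * norm y\<close>. This serves the open mapping theorem as well as the
  surjectivity of \<open>Q\<close>; in both cases only approximate preimages are at hand at
  first.\<close>

lemma approximate_lifting:
  fixes Q :: "'a::{complex_normed_vector,complete_space} \<Rightarrow> 'b::complex_normed_vector"
  assumes V: "csubspace V" "closed V" and Q: "clinear_on V Q" "continuous_on V Q"
    and Y: "csubspace Y" "Q ` V \<subseteq> Y" and C: "0 \<le> C"
    and step: "\<And>y. y \<in> Y \<Longrightarrow> \<exists>t\<in>V. norm t \<le> C * norm y \<and> norm (y - Q t) \<le> norm y / 2"
    and y: "y \<in> Y"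
  shows "\<exists>t\<in>V. Q t = y \<and> norm t \<le> 2 * C * norm y"
proof -
  obtain L where L: "\<And>y. y \<in> Y \<Longrightarrow> L y \<in> V" "\<And>y. y \<in> Y \<Longrightarrow> norm (L y) \<le> C * norm y"
    "\<And>y. y \<in> Y \<Longrightarrow> norm (y - Q (L y)) \<le> norm y / 2"
    using step by metis
  define ys where "ys = (\<lambda>n. ((\<lambda>y. y - Q (L y)) ^^ n) y)"
  have ys_Suc: "ys (Suc n) = ys n - Q (L (ys n))" for n by (simp add: ys_def)
  have ysY: "ys n \<in> Y" for n
  proof (induction n)
    case (Suc n)
    then show ?case unfolding ys_Suc using L(1) Y(2) by (intro csubspaceD(5)[OF Y(1)]) auto
  qed (simp add: ys_def y)
  have ysn: "norm (ys n) \<le> norm y * (1 / 2) ^ n" for n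
  proof (induction n)
    case (Suc n)
    have "norm (ys (Suc n)) \<le> norm (ys n) / 2" unfolding ys_Suc by (rule L(3)[OF ysY])
    then show ?case using Suc by simp
  qed (simp add: ys_def)
  define t where "t = (\<lambda>n. L (ys n))"
  have tn: "norm (t n) \<le> C * norm y * (1 / 2) ^ n" for n
    using order_trans[OF L(2)[OF ysY[of n]] mult_left_mono[OF ysn[of n] C]] by (simp add: t_def)
  have geo: "(\<lambda>n. C * norm y * (1 / 2) ^ n) sums (C * norm y * 2)"
    using sums_mult[OF geometric_sums[of "1 / 2 :: real"], of "C * norm y"] by simp
  let ?s = "\<lambda>n. \<Sum>k<n. t k"
  have sV: "?s n \<in> V" for n
    using L(1) ysY by (intro csubspace_sum[OF V(1)]) (auto simp: t_def)
  have "Cauchy ?s"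
  proof (rule metric_CauchyI)
    fix e :: real assume e: "e > 0"
    have "Cauchy (\<lambda>n. \<Sum>k<n. C * norm y * (1 / 2) ^ k)"
      using geo by (intro LIMSEQ_imp_Cauchy) (simp add: sums_def)
    then obtain M where M: "\<And>m n. m \<ge> M \<Longrightarrow> n \<ge> M \<Longrightarrow>
        dist (\<Sum>k<m. C * norm y * (1 / 2) ^ k) (\<Sum>k<n. C * norm y * (1 / 2) ^ k) < e"
      using e unfolding Cauchy_def by meson
    have le: "dist (?s m) (?s n) < e" if "m \<ge> n" "n \<ge> M" for m n
    proof -
      have diff: "(\<Sum>k<m. f k) - (\<Sum>k<n. f k) = (\<Sum>k\<in>{n..<m}. f k)" for f :: "nat \<Rightarrow> 'c::real_normed_vector"
        using that by (metis atLeast0LessThan diff_eq_eq add.commute sum.atLeastLessThan_concat zero_le)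
      have "norm (?s m - ?s n) \<le> (\<Sum>k\<in>{n..<m}. C * norm y * (1 / 2) ^ k)"
        unfolding diff by (intro order_trans[OF norm_sum] sum_mono tn)
      also have "\<dots> = (\<Sum>k<m. C * norm y * (1 / 2) ^ k) - (\<Sum>k<n. C * norm y * (1 / 2) ^ k)"
        unfolding diff ..
      also have "\<dots> < e" using M[of m n] that by (simp add: dist_norm)
      finally show ?thesis by (simp add: dist_norm)
    qed
    have "dist (?s m) (?s n) < e" if "m \<ge> M" "n \<ge> M" for m n
      using le[of m n] le[of n m] that by (metis dist_commute nat_le_linear)
    then show "\<exists>M. \<forall>m\<ge>M. \<forall>n\<ge>M. dist (?s m) (?s n) < e" by blast
  qed
  then obtain T where T: "?s \<longlonglongrightarrow> T" by (auto simp: Cauchy_convergent_iff convergent_def)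
  have TV: "T \<in> V" by (rule closed_sequentially[OF V(2) _ T]) (use sV in auto)
  have "(\<lambda>n. Q (?s n)) \<longlonglongrightarrow> Q T"
    by (rule continuous_on_tendsto_compose[OF Q(2) T TV]) (use sV in auto)
  moreover have "Q (?s n) = y - ys n" for n
  proof (induction n)
    case 0
    then show ?case by (simp add: ys_def clinear_onD(3)[OF Q(1) V(1)])
  next
    case (Suc n)
    have "t n \<in> V" using L(1) ysY by (simp add: t_def)
    then show ?case using Suc sV[of n] by (simp add: clinear_onD(1)[OF Q(1) V(1)] ys_Suc t_def)
  qed
  moreover have "(\<lambda>n. y - ys n) \<longlonglongrightarrow> y - 0"
  proof (intro tendsto_diff tendsto_const Lim_null_comparison[of ys])
    show "(\<lambda>n. norm y * (1 / 2) ^ n) \<longlonglongrightarrow> 0"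
      by (intro tendsto_mult_right_zero LIMSEQ_realpow_zero) auto
  qed (use ysn in auto)
  ultimately have "Q T = y" using LIMSEQ_unique by fastforce
  moreover have "norm T \<le> 2 * C * norm y"
  proof (rule LIMSEQ_le[OF tendsto_norm[OF T]])
    show "(\<lambda>n. \<Sum>k<n. C * norm y * (1 / 2) ^ k) \<longlonglongrightarrow> 2 * C * norm y"
      using geo by (simp add: sums_def mult_ac)
    show "\<exists>N. \<forall>n\<ge>N. norm (?s n) \<le> (\<Sum>k<n. C * norm y * (1 / 2) ^ k)"
      by (intro exI[of _ 0] allI impI order_trans[OF norm_sum] sum_mono tn)
  qed
  ultimately show ?thesis using TV by blast
qed

section \<open>The canonical map\<close>

lemma min_tensor_alt: "A \<otimes>\<^sub>m\<^sub>i\<^sub>n X = closure (cspan ((\<lambda>(a, b). a \<otimes>\<^sub>o b) ` (A \<times> X)))"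
  unfolding min_tensor_def by (intro arg_cong[of _ _ closure] arg_cong[of _ _ cspan]) auto

lemma csubspace_min_tensor: "csubspace (A \<otimes>\<^sub>m\<^sub>i\<^sub>n X)"
  unfolding min_tensor_def by (rule csubspace_closure[OF csubspace_cspan])

lemma closed_min_tensor: "closed (A \<otimes>\<^sub>m\<^sub>i\<^sub>n X)"
  by (simp add: min_tensor_def)

lemma tensor_op_min_tensor: "a \<in> A \<Longrightarrow> x \<in> X \<Longrightarrow> a \<otimes>\<^sub>o x \<in> A \<otimes>\<^sub>m\<^sub>i\<^sub>n X"
  unfolding min_tensor_def by (rule subsetD[OF closure_cspan_superset]) blast

lemma min_tensor_mono: "A \<subseteq> A' \<Longrightarrow> X \<subseteq> X' \<Longrightarrow> A \<otimes>\<^sub>m\<^sub>i\<^sub>n X \<subseteq> A' \<otimes>\<^sub>m\<^sub>i\<^sub>n X'"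
  unfolding min_tensor_def by (intro closure_mono cspan_mono) blast

text \<open>Scalar coefficients are absorbed into the right leg, which leaves a plain sum of
  elementary tensors indexed by pairs of operators.\<close>

lemma min_tensor_approx:
  fixes A :: "('a::complex_hilbert \<Rightarrow>\<^sub>L 'a) set" and X :: "('b::complex_hilbert \<Rightarrow>\<^sub>L 'b) set"
  assumes t: "t \<in> A \<otimes>\<^sub>m\<^sub>i\<^sub>n X" and e: "0 < e" and A: "A \<subseteq> bounded_ops" and X: "X \<subseteq> bounded_ops" "csubspace X"
  shows "\<exists>(F :: (('a \<Rightarrow>\<^sub>L 'a) \<times> ('b \<Rightarrow>\<^sub>L 'b)) set) a x. finite F \<and> (\<forall>i\<in>F. a i \<in> A) \<and> (\<forall>i\<in>F. x i \<in> X) \<and>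
    norm (t - (\<Sum>i\<in>F. a i \<otimes>\<^sub>o x i)) < e"
proof -
  obtain s where s: "s \<in> cspan ((\<lambda>(a, b). a \<otimes>\<^sub>o b) ` (A \<times> X))" "dist s t < e"
    using t e unfolding min_tensor_alt closure_approachable by blast
  obtain F c where F: "finite F" "F \<subseteq> A \<times> X" "s = (\<Sum>v\<in>F. c v *\<^sub>C (case v of (a, b) \<Rightarrow> a \<otimes>\<^sub>o b))"
    using s(1) unfolding cspan_image by blast
  have "s = (\<Sum>v\<in>F. fst v \<otimes>\<^sub>o (c v *\<^sub>C snd v))"
    unfolding F(3)
  proof (rule sum.cong[OF refl])
    fix v assume "v \<in> F"
    then have "v \<in> A \<times> X" using F(2) by blast
    then have "fst v \<in> bounded_ops" "snd v \<in> bounded_ops" using A X(1) by auto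
    then show "c v *\<^sub>C (case v of (a, b) \<Rightarrow> a \<otimes>\<^sub>o b) = fst v \<otimes>\<^sub>o (c v *\<^sub>C snd v)"
      by (simp add: tensor_op_scaleC case_prod_unfold)
  qed
  then show ?thesis
    using s(2) F(1,2) csubspaceD(3)[OF X(2)]
    by (intro exI[of _ F] exI[of _ fst] exI[of _ "\<lambda>v. c v *\<^sub>C snd v"]) (auto simp: dist_norm norm_minus_commute)
qed

locale calkin_operator_space = calkin \<pi>
  for \<pi> :: "(nat ell2 \<Rightarrow>\<^sub>L nat ell2) set \<Rightarrow> ('k::complex_hilbert \<Rightarrow>\<^sub>L 'k)" +
  fixes X :: "('h::complex_hilbert \<Rightarrow>\<^sub>L 'h) set"
  assumes X: "operator_space X"
begin

lemma XD: "X \<subseteq> bounded_ops" "csubspace X" "closed X"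
  using X by (auto simp: operator_space_def)

lemma X_bounded: "x \<in> X \<Longrightarrow> x \<in> bounded_ops"
  using XD by blast

abbreviation BX where "BX \<equiv> B_ell2 \<otimes>\<^sub>m\<^sub>i\<^sub>n X"
abbreviation KX where "KX \<equiv> K_ell2 \<otimes>\<^sub>m\<^sub>i\<^sub>n X"
abbreviation CX where "CX \<equiv> calkin_algebra \<pi> \<otimes>\<^sub>m\<^sub>i\<^sub>n X"
abbreviation Q where "Q \<equiv> quotient_tensor_map \<pi> X"

lemma calkin_algebra_eq: "calkin_algebra \<pi> = q ` bounded_ops"
  by (auto simp: calkin_algebra_def quotient_space_def q_def)

lemma KX_subset: "KX \<subseteq> BX"
  by (intro min_tensor_mono subset_refl) (auto simp: compact_ops_bounded)

text \<open>Contractivity of \<open>q \<otimes> id\<close> on finite sums yields a map with the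
  required properties, and density of these sums determines it on \<open>BX\<close>. The choice made
  by \<open>SOME\<close> is therefore harmless.\<close>

lemma quotient_tensor_map:
  shows Q_linear: "clinear_on BX Q" and Q_cont: "continuous_on BX Q"
    and Q_tensor: "\<And>b x. b \<in> bounded_ops \<Longrightarrow> x \<in> X \<Longrightarrow> Q (b \<otimes>\<^sub>o x) = q b \<otimes>\<^sub>o x"
    and norm_Q_le: "\<And>t. t \<in> BX \<Longrightarrow> norm (Q t) \<le> norm t"
proof -
  let ?g = "\<lambda>(a, b). a \<otimes>\<^sub>o b" and ?h = "\<lambda>(a, b). q a \<otimes>\<^sub>o b"
  have bound: "norm (\<Sum>v\<in>F. c v *\<^sub>C ?h v) \<le> 1 * norm (\<Sum>v\<in>F. c v *\<^sub>C ?g v)"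
    if F: "finite F" "F \<subseteq> B_ell2 \<times> X" for F c
  proof -
    have b: "\<And>v. v \<in> F \<Longrightarrow> fst v \<in> bounded_ops" "\<And>v. v \<in> F \<Longrightarrow> snd v \<in> bounded_ops"
      using F(2) X_bounded by auto
    have "(\<Sum>v\<in>F. c v *\<^sub>C ?h v) = (\<Sum>v\<in>F. q (fst v) \<otimes>\<^sub>o (c v *\<^sub>C snd v))"
      "(\<Sum>v\<in>F. c v *\<^sub>C ?g v) = (\<Sum>v\<in>F. fst v \<otimes>\<^sub>o (c v *\<^sub>C snd v))"
      using b by (auto intro!: sum.cong simp: tensor_op_scaleC case_prod_unfold)
    then show ?thesis
      using norm_tensor_q_le[of F fst "\<lambda>v. c v *\<^sub>C snd v"] b by simp
  qed
  have "\<exists>R. clinear_on (closure (cspan (?g ` (B_ell2 \<times> X)))) R \<and>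
    (\<forall>t\<in>closure (cspan (?g ` (B_ell2 \<times> X))). norm (R t) \<le> 1 * norm t) \<and>
    (\<forall>v\<in>B_ell2 \<times> X. R (?g v) = ?h v) \<and> continuous_on (closure (cspan (?g ` (B_ell2 \<times> X)))) R"
    by (rule extend_clinear[OF bound])
  then obtain R where R: "clinear_on BX R" "\<And>t. t \<in> BX \<Longrightarrow> norm (R t) \<le> 1 * norm t"
    "\<And>v. v \<in> B_ell2 \<times> X \<Longrightarrow> R (?g v) = ?h v" "continuous_on BX R"
    unfolding min_tensor_alt[symmetric] by blast
  let ?P = "\<lambda>Q. clinear_on BX Q \<and> continuous_on BX Q \<and>
     (\<forall>b\<in>B_ell2. \<forall>x\<in>X. Q (b \<otimes>\<^sub>o x) = \<pi> (calkin_class b) \<otimes>\<^sub>o x)"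
  have "?P R" using R(1,3,4) by (auto simp: q_def)
  then have Q: "?P Q" unfolding quotient_tensor_map_def by (rule someI[of ?P])
  \<comment> \<open>The defining conditions contain no norm bound; it is inherited from
    \<open>R\<close> by uniqueness.\<close>
  have eq: "Q t = R t" if "t \<in> BX" for t
    by (rule clinear_on_closure_cspan_eq[where S="?g ` (B_ell2 \<times> X)"])
      (use Q R that in \<open>auto simp: q_def simp flip: min_tensor_alt\<close>)
  show "clinear_on BX Q" "continuous_on BX Q" using Q by auto
  show "Q (b \<otimes>\<^sub>o x) = q b \<otimes>\<^sub>o x" if "b \<in> bounded_ops" "x \<in> X" for b x
    using Q that by (simp add: q_def)
  show "norm (Q t) \<le> norm t" if "t \<in> BX" for t using R(2)[OF that] eq[OF that] by simp
qed

lemmas BX_sub = csubspaceD[OF csubspace_min_tensor[of "B_ell2" X]]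
lemmas KX_sub = csubspaceD[OF csubspace_min_tensor[of "K_ell2" X]]
lemmas Q_D = clinear_onD[OF Q_linear csubspace_min_tensor]

lemma tensor_sum_BX:
  "(\<And>i. i \<in> F \<Longrightarrow> b i \<in> bounded_ops) \<Longrightarrow> (\<And>i. i \<in> F \<Longrightarrow> x i \<in> X) \<Longrightarrow> (\<Sum>i\<in>F. b i \<otimes>\<^sub>o x i) \<in> BX"
  by (intro csubspace_sum[OF csubspace_min_tensor] tensor_op_min_tensor)

lemma Q_sum:
  assumes "\<And>i. i \<in> F \<Longrightarrow> b i \<in> bounded_ops" "\<And>i. i \<in> F \<Longrightarrow> x i \<in> X"
  shows "Q (\<Sum>i\<in>F. b i \<otimes>\<^sub>o x i) = (\<Sum>i\<in>F. q (b i) \<otimes>\<^sub>o x i)"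
  using assms by (subst clinear_on_sum[OF Q_linear csubspace_min_tensor])
    (auto intro!: tensor_op_min_tensor simp: Q_tensor)

lemma Q_KX: "t \<in> KX \<Longrightarrow> Q t = 0"
proof -
  assume t: "t \<in> KX"
  have sub: "clinear_on KX Q" "continuous_on KX Q"
    using clinear_on_subset[OF Q_linear KX_subset] continuous_on_subset[OF Q_cont KX_subset] by auto
  have "Q t = (\<lambda>_. 0) t"
    by (rule clinear_on_closure_cspan_eq[where S="(\<lambda>(a, b). a \<otimes>\<^sub>o b) ` (K_ell2 \<times> X)"])
      (use sub t in \<open>auto simp: clinear_on_def Q_tensor compact_ops_bounded q_compact tensor_op_zero_left X_bounded
          simp flip: min_tensor_alt\<close>)
  then show "Q t = 0" by simp
qed

lemma Q_image_subset: "Q ` BX \<subseteq> CX"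
proof clarify
  fix t assume t: "t \<in> BX"
  obtain ts where ts: "\<And>n. ts n \<in> cspan ((\<lambda>(a, b). a \<otimes>\<^sub>o b) ` (B_ell2 \<times> X))" "ts \<longlonglongrightarrow> t"
    using t unfolding min_tensor_alt closure_sequential by blast
  have tsB: "ts n \<in> BX" for n using ts(1)[of n] closure_subset unfolding min_tensor_alt by blast
  have "Q (ts n) \<in> CX" for n
  proof -
    obtain F c where F: "finite F" "F \<subseteq> B_ell2 \<times> X" "ts n = (\<Sum>v\<in>F. c v *\<^sub>C (case v of (a, b) \<Rightarrow> a \<otimes>\<^sub>o b))"
      using ts(1)[of n] unfolding cspan_image by blast
    have FT: "(case v of (a, b) \<Rightarrow> a \<otimes>\<^sub>o b) \<in> BX" "Q (case v of (a, b) \<Rightarrow> a \<otimes>\<^sub>o b) \<in> CX" if vF: "v \<in> F" for v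
    proof -
      obtain a b where "v = (a, b)" "a \<in> bounded_ops" "b \<in> X" using vF F(2) by blast
      then show "(case v of (a, b) \<Rightarrow> a \<otimes>\<^sub>o b) \<in> BX" "Q (case v of (a, b) \<Rightarrow> a \<otimes>\<^sub>o b) \<in> CX"
        by (simp_all add: Q_tensor calkin_algebra_eq tensor_op_min_tensor)
    qed
    have "Q (ts n) = (\<Sum>v\<in>F. c v *\<^sub>C Q (case v of (a, b) \<Rightarrow> a \<otimes>\<^sub>o b))"
      unfolding F(3) by (rule clinear_on_sum_scaleC[OF Q_linear csubspace_min_tensor]) (use FT in auto)
    also have "\<dots> \<in> CX"
      by (intro csubspace_sum[OF csubspace_min_tensor] csubspaceD(3)[OF csubspace_min_tensor] FT(2))
    finally show ?thesis .
  qed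
  moreover have "(\<lambda>n. Q (ts n)) \<longlonglongrightarrow> Q t"
    by (rule continuous_on_tendsto_compose[OF Q_cont ts(2) t]) (use tsB in auto)
  ultimately show "Q t \<in> CX" by (rule closed_sequentially[OF closed_min_tensor])
qed

lemma T_map_coset:
  assumes "t \<in> BX"
  shows "T_map \<pi> X (coset KX t) = Q t"
proof -
  have "Q (t + w) = Q t" if "w \<in> KX" for w
    using Q_D(1)[OF assms] that KX_subset Q_KX[OF that] by auto
  then have "Q ` coset KX t = {Q t}"
    using KX_sub(1) by (auto simp: coset_def image_image)
  then show ?thesis by (simp add: T_map_def)
qed

text \<open>\<open>inv_into\<close> returns some coset above \<open>y\<close>. How its quotient norm
  compares with the norms of other preimages is settled in
  \<open>coset_quotient_norm_eq\<close>.\<close>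

lemma T_inverse:
  assumes "y \<in> Q ` BX"
  obtains t where "t \<in> BX" "Q t = y" "inv_into (quotient_space BX KX) (T_map \<pi> X) y = coset KX t"
proof -
  let ?i = "inv_into (quotient_space BX KX) (T_map \<pi> X) y"
  have y: "y \<in> T_map \<pi> X ` quotient_space BX KX"
    using assms T_map_coset by (force simp: quotient_space_def)
  then have "?i \<in> quotient_space BX KX" "T_map \<pi> X ?i = y"
    by (auto intro: inv_into_into f_inv_into_f)
  then obtain t where "t \<in> BX" "?i = coset KX t" "T_map \<pi> X (coset KX t) = y"
    by (auto simp: quotient_space_def)
  then show thesis using that T_map_coset by simp
qed

end

section \<open>Subspaces of the compact operators\<close>

lemma cb_norm_zeroD:
  assumes "cb_norm E u = 0" "csubspace E" "clinear_on E u" "x \<in> E"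
  shows "u x = 0"
proof -
  have "mat_norm (Suc 0) (\<lambda>i j. u x) \<le> 0 * mat_norm (Suc 0) (\<lambda>i j. x)"
    by (rule cb_norm_leD[of E u 0]) (use assms in auto)
  then show ?thesis by (simp add: mat_norm_one)
qed

lemma clinear_on_inv_into:
  assumes "clinear_on E u" "csubspace E" "bij_betw u E F"
  shows "clinear_on F (inv_into E u)" "csubspace F"
proof -
  have inj: "inj_on u E" and F: "F = u ` E" using assms(3) by (auto simp: bij_betw_def)
  note D = clinear_onD[OF assms(1,2)] csubspaceD[OF assms(2)]
  show "csubspace F"
    unfolding csubspace_def F
  proof (intro conjI ballI allI)
    show "0 \<in> u ` E" using D by (metis image_eqI)
    show "x + y \<in> u ` E" if "x \<in> u ` E" "y \<in> u ` E" for x y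
      using that D(1) D(6) by (auto simp flip: D(1))
    show "c *\<^sub>C x \<in> u ` E" if "x \<in> u ` E" for c x
      using that D(7) by (auto simp flip: D(2))
  qed
  show "clinear_on F (inv_into E u)"
    unfolding clinear_on_def F
  proof (intro conjI ballI allI)
    fix x y assume "x \<in> u ` E" "y \<in> u ` E"
    then obtain a b where ab: "a \<in> E" "b \<in> E" "x = u a" "y = u b" by blast
    show "inv_into E u (x + y) = inv_into E u x + inv_into E u y"
      using ab D(6)[OF ab(1,2)] inj by (simp add: D(1)[symmetric])
  next
    fix c x assume "x \<in> u ` E"
    then obtain a where a: "a \<in> E" "x = u a" by blast
    show "inv_into E u (c *\<^sub>C x) = c *\<^sub>C inv_into E u x"
      using a D(7)[OF a(1)] inj by (simp add: D(2)[symmetric])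
  qed
qed

text \<open>The strict inequality unfolds both infima into one embedding, with real bounds in place
  of extended ones, so that later estimates are ordinary arithmetic.\<close>

lemma d_SK_lessE:
  fixes E :: "('h::complex_hilbert \<Rightarrow>\<^sub>L 'h) set"
  assumes less: "d_SK E < ennreal S" and E: "csubspace E" and S: "0 \<le> S"
  obtains F and u :: "_ \<Rightarrow> (nat ell2 \<Rightarrow>\<^sub>L nat ell2)" and U V where
    "operator_space F" "F \<subseteq> compact_ops" "clinear_on E u" "bij_betw u E F"
    "0 \<le> U" "0 \<le> V" "U * V \<le> S" "cb_norm E u \<le> ennreal U" "cb_norm F (inv_into E u) \<le> ennreal V"
proof -
  obtain F :: "(nat ell2 \<Rightarrow>\<^sub>L nat ell2) set"
    where F: "operator_space F" "F \<subseteq> compact_ops" "d_cb E F < ennreal S"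
    using less unfolding d_SK_def INF_less_iff by blast
  obtain u where u: "clinear_on E u" "bij_betw u E F"
    "cb_norm E u * cb_norm F (inv_into E u) < ennreal S"
    using F(3) unfolding d_cb_def INF_less_iff by blast
  let ?v = "inv_into E u"
  note v = clinear_on_inv_into[OF u(1) E u(2)]
  have inv: "?v (u x) = x" "u x \<in> F" if "x \<in> E" for x
    using u(2) that by (auto simp: bij_betw_def)
  \<comment> \<open>Because of \<open>0 * \<infinity> = 0\<close>, a finite product bounds the two factors only if neither vanishes.\<close>
  show thesis
  proof (cases "E = {0}")
    case True
    have F0: "F = {0}" using u(2) True clinear_onD(3)[OF u(1) E] by (auto simp: bij_betw_def)
    have v0: "?v 0 = 0" using clinear_onD(3)[OF v] .
    have u0: "u 0 = 0" using clinear_onD(3)[OF u(1) E] .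

    have cu: "cb_norm E u \<le> ennreal 0"
    proof (rule cb_norm_le_ennreal)
      fix n :: nat and a assume "\<And>i j. i < n \<Longrightarrow> j < n \<Longrightarrow> a i j \<in> E"
      then have "mat_norm n (\<lambda>i j. u (a i j)) = mat_norm n (\<lambda>i j. 0 :: nat ell2 \<Rightarrow>\<^sub>L nat ell2)"
        using True u0 by (intro mat_norm_cong) auto
      then show "mat_norm n (\<lambda>i j. u (a i j)) \<le> 0" by (simp add: mat_norm_zero_matrix)
    qed simp
    have cv: "cb_norm F ?v \<le> ennreal 0"
    proof (rule cb_norm_le_ennreal)
      fix n :: nat and a assume "\<And>i j. i < n \<Longrightarrow> j < n \<Longrightarrow> a i j \<in> F"
      then have "mat_norm n (\<lambda>i j. ?v (a i j)) = mat_norm n (\<lambda>i j. 0 :: 'h \<Rightarrow>\<^sub>L 'h)"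
        using F0 v0 by (intro mat_norm_cong) auto
      then show "mat_norm n (\<lambda>i j. ?v (a i j)) \<le> 0" by (simp add: mat_norm_zero_matrix)
    qed simp
    show thesis by (rule that[OF F(1,2) u(1,2) _ _ _ cu cv]) (use S in auto)
  next
    case False
    then obtain x where x: "x \<in> E" "x \<noteq> 0" using csubspaceD(1)[OF E] by auto
    have "cb_norm E u \<noteq> 0"
      using cb_norm_zeroD[OF _ E u(1) x(1)] inv[OF x(1)] x(2) clinear_onD(3)[OF v] by metis
    moreover have "cb_norm F ?v \<noteq> 0"
      using cb_norm_zeroD[OF _ v(2,1) inv(2)[OF x(1)]] inv[OF x(1)] x(2) by metis
    moreover have "cb_norm E u * cb_norm F ?v < \<infinity>"
      using u(3) by (simp add: less_top order_less_trans[OF _ ennreal_less_top])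
    ultimately have fin: "cb_norm E u < \<infinity>" "cb_norm F ?v < \<infinity>"
      by (auto simp: ennreal_mult_less_top)
    obtain U where U: "0 \<le> U" "cb_norm E u = ennreal U"
      using fin(1) by (cases "cb_norm E u") auto
    obtain V where V: "0 \<le> V" "cb_norm F ?v = ennreal V"
      using fin(2) by (cases "cb_norm F ?v") auto
    have "U * V \<le> S"
      using u(3) U(1) V(1) S unfolding U(2) V(2) by (simp add: ennreal_mult[symmetric] ennreal_less_iff)
    then show thesis using that[OF F(1,2) u(1,2) U(1) V(1)] U(2) V(2) by simp
  qed
qed

text \<open>Only the corner of size \<open>m\<close> of the second leg survives, so the sum is in
  effect a matrix of size \<open>m\<close> over operators on the first leg, whose entries are
  combinations of the \<open>b i\<close>.\<close>

lemma norm_tensor_section_le: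
  fixes b :: "'i \<Rightarrow> ('k::complex_hilbert \<Rightarrow>\<^sub>L 'k)"
  assumes b: "\<And>i. i \<in> I \<Longrightarrow> b i \<in> bounded_ops" and f: "\<And>i. i \<in> I \<Longrightarrow> f i \<in> bounded_ops"
  shows "norm (\<Sum>i\<in>I. b i \<otimes>\<^sub>o section_op m (f i))
    \<le> mat_norm m (\<lambda>r s. \<Sum>i\<in>I. coord (blinfun_apply (f i) (unit_ell2 s)) r *\<^sub>C b i)" (is "_ \<le> mat_norm m ?z")
proof -
  define P where "P = (some_onb :: 'k set)"
  have P: "orthonormal_basis P" by (simp add: P_def orthonormal_basis_some_onb)
  let ?N = "\<lambda>u v. \<Sum>i\<in>I. cinner (fst u) (blinfun_apply (b i) (fst v)) * cinner (snd u) (blinfun_apply (section_op m (f i)) (snd v))"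
  have z: "?z r s \<in> bounded_ops" for r s using b by auto
  have pu: "blinfun_apply (coord_proj A) (unit_ell2 s) = (if s \<in> A then unit_ell2 s else 0)" for A and s :: nat
    by (rule ell2_eqI) (auto simp: coord_coord_proj coord_unit zero_ell2.rep_eq)
  have sec: "coord (blinfun_apply (section_op m g) (unit_ell2 s)) r
      = (if r < m \<and> s < m then coord (blinfun_apply g (unit_ell2 s)) r else 0)" for g r s
    by (auto simp: coord_coord_proj pu zero_ell2.rep_eq)
  have "mbound ({..<m} \<times> P) (entry ?z) (mat_norm m ?z)"
    by (rule mbound_entry_le[OF z orthonormal_basisD[OF P]])
  \<comment> \<open>The legs change places: a coordinate of the right leg becomes the matrix
    index.\<close>
  then have 1: "mbound (P \<times> unit_ell2 ` {..<m}) ?N (mat_norm m ?z)"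
  proof (rule mbound_reindex[where \<phi>="\<lambda>(p, g). (inv unit_ell2 g, p)"])
    show "inj_on (\<lambda>(p, g). (inv unit_ell2 g, p)) (P \<times> unit_ell2 ` {..<m})"
      by (auto simp: inj_on_def inv_f_f[OF inj_unit])
    show "(\<lambda>(p, g). (inv unit_ell2 g, p)) ` (P \<times> unit_ell2 ` {..<m}) \<subseteq> {..<m} \<times> P"
      by (auto simp: inv_f_f[OF inj_unit])
    fix u v assume "u \<in> P \<times> unit_ell2 ` {..<m}" "v \<in> P \<times> unit_ell2 ` {..<m}"
    then obtain p r p' s where uv: "u = (p, unit_ell2 r)" "v = (p', unit_ell2 s)" "r < m" "s < m" by auto
    have "?N u v = (\<Sum>i\<in>I. cinner p (blinfun_apply (b i) p') * coord (blinfun_apply (f i) (unit_ell2 s)) r)"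
      unfolding uv fst_conv snd_conv cinner_unit sec using uv(3,4) by simp
    then show "?N u v = entry ?z (case u of (p, g) \<Rightarrow> (inv unit_ell2 g, p)) (case v of (p, g) \<Rightarrow> (inv unit_ell2 g, p))"
      unfolding uv(1,2) by (simp add: inv_f_f[OF inj_unit] blinfun.sum_left cinner_sum_right
          scaleC_blinfun.rep_eq cinner_scaleC_right mult.commute)
  qed
  have "mbound (P \<times> range unit_ell2) ?N (mat_norm m ?z)"
  proof (rule mbound_zero_extend[OF 1 _ mat_norm_nonneg])
    fix u v assume uv: "u \<in> P \<times> range unit_ell2" "v \<in> P \<times> range unit_ell2"
      "u \<notin> P \<times> unit_ell2 ` {..<m} \<or> v \<notin> P \<times> unit_ell2 ` {..<m}"
    obtain p r where u1: "u = (p, unit_ell2 r)" "p \<in> P" using uv(1) by auto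
    obtain p' s where v1: "v = (p', unit_ell2 s)" "p' \<in> P" using uv(2) by auto
    note u = u1(1) v1(1) u1(2) v1(2)
    have "\<not> (r < m \<and> s < m)" using uv(3) u by auto
    then show "?N u v = 0" unfolding u(1,2) fst_conv snd_conv cinner_unit sec by (intro sum.neutral) auto
  qed
  then show ?thesis
    using norm_tensor_sum_mbound[of I b "\<lambda>i. section_op m (f i)", OF b _ P orthonormal_basis_unit mat_norm_nonneg] f
    by auto
qed

text \<open>The first \<open>m\<close> unit vectors of the right leg form one of the slices. In
  \<open>lift_SK\<close> this estimate is used for the images under \<open>q\<close>, and
  \<open>norm_tensor_section_le\<close> for the operators themselves.\<close>

lemma mat_norm_section_le:
  fixes b :: "'i \<Rightarrow> ('k::complex_hilbert \<Rightarrow>\<^sub>L 'k)"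
  assumes b: "\<And>i. i \<in> I \<Longrightarrow> b i \<in> bounded_ops" and f: "\<And>i. i \<in> I \<Longrightarrow> f i \<in> bounded_ops"
  shows "mat_norm m (\<lambda>r s. \<Sum>i\<in>I. coord (blinfun_apply (f i) (unit_ell2 s)) r *\<^sub>C b i) \<le> norm (\<Sum>i\<in>I. b i \<otimes>\<^sub>o f i)"
proof -
  have "\<forall>n g. inj_on g {..<n} \<longrightarrow> g ` {..<n} \<subseteq> range unit_ell2 \<longrightarrow>
       mat_norm n (\<lambda>r s. \<Sum>i\<in>I. cinner (g r) (blinfun_apply (f i) (g s)) *\<^sub>C b i) \<le> norm (\<Sum>i\<in>I. b i \<otimes>\<^sub>o f i)"
    using norm_tensor_sum_le_right[of I b f, OF b f orthonormal_basis_unit norm_ge_zero] by blast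
  from this[rule_format, of unit_ell2 m] show ?thesis
    by (simp add: cinner_unit inj_on_subset[OF inj_unit] image_subset_iff)
qed

lemma mat_norm_comp_left_le:
  assumes "norm R \<le> 1"
  shows "mat_norm m (\<lambda>i j. R o\<^sub>L a i j) \<le> mat_norm m a"
proof (subst mat_norm_le_iff[OF mat_norm_nonneg], rule allI)
  fix x
  have "norm (\<Sum>j<m. blinfun_apply (R o\<^sub>L a i j) (x j)) \<le> norm (\<Sum>j<m. blinfun_apply (a i j) (x j))" for i
  proof -
    have "norm (blinfun_apply R (\<Sum>j<m. blinfun_apply (a i j) (x j))) \<le> 1 * norm (\<Sum>j<m. blinfun_apply (a i j) (x j))"
      by (rule order_trans[OF norm_blinfun]) (intro mult_right_mono assms norm_ge_zero)
    then show ?thesis by (simp add: blinfun.sum_right)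
  qed
  then have "L2_set (\<lambda>i. norm (\<Sum>j<m. blinfun_apply (R o\<^sub>L a i j) (x j))) {..<m}
     \<le> L2_set (\<lambda>i. norm (\<Sum>j<m. blinfun_apply (a i j) (x j))) {..<m}" by (intro L2_set_mono) auto
  also have "\<dots> \<le> mat_norm m a * L2_set (\<lambda>j. norm (x j)) {..<m}" by (rule mat_norm_apply)
  finally show "L2_set (\<lambda>i. norm (\<Sum>j<m. blinfun_apply (R o\<^sub>L a i j) (x j))) {..<m} \<le> mat_norm m a * L2_set (\<lambda>j. norm (x j)) {..<m}" .
qed

section \<open>Bounded \<open>d_SK\<close> implies exactness\<close>

context calkin
begin

text \<open>Both sides are compared in the image \<open>F\<close> of \<open>E\<close>, where finite
  sections turn tensors into matrices. Composing the \<open>b i\<close> with a coordinate projection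
  of finite codimension changes them by compact operators only, so the sum on the left still lifts
  the one on the right.\<close>

lemma lift_SK:
  fixes E :: "('h::complex_hilbert \<Rightarrow>\<^sub>L 'h) set" and I :: "'i set"
  assumes E: "operator_space E" and less: "d_SK E < ennreal S" and S: "0 \<le> S" and I: "finite I"
    and b: "\<And>i. i \<in> I \<Longrightarrow> b i \<in> bounded_ops" and x: "\<And>i. i \<in> I \<Longrightarrow> x i \<in> E" and e: "0 < e"
  shows "\<exists>n. norm (\<Sum>i\<in>I. (coord_proj (- {..<n}) o\<^sub>L b i) \<otimes>\<^sub>o x i) \<le> S * norm (\<Sum>i\<in>I. q (b i) \<otimes>\<^sub>o x i) + e"
proof -
  have ED: "E \<subseteq> bounded_ops" "csubspace E" using E by (auto simp: operator_space_def)
  obtain F and u :: "_ \<Rightarrow> (nat ell2 \<Rightarrow>\<^sub>L nat ell2)" and U V where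
    F: "operator_space F" "F \<subseteq> compact_ops" and u: "clinear_on E u" "bij_betw u E F"
    and UV: "0 \<le> U" "0 \<le> V" "U * V \<le> S" and cb: "cb_norm E u \<le> ennreal U" "cb_norm F (inv_into E u) \<le> ennreal V"
    by (rule d_SK_lessE[OF less ED(2) S])
  let ?v = "inv_into E u"
  have FD: "csubspace F" "F \<subseteq> bounded_ops" using F by (auto simp: operator_space_def)
  have v: "clinear_on F ?v" by (rule clinear_on_inv_into[OF u(1) ED(2) u(2)])
  have vE: "?v y \<in> E" if "y \<in> F" for y
    using that u(2) inv_into_into[of y u E] by (auto simp: bij_betw_def)
  have vu: "?v (u y) = y" if "y \<in> E" for y using that u(2) by (auto simp: bij_betw_def)
  define f where "f = (\<lambda>i. u (x i))"
  have fF: "f i \<in> F" if "i \<in> I" for i using x[OF that] u(2) by (auto simp: f_def bij_betw_def)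
  have fb: "f i \<in> bounded_ops" and fK: "f i \<in> compact_ops" if "i \<in> I" for i
    using fF[OF that] F(2) FD(2) by auto
  define Y where "Y = norm (\<Sum>i\<in>I. q (b i) \<otimes>\<^sub>o x i)"
  have hY: "norm (\<Sum>i\<in>I. q (b i) \<otimes>\<^sub>o f i) \<le> U * Y"
    unfolding Y_def f_def
    by (rule norm_tensor_cb_le[OF cb(1) UV(1) ED(2,1) u(1)]) (use x b u(2) FD(2) in \<open>auto simp: bij_betw_def\<close>)
  \<comment> \<open>Three errors of size \<open>\<delta>\<close> occur in \<open>F\<close> and are
    multiplied by \<open>V\<close> on the way back; the 1 in the denominator allows
    \<open>V = 0\<close>.\<close>
  define \<delta> where "\<delta> = e / (4 * V + 1)"
  have \<delta>: "0 < \<delta>" "4 * V * \<delta> \<le> e" using e UV(2) by (auto simp: \<delta>_def field_simps)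
  \<comment> \<open>The errors of the sections are weighted by the norms of the \<open>b i\<close>,
    hence the tolerance \<open>\<delta> / (\<beta> + 1)\<close> below.\<close>
  define \<beta> where "\<beta> = (\<Sum>i\<in>I. norm (b i))"
  have \<beta>: "0 \<le> \<beta>" by (simp add: \<beta>_def sum_nonneg)
  have "\<exists>m. \<forall>i\<in>I. norm (f i - section_op m (f i)) < \<delta> / (\<beta> + 1)"
  proof -
    have "\<forall>\<^sub>F m in sequentially. \<forall>i\<in>I. norm (f i - section_op m (f i)) < \<delta> / (\<beta> + 1)"
      using I
    proof (rule eventually_ball_finite, intro ballI)
      fix i assume "i \<in> I"
      then show "\<forall>\<^sub>F m in sequentially. norm (f i - section_op m (f i)) < \<delta> / (\<beta> + 1)"
        using finite_sections[OF fK, of i "\<delta> / (\<beta> + 1)"] \<delta>(1) \<beta> unfolding eventually_sequentially by simp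
    qed
    then show ?thesis unfolding eventually_sequentially by blast
  qed
  then obtain m where m: "\<And>i. i \<in> I \<Longrightarrow> norm (f i - section_op m (f i)) < \<delta> / (\<beta> + 1)" by blast
  \<comment> \<open>\<open>z\<close> is the matrix over \<open>B\<close> that represents
    \<open>\<Sum>i b i \<otimes> f i\<close> on the first \<open>m\<close> coordinates of the right
    leg.\<close>
  define z where "z = (\<lambda>r s. \<Sum>i\<in>I. coord (blinfun_apply (f i) (unit_ell2 s)) r *\<^sub>C b i)"
  have zb: "z r s \<in> bounded_ops" for r s using b by (auto simp: z_def)
  have "mat_norm m (\<lambda>r s. q (z r s)) = mat_norm m (\<lambda>r s. \<Sum>i\<in>I. coord (blinfun_apply (f i) (unit_ell2 s)) r *\<^sub>C q (b i))"
    using b by (simp add: z_def q_sum q_scaleC)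
  also have "\<dots> \<le> norm (\<Sum>i\<in>I. q (b i) \<otimes>\<^sub>o f i)"
    by (rule mat_norm_section_le) (use b fb in auto)
  finally have qz: "mat_norm m (\<lambda>r s. q (z r s)) \<le> U * Y" using hY by linarith
  obtain k where k: "\<And>i j. i < m \<Longrightarrow> j < m \<Longrightarrow> k i j \<in> compact_ops"
    "mat_norm m (\<lambda>i j. z i j + k i j) \<le> mat_norm m (\<lambda>i j. q (z i j)) + \<delta>"
    using mat_norm_q_lift[of m z, OF zb \<delta>(1)] by blast
  have fin: "finite {n. i \<in> - {..<n}}" for i :: nat
    by (rule finite_subset[of _ "{..i}"]) auto
  \<comment> \<open>The finitely many compact corrections become small once enough initial
    coordinates are projected away.\<close>
  have "(\<lambda>n. \<Sum>i<m. \<Sum>j<m. norm (coord_proj (- {..<n}) o\<^sub>L k i j)) \<longlonglongrightarrow> (\<Sum>i<m. \<Sum>j<m. 0)"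
    by (intro tendsto_sum compact_coord_proj_left k fin) auto
  then have "\<forall>\<^sub>F n in sequentially. (\<Sum>i<m. \<Sum>j<m. norm (coord_proj (- {..<n}) o\<^sub>L k i j)) < \<delta>"
    using \<delta>(1) by (intro order_tendstoD(2)) auto
  then obtain n where n: "(\<Sum>i<m. \<Sum>j<m. norm (coord_proj (- {..<n}) o\<^sub>L k i j)) < \<delta>"
    unfolding eventually_sequentially by blast
  define R where "R = coord_proj (- {..<n})"
  have R: "R \<in> bounded_ops" "norm R \<le> 1" by (auto simp: R_def norm_coord_proj)
  have Rb: "R o\<^sub>L b i \<in> bounded_ops" if "i \<in> I" for i using b[OF that] R by blast
  have Rb_norm: "norm (R o\<^sub>L b i) \<le> norm (b i)" for i
    using order_trans[OF norm_blinfun_compose mult_right_mono[OF R(2) norm_ge_zero]] by simp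
  \<comment> \<open>The compact correction is inserted, so that the lift controls the main part, and
    removed again at the cost of one \<open>\<delta>\<close>.\<close>
  have "mat_norm m (\<lambda>r s. R o\<^sub>L z r s) = mat_norm m (\<lambda>r s. (R o\<^sub>L (z r s + k r s)) + (- (R o\<^sub>L k r s)))"
    by (intro mat_norm_cong blinfun_eqI)
      (simp add: blinfun.add_left blinfun.add_right blinfun.minus_left blinfun.diff_left)
  also have "\<dots> \<le> mat_norm m (\<lambda>r s. R o\<^sub>L (z r s + k r s)) + mat_norm m (\<lambda>r s. - (R o\<^sub>L k r s))"
    by (rule mat_norm_add)
  also have "mat_norm m (\<lambda>r s. R o\<^sub>L (z r s + k r s)) \<le> mat_norm m (\<lambda>r s. z r s + k r s)"
    by (rule mat_norm_comp_left_le[OF R(2)])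
  also have "mat_norm m (\<lambda>r s. - (R o\<^sub>L k r s)) \<le> (\<Sum>r<m. \<Sum>s<m. norm (- (R o\<^sub>L k r s)))"
    by (rule mat_norm_le_sum)
  finally have Rz: "mat_norm m (\<lambda>r s. R o\<^sub>L z r s) \<le> U * Y + 2 * \<delta>"
    using n k(2) qz by (simp add: R_def)
  have "norm (\<Sum>i\<in>I. (R o\<^sub>L b i) \<otimes>\<^sub>o section_op m (f i))
      \<le> mat_norm m (\<lambda>r s. \<Sum>i\<in>I. coord (blinfun_apply (f i) (unit_ell2 s)) r *\<^sub>C (R o\<^sub>L b i))"
    by (rule norm_tensor_section_le) (use Rb fb in auto)
  also have "\<dots> = mat_norm m (\<lambda>r s. R o\<^sub>L z r s)"
    by (intro mat_norm_cong blinfun_eqI)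
      (simp add: z_def blinfun.sum_left blinfun.sum_right scaleC_blinfun.rep_eq bounded_opsD[OF R(1)])
  finally have sec: "norm (\<Sum>i\<in>I. (R o\<^sub>L b i) \<otimes>\<^sub>o section_op m (f i)) \<le> U * Y + 2 * \<delta>" using Rz by linarith
  have sb: "section_op m (f i) \<in> bounded_ops" "f i - section_op m (f i) \<in> bounded_ops" if "i \<in> I" for i
    using fb[OF that] by (auto intro!: comp_bounded_ops bounded_ops_arith(5))
  have "(\<Sum>i\<in>I. (R o\<^sub>L b i) \<otimes>\<^sub>o f i)
      = (\<Sum>i\<in>I. (R o\<^sub>L b i) \<otimes>\<^sub>o section_op m (f i)) + (\<Sum>i\<in>I. (R o\<^sub>L b i) \<otimes>\<^sub>o (f i - section_op m (f i)))"
    unfolding sum.distrib[symmetric]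
  proof (rule sum.cong[OF refl])
    fix i assume i: "i \<in> I"
    show "(R o\<^sub>L b i) \<otimes>\<^sub>o f i = (R o\<^sub>L b i) \<otimes>\<^sub>o section_op m (f i) + (R o\<^sub>L b i) \<otimes>\<^sub>o (f i - section_op m (f i))"
      by (subst tensor_op_add_right[OF Rb[OF i] sb[OF i], symmetric]) simp
  qed
  then have "norm (\<Sum>i\<in>I. (R o\<^sub>L b i) \<otimes>\<^sub>o f i) \<le> norm (\<Sum>i\<in>I. (R o\<^sub>L b i) \<otimes>\<^sub>o section_op m (f i))
      + norm (\<Sum>i\<in>I. (R o\<^sub>L b i) \<otimes>\<^sub>o (f i - section_op m (f i)))"
    by (simp add: norm_triangle_ineq)
  also have "norm (\<Sum>i\<in>I. (R o\<^sub>L b i) \<otimes>\<^sub>o (f i - section_op m (f i))) \<le> (\<Sum>i\<in>I. norm (b i) * (\<delta> / (\<beta> + 1)))"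
  proof (rule order_trans[OF norm_sum sum_mono])
    fix i assume i: "i \<in> I"
    have "norm ((R o\<^sub>L b i) \<otimes>\<^sub>o (f i - section_op m (f i))) \<le> norm (R o\<^sub>L b i) * norm (f i - section_op m (f i))"
      by (rule norm_tensor_op_le[OF Rb[OF i] sb(2)[OF i]])
    also have "\<dots> \<le> norm (b i) * (\<delta> / (\<beta> + 1))"
      using m[OF i] Rb_norm[of i] by (intro mult_mono) auto
    finally show "norm ((R o\<^sub>L b i) \<otimes>\<^sub>o (f i - section_op m (f i))) \<le> norm (b i) * (\<delta> / (\<beta> + 1))" .
  qed
  also have "(\<Sum>i\<in>I. norm (b i) * (\<delta> / (\<beta> + 1))) = \<beta> * (\<delta> / (\<beta> + 1))"
    by (simp only: \<beta>_def sum_distrib_right)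
  also have "\<beta> * (\<delta> / (\<beta> + 1)) \<le> \<delta>"
    using \<beta> \<delta>(1) by (simp add: field_simps)
  finally have Rf: "norm (\<Sum>i\<in>I. (R o\<^sub>L b i) \<otimes>\<^sub>o f i) \<le> U * Y + 3 * \<delta>" using sec by linarith
  have "norm (\<Sum>i\<in>I. (R o\<^sub>L b i) \<otimes>\<^sub>o x i) = norm (\<Sum>i\<in>I. (R o\<^sub>L b i) \<otimes>\<^sub>o ?v (f i))"
    using x by (simp add: f_def vu cong: sum.cong)
  also have "\<dots> \<le> V * norm (\<Sum>i\<in>I. (R o\<^sub>L b i) \<otimes>\<^sub>o f i)"
    by (rule norm_tensor_cb_le[OF cb(2) UV(2) FD v]) (use vE ED(1) Rb fF in auto)
  also have "\<dots> \<le> V * (U * Y + 3 * \<delta>)" by (intro mult_left_mono Rf UV)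
  also have "\<dots> = (U * V) * Y + 3 * V * \<delta>" by (simp add: algebra_simps)
  also have "\<dots> \<le> S * Y + e"
  proof (rule add_mono)
    show "(U * V) * Y \<le> S * Y" by (rule mult_right_mono[OF UV(3)]) (simp add: Y_def)
    have "3 * V * \<delta> \<le> 4 * V * \<delta>" using UV(2) \<delta>(1) by (intro mult_right_mono) auto
    then show "3 * V * \<delta> \<le> e" using \<delta>(2) by linarith
  qed
  finally show ?thesis unfolding R_def Y_def by blast
qed

end

context calkin_operator_space
begin

text \<open>The space \<open>E\<close> in the hypothesis only has to contain \<open>Z\<close>: it
  will be the span of \<open>Z\<close> for general \<open>X\<close>, and \<open>X\<close> itself in
  the finite-dimensional case.\<close>

lemma quotient_norm_le:
  assumes S: "0 \<le> S" and SK: "\<And>Z. finite Z \<Longrightarrow> Z \<subseteq> X \<Longrightarrow> \<exists>E. operator_space E \<and> Z \<subseteq> E \<and> d_SK E \<le> ennreal S"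
    and t: "t \<in> BX"
  shows "quotient_norm (coset KX t) \<le> S * norm (Q t)"
proof (rule field_le_epsilon)
  fix e :: real assume e: "0 < e"
  define N where "N = norm (Q t)"
  \<comment> \<open>The errors add up to \<open>\<delta> * (2 + S + N + \<delta>)\<close>, which is
    at most \<open>\<delta> * (3 + S + N)\<close> because \<open>\<delta> \<le> 1\<close>.\<close>
  define \<delta> where "\<delta> = min 1 (e / (3 + S + N))"
  have N: "0 \<le> N" by (simp add: N_def)
  have \<delta>: "0 < \<delta>" "\<delta> \<le> 1" "\<delta> * (3 + S + N) \<le> e"
  proof -
    show "0 < \<delta>" using e S N by (simp add: \<delta>_def)
    show "\<delta> \<le> 1" by (simp add: \<delta>_def)
    have "\<delta> * (3 + S + N) \<le> (e / (3 + S + N)) * (3 + S + N)" using S N by (intro mult_right_mono) (auto simp: \<delta>_def)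
    then show "\<delta> * (3 + S + N) \<le> e" using S N by simp
  qed
  obtain F :: "((nat ell2 \<Rightarrow>\<^sub>L nat ell2) \<times> ('h \<Rightarrow>\<^sub>L 'h)) set" and b x where
    F0: "finite F" "\<forall>i\<in>F. b i \<in> bounded_ops" "\<forall>i\<in>F. x i \<in> X" "norm (t - (\<Sum>i\<in>F. b i \<otimes>\<^sub>o x i)) < \<delta>"
    using min_tensor_approx[OF t \<delta>(1) subset_refl XD(1,2)] by blast
  have F: "finite F" "\<And>i. i \<in> F \<Longrightarrow> b i \<in> bounded_ops" "\<And>i. i \<in> F \<Longrightarrow> x i \<in> X"
    "norm (t - (\<Sum>i\<in>F. b i \<otimes>\<^sub>o x i)) < \<delta>" using F0 by blast+
  let ?t0 = "\<Sum>i\<in>F. b i \<otimes>\<^sub>o x i"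
  have xb: "x i \<in> bounded_ops" if "i \<in> F" for i using F(3)[OF that] by (rule X_bounded)
  have t0: "?t0 \<in> BX" using F by (intro tensor_sum_BX)
  obtain E where E: "operator_space E" "x ` F \<subseteq> E" "d_SK E \<le> ennreal S"
    using SK[of "x ` F"] F(1,3) by blast
  note E(3)
  also have "ennreal S < ennreal (S + \<delta>)" using S \<delta>(1) by (simp add: ennreal_less_iff)
  finally have less: "d_SK E < ennreal (S + \<delta>)" .
  obtain n where n: "norm (\<Sum>i\<in>F. (coord_proj (- {..<n}) o\<^sub>L b i) \<otimes>\<^sub>o x i)
      \<le> (S + \<delta>) * norm (\<Sum>i\<in>F. q (b i) \<otimes>\<^sub>o x i) + \<delta>"
  proof -
    have "x i \<in> E" if "i \<in> F" for i using that E(2) by blast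
    then have "\<exists>n. norm (\<Sum>i\<in>F. (coord_proj (- {..<n}) o\<^sub>L b i) \<otimes>\<^sub>o x i)
        \<le> (S + \<delta>) * norm (\<Sum>i\<in>F. q (b i) \<otimes>\<^sub>o x i) + \<delta>"
      using S \<delta>(1) by (intro lift_SK[OF E(1) less _ F(1,2)]) auto
    then show thesis using that by blast
  qed
  \<comment> \<open>The part of the sum living on the first \<open>n\<close> coordinates lies in
    \<open>KX\<close> and may be subtracted from \<open>t\<close>.\<close>
  define \<kappa> where "\<kappa> = (\<Sum>i\<in>F. (coord_proj {..<n} o\<^sub>L b i) \<otimes>\<^sub>o x i)"
  have \<kappa>: "\<kappa> \<in> KX"
    unfolding \<kappa>_def using F coord_proj_compact[of "{..<n}"]
    by (intro csubspace_sum[OF csubspace_min_tensor] tensor_op_min_tensor compact_ops_comp_right) auto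
  have "?t0 = (\<Sum>i\<in>F. (coord_proj (- {..<n}) o\<^sub>L b i) \<otimes>\<^sub>o x i) + \<kappa>"
    unfolding \<kappa>_def sum.distrib[symmetric]
  proof (rule sum.cong[OF refl])
    fix i assume i: "i \<in> F"
    have "b i = (coord_proj (- {..<n}) o\<^sub>L b i) + (coord_proj {..<n} o\<^sub>L b i)"
      by (rule blinfun_eqI) (simp add: blinfun.add_left coord_proj_Compl del: Compl_lessThan)
    then show "b i \<otimes>\<^sub>o x i = (coord_proj (- {..<n}) o\<^sub>L b i) \<otimes>\<^sub>o x i + (coord_proj {..<n} o\<^sub>L b i) \<otimes>\<^sub>o x i"
      using tensor_op_add_left[of "coord_proj (- {..<n}) o\<^sub>L b i" "coord_proj {..<n} o\<^sub>L b i" "x i"] F(2)[OF i] xb[OF i]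
      by simp
  qed
  then have eq: "t + (- \<kappa>) = (t - ?t0) + (\<Sum>i\<in>F. (coord_proj (- {..<n}) o\<^sub>L b i) \<otimes>\<^sub>o x i)" by simp
  have Qt0: "norm (\<Sum>i\<in>F. q (b i) \<otimes>\<^sub>o x i) \<le> N + \<delta>"
  proof -
    have Qs: "(\<Sum>i\<in>F. q (b i) \<otimes>\<^sub>o x i) = Q ?t0" by (rule Q_sum[symmetric]) (use F in auto)
    have "norm (Q t - Q ?t0) \<le> norm (t - ?t0)"
      using norm_Q_le[OF BX_sub(5)[OF t t0]] Q_D(4)[OF t t0] by simp
    then show ?thesis
      unfolding Qs N_def using F(4) norm_triangle_ineq4[of "Q t" "Q t - Q ?t0"] by simp
  qed
  have "quotient_norm (coset KX t) \<le> norm (t + (- \<kappa>))"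
    by (rule norm_quotient(4)[OF csubspace_min_tensor KX_sub(4)[OF \<kappa>]])
  also have "\<dots> \<le> norm (t - ?t0) + norm (\<Sum>i\<in>F. (coord_proj (- {..<n}) o\<^sub>L b i) \<otimes>\<^sub>o x i)"
    unfolding eq by (rule norm_triangle_ineq)
  also have "\<dots> \<le> \<delta> + ((S + \<delta>) * (N + \<delta>) + \<delta>)"
  proof (intro add_mono order_trans[OF n] add_right_mono mult_left_mono Qt0)
    show "norm (t - ?t0) \<le> \<delta>" using F(4) by simp
  qed (use S \<delta> in auto)
  also have "\<dots> = S * N + \<delta> * (2 + S + N + \<delta>)" by (simp add: algebra_simps)
  also have "\<dots> \<le> S * N + \<delta> * (3 + S + N)"
    using \<delta> by (intro add_left_mono mult_left_mono) auto
  finally show "quotient_norm (coset KX t) \<le> S * norm (Q t) + e" using \<delta>(3) by (simp add: N_def)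
qed

text \<open>The estimate of the quotient norm gives both halves of exactness: an element of the
  kernel has distance 0 from the closed space \<open>KX\<close>, and lifts of controlled norm allow
  the approximation of \<open>y\<close> by finite sums to be iterated.\<close>

lemma exact_if_SK_bounded:
  assumes S: "0 \<le> S" and SK: "\<And>Z. finite Z \<Longrightarrow> Z \<subseteq> X \<Longrightarrow> \<exists>E. operator_space E \<and> Z \<subseteq> E \<and> d_SK E \<le> ennreal S"
  shows "exact_operator_space \<pi> X" "ex \<pi> X \<le> ennreal S"
proof -
  have le: "quotient_norm (coset KX t) \<le> S * norm (Q t)" if "t \<in> BX" for t
    by (rule quotient_norm_le[OF S _ that]) (rule SK)
  have lift: "\<exists>t'\<in>BX. Q t' = Q t \<and> norm t' \<le> S * norm (Q t) + e" if t: "t \<in> BX" and e: "0 < e" for t e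
  proof -
    obtain w where w: "w \<in> KX" "norm (t + w) < quotient_norm (coset KX t) + e"
      using norm_quotient(2)[OF csubspace_min_tensor e] by blast
    have wB: "w \<in> BX" using w(1) KX_subset by blast
    have "t + w \<in> BX" "Q (t + w) = Q t"
      using BX_sub(2)[OF t wB] Q_D(1)[OF t wB] Q_KX[OF w(1)] by auto
    then show ?thesis using w(2) le[OF t] by (intro bexI[of _ "t + w"]) auto
  qed
  have ker: "{t \<in> BX. Q t = 0} = KX"
  proof
    show "KX \<subseteq> {t \<in> BX. Q t = 0}" using KX_subset Q_KX by auto
    show "{t \<in> BX. Q t = 0} \<subseteq> KX"
    proof clarify
      fix t assume t: "t \<in> BX" "Q t = 0"
      have "t \<in> closure KX"
        unfolding closure_approachable
      proof (intro allI impI)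
        fix e :: real assume e: "0 < e"
        obtain w where w: "w \<in> KX" "norm (t + w) < quotient_norm (coset KX t) + e"
          using norm_quotient(2)[OF csubspace_min_tensor e] by blast
        then have "norm (t + w) < e" using le[OF t(1)] t(2) by simp
        then have "dist (- w) t < e"
          by (metis add.inverse_inverse diff_minus_eq_add dist_commute dist_norm)
        then show "\<exists>y\<in>KX. dist y t < e" using KX_sub(4)[OF w(1)] by blast
      qed
      then show "t \<in> KX" using closed_min_tensor closure_closed by blast
    qed
  qed
  have surj: "y \<in> Q ` BX" if y: "y \<in> CX" for y
  proof -
    have "\<exists>t\<in>BX. Q t = y \<and> norm t \<le> 2 * (2 * S + 1) * norm y"
    proof (rule approximate_lifting[OF csubspace_min_tensor closed_min_tensor Q_linear Q_cont csubspace_min_tensor Q_image_subset _ _ y])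
      fix y assume y: "y \<in> CX"
      \<comment> \<open>A finite sum within \<open>norm y / 2\<close> of \<open>y\<close> has norm
        at most \<open>2 * norm y\<close>; lifting it costs the factor \<open>S\<close> and an
        excess of \<open>norm y / 2\<close>, which is covered by \<open>2 * S + 1\<close>.\<close>
      show "\<exists>t\<in>BX. norm t \<le> (2 * S + 1) * norm y \<and> norm (y - Q t) \<le> norm y / 2"
      proof (cases "y = 0")
        case True
        then show ?thesis using BX_sub(1) Q_D(3) by (intro bexI[of _ 0]) auto
      next
        case False
        then have e: "0 < norm y / 2" by simp
        have CB: "calkin_algebra \<pi> \<subseteq> bounded_ops" by (auto simp: calkin_algebra_eq)
        obtain F :: "(('k \<Rightarrow>\<^sub>L 'k) \<times> ('h \<Rightarrow>\<^sub>L 'h)) set" and a x where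
          F0: "finite F" "\<forall>i\<in>F. a i \<in> calkin_algebra \<pi>" "\<forall>i\<in>F. x i \<in> X"
            "norm (y - (\<Sum>i\<in>F. a i \<otimes>\<^sub>o x i)) < norm y / 2"
          using min_tensor_approx[OF y e CB XD(1,2)] by blast
        have F: "finite F" "\<And>i. i \<in> F \<Longrightarrow> a i \<in> calkin_algebra \<pi>" "\<And>i. i \<in> F \<Longrightarrow> x i \<in> X"
          "norm (y - (\<Sum>i\<in>F. a i \<otimes>\<^sub>o x i)) < norm y / 2" using F0 by blast+
        have "\<forall>i\<in>F. \<exists>b. b \<in> bounded_ops \<and> a i = q b" using F(2) by (auto simp: calkin_algebra_eq)
        then obtain b where b: "\<And>i. i \<in> F \<Longrightarrow> b i \<in> bounded_ops" "\<And>i. i \<in> F \<Longrightarrow> a i = q (b i)" by metis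
        have tB: "(\<Sum>i\<in>F. b i \<otimes>\<^sub>o x i) \<in> BX" using b(1) F(3) by (rule tensor_sum_BX)
        have Qt: "Q (\<Sum>i\<in>F. b i \<otimes>\<^sub>o x i) = (\<Sum>i\<in>F. a i \<otimes>\<^sub>o x i)"
          using b F(3) by (simp add: Q_sum)
        obtain t where t: "t \<in> BX" "Q t = (\<Sum>i\<in>F. a i \<otimes>\<^sub>o x i)" "norm t \<le> S * norm (\<Sum>i\<in>F. a i \<otimes>\<^sub>o x i) + norm y / 2"
          using lift[OF tB e] unfolding Qt by blast
        have "norm (\<Sum>i\<in>F. a i \<otimes>\<^sub>o x i) \<le> norm y + norm (y - (\<Sum>i\<in>F. a i \<otimes>\<^sub>o x i))"
          using norm_triangle_ineq4[of y "y - (\<Sum>i\<in>F. a i \<otimes>\<^sub>o x i)"] by simp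
        then have "norm (\<Sum>i\<in>F. a i \<otimes>\<^sub>o x i) \<le> 2 * norm y" using F(4) norm_ge_zero[of y] by linarith
        then have "S * norm (\<Sum>i\<in>F. a i \<otimes>\<^sub>o x i) \<le> S * (2 * norm y)" by (rule mult_left_mono[OF _ S])
        moreover have "(2 * S + 1) * norm y = S * (2 * norm y) + norm y" by (simp add: algebra_simps)
        ultimately have "norm t \<le> (2 * S + 1) * norm y" using t(3) norm_ge_zero[of y] by linarith
        then show ?thesis using t F(4) by (intro bexI[of _ t]) auto
      qed
    qed (use S in simp)
    then show ?thesis by blast
  qed
  then have im: "Q ` BX = CX" using Q_image_subset by blast
  show exact: "exact_operator_space \<pi> X"
    unfolding exact_operator_space_def using ker im by blast
  show "ex \<pi> X \<le> ennreal S"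
    unfolding ex_def using exact
  proof (simp, intro SUP_least)
    fix y assume y: "y \<in> {y \<in> CX. norm y \<le> 1}"
    then have "y \<in> Q ` BX" using im by blast
    then obtain t where t: "t \<in> BX" "Q t = y" "inv_into (quotient_space BX KX) (T_map \<pi> X) y = coset KX t"
      by (rule T_inverse)
    have "quotient_norm (coset KX t) \<le> S * norm y" using le[OF t(1)] t(2) by simp
    also have "\<dots> \<le> S * 1" using y S by (intro mult_left_mono) auto
    finally show "ennreal (quotient_norm (inv_into (quotient_space BX KX) (T_map \<pi> X) y)) \<le> ennreal S"
      unfolding t(3) by (simp add: ennreal_leI)
  qed
qed

end

section \<open>The open mapping theorem for closed subspaces\<close>

text \<open>Baire's theorem in the complete space \<open>Y\<close>: if no \<open>A n\<close>
  contained a relative ball, the sets \<open>A n \<inter> Y\<close> would be nowhere dense and yet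
  cover \<open>Y\<close>.\<close>

lemma Baire_union_interior:
  fixes Y :: "'a::complete_space set"
  assumes Y: "closed Y" "Y \<noteq> {}" and A: "\<And>n :: nat. closed (A n)" "Y \<subseteq> (\<Union>n. A n)"
  shows "\<exists>n y r. y \<in> Y \<and> 0 < r \<and> ball y r \<inter> Y \<subseteq> A n"
proof (rule ccontr)
  assume neg: "\<not> ?thesis"
  let ?X = "top_of_set Y"
  have "?X interior_of \<Union>(range (\<lambda>n. A n \<inter> Y)) = {}"
  proof (rule Baire_category_alt)
    have "completely_metrizable_space (euclidean :: 'a topology)" "closedin (euclidean :: 'a topology) Y"
      using Y(1) by (auto simp: completely_metrizable_space_euclidean)
    then show "completely_metrizable_space ?X \<or> locally_compact_space ?X \<and> regular_space ?X"
      by (intro disjI1 completely_metrizable_space_closedin)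
    fix T assume "T \<in> range (\<lambda>n. A n \<inter> Y)"
    then obtain n where T: "T = A n \<inter> Y" by blast
    show "closedin ?X T \<and> ?X interior_of T = {}"
    proof
      show "closedin ?X T" unfolding T using A(1) by (metis Int_commute closedin_closed_Int)
      show "?X interior_of T = {}"
      proof (rule ccontr)
        assume "?X interior_of T \<noteq> {}"
        then obtain y U where U: "openin ?X U" "y \<in> U" "U \<subseteq> T"
          by (meson ex_in_conv interior_of_subset openin_interior_of)
        then obtain r where "0 < r" "ball y r \<inter> Y \<subseteq> U" unfolding openin_contains_ball by blast
        moreover have "y \<in> Y" using U T by blast
        ultimately show False using neg U(3) T by blast
      qed
    qed
  qed auto
  moreover have "\<Union>(range (\<lambda>n. A n \<inter> Y)) = Y" using A(2) by blast
  ultimately have "?X interior_of Y = {}" by simp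
  then show False using Y(2) interior_of_topspace[of ?X] by simp
qed

text \<open>The classical argument for a map that is linear only on the subspace \<open>V\<close>:
  Baire's theorem gives approximate preimages of controlled norm, and
  \<open>approximate_lifting\<close> makes them exact.\<close>

lemma open_mapping:
  fixes Q :: "'a::{complex_normed_vector,complete_space} \<Rightarrow> 'b::{complex_normed_vector,complete_space}"
  assumes V: "csubspace V" "closed V" and Q: "clinear_on V Q" "continuous_on V Q"
    and Y: "csubspace Y" "closed Y" "Q ` V = Y"
  shows "\<exists>C\<ge>0. \<forall>y\<in>Y. \<exists>t\<in>V. Q t = y \<and> norm t \<le> C * norm y"
proof -
  note D = clinear_onD[OF Q(1) V(1)] csubspaceD[OF V(1)]
  let ?A = "\<lambda>n :: nat. closure (Q ` (V \<inter> cball 0 (real n)))"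
  have "Y \<subseteq> (\<Union>n. ?A n)"
  proof
    fix y assume "y \<in> Y"
    then obtain t where t: "t \<in> V" "Q t = y" using Y(3) by blast
    obtain n :: nat where "norm t \<le> real n" using real_arch_simple by blast
    then have "y \<in> Q ` (V \<inter> cball 0 (real n))" using t by auto
    then have "y \<in> ?A n" by (rule subsetD[OF closure_subset])
    then show "y \<in> (\<Union>n. ?A n)" by blast
  qed
  then have "\<exists>n y r. y \<in> Y \<and> 0 < r \<and> ball y r \<inter> Y \<subseteq> ?A n"
    using csubspaceD(1)[OF Y(1)] by (intro Baire_union_interior Y(2)) auto
  then obtain n y0 r where r: "y0 \<in> Y" "0 < r" "ball y0 r \<inter> Y \<subseteq> ?A n" by blast
  \<comment> \<open>Subtracting approximations of \<open>y0 + y\<close> and \<open>y0\<close> moves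
    the ball to the origin and doubles the norm bound.\<close>
  have small: "\<exists>t\<in>V. norm t \<le> 2 * real n \<and> norm (y - Q t) < e" if y: "y \<in> Y" "norm y < r" and e: "0 < e" for y e
  proof -
    have "y0 + y \<in> ?A n" "y0 \<in> ?A n"
      using r y csubspaceD(2)[OF Y(1)] by (auto intro!: subsetD[OF r(3)] simp: dist_norm)
    then have "\<exists>x\<in>Q ` (V \<inter> cball 0 (real n)). dist x (y0 + y) < e / 2"
      "\<exists>x\<in>Q ` (V \<inter> cball 0 (real n)). dist x y0 < e / 2"
      using half_gt_zero[OF e] unfolding closure_approachable by blast+
    then obtain a b where ab: "a \<in> V" "norm a \<le> real n" "dist (Q a) (y0 + y) < e / 2"
      "b \<in> V" "norm b \<le> real n" "dist (Q b) y0 < e / 2" by auto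
    show ?thesis
    proof (intro bexI conjI)
      show "a - b \<in> V" by (rule D(9)[OF ab(1,4)])
      show "norm (a - b) \<le> 2 * real n" using norm_triangle_ineq4[of a b] ab by simp
      have eq: "y - Q (a - b) = (Q b - y0) - (Q a - (y0 + y))" using D(4)[OF ab(1,4)] by simp
      have "norm (y - Q (a - b)) \<le> dist (Q b) y0 + dist (Q a) (y0 + y)"
        unfolding eq dist_norm by (rule norm_triangle_ineq4)
      then show "norm (y - Q (a - b)) < e" using ab(3,6) by linarith
    qed
  qed
  \<comment> \<open>\<open>y\<close> is scaled to norm \<open>r / 2\<close>, where approximate
    preimages have norm at most \<open>2 * real n\<close>; the quotient of the two is
    \<open>C\<close>. The tolerance \<open>r / 4\<close> scales back to
    \<open>norm y / 2\<close>.\<close>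
  define C where "C = 4 * real n / r"
  have C: "0 \<le> C" using r(2) by (simp add: C_def)
  have "\<exists>t\<in>V. norm t \<le> C * norm y \<and> norm (y - Q t) \<le> norm y / 2" if y: "y \<in> Y" for y
  proof (cases "y = 0")
    case True
    then show ?thesis using D(3,5) by (intro bexI[of _ 0]) auto
  next
    case False
    define c where "c = r / (2 * norm y)"
    have c: "0 < c" using False r(2) by (simp add: c_def)
    let ?z = "complex_of_real c *\<^sub>C y"
    have "norm ?z = r / 2" using c False by (simp add: norm_scaleC) (simp add: c_def)
    then have z: "?z \<in> Y" "norm ?z < r" "0 < r / 4"
      using csubspaceD(3)[OF Y(1) y] r(2) by auto
    obtain t where t: "t \<in> V" "norm t \<le> 2 * real n" "norm (?z - Q t) < r / 4"
      using small[OF z] by blast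
    let ?t = "complex_of_real (inverse c) *\<^sub>C t"
    show ?thesis
    proof (intro bexI conjI)
      show "?t \<in> V" by (rule D(7)[OF t(1)])
      have "norm ?t = inverse c * norm t" using c by (simp add: norm_scaleC norm_inverse)
      also have "\<dots> \<le> inverse c * (2 * real n)" using c t(2) by (intro mult_left_mono) auto
      also have "\<dots> = C * norm y" using False r(2) by (simp add: c_def C_def field_simps)
      finally show "norm ?t \<le> C * norm y" .
      have "y - Q ?t = complex_of_real (inverse c) *\<^sub>C (?z - Q t)"
        using c D(2)[OF t(1)] by (simp add: scaleC_diff_right scaleC_scaleC)
      then have "norm (y - Q ?t) = inverse c * norm (?z - Q t)" using c by (simp add: norm_scaleC norm_inverse)
      also have "\<dots> \<le> inverse c * (r / 4)" using c t(3) by (intro mult_left_mono) auto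
      also have "\<dots> = norm y / 2" using False r(2) by (simp add: c_def field_simps)
      finally show "norm (y - Q ?t) \<le> norm y / 2" .
    qed
  qed
  then have "\<exists>t\<in>V. Q t = y \<and> norm t \<le> 2 * C * norm y" if "y \<in> Y" for y
    using approximate_lifting[OF V Q Y(1) _ C] Y(3) that by blast
  then show ?thesis using C by (intro exI[of _ "2 * C"]) auto
qed

section \<open>Consequences of exactness\<close>

context calkin_operator_space
begin

lemma exactD:
  assumes "exact_operator_space \<pi> X"
  shows "{t \<in> BX. Q t = 0} = KX" "Q ` BX = CX"
  using assms by (auto simp: exact_operator_space_def)

text \<open>By exactness all preimages of a point lie in one coset of \<open>KX\<close>.\<close>

lemma coset_quotient_norm_eq:
  assumes ex: "exact_operator_space \<pi> X" and st: "s \<in> BX" "t \<in> BX" "Q s = Q t"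
  shows "quotient_norm (coset KX t) \<le> norm s"
proof -
  have "Q (s - t) = 0" using Q_D(4)[OF st(1,2)] st(3) by simp
  then have "s - t \<in> KX" using exactD(1)[OF ex] BX_sub(5)[OF st(1,2)] by blast
  then have "quotient_norm (coset KX t) \<le> norm (t + (s - t))" by (rule norm_quotient(4)[OF csubspace_min_tensor])
  then show ?thesis by simp
qed

lemma ex_finite:
  assumes ex: "exact_operator_space \<pi> X"
  shows "ex \<pi> X < \<infinity>"
proof -
  obtain C where C: "0 \<le> C" "\<And>y. y \<in> CX \<Longrightarrow> \<exists>t\<in>BX. Q t = y \<and> norm t \<le> C * norm y"
    using open_mapping[OF csubspace_min_tensor closed_min_tensor Q_linear Q_cont csubspace_min_tensor closed_min_tensor exactD(2)[OF ex]]
    by blast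
  have "ex \<pi> X \<le> ennreal C"
    unfolding ex_def using ex
  proof (simp, intro SUP_least)
    fix y assume y: "y \<in> {y \<in> CX. norm y \<le> 1}"
    then have "y \<in> Q ` BX" using exactD(2)[OF ex] by blast
    then obtain t where t: "t \<in> BX" "Q t = y" "inv_into (quotient_space BX KX) (T_map \<pi> X) y = coset KX t"
      by (rule T_inverse)
    obtain s where s: "s \<in> BX" "Q s = y" "norm s \<le> C * norm y" using C(2)[of y] y by blast
    have "quotient_norm (coset KX t) \<le> norm s" using s t by (intro coset_quotient_norm_eq[OF ex]) auto
    also have "\<dots> \<le> C * norm y" by (rule s(3))
    also have "\<dots> \<le> C * 1" using y C(1) by (intro mult_left_mono) auto
    finally show "ennreal (quotient_norm (inv_into (quotient_space BX KX) (T_map \<pi> X) y)) \<le> ennreal C"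
      unfolding t(3) by (simp add: ennreal_leI)
  qed
  also have "\<dots> < \<infinity>" by simp
  finally show ?thesis .
qed

text \<open>\<open>ex\<close> evaluates the quotient norm at the coset chosen by
  \<open>inv_into\<close>. Representatives of that coset of nearly minimal norm are preimages of
  \<open>Q a\<close> and therefore bound the quotient norm of the coset of \<open>a\<close>.\<close>

lemma quotient_norm_le_ex:
  assumes ex: "exact_operator_space \<pi> X" and C: "0 \<le> C" "ex \<pi> X \<le> ennreal C"
    and a: "a \<in> BX" "norm (Q a) \<le> 1"
  shows "quotient_norm (coset KX a) \<le> C"
proof -
  have "Q a \<in> Q ` BX" using a(1) by blast
  then obtain t where t: "t \<in> BX" "Q t = Q a" "inv_into (quotient_space BX KX) (T_map \<pi> X) (Q a) = coset KX t"
    by (rule T_inverse)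
  have "Q a \<in> {y \<in> CX. norm y \<le> 1}" using a exactD(2)[OF ex] by blast
  then have "ennreal (quotient_norm (inv_into (quotient_space BX KX) (T_map \<pi> X) (Q a))) \<le> ex \<pi> X"
    unfolding ex_def using ex by (simp, intro SUP_upper) simp
  then have "ennreal (quotient_norm (coset KX t)) \<le> ennreal C" using C(2) unfolding t(3) by (rule order_trans)
  then have le: "quotient_norm (coset KX t) \<le> C" using C(1) by (simp add: ennreal_le_iff)
  show ?thesis
  proof (rule field_le_epsilon)
    fix e :: real assume e: "0 < e"
    obtain w where w: "w \<in> KX" "norm (t + w) < quotient_norm (coset KX t) + e"
      using norm_quotient(2)[OF csubspace_min_tensor e] by blast
    have wB: "w \<in> BX" using w(1) KX_subset by blast
    have "quotient_norm (coset KX a) \<le> norm (t + w)"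
      by (rule coset_quotient_norm_eq[OF ex BX_sub(2)[OF t(1) wB] a(1)])
        (use Q_D(1)[OF t(1) wB] Q_KX[OF w(1)] t(2) in simp)
    then show "quotient_norm (coset KX a) \<le> C + e" using w(2) le by simp
  qed
qed

end

section \<open>Countable norming sets of basis vectors\<close>

lemma countable_dense_finite_dim:
  fixes E :: "('a::complex_hilbert \<Rightarrow>\<^sub>L 'a) set" and x :: "nat \<Rightarrow> ('a \<Rightarrow>\<^sub>L 'a)"
  assumes x: "\<And>l. l < d \<Longrightarrow> x l \<in> E" and E: "csubspace E"
    and rep: "\<And>e. e \<in> E \<Longrightarrow> e = (\<Sum>l<d. f l e *\<^sub>C x l)"
  shows "\<exists>D\<subseteq>E. countable D \<and> (\<forall>e\<in>E. \<forall>\<epsilon>>0. \<exists>y\<in>D. norm (e - y) < \<epsilon>)"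
proof -
  obtain Z :: "complex set" where Z: "countable Z" "\<And>U. open U \<Longrightarrow> U \<noteq> {} \<Longrightarrow> \<exists>z\<in>Z. z \<in> U"
    using countable_dense_exists by metis
  \<comment> \<open>Coefficient tuples are coded as lists because lists over a countable set are
    countable. A list that is too short only yields some other element of \<open>E\<close>.\<close>
  define D where "D = (\<lambda>zs. \<Sum>l<d. zs ! l *\<^sub>C x l) ` lists Z"
  have "D \<subseteq> E" unfolding D_def using x by (auto intro!: csubspace_sum[OF E] csubspaceD(3)[OF E])
  moreover have "countable D" unfolding D_def using Z(1) by (intro countable_image countable_lists)
  moreover have "\<exists>y\<in>D. norm (e - y) < \<epsilon>" if e: "e \<in> E" and \<epsilon>: "\<epsilon> > 0" for e \<epsilon>
  proof -
    define b where "b = (\<Sum>l<d. norm (x l))"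
    have b: "0 \<le> b" by (simp add: b_def sum_nonneg)
    define \<eta> where "\<eta> = \<epsilon> / (b + 1)"
    have \<eta>: "0 < \<eta>" using \<epsilon> b by (simp add: \<eta>_def)
    have "\<exists>z\<in>Z. z \<in> ball (f l e) \<eta>" for l by (rule Z(2)) (use \<eta> in auto)
    then obtain z where z: "\<And>l. z l \<in> Z" "\<And>l. cmod (f l e - z l) < \<eta>"
      by (metis dist_norm mem_ball)
    let ?y = "\<Sum>l<d. map z [0..<d] ! l *\<^sub>C x l"
    have y: "?y = (\<Sum>l<d. z l *\<^sub>C x l)" by (intro sum.cong) auto
    have "e - ?y = (\<Sum>l<d. f l e *\<^sub>C x l) - (\<Sum>l<d. z l *\<^sub>C x l)" unfolding y using rep[OF e] by simp
    also have "\<dots> = (\<Sum>l<d. (f l e - z l) *\<^sub>C x l)"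
      by (simp only: sum_subtractf scaleC_diff_left)
    finally have "norm (e - ?y) \<le> (\<Sum>l<d. norm ((f l e - z l) *\<^sub>C x l))" by (simp add: norm_sum)
    also have "\<dots> \<le> (\<Sum>l<d. \<eta> * norm (x l))"
      unfolding norm_scaleC using z(2) by (intro sum_mono mult_right_mono) (auto simp: less_imp_le)
    also have "\<dots> = \<eta> * b" by (simp add: b_def sum_distrib_left)
    also have "\<dots> < \<epsilon>" using \<epsilon> b by (simp add: \<eta>_def field_simps)
    finally show ?thesis using z(1) unfolding D_def by (intro bexI[of _ ?y] imageI) auto
  qed
  ultimately show ?thesis by blast
qed

text \<open>A sequence of blocks can only exhaust countably many basis vectors, whereas \<open>some_onb\<close> may be
  uncountable.\<close>

lemma countable_norming_set:
  fixes E D :: "('a::complex_hilbert \<Rightarrow>\<^sub>L 'a) set"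
  assumes E: "E \<subseteq> bounded_ops" and D: "D \<subseteq> E" "countable D" "\<And>e \<epsilon>. e \<in> E \<Longrightarrow> \<epsilon> > 0 \<Longrightarrow> \<exists>y\<in>D. norm (e - y) < \<epsilon>"
  shows "\<exists>A\<subseteq>some_onb. countable A \<and>
    (\<forall>n a C. (\<forall>i<n. \<forall>j<n. a i j \<in> E) \<longrightarrow> 0 \<le> C \<longrightarrow> mbound ({..<n} \<times> A) (entry a) C \<longrightarrow> mat_norm n a \<le> C)"
proof -
  let ?O = "some_onb :: 'a set"
  note onb = orthonormal_basis_some_onb[where 'a='a]
  \<comment> \<open>\<open>G\<close> is a finite certificate that the matrix coded by
    \<open>M\<close> has norm greater than \<open>p\<close>.\<close>
  define P where "P = (\<lambda>n M (p :: rat) G. finite G \<and> G \<subseteq> ?O \<and> \<not> mbound ({..<n} \<times> G) (entry (\<lambda>i j. M ! i ! j)) (of_rat p))"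
  \<comment> \<open>One certificate is fixed for each \<open>n\<close>, \<open>M\<close> and
    \<open>p\<close>, and the empty set where there is none, so that \<open>A\<close> is a countable
    union of finite sets.\<close>
  define W where "W = (\<lambda>n M p. if \<exists>G. P n M p G then SOME G. P n M p G else {})"
  have W: "P n M p (W n M p)" if "P n M p G" for n M p G
    unfolding W_def using that someI[of "P n M p" G] by auto
  have W': "finite (W n M p)" "W n M p \<subseteq> ?O" for n M p
  proof -
    have "finite (W n M p) \<and> W n M p \<subseteq> ?O"
    proof (cases "\<exists>G. P n M p G")
      case True
      then show ?thesis using W unfolding P_def by blast
    next
      case False
      then have "W n M p = {}" unfolding W_def by (rule if_not_P)
      then show ?thesis by simp
    qed
    then show "finite (W n M p)" "W n M p \<subseteq> ?O" by auto
  qed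
  define A where "A = (\<Union>n. \<Union>M\<in>lists (lists D). \<Union>p. W n M p)"
  have "A \<subseteq> ?O" unfolding A_def using W'(2) by blast
  moreover have "countable A"
    unfolding A_def using D(2) W'(1) by (intro countable_UN countable_lists) (auto simp: countable_finite)
  moreover have "mat_norm n a \<le> C"
    if a: "\<forall>i<n. \<forall>j<n. a i j \<in> E" and C: "0 \<le> C" and mb: "mbound ({..<n} \<times> A) (entry a) C" for n a C
  proof (rule ccontr)
    assume "\<not> mat_norm n a \<le> C"
    \<comment> \<open>A rational number strictly between keeps the certificates countable and leaves
      a gap on either side for replacing \<open>a\<close> by a matrix \<open>y\<close> over
      \<open>D\<close>.\<close>
    then obtain p :: rat where p: "C < of_rat p" "of_rat p < mat_norm n a"
      using of_rat_dense[of C "mat_norm n a"] by auto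
    define \<mu> where "\<mu> = min (of_rat p - C) (mat_norm n a - of_rat p)"
    have \<mu>: "0 < \<mu>" using p by (simp add: \<mu>_def)
    \<comment> \<open>The error is spread over \<open>n * n\<close> entries; the added 1 makes the
      total strictly smaller than \<open>\<mu>\<close>.\<close>
    define \<eta> where "\<eta> = \<mu> / (real n * real n + 1)"
    have \<eta>: "0 < \<eta>" "real n * (real n * \<eta>) < \<mu>"
    proof -
      show "0 < \<eta>" using \<mu> by (simp add: \<eta>_def add_nonneg_pos)
      have "real n * (real n * \<eta>) = \<mu> * (real n * real n) / (real n * real n + 1)" by (simp add: \<eta>_def)
      also have "\<dots> < \<mu>"
      proof -
        have "0 < real n * real n + 1" by (simp add: add_nonneg_pos)
        then show ?thesis using \<mu> by (simp add: divide_less_eq distrib_left)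
      qed
      finally show "real n * (real n * \<eta>) < \<mu>" .
    qed
    have "\<exists>y. y \<in> D \<and> norm (a i j - y) < \<eta>" if "i < n" "j < n" for i j
      using D(3)[of "a i j" \<eta>] a that \<eta>(1) by blast
    then obtain y where y: "\<And>i j. i < n \<Longrightarrow> j < n \<Longrightarrow> y i j \<in> D \<and> norm (a i j - y i j) < \<eta>" by metis
    let ?M = "map (\<lambda>i. map (y i) [0..<n]) [0..<n]"
    have M: "?M ! i ! j = y i j" if "i < n" "j < n" for i j using that by simp
    have Mlist: "?M \<in> lists (lists D)" using y by auto
    have ab: "a i j \<in> bounded_ops" "y i j \<in> bounded_ops" "a i j - y i j \<in> bounded_ops" "y i j - a i j \<in> bounded_ops"
      if "i < n" "j < n" for i j
      using a y[OF that] that E D(1) by (auto intro!: bounded_ops_arith(5))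
    have sm: "(\<Sum>i<n. \<Sum>j<n. norm (a i j - y i j)) < \<mu>"
    proof -
      have "(\<Sum>i<n. \<Sum>j<n. norm (a i j - y i j)) \<le> (\<Sum>i<n. \<Sum>j<n. \<eta>)"
        using y by (intro sum_mono) (auto simp: less_imp_le)
      then show ?thesis using \<eta>(2) by simp
    qed
    have ya: "mat_norm n (\<lambda>i j. y i j - a i j) < \<mu>"
      using mat_norm_le_sum[of n "\<lambda>i j. y i j - a i j"] sm by (simp add: norm_minus_commute)
    have ay: "mat_norm n (\<lambda>i j. a i j - y i j) < \<mu>"
      using mat_norm_le_sum[of n "\<lambda>i j. a i j - y i j"] sm by simp
    have "mat_norm n a \<le> mat_norm n y + mat_norm n (\<lambda>i j. a i j - y i j)"
      using mat_norm_add[of n y "\<lambda>i j. a i j - y i j"] by simp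
    then have "of_rat p < mat_norm n y" using ay by (simp add: \<mu>_def)
    moreover have p0: "0 \<le> (of_rat p :: real)" using p(1) C by linarith
    ultimately have "\<not> mbound ({..<n} \<times> ?O) (entry y) (of_rat p)"
      using mat_norm_le_mbound[of n y, OF ab(2) onb p0] by auto
    then obtain F where F: "finite F" "F \<subseteq> {..<n} \<times> ?O"
      "\<And>H. finite H \<Longrightarrow> F \<subseteq> H \<Longrightarrow> \<not> mbound H (entry y) (of_rat p)"
      using mbound_cofinal[of "{..<n} \<times> ?O" "entry y" "of_rat p"] by blast
    define G where "G = snd ` F"
    have G: "finite G" "G \<subseteq> ?O" "F \<subseteq> {..<n} \<times> G" using F(1,2) by (force simp: G_def)+
    have eqM: "mbound ({..<n} \<times> H) (entry (\<lambda>i j. ?M ! i ! j)) K \<longleftrightarrow> mbound ({..<n} \<times> H) (entry y) K" for H K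
      by (rule mbound_cong) (auto simp: M)
    have "\<not> mbound ({..<n} \<times> G) (entry y) (of_rat p)" using F(3)[of "{..<n} \<times> G"] G by simp
    then have "P n ?M p G" unfolding P_def eqM using G by blast
    then have "P n ?M p (W n ?M p)" by (rule W)
    then have no: "\<not> mbound ({..<n} \<times> W n ?M p) (entry y) (of_rat p)" unfolding P_def eqM by blast
    have WA: "W n ?M p \<subseteq> A" unfolding A_def using Mlist by blast
    \<comment> \<open>Over \<open>A\<close> the matrix \<open>y\<close> inherits the bound
      \<open>C\<close> of \<open>a\<close> enlarged by the gap, that is \<open>p\<close>, which its
      certificate excludes.\<close>
    have "mbound ({..<n} \<times> ?O) (entry (\<lambda>i j. y i j - a i j)) (mat_norm n (\<lambda>i j. y i j - a i j))"
      by (rule mbound_entry_le[OF _ orthonormal_some_onb]) (use ab in auto)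
    then have "mbound ({..<n} \<times> A) (entry (\<lambda>i j. y i j - a i j)) (of_rat p - C)"
      using \<open>A \<subseteq> ?O\<close> ya by (elim mbound_mono[OF mbound_subset]) (auto simp: \<mu>_def)
    from mbound_add[OF mb this]
    have "mbound ({..<n} \<times> A) (entry y) (of_rat p)"
      by (simp add: blinfun.diff_left cinner_diff_right)
    then have "mbound ({..<n} \<times> W n ?M p) (entry y) (of_rat p)"
      by (rule mbound_subset) (use WA in auto)
    then show False using no by blast
  qed
  ultimately show ?thesis by blast
qed

section \<open>Compressions\<close>

text \<open>The matrix of \<open>e\<close> with respect to \<open>G\<close>, placed at the
  coordinates assigned by \<open>\<iota>\<close>. The transplantation makes it an element of
  \<open>K\<close>, as \<open>d_SK\<close> demands of its competitors.\<close>

definition compression :: "('a \<Rightarrow> nat) \<Rightarrow> 'a set \<Rightarrow> ('a::complex_hilbert \<Rightarrow>\<^sub>L 'a) \<Rightarrow> (nat ell2 \<Rightarrow>\<^sub>L nat ell2)" where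
  "compression \<iota> G e = (\<Sum>g\<in>G. \<Sum>h\<in>G. cinner g (blinfun_apply e h) *\<^sub>C rank_one (unit_ell2 (\<iota> g)) (unit_ell2 (\<iota> h)))"

lemma compression_compact: "compression \<iota> G e \<in> compact_ops"
  unfolding compression_def by (intro compact_ops_sum compact_ops_arith(3) rank_one_compact)

lemma compression_linear:
  "compression \<iota> G (x + y) = compression \<iota> G x + compression \<iota> G y"
  "compression \<iota> G (c *\<^sub>C x) = c *\<^sub>C compression \<iota> G x"
  by (simp_all add: compression_def blinfun.add_left cinner_add_right scaleC_add_left sum.distrib
      scaleC_blinfun.rep_eq cinner_scaleC_right scaleC_sum_right scaleC_scaleC)

lemma coord_compression:
  "coord (blinfun_apply (compression \<iota> G e) (unit_ell2 s)) r
    = (\<Sum>g\<in>G. \<Sum>h\<in>G. if r = \<iota> g \<and> s = \<iota> h then cinner g (blinfun_apply e h) else 0)"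
  unfolding compression_def blinfun.sum_left coord_sum
  by (intro sum.cong refl)
    (auto simp: scaleC_blinfun.rep_eq rank_one_apply coord_scaleC coord_unit cinner_unit)

lemma coord_compression_inside:
  assumes G: "finite G" "inj_on \<iota> G" "g \<in> G" "h \<in> G"
  shows "coord (blinfun_apply (compression \<iota> G e) (unit_ell2 (\<iota> h))) (\<iota> g) = cinner g (blinfun_apply e h)"
proof -
  have "coord (blinfun_apply (compression \<iota> G e) (unit_ell2 (\<iota> h))) (\<iota> g)
      = (\<Sum>g'\<in>G. if g = g' then \<Sum>h'\<in>G. if h = h' then cinner g' (blinfun_apply e h') else 0 else 0)"
    unfolding coord_compression
  proof (intro sum.cong refl)
    fix g' assume "g' \<in> G"
    then have "(\<Sum>h'\<in>G. if \<iota> g = \<iota> g' \<and> \<iota> h = \<iota> h' then cinner g' (blinfun_apply e h') else 0)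
        = (\<Sum>h'\<in>G. if g = g' \<and> h = h' then cinner g' (blinfun_apply e h') else 0)"
      using G by (intro sum.cong refl) (auto simp: inj_on_eq_iff)
    then show "(\<Sum>h'\<in>G. if \<iota> g = \<iota> g' \<and> \<iota> h = \<iota> h' then cinner g' (blinfun_apply e h') else 0)
        = (if g = g' then \<Sum>h'\<in>G. if h = h' then cinner g' (blinfun_apply e h') else 0 else 0)" by simp
  qed
  then show ?thesis using G by simp
qed

lemma coord_compression_outside:
  "r \<notin> \<iota> ` G \<or> s \<notin> \<iota> ` G \<Longrightarrow> coord (blinfun_apply (compression \<iota> G e) (unit_ell2 s)) r = 0"
  unfolding coord_compression by (intro sum.neutral ballI) auto

text \<open>Up to relabelling, compression restricts the scalar matrix of \<open>a\<close> to
  \<open>{..<n} \<times> G\<close> and fills up with zeros.\<close>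

lemma mat_norm_compression_iff:
  assumes G: "finite G" "inj_on \<iota> G" and C: "0 \<le> C"
  shows "mat_norm n (\<lambda>i j. compression \<iota> G (a i j)) \<le> C \<longleftrightarrow> mbound ({..<n} \<times> G) (entry a) C"
proof -
  let ?c = "\<lambda>i j. compression \<iota> G (a i j)"
  have c: "?c i j \<in> bounded_ops" for i j by (rule compact_ops_bounded[OF compression_compact])
  let ?\<phi> = "\<lambda>u. (fst u, unit_ell2 (\<iota> (snd u)))"
  let ?\<psi> = "\<lambda>u. (fst u, inv_into G (unit_ell2 \<circ> \<iota>) (snd u))"
  have inj: "inj_on (unit_ell2 \<circ> \<iota>) G"
    using G(2) inj_unit by (intro comp_inj_on) (auto intro: inj_on_subset)
  have e: "entry ?c (?\<phi> u) (?\<phi> v) = entry a u v" if "snd u \<in> G" "snd v \<in> G" for u v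
    using that by (simp add: cinner_unit coord_compression_inside[OF G])
  let ?J = "{..<n} \<times> unit_ell2 ` \<iota> ` G"
  show ?thesis
  proof
    assume "mat_norm n ?c \<le> C"
    then have "mbound ({..<n} \<times> range unit_ell2) (entry ?c) C"
      by (intro mbound_mono[OF mbound_entry_le[OF c orthonormal_basisD[OF orthonormal_basis_unit]]])
    then show "mbound ({..<n} \<times> G) (entry a) C"
    proof (rule mbound_reindex[where \<phi>="?\<phi>"])
      show "inj_on ?\<phi> ({..<n} \<times> G)" using inj by (auto simp: inj_on_def)
    qed (use e in auto)
  next
    assume M: "mbound ({..<n} \<times> G) (entry a) C"
    have J: "mbound ?J (entry ?c) C"
    proof (rule mbound_reindex[OF M, where \<phi>="?\<psi>"])
      have inv: "inv_into G (unit_ell2 \<circ> \<iota>) w \<in> G" "unit_ell2 (\<iota> (inv_into G (unit_ell2 \<circ> \<iota>) w)) = w"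
        if "w \<in> unit_ell2 ` \<iota> ` G" for w
        using that inv_into_into[of w "unit_ell2 \<circ> \<iota>" G] f_inv_into_f[of w "unit_ell2 \<circ> \<iota>" G]
        by (auto simp: image_comp)
      show "?\<psi> ` ?J \<subseteq> {..<n} \<times> G" using inv(1) by auto
      show "inj_on ?\<psi> ?J"
      proof (rule inj_onI)
        fix u v assume uv: "u \<in> ?J" "v \<in> ?J" "?\<psi> u = ?\<psi> v"
        have "snd u \<in> unit_ell2 ` \<iota> ` G" "snd v \<in> unit_ell2 ` \<iota> ` G" using uv(1,2) by auto
        note s = inv(2)[OF this(1)] inv(2)[OF this(2)]
        have i: "fst u = fst v"
          "inv_into G (unit_ell2 \<circ> \<iota>) (snd u) = inv_into G (unit_ell2 \<circ> \<iota>) (snd v)"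
          using uv(3) by (simp_all only: prod.inject)
        have "snd u = snd v" using s unfolding i(2) by (rule trans[OF sym])
        with i(1) show "u = v" by (rule prod_eqI)
      qed
      fix u v assume uv: "u \<in> ?J" "v \<in> ?J"
      have s: "snd u \<in> unit_ell2 ` \<iota> ` G" "snd v \<in> unit_ell2 ` \<iota> ` G" using uv by auto
      have "?\<phi> (?\<psi> u) = u" "?\<phi> (?\<psi> v) = v" using inv(2)[OF s(1)] inv(2)[OF s(2)] by (simp_all add: prod_eq_iff)
      then show "entry ?c u v = entry a (?\<psi> u) (?\<psi> v)"
        using e[of "?\<psi> u" "?\<psi> v"] inv(1)[OF s(1)] inv(1)[OF s(2)] by simp
    qed
    have "mbound ({..<n} \<times> range unit_ell2) (entry ?c) C"
    proof (rule mbound_zero_extend[OF J _ C])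
      fix u v assume uv: "u \<in> {..<n} \<times> range unit_ell2" "v \<in> {..<n} \<times> range unit_ell2" "u \<notin> ?J \<or> v \<notin> ?J"
      obtain i r where u: "u = (i, unit_ell2 r)" "i < n" using uv(1) by auto
      obtain j s where v: "v = (j, unit_ell2 s)" "j < n" using uv(2) by auto
      have "r \<notin> \<iota> ` G \<or> s \<notin> \<iota> ` G" using uv(3) u v by auto
      then show "entry ?c u v = 0" by (simp add: u v cinner_unit coord_compression_outside)
    qed
    then show "mat_norm n ?c \<le> C" by (rule mat_norm_le_mbound[OF c orthonormal_basis_unit C])
  qed
qed

lemma image_cspan:
  assumes "\<And>x y. u (x + y) = u x + u y" "\<And>c x. u (c *\<^sub>C x) = c *\<^sub>C u x"
  shows "u ` cspan S = cspan (u ` S)"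
proof
  have "cspan S \<subseteq> {x. u x \<in> cspan (u ` S)}"
    using cspan_superset[of "u ` S"] by (intro cspan_minimal csubspace_vimage_linear csubspace_cspan assms) auto
  then show "u ` cspan S \<subseteq> cspan (u ` S)" by blast
  note D = csubspaceD[OF csubspace_cspan[of S]]
  have u0: "u 0 = 0" using assms(2)[of 0 0] by simp
  show "cspan (u ` S) \<subseteq> u ` cspan S"
  proof (rule cspan_minimal)
    show "u ` S \<subseteq> u ` cspan S" by (intro image_mono cspan_superset)
    show "csubspace (u ` cspan S)"
      unfolding csubspace_def
    proof (intro conjI ballI allI)
      show "0 \<in> u ` cspan S" using D(1) u0 by (metis image_eqI)
    qed (use D in \<open>auto simp flip: assms\<close>)
  qed
qed

text \<open>The compression is completely contractive, it is injective on \<open>E\<close> by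
  \<open>sep\<close>, and its image competes in \<open>d_SK\<close>. Hence its inverse has cb norm
  greater than \<open>C\<close>; a matrix showing this is pulled back to \<open>E\<close>.\<close>

lemma d_SK_witness:
  fixes E :: "('h::complex_hilbert \<Rightarrow>\<^sub>L 'h) set" and \<iota> :: "'h \<Rightarrow> nat"
  assumes E: "operator_space E" "cfinite_dim E" and G: "finite G" "inj_on \<iota> G" "G \<subseteq> some_onb"
    and sep: "\<And>e. e \<in> E \<Longrightarrow> (\<And>g h. g \<in> G \<Longrightarrow> h \<in> G \<Longrightarrow> cinner g (blinfun_apply e h) = 0) \<Longrightarrow> e = 0"
    and less: "ennreal C < d_SK E"
  shows "\<exists>k a. 0 < k \<and> (\<forall>i<k. \<forall>j<k. a i j \<in> E) \<and> mbound ({..<k} \<times> G) (entry a) 1 \<and> C < mat_norm k a"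
proof -
  let ?u = "compression \<iota> G"
  let ?F = "?u ` E" and ?v = "inv_into E ?u"
  have ED: "E \<subseteq> bounded_ops" "csubspace E" using E(1) by (auto simp: operator_space_def)
  obtain S where S: "finite S" "E = cspan S" using E(2) by (auto simp: cfinite_dim_def)
  have lin: "clinear_on E ?u" by (simp add: clinear_on_def compression_linear)
  have zero: "e = 0" if e: "e \<in> E" "?u e = 0" for e
  proof (rule sep[OF e(1)])
    fix g h assume gh: "g \<in> G" "h \<in> G"
    show "cinner g (blinfun_apply e h) = 0"
      using coord_compression_inside[OF G(1,2) gh, of e] e(2) by (simp add: zero_ell2.rep_eq)
  qed
  have inj: "inj_on ?u E"
  proof (rule inj_onI)
    fix x y assume xy: "x \<in> E" "y \<in> E" "?u x = ?u y"
    then have "?u (x - y) = 0" using clinear_onD(4)[OF lin ED(2)] by simp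
    then have "x - y = 0" using zero csubspaceD(5)[OF ED(2) xy(1,2)] by blast
    then show "x = y" by simp
  qed
  have bij: "bij_betw ?u E ?F" using inj by (simp add: bij_betw_def)
  have F_eq: "?F = cspan (?u ` S)" unfolding S(2) by (rule image_cspan) (simp_all add: compression_linear)
  have "operator_space ?F"
    unfolding F_eq using S(1) by (intro operator_space_cspan) (auto intro: compact_ops_bounded compression_compact)
  moreover have "?F \<subseteq> compact_ops" using compression_compact by blast
  ultimately have "d_SK E \<le> d_cb E ?F" unfolding d_SK_def by (intro INF_lower) auto
  also have "\<dots> \<le> cb_norm E ?u * cb_norm ?F ?v" unfolding d_cb_def using lin bij by (intro INF_lower) auto
  also have "\<dots> \<le> ennreal 1 * cb_norm ?F ?v"
  proof (intro mult_right_mono cb_norm_le_ennreal)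
    fix n :: nat and a assume a: "\<And>i j. i < n \<Longrightarrow> j < n \<Longrightarrow> a i j \<in> E" "mat_norm n a \<le> 1"
    have "mbound ({..<n} \<times> some_onb) (entry a) 1"
      using a ED(1) by (intro mbound_mono[OF mbound_entry_le[OF _ orthonormal_some_onb]]) auto
    then have "mbound ({..<n} \<times> G) (entry a) 1" by (rule mbound_subset) (use G(3) in auto)
    then show "mat_norm n (\<lambda>i j. ?u (a i j)) \<le> 1" using mat_norm_compression_iff[OF G(1,2), of 1 n a] by simp
  qed auto
  finally have "ennreal C < cb_norm ?F ?v" using less by simp
  then obtain k b where b: "1 \<le> k" "\<forall>i<k. \<forall>j<k. b i j \<in> ?F" "mat_norm k b \<le> 1"
    "ennreal C < ennreal (mat_norm k (\<lambda>i j. ?v (b i j)))"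
    unfolding cb_norm_def less_SUP_iff by auto
  have uv: "?u (?v y) = y" "?v y \<in> E" if "y \<in> ?F" for y
    using that by (auto intro: f_inv_into_f inv_into_into)
  have "mat_norm k (\<lambda>i j. ?u (?v (b i j))) = mat_norm k b" using b(2) uv(1) by (intro mat_norm_cong) auto
  then have "mbound ({..<k} \<times> G) (entry (\<lambda>i j. ?v (b i j))) 1"
    using mat_norm_compression_iff[OF G(1,2), of 1 k "\<lambda>i j. ?v (b i j)"] b(3) by simp
  moreover have "C < mat_norm k (\<lambda>i j. ?v (b i j))"
    using b(4) mat_norm_nonneg ennreal_less_iff ennreal_leI leD linorder_le_less_linear by blast
  ultimately show ?thesis using b(1,2) uv(2) by (intro exI[of _ k] exI[of _ "\<lambda>i j. ?v (b i j)"]) auto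
qed

section \<open>Block diagonal operators\<close>

text \<open>Block \<open>n\<close> occupies the coordinates coded by the pairs \<open>(n, i)\<close>
  with \<open>i < k n\<close>; all other entries are 0. The common bound \<open>B\<close> of the
  blocks bounds the whole matrix.\<close>

lemma ex_block_diagonal:
  fixes N :: "nat \<Rightarrow> nat \<Rightarrow> nat \<Rightarrow> complex"
  assumes N: "\<And>n. mbound {..<k n} (N n) B" and B: "0 \<le> B"
  shows "\<exists>T\<in>bounded_ops. \<forall>n i n' j. coord (blinfun_apply T (unit_ell2 (prod_encode (n', j)))) (prod_encode (n, i))
    = (if n = n' \<and> i < k n \<and> j < k n then N n i j else 0)"
proof -
  define b where "b = (\<lambda>r. fst (prod_decode r))"
  define p where "p = (\<lambda>r. snd (prod_decode r))"
  define M where "M = (\<lambda>r s. if b r = b s \<and> p r < k (b r) \<and> p s < k (b r) then N (b r) (p r) (p s) else 0)"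
  have inj: "r = s" if "b r = b s" "p r = p s" for r s
    using that by (metis b_def p_def prod.expand prod_decode_inverse)
  have "mbound UNIV M B"
  proof (rule mbound_direct_sum[where k=b, OF _ _ B])
    fix n
    have "mbound {r. b r = n \<and> p r < k n} M B"
      by (rule mbound_reindex[OF N[of n], where \<phi>=p]) (auto simp: inj_on_def M_def intro: inj)
    then show "mbound {r \<in> UNIV. b r = n} M B"
      by (rule mbound_zero_extend[OF _ _ B]) (auto simp: M_def)
  qed (auto simp: M_def)
  then obtain T where T: "T \<in> bounded_ops" "\<And>i j. coord (blinfun_apply T (unit_ell2 j)) i = M i j"
    using ex_matrix_operator[OF _ B] by metis
  show ?thesis
    using T by (intro bexI[of _ T]) (auto simp: M_def b_def p_def)
qed

text \<open>Fixing a row vector and a column vector selects a minor of the scalar matrix of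
  \<open>a\<close>. The resulting bound depends on the functional only, not on the block, and so
  makes the block diagonal operators bounded.\<close>

lemma mbound_entry_functional:
  assumes M: "mbound ({..<k} \<times> G) (entry a) 1"
    and f: "\<And>e. f e = (\<Sum>r\<in>R. \<gamma> r * cinner (fst r) (blinfun_apply e (snd r)))" and R: "R \<subseteq> G \<times> G"
  shows "mbound {..<k} (\<lambda>i j. f (a i j)) (\<Sum>r\<in>R. cmod (\<gamma> r))"
  unfolding f
proof (rule mbound_sum)
  fix r assume "r \<in> R"
  then have r: "fst r \<in> G" "snd r \<in> G" using R by auto
  have "mbound {..<k} (\<lambda>i j. entry a (i, fst r) (j, snd r)) 1"
    by (rule mbound_minor[OF M]) (use r in \<open>auto simp: inj_on_def\<close>)
  from mbound_cmult[OF this, of "\<gamma> r"]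
  show "mbound {..<k} (\<lambda>i j. \<gamma> r * cinner (fst r) (blinfun_apply (a i j) (snd r))) (cmod (\<gamma> r))" by simp
qed

context calkin
begin

text \<open>Once the first \<open>m\<close> blocks are removed, only blocks with
  \<open>n \<ge> m\<close> remain, and for these \<open>G n\<close> contains the vectors
  \<open>\<gamma>\<close>. Each such block is then a submatrix of the scalar matrix of
  \<open>a n\<close> on \<open>{..<k n} \<times> G n\<close>.\<close>

lemma mat_norm_block_tail:
  fixes a :: "nat \<Rightarrow> nat \<Rightarrow> nat \<Rightarrow> ('h::complex_hilbert \<Rightarrow>\<^sub>L 'h)"
  assumes T: "\<And>l. l < d \<Longrightarrow> T l \<in> bounded_ops"
    and entries: "\<And>l n i n' j. l < d \<Longrightarrow> coord (blinfun_apply (T l) (unit_ell2 (prod_encode (n', j)))) (prod_encode (n, i))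
      = (if n = n' \<and> i < k n \<and> j < k n then f l (a n i j) else 0)"
    and rep: "\<And>n i j. i < k n \<Longrightarrow> j < k n \<Longrightarrow> a n i j = (\<Sum>l<d. f l (a n i j) *\<^sub>C x l)"
    and M: "\<And>n. mbound ({..<k n} \<times> G n) (entry (a n)) 1" and G: "\<And>n n'. n \<le> n' \<Longrightarrow> G n \<subseteq> G n'"
    and \<gamma>: "inj_on \<gamma> {..<c}" "\<gamma> ` {..<c} \<subseteq> G m"
  shows "mat_norm c (\<lambda>\<rho> \<sigma>. q (\<Sum>l<d. cinner (\<gamma> \<rho>) (blinfun_apply (x l) (\<gamma> \<sigma>)) *\<^sub>C T l)) \<le> 1"
proof -
  define z where "z = (\<lambda>\<rho> \<sigma>. \<Sum>l<d. cinner (\<gamma> \<rho>) (blinfun_apply (x l) (\<gamma> \<sigma>)) *\<^sub>C T l)"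
  have zb: "z \<rho> \<sigma> \<in> bounded_ops" for \<rho> \<sigma> using T by (auto simp: z_def)
  \<comment> \<open>The first \<open>m\<close> blocks occupy finitely many coordinates, so removing them is a compact perturbation.\<close>
  define D where "D = prod_encode ` (SIGMA n:{..<m}. {..<k n})"
  have D: "finite D" by (simp add: D_def)
  let ?R = "coord_proj (- D)"
  have Rz: "?R o\<^sub>L z \<rho> \<sigma> \<in> bounded_ops" for \<rho> \<sigma> by (intro comp_bounded_ops zb coord_proj_bounded)
  have "q (z \<rho> \<sigma>) = q (?R o\<^sub>L z \<rho> \<sigma>)" for \<rho> \<sigma>
  proof -
    have K: "coord_proj D o\<^sub>L z \<rho> \<sigma> \<in> compact_ops" by (intro compact_ops_comp_right zb coord_proj_compact D)
    have "z \<rho> \<sigma> = (?R o\<^sub>L z \<rho> \<sigma>) + (coord_proj D o\<^sub>L z \<rho> \<sigma>)"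
      by (rule blinfun_eqI) (simp add: blinfun.add_left coord_proj_Compl)
    then have "q (z \<rho> \<sigma>) = q (?R o\<^sub>L z \<rho> \<sigma>) + q (coord_proj D o\<^sub>L z \<rho> \<sigma>)"
      using q_add[OF Rz[of \<rho> \<sigma>] compact_ops_bounded[OF K]] by simp
    then show ?thesis using q_compact[OF K] by simp
  qed
  then have "mat_norm c (\<lambda>\<rho> \<sigma>. q (z \<rho> \<sigma>)) = mat_norm c (\<lambda>\<rho> \<sigma>. q (?R o\<^sub>L z \<rho> \<sigma>))" by simp
  also have "\<dots> \<le> mat_norm c (\<lambda>\<rho> \<sigma>. ?R o\<^sub>L z \<rho> \<sigma>)" by (rule mat_norm_q_le) (rule Rz)
  also have "\<dots> \<le> 1"
  proof (rule mat_norm_le_mbound[OF Rz orthonormal_basis_unit])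
    define r where "r = (\<lambda>u :: nat \<times> nat ell2. prod_decode (inv unit_ell2 (snd u)))"
    let ?I = "{..<c} \<times> range (unit_ell2 :: nat \<Rightarrow> nat ell2)"
    have snd_r: "snd u = unit_ell2 (prod_encode (r u))" if "u \<in> ?I" for u
      using that by (auto simp: r_def inv_f_f[OF inj_unit])
    \<comment> \<open>By \<open>rep\<close> the coefficients \<open>f l (a n i j)\<close> recombine
      with the entries of the \<open>x l\<close> to entries of \<open>a n i j\<close>.\<close>
    have ent: "entry (\<lambda>\<rho> \<sigma>. ?R o\<^sub>L z \<rho> \<sigma>) u v =
        (if fst (r u) = fst (r v) \<and> m \<le> fst (r u) \<and> snd (r u) < k (fst (r u)) \<and> snd (r v) < k (fst (r u))
         then cinner (\<gamma> (fst u)) (blinfun_apply (a (fst (r u)) (snd (r u)) (snd (r v))) (\<gamma> (fst v))) else 0)"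
      if uv: "u \<in> ?I" "v \<in> ?I" for u v
    proof -
      obtain n i where ru: "r u = (n, i)" by fastforce
      obtain n' j where rv: "r v = (n', j)" by fastforce
      have memD: "prod_encode (n, i) \<in> D \<longleftrightarrow> n < m \<and> i < k n"
        unfolding D_def by (auto simp: inj_image_mem_iff[OF inj_prod_encode])
      have "entry (\<lambda>\<rho> \<sigma>. ?R o\<^sub>L z \<rho> \<sigma>) u v = (if prod_encode (n, i) \<in> D then 0 else
          (\<Sum>l<d. cinner (\<gamma> (fst u)) (blinfun_apply (x l) (\<gamma> (fst v))) *
             coord (blinfun_apply (T l) (unit_ell2 (prod_encode (n', j)))) (prod_encode (n, i))))"
        unfolding snd_r[OF uv(1)] snd_r[OF uv(2)] ru rv z_def
        by (simp add: cinner_unit coord_coord_proj blinfun.sum_left coord_sum scaleC_blinfun.rep_eq coord_scaleC)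
      also have "\<dots> = (if prod_encode (n, i) \<in> D then 0 else if n = n' \<and> i < k n \<and> j < k n then
          (\<Sum>l<d. cinner (\<gamma> (fst u)) (blinfun_apply (x l) (\<gamma> (fst v))) * f l (a n i j)) else 0)"
        by (cases "n = n' \<and> i < k n \<and> j < k n") (auto simp: entries intro!: sum.neutral sum.cong)
      also have "(\<Sum>l<d. cinner (\<gamma> (fst u)) (blinfun_apply (x l) (\<gamma> (fst v))) * f l (a n i j))
          = cinner (\<gamma> (fst u)) (blinfun_apply (\<Sum>l<d. f l (a n i j) *\<^sub>C x l) (\<gamma> (fst v)))"
        by (simp add: blinfun.sum_left cinner_sum_right scaleC_blinfun.rep_eq cinner_scaleC_right mult.commute)
      finally show ?thesis
        unfolding ru rv fst_conv snd_conv memD using rep[of i n j] by auto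
    qed
    show "mbound ?I (entry (\<lambda>\<rho> \<sigma>. ?R o\<^sub>L z \<rho> \<sigma>)) 1"
    proof (rule mbound_direct_sum[where k="\<lambda>u. fst (r u)"])
      show "entry (\<lambda>\<rho> \<sigma>. ?R o\<^sub>L z \<rho> \<sigma>) u v = 0" if "u \<in> ?I" "v \<in> ?I" "fst (r u) \<noteq> fst (r v)" for u v
        using ent[OF that(1,2)] that(3) by simp
      fix n
      let ?J = "{u \<in> ?I. fst (r u) = n \<and> m \<le> n \<and> snd (r u) < k n}"
      \<comment> \<open>Matrix index and coordinate exchange roles: the position within the block
        becomes the matrix index of \<open>a n\<close>, and the slice index becomes a basis
        vector.\<close>
      have "mbound ?J (entry (\<lambda>\<rho> \<sigma>. ?R o\<^sub>L z \<rho> \<sigma>)) 1"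
      proof (rule mbound_reindex[OF M[of n], where \<phi>="\<lambda>u. (snd (r u), \<gamma> (fst u))"])
        show "inj_on (\<lambda>u. (snd (r u), \<gamma> (fst u))) ?J"
        proof (rule inj_onI)
          fix u v assume uv: "u \<in> ?J" "v \<in> ?J" "(snd (r u), \<gamma> (fst u)) = (snd (r v), \<gamma> (fst v))"
          then have "r u = r v" by (simp add: prod_eq_iff)
          then have "snd u = snd v" using snd_r[of u] snd_r[of v] uv(1,2) by simp
          moreover have "fst u = fst v" using uv inj_onD[OF \<gamma>(1), of "fst u" "fst v"] by auto
          ultimately show "u = v" by (simp add: prod_eq_iff)
        qed
        show "(\<lambda>u. (snd (r u), \<gamma> (fst u))) ` ?J \<subseteq> {..<k n} \<times> G n"
        proof (rule image_subsetI)
          fix u assume u: "u \<in> ?J"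
          then have "m \<le> n" "fst u \<in> {..<c}" by auto
          then have "\<gamma> (fst u) \<in> G n" using \<gamma>(2) G[of m n] by blast
          then show "(snd (r u), \<gamma> (fst u)) \<in> {..<k n} \<times> G n" using u by auto
        qed
        show "entry (\<lambda>\<rho> \<sigma>. ?R o\<^sub>L z \<rho> \<sigma>) u v = entry (a n) (snd (r u), \<gamma> (fst u)) (snd (r v), \<gamma> (fst v))"
          if "u \<in> ?J" "v \<in> ?J" for u v
          using ent[of u v] that by auto
      qed
      then show "mbound {u \<in> ?I. fst (r u) = n} (entry (\<lambda>\<rho> \<sigma>. ?R o\<^sub>L z \<rho> \<sigma>)) 1"
      proof (rule mbound_zero_extend)
        fix u v assume uv: "u \<in> {u \<in> ?I. fst (r u) = n}" "v \<in> {u \<in> ?I. fst (r u) = n}" "u \<notin> ?J \<or> v \<notin> ?J"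
        then have I: "u \<in> ?I" "v \<in> ?I" and n: "fst (r u) = n" "fst (r v) = n" by auto
        then have "\<not> (m \<le> n \<and> snd (r u) < k n \<and> snd (r v) < k n)" using uv(3) by auto
        then show "entry (\<lambda>\<rho> \<sigma>. ?R o\<^sub>L z \<rho> \<sigma>) u v = 0" unfolding ent[OF I] n by auto
      qed simp
    qed simp
  qed simp
  finally show ?thesis by (simp add: z_def)
qed

end

section \<open>Exactness bounds \<open>d_SK\<close>\<close>

context calkin_operator_space
begin

section \<open>Cutting off coordinates in the left leg\<close>

abbreviation row_proj :: "nat set \<Rightarrow> ((nat ell2, 'h) htensor \<Rightarrow>\<^sub>L (nat ell2, 'h) htensor)" where
  "row_proj A \<equiv> coord_proj A \<otimes>\<^sub>o id_blinfun"

lemma norm_row_proj: "norm (row_proj A) \<le> 1"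
proof -
  have "norm (row_proj A) \<le> norm (coord_proj A) * norm (id_blinfun :: 'h \<Rightarrow>\<^sub>L 'h)"
    by (rule norm_tensor_op_le) auto
  also have "\<dots> \<le> 1 * 1"
    by (intro mult_mono norm_coord_proj norm_blinfun_bound) auto
  finally show ?thesis by simp
qed

lemma norm_row_proj_comp_le: "norm (row_proj A o\<^sub>L t) \<le> norm t"
  using order_trans[OF norm_blinfun_compose mult_right_mono[OF norm_row_proj norm_ge_zero]] by simp

lemma row_proj_tensor: "b \<in> bounded_ops \<Longrightarrow> y \<in> bounded_ops \<Longrightarrow> row_proj A o\<^sub>L (b \<otimes>\<^sub>o y) = (coord_proj A o\<^sub>L b) \<otimes>\<^sub>o y"
proof -
  assume b: "b \<in> bounded_ops" and y: "y \<in> bounded_ops"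
  have "id_blinfun o\<^sub>L y = y" by (rule blinfun_eqI) simp
  then show ?thesis using tensor_op_comp[OF coord_proj_bounded b id_bounded_ops y] by simp
qed

text \<open>On \<open>k \<otimes> y\<close> the norm is at most that of
  \<open>coord_proj (A n)\<close> composed with \<open>k\<close>, times \<open>norm y\<close>, and
  tends to 0 by compactness of \<open>k\<close>. Contractivity extends this from the span to its
  closure.\<close>

lemma row_proj_null:
  assumes \<kappa>: "\<kappa> \<in> KX" and A: "\<And>i. finite {n :: nat. i \<in> A n}"
  shows "(\<lambda>n. norm (row_proj (A n) o\<^sub>L \<kappa>)) \<longlonglongrightarrow> 0"
proof -
  let ?V = "{s :: (nat ell2, 'h) htensor \<Rightarrow>\<^sub>L (nat ell2, 'h) htensor. (\<lambda>n. norm (row_proj (A n) o\<^sub>L s)) \<longlonglongrightarrow> 0}"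
  have sub: "csubspace ?V"
    unfolding csubspace_def
  proof (intro conjI ballI allI)
    show "0 \<in> ?V" by simp
  next
    fix s t :: "(nat ell2, 'h) htensor \<Rightarrow>\<^sub>L (nat ell2, 'h) htensor" assume "s \<in> ?V" "t \<in> ?V"
    then have "(\<lambda>n. norm (row_proj (A n) o\<^sub>L s) + norm (row_proj (A n) o\<^sub>L t)) \<longlonglongrightarrow> 0 + 0"
      by (intro tendsto_add) auto
    moreover have "norm (row_proj (A n) o\<^sub>L (s + t)) \<le> norm (row_proj (A n) o\<^sub>L s) + norm (row_proj (A n) o\<^sub>L t)" for n
    proof -
      have "row_proj (A n) o\<^sub>L (s + t) = (row_proj (A n) o\<^sub>L s) + (row_proj (A n) o\<^sub>L t)"
        by (rule blinfun_eqI) (simp add: blinfun.add_left blinfun.add_right)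
      then show ?thesis by (simp add: norm_triangle_ineq)
    qed
    ultimately show "s + t \<in> ?V"
      by (simp, intro Lim_null_comparison[of "\<lambda>n. norm (row_proj (A n) o\<^sub>L (s + t))"]) auto
  next
    fix c and s :: "(nat ell2, 'h) htensor \<Rightarrow>\<^sub>L (nat ell2, 'h) htensor" assume s: "s \<in> ?V"
    have "row_proj (A n) o\<^sub>L (c *\<^sub>C s) = c *\<^sub>C (row_proj (A n) o\<^sub>L s)" for n
      by (rule blinfun_eqI)
        (simp add: scaleC_blinfun.rep_eq bounded_opsD[OF tensor_op_bounded[OF coord_proj_bounded id_bounded_ops]])
    then show "c *\<^sub>C s \<in> ?V"
      using tendsto_mult_right_zero[of "\<lambda>n. norm (row_proj (A n) o\<^sub>L s)" sequentially "cmod c"] s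
      by (simp add: norm_scaleC)
  qed
  have gen: "k \<otimes>\<^sub>o y \<in> ?V" if k: "k \<in> compact_ops" and y: "y \<in> X" for k y
  proof -
    have "(\<lambda>n. norm (coord_proj (A n) o\<^sub>L k) * norm y) \<longlonglongrightarrow> 0 * norm y"
      by (intro tendsto_mult tendsto_const compact_coord_proj_left k A)
    moreover have "norm (row_proj (A n) o\<^sub>L (k \<otimes>\<^sub>o y)) \<le> norm (coord_proj (A n) o\<^sub>L k) * norm y" for n
      unfolding row_proj_tensor[OF compact_ops_bounded[OF k] X_bounded[OF y]]
      by (rule norm_tensor_op_le) (use compact_ops_bounded[OF k] X_bounded[OF y] in auto)
    ultimately show ?thesis
      by (simp, intro Lim_null_comparison[of "\<lambda>n. norm (row_proj (A n) o\<^sub>L (k \<otimes>\<^sub>o y))"]) auto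
  qed
  have sp: "cspan ((\<lambda>(a, b). a \<otimes>\<^sub>o b) ` (K_ell2 \<times> X)) \<subseteq> ?V"
    by (rule cspan_minimal[OF _ sub]) (use gen in auto)
  show ?thesis
  proof (rule LIMSEQ_I)
    fix e :: real assume e: "0 < e"
    obtain s where s: "s \<in> cspan ((\<lambda>(a, b). a \<otimes>\<^sub>o b) ` (K_ell2 \<times> X))" "dist s \<kappa> < e / 2"
      using \<kappa> half_gt_zero[OF e] unfolding min_tensor_alt closure_approachable by blast
    have "(\<lambda>n. norm (row_proj (A n) o\<^sub>L s)) \<longlonglongrightarrow> 0" using sp s(1) by blast
    then obtain N where N: "\<And>n. n \<ge> N \<Longrightarrow> norm (row_proj (A n) o\<^sub>L s) < e / 2"
      using LIMSEQ_D[of _ 0 "e / 2"] e by fastforce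
    have "norm (row_proj (A n) o\<^sub>L \<kappa>) < e" if n: "n \<ge> N" for n
    proof -
      have "row_proj (A n) o\<^sub>L \<kappa> = (row_proj (A n) o\<^sub>L s) - (row_proj (A n) o\<^sub>L (s - \<kappa>))"
        by (rule blinfun_eqI) (simp add: blinfun.diff_left blinfun.diff_right)
      then have "norm (row_proj (A n) o\<^sub>L \<kappa>) \<le> norm (row_proj (A n) o\<^sub>L s) + norm (row_proj (A n) o\<^sub>L (s - \<kappa>))"
        by (simp add: norm_triangle_ineq4)
      also have "\<dots> \<le> norm (row_proj (A n) o\<^sub>L s) + norm (s - \<kappa>)"
        by (intro add_left_mono norm_row_proj_comp_le)
      finally show ?thesis using N[OF n] s(2) by (simp add: dist_norm)
    qed
    then show "\<exists>N. \<forall>n\<ge>N. norm (norm (row_proj (A n) o\<^sub>L \<kappa>) - 0) < e" by auto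
  qed
qed

lemma SK_le_if_exact:
  assumes exact: "exact_operator_space \<pi> X" and C: "0 \<le> C" "ex \<pi> X \<le> ennreal C"
    and E: "operator_space E" "E \<subseteq> X" "cfinite_dim E"
  shows "d_SK E \<le> ennreal C"
proof (rule ccontr)
  assume "\<not> d_SK E \<le> ennreal C"
  \<comment> \<open>A value strictly between the two becomes the real number \<open>C'\<close>; the
    gap \<open>C < C'\<close> carries the contradiction.\<close>
  then obtain w where w: "ennreal C < w" "w < d_SK E" unfolding not_le using dense by blast
  then have "w \<noteq> \<infinity>" by auto
  then obtain C' where C': "0 \<le> C'" "w = ennreal C'" by (cases w) auto
  then have CC': "C < C'" "ennreal C' < d_SK E" using w C(1) by (auto simp: ennreal_less_iff)
  have ED: "E \<subseteq> bounded_ops" "csubspace E" using E(1) by (auto simp: operator_space_def)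
  obtain S where S: "finite S" "E = cspan S" using E(3) by (auto simp: cfinite_dim_def)
  then have SB: "S \<subseteq> bounded_ops" using ED(1) cspan_superset[of S] by blast
  obtain d :: nat and x f where
    F0: "\<forall>l<d. x l \<in> cspan S \<and> f l \<in> entry_functionals" "\<forall>e\<in>cspan S. e = (\<Sum>l<d. f l e *\<^sub>C x l)"
    using finite_dim_dual[OF S(1) SB] by blast
  have xE: "\<And>l. l < d \<Longrightarrow> x l \<in> E" and rep: "\<And>e. e \<in> E \<Longrightarrow> e = (\<Sum>l<d. f l e *\<^sub>C x l)"
    using F0 S(2) by blast+
  have xX: "x l \<in> X" and xB: "x l \<in> bounded_ops" if "l < d" for l
    using xE[OF that] E(2) ED(1) by auto
  define represents where "represents = (\<lambda>l R \<gamma>. finite R \<and> R \<subseteq> some_onb \<times> some_onb \<and>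
     (\<forall>e. f l e = (\<Sum>r\<in>R. \<gamma> r * cinner (fst r) (blinfun_apply e (snd r)))))"
  have "\<exists>R \<gamma>. represents l R \<gamma>" if "l < d" for l
  proof -
    have "f l \<in> entry_functionals" using F0(1) that by blast
    then show ?thesis unfolding entry_functionals_def represents_def by (rule CollectD)
  qed
  then obtain R \<gamma> where R0: "\<And>l. l < d \<Longrightarrow> represents l (R l) (\<gamma> l)" by metis
  have R: "\<And>l. l < d \<Longrightarrow> finite (R l)" "\<And>l. l < d \<Longrightarrow> R l \<subseteq> some_onb \<times> some_onb"
    "\<And>l e. l < d \<Longrightarrow> f l e = (\<Sum>r\<in>R l. \<gamma> l r * cinner (fst r) (blinfun_apply e (snd r)))"
    using R0 unfolding represents_def by simp_all
  \<comment> \<open>All basis vectors seen by the coefficient functionals. As part of every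
    \<open>G n\<close> they make the compressions injective on \<open>E\<close> and bound the
    coefficients uniformly in \<open>n\<close>.\<close>
  define O0 where "O0 = (\<Union>l<d. fst ` R l \<union> snd ` R l)"
  have "fst ` R l \<union> snd ` R l \<subseteq> some_onb" if "l < d" for l using R(2)[OF that] by auto
  then have O0: "finite O0" "O0 \<subseteq> some_onb" using R(1) unfolding O0_def by (blast intro: finite_UN_I)+
  have RO: "R l \<subseteq> O0 \<times> O0" if "l < d" for l using that by (force simp: O0_def)
  obtain D where D: "D \<subseteq> E" "countable D" "\<forall>e\<in>E. \<forall>\<epsilon>>0. \<exists>y\<in>D. norm (e - y) < \<epsilon>"
    using countable_dense_finite_dim[OF xE ED(2) rep] by blast
  have D3: "\<And>e \<epsilon>. e \<in> E \<Longrightarrow> \<epsilon> > 0 \<Longrightarrow> \<exists>y\<in>D. norm (e - y) < \<epsilon>" using D(3) by blast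
  obtain A where A0: "A \<subseteq> some_onb" "countable A" and norming0:
    "\<forall>n a C. (\<forall>i<n. \<forall>j<n. a i j \<in> E) \<longrightarrow> 0 \<le> C \<longrightarrow> mbound ({..<n} \<times> A) (entry a) C \<longrightarrow> mat_norm n a \<le> C"
    using countable_norming_set[OF ED(1) D(1,2) D3] by blast
  \<comment> \<open>One numbering of all basis vectors in use serves both the filtration
    \<open>G n\<close> and the placement in \<open>compression\<close>.\<close>
  define \<iota> where "\<iota> = to_nat_on (A \<union> O0)"
  have \<iota>: "inj_on \<iota> (A \<union> O0)"
    unfolding \<iota>_def by (intro inj_on_to_nat_on) (use A0(2) O0(1) in \<open>auto simp: countable_finite\<close>)
  define G where "G = (\<lambda>n. O0 \<union> {g \<in> A. \<iota> g < n})"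
  have G_fin: "finite (G n)" for n
  proof -
    have "finite {g \<in> A. \<iota> g < n}"
      by (rule finite_imageD[of \<iota>]) (auto intro: finite_subset[of _ "{..<n}"] inj_on_subset[OF \<iota>])
    then show ?thesis using O0(1) by (simp add: G_def)
  qed
  have G_onb: "G n \<subseteq> some_onb" for n using A0(1) O0(2) by (auto simp: G_def)
  have G_mono: "G n \<subseteq> G n'" if "n \<le> n'" for n n' using that by (auto simp: G_def)
  have G_inj: "inj_on \<iota> (G n)" for n by (rule inj_on_subset[OF \<iota>]) (auto simp: G_def)
  define bad where "bad = (\<lambda>n k a. 0 < k \<and> (\<forall>i<k. \<forall>j<k. a i j \<in> E) \<and>
    mbound ({..<k} \<times> G n) (entry a) 1 \<and> C' < mat_norm k a)"
  have "\<exists>k a. bad n k a" for n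
    unfolding bad_def
  proof (rule d_SK_witness[OF E(1,3) G_fin G_inj G_onb _ CC'(2)])
    fix e assume e: "e \<in> E" and z: "\<And>g h. g \<in> G n \<Longrightarrow> h \<in> G n \<Longrightarrow> cinner g (blinfun_apply e h) = 0"
    have "f l e = 0" if l: "l < d" for l
      unfolding R(3)[OF l] using RO[OF l] z by (intro sum.neutral) (auto simp: G_def)
    then have "(\<Sum>l<d. f l e *\<^sub>C x l) = 0" by simp
    then show "e = 0" using rep[OF e] by simp
  qed
  then obtain k a where ka: "\<And>n. bad n (k n) (a n)" by metis
  have a: "\<And>n i j. i < k n \<Longrightarrow> j < k n \<Longrightarrow> a n i j \<in> E"
    "\<And>n. mbound ({..<k n} \<times> G n) (entry (a n)) 1" "\<And>n. C' < mat_norm (k n) (a n)"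
    using ka unfolding bad_def by simp_all
  define diagonal where "diagonal = (\<lambda>l T. T \<in> bounded_ops \<and>
     (\<forall>n i n' j. coord (blinfun_apply T (unit_ell2 (prod_encode (n', j)))) (prod_encode (n, i))
      = (if n = n' \<and> i < k n \<and> j < k n then f l (a n i j) else 0)))"
  have "\<exists>T. diagonal l T" if l: "l < d" for l
  proof -
    have "mbound {..<k n} (\<lambda>i j. f l (a n i j)) (\<Sum>r\<in>R l. cmod (\<gamma> l r))" for n
      by (rule mbound_entry_functional[OF a(2) R(3)[OF l]]) (use RO[OF l] in \<open>auto simp: G_def\<close>)
    from ex_block_diagonal[where N="\<lambda>n i j. f l (a n i j)", OF this]
    show ?thesis unfolding diagonal_def by (simp add: sum_nonneg Bex_def)
  qed
  then obtain T where T0: "\<And>l. l < d \<Longrightarrow> diagonal l (T l)" by metis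
  have T: "\<And>l. l < d \<Longrightarrow> T l \<in> bounded_ops"
    and entries: "\<And>l n i n' j. l < d \<Longrightarrow> coord (blinfun_apply (T l) (unit_ell2 (prod_encode (n', j)))) (prod_encode (n, i))
      = (if n = n' \<and> i < k n \<and> j < k n then f l (a n i j) else 0)"
    using T0 unfolding diagonal_def by simp_all
  define t where "t = (\<Sum>l<d. T l \<otimes>\<^sub>o x l)"
  have tB: "t \<in> BX" unfolding t_def by (rule tensor_sum_BX) (use T xX in auto)
  have Qt: "Q t = (\<Sum>l<d. q (T l) \<otimes>\<^sub>o x l)" unfolding t_def by (rule Q_sum) (use T xX in auto)
  \<comment> \<open>Slicing the left leg, on the space of the representation, gives matrices over
    \<open>E\<close>. The norming set \<open>A\<close> reduces their norms to finitely many basis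
    vectors of the right leg, all in some \<open>G m\<close>; slicing by those vectors instead leads
    to \<open>mat_norm_block_tail\<close>.\<close>
  have upper: "norm (Q t) \<le> 1"
    unfolding Qt
  proof (subst norm_tensor_sum_le_left[OF _ _ orthonormal_basis_some_onb])
    show "\<forall>N p. inj_on p {..<N} \<longrightarrow> p ` {..<N} \<subseteq> some_onb \<longrightarrow>
       mat_norm N (\<lambda>r s. \<Sum>l<d. cinner (p r) (blinfun_apply (q (T l)) (p s)) *\<^sub>C x l) \<le> 1"
    proof (intro allI impI)
      fix N and p :: "nat \<Rightarrow> 'k" assume p: "inj_on p {..<N}" "p ` {..<N} \<subseteq> some_onb"
      let ?b = "\<lambda>r s. \<Sum>l<d. cinner (p r) (blinfun_apply (q (T l)) (p s)) *\<^sub>C x l"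
      have bE: "?b r s \<in> E" for r s
        using xE by (intro csubspace_sum[OF ED(2)] csubspaceD(3)[OF ED(2)]) auto
      have "mbound ({..<N} \<times> A) (entry ?b) 1"
      proof (rule mbound_cofinal)
        fix F assume F: "finite F" "F \<subseteq> {..<N} \<times> A"
        have "\<exists>m. snd ` F \<subseteq> G m"
        proof -
          obtain m where "\<forall>v\<in>\<iota> ` snd ` F. v < m"
            using F(1) finite_nat_set_iff_bounded[of "\<iota> ` snd ` F"] by auto
          then show ?thesis using F(2) by (intro exI[of _ m]) (auto simp: G_def)
        qed
        then obtain m where m: "snd ` F \<subseteq> G m" by blast
        obtain \<gamma>' where "bij_betw \<gamma>' {..<card (G m)} (G m)"
          using ex_bij_betw_nat_finite[OF G_fin[of m]] by (auto simp: lessThan_atLeast0)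
        then have g: "inj_on \<gamma>' {..<card (G m)}" "\<gamma>' ` {..<card (G m)} = G m" by (auto simp: bij_betw_def)
        let ?c = "card (G m)"
        let ?z = "\<lambda>\<rho> \<sigma>. q (\<Sum>l<d. cinner (\<gamma>' \<rho>) (blinfun_apply (x l) (\<gamma>' \<sigma>)) *\<^sub>C T l)"
        have zb: "?z \<rho> \<sigma> \<in> bounded_ops" for \<rho> \<sigma> using T by (intro q_bounded bounded_ops_sum bounded_ops_arith(3)) auto
        have z_eq: "?z \<rho> \<sigma> = (\<Sum>l<d. cinner (\<gamma>' \<rho>) (blinfun_apply (x l) (\<gamma>' \<sigma>)) *\<^sub>C q (T l))" for \<rho> \<sigma>
          using T by (subst q_sum) (auto simp: q_scaleC)
        have "mat_norm ?c ?z \<le> 1"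
          by (rule mat_norm_block_tail[OF T entries rep[OF a(1)] a(2) G_mono g(1), of m]) (use g(2) in auto)
        then have M: "mbound ({..<?c} \<times> some_onb) (entry ?z) 1"
          by (intro mbound_mono[OF mbound_entry_le[OF zb orthonormal_some_onb]])
        define \<nu> where "\<nu> = the_inv_into {..<?c} \<gamma>'"
        have \<nu>: "\<nu> e < ?c" "\<gamma>' (\<nu> e) = e" if "e \<in> G m" for e
          using that the_inv_into_into[OF g(1), of e "{..<?c}"] f_the_inv_into_f[OF g(1), of e] g(2)
          unfolding \<nu>_def by auto
        \<comment> \<open>The same scalars are read with the legs exchanged: \<open>?z\<close> is
          indexed by the vectors of \<open>G m\<close>, and its entries act on the representation
          space.\<close>
        have "mbound ({..<N} \<times> G m) (entry ?b) 1"
        proof (rule mbound_reindex[OF M, where \<phi>="\<lambda>u. (\<nu> (snd u), p (fst u))"])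
          show "inj_on (\<lambda>u. (\<nu> (snd u), p (fst u))) ({..<N} \<times> G m)"
          proof (rule inj_onI)
            fix u v assume uv: "u \<in> {..<N} \<times> G m" "v \<in> {..<N} \<times> G m" "(\<nu> (snd u), p (fst u)) = (\<nu> (snd v), p (fst v))"
            have "snd u = snd v" using \<nu>(2)[of "snd u"] \<nu>(2)[of "snd v"] uv by auto
            moreover have "fst u = fst v" using uv inj_onD[OF p(1), of "fst u" "fst v"] by auto
            ultimately show "u = v" by (simp add: prod_eq_iff)
          qed
          show "(\<lambda>u. (\<nu> (snd u), p (fst u))) ` ({..<N} \<times> G m) \<subseteq> {..<?c} \<times> some_onb"
            using \<nu>(1) p(2) by auto
          fix u v assume uv: "u \<in> {..<N} \<times> G m" "v \<in> {..<N} \<times> G m"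
          then have n: "\<gamma>' (\<nu> (snd u)) = snd u" "\<gamma>' (\<nu> (snd v)) = snd v" using \<nu>(2) by auto
          show "entry ?b u v = entry ?z (\<nu> (snd u), p (fst u)) (\<nu> (snd v), p (fst v))"
            unfolding z_eq unfolding fst_conv snd_conv n
            by (simp add: blinfun.sum_left cinner_sum_right scaleC_blinfun.rep_eq cinner_scaleC_right mult.commute)
        qed
        moreover have "F \<subseteq> {..<N} \<times> G m"
        proof
          fix v assume v: "v \<in> F"
          then have "fst v \<in> {..<N}" using F(2) by auto
          moreover have "snd v \<in> G m" using m v by blast
          ultimately show "v \<in> {..<N} \<times> G m" by (simp add: mem_Times_iff)
        qed
        ultimately show "\<exists>H. finite H \<and> F \<subseteq> H \<and> mbound H (entry ?b) 1"
          using G_fin[of m] by (intro exI[of _ "{..<N} \<times> G m"] conjI finite_cartesian_product finite_lessThan)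
      qed
      moreover have "\<forall>i<N. \<forall>j<N. ?b i j \<in> E" using bE by blast
      ultimately show "mat_norm N ?b \<le> 1" using norming0[rule_format, of N ?b 1] by simp
    qed
  qed (use T xB in auto)
  have lower: "C' \<le> quotient_norm (coset KX t)"
  proof (rule norm_quotient(3)[OF csubspace_min_tensor])
    fix w assume wK: "w \<in> KX"
    \<comment> \<open>\<open>?A n\<close> is the set of coordinates of block \<open>n\<close>. A
      coordinate belongs to one block only, so elements of \<open>KX\<close> die out along the
      blocks.\<close>
    let ?A = "\<lambda>n. {r. fst (prod_decode r) = n}"
    have "finite {n. i \<in> ?A n}" for i by (rule finite_subset[of _ "{fst (prod_decode i)}"]) auto
    then have lim: "(\<lambda>n. norm (row_proj (?A n) o\<^sub>L w)) \<longlonglongrightarrow> 0" by (rule row_proj_null[OF wK])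
    have ineq: "C' \<le> norm (t + w) + norm (row_proj (?A n) o\<^sub>L w)" for n
    proof -
      have bd: "coord_proj (?A n) o\<^sub>L T l \<in> bounded_ops" if "l < d" for l
        using T[OF that] by (intro comp_bounded_ops coord_proj_bounded)
      have eq: "row_proj (?A n) o\<^sub>L t = (\<Sum>l<d. (coord_proj (?A n) o\<^sub>L T l) \<otimes>\<^sub>o x l)"
      proof -
        have "row_proj (?A n) o\<^sub>L t = (\<Sum>l<d. row_proj (?A n) o\<^sub>L (T l \<otimes>\<^sub>o x l))"
          unfolding t_def by (rule blinfun_eqI) (simp add: blinfun.sum_left blinfun.sum_right)
        also have "\<dots> = (\<Sum>l<d. (coord_proj (?A n) o\<^sub>L T l) \<otimes>\<^sub>o x l)"
          using T xB by (intro sum.cong refl row_proj_tensor) auto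
        finally show ?thesis .
      qed
      let ?p = "\<lambda>i. unit_ell2 (prod_encode (n, i)) :: nat ell2"
      have inj_p: "inj_on ?p {..<k n}"
        by (auto simp: inj_on_def inj_eq[OF inj_unit])
      have "C' < mat_norm (k n) (a n)" by (rule a(3))
      \<comment> \<open>Cut down to block \<open>n\<close>, \<open>t\<close> has the coefficients of
        \<open>a n\<close> and reproduces \<open>a n\<close> as one of its slices.\<close>
      also have "mat_norm (k n) (a n) = mat_norm (k n) (\<lambda>i j. \<Sum>l<d. cinner (?p i) (blinfun_apply (coord_proj (?A n) o\<^sub>L T l) (?p j)) *\<^sub>C x l)"
      proof (rule mat_norm_cong)
        fix i j assume ij: "i < k n" "j < k n"
        have "(\<Sum>l<d. cinner (?p i) (blinfun_apply (coord_proj (?A n) o\<^sub>L T l) (?p j)) *\<^sub>C x l) = (\<Sum>l<d. f l (a n i j) *\<^sub>C x l)"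
          using ij by (intro sum.cong refl) (simp add: cinner_unit coord_coord_proj entries)
        then show "a n i j = (\<Sum>l<d. cinner (?p i) (blinfun_apply (coord_proj (?A n) o\<^sub>L T l) (?p j)) *\<^sub>C x l)"
          using rep[OF a(1)[OF ij]] by simp
      qed
      also have "\<dots> \<le> norm (row_proj (?A n) o\<^sub>L t)"
      proof -
        let ?B = "\<lambda>l. coord_proj (?A n) o\<^sub>L T l"
        have "\<forall>N p. inj_on p {..<N} \<longrightarrow> p ` {..<N} \<subseteq> range unit_ell2 \<longrightarrow>
           mat_norm N (\<lambda>r s. \<Sum>l<d. cinner (p r) (blinfun_apply (?B l) (p s)) *\<^sub>C x l) \<le> norm (\<Sum>l<d. ?B l \<otimes>\<^sub>o x l)"
          using norm_tensor_sum_le_left[of "{..<d}" ?B x, OF _ _ orthonormal_basis_unit norm_ge_zero, of "\<Sum>l<d. ?B l \<otimes>\<^sub>o x l"] bd xB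
          by blast
        from this[rule_format, of ?p "k n"] show ?thesis
          unfolding eq using inj_p by (simp add: image_subset_iff)
      qed
      also have "\<dots> \<le> norm (row_proj (?A n) o\<^sub>L (t + w)) + norm (row_proj (?A n) o\<^sub>L w)"
      proof -
        have "row_proj (?A n) o\<^sub>L t = (row_proj (?A n) o\<^sub>L (t + w)) - (row_proj (?A n) o\<^sub>L w)"
          by (rule blinfun_eqI) (simp add: blinfun.add_left blinfun.diff_left blinfun.add_right)
        then show ?thesis by (simp add: norm_triangle_ineq4)
      qed
      also have "\<dots> \<le> norm (t + w) + norm (row_proj (?A n) o\<^sub>L w)"
        by (intro add_right_mono norm_row_proj_comp_le)
      finally show ?thesis by simp
    qed
    have "(\<lambda>n. norm (t + w) + norm (row_proj (?A n) o\<^sub>L w)) \<longlonglongrightarrow> norm (t + w) + 0"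
      by (intro tendsto_intros lim)
    then show "C' \<le> norm (t + w)" using ineq by (auto intro: LIMSEQ_le_const)
  qed
  have "quotient_norm (coset KX t) \<le> C" by (rule quotient_norm_le_ex[OF exact C tB upper])
  then show False using lower CC'(1) by linarith
qed

end

theorem theorem1:
  fixes \<pi> :: "(nat ell2 \<Rightarrow>\<^sub>L nat ell2) set \<Rightarrow> ('k::complex_hilbert \<Rightarrow>\<^sub>L 'k)"
  assumes "calkin_representation \<pi>"
  shows "(\<forall>E :: ('h::complex_hilbert \<Rightarrow>\<^sub>L 'h) set.
            operator_space E \<and> cfinite_dim E \<longrightarrow> ex \<pi> E = d_SK E) \<and>
         (\<forall>X :: ('h \<Rightarrow>\<^sub>L 'h) set. operator_space X \<longrightarrow>
            ex \<pi> X = (SUP E \<in> {E. operator_space E \<and> E \<subseteq> X \<and> cfinite_dim E}. d_SK E) \<and>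
            (exact_operator_space \<pi> X \<longleftrightarrow>
              (SUP E \<in> {E. operator_space E \<and> E \<subseteq> X \<and> cfinite_dim E}. d_SK E) < \<infinity>))"
proof -
  \<comment> \<open>\<open>E\<close> is not tied to the span of \<open>Z\<close>, so this one
    statement serves a finite-dimensional space directly and a general space through its
    subspaces.\<close>
  have exact_le: "exact_operator_space \<pi> X \<and> ex \<pi> X \<le> s"
    if X: "operator_space X" and s: "s < \<infinity>"
      and SK: "\<And>Z. finite Z \<Longrightarrow> Z \<subseteq> X \<Longrightarrow> \<exists>E. operator_space E \<and> Z \<subseteq> E \<and> d_SK E \<le> s"
    for X :: "('h \<Rightarrow>\<^sub>L 'h) set" and s
  proof -
    interpret calkin_operator_space \<pi> X by unfold_locales (use assms X in auto)
    obtain S where "0 \<le> S" "s = ennreal S" using s by (cases s) auto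
    then show ?thesis using exact_if_SK_bounded[of S] SK by blast
  qed
  have SK_le: "ex \<pi> X < \<infinity> \<and> (\<forall>E. operator_space E \<and> E \<subseteq> X \<and> cfinite_dim E \<longrightarrow> d_SK E \<le> ex \<pi> X)"
    if X: "operator_space X" and exact: "exact_operator_space \<pi> X" for X :: "('h \<Rightarrow>\<^sub>L 'h) set"
  proof -
    interpret calkin_operator_space \<pi> X by unfold_locales (use assms X in auto)
    have fin: "ex \<pi> X < \<infinity>" by (rule ex_finite[OF exact])
    then obtain C where "0 \<le> C" "ex \<pi> X = ennreal C" by (cases "ex \<pi> X") auto
    then show ?thesis using SK_le_if_exact[OF exact, of C] fin by auto
  qed
  have not_exact: "ex \<pi> X = \<infinity>" if "\<not> exact_operator_space \<pi> X" for X :: "('h \<Rightarrow>\<^sub>L 'h) set"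
    using that by (simp add: ex_def)
  show ?thesis
  proof (intro conjI allI impI)
    fix E :: "('h \<Rightarrow>\<^sub>L 'h) set" assume E: "operator_space E \<and> cfinite_dim E"
    \<comment> \<open>The finite-dimensional space itself contains every \<open>Z\<close>, so its
      own \<open>d_SK\<close> is the bound.\<close>
    have le: "exact_operator_space \<pi> E \<and> ex \<pi> E \<le> d_SK E" if "d_SK E < \<infinity>"
      by (rule exact_le) (use E that in auto)
    show "ex \<pi> E = d_SK E"
    proof (cases "exact_operator_space \<pi> E")
      case True
      then have "d_SK E \<le> ex \<pi> E" "d_SK E < \<infinity>" using SK_le[of E] E by (auto intro: order_le_less_trans)
      then show ?thesis using le by (auto intro: antisym)
    next
      case False
      then have "d_SK E = \<infinity>" using le by (metis infinity_ennreal_def top.not_eq_extremum)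
      then show ?thesis using not_exact[OF False] by simp
    qed
  next
    fix X :: "('h \<Rightarrow>\<^sub>L 'h) set" assume X: "operator_space X"
    let ?s = "SUP E \<in> {E. operator_space E \<and> E \<subseteq> X \<and> cfinite_dim E}. d_SK E"
    have XD: "X \<subseteq> bounded_ops" "csubspace X" using X by (auto simp: operator_space_def)
    have le: "exact_operator_space \<pi> X \<and> ex \<pi> X \<le> ?s" if fin: "?s < \<infinity>"
    proof (rule exact_le[OF X fin])
      fix Z assume Z: "finite Z" "Z \<subseteq> X"
      have "operator_space (cspan Z)" "cfinite_dim (cspan Z)" "cspan Z \<subseteq> X"
        using operator_space_cspan[of Z] Z XD cspan_minimal[of Z X] by auto
      then show "\<exists>E. operator_space E \<and> Z \<subseteq> E \<and> d_SK E \<le> ?s"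
        by (intro exI[of _ "cspan Z"] conjI cspan_superset SUP_upper) auto
    qed
    have ge: "?s \<le> ex \<pi> X" "ex \<pi> X < \<infinity>" if "exact_operator_space \<pi> X"
      using SK_le[OF X that] by (auto intro: SUP_least)
    show iff: "exact_operator_space \<pi> X \<longleftrightarrow> ?s < \<infinity>"
      using le ge order_le_less_trans by blast
    show "ex \<pi> X = ?s"
    proof (cases "exact_operator_space \<pi> X")
      case True
      then show ?thesis using le ge iff by (auto intro: antisym)
    next
      case False
      then have "?s = \<infinity>" using iff by (metis infinity_ennreal_def top.not_eq_extremum)
      then show ?thesis using not_exact[OF False] by (simp only:)
    qed
  qed
qed

end
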